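(* Let $n\geqslant 1$, let $X$ be a finite connected $d$-regular graph, and let $\chi_{v,v'}\in\mathrm{Sp}_{2n}(\mathbb{Z})$ be assigned to the oriented edges $(v,v')$ of $X$ with $\chi_{v',v}=\chi_{v,v'}^{-1}$. For each positive even integer $N$ let $\Delta^N$ be the associated operator on $C(X,\mathcal{H}_N)$ given by $(\Delta^N u)(v)=\sum_{v'\sim v}M_{\chi_{v,v'},N}\,u(v')$, with eigenvalues $\lambda_{N,i}$, $1\leqslant i\leqslant |X|N^n$, counted with multiplicity. Assume the blockwise invertibility condition [BIV]: for every nonidentity element $\gamma$ of the fundamental group of $X$ (at a fixed base vertex), the upper right $n\times n$ block $B_\gamma$ of $\chi(\gamma)=\begin{pmatrix}A_\gamma&B_\gamma\\C_\gamma&D_\gamma\end{pmatrix}$ satisfies $\det B_\gamma\neq 0$. Then for every interval $I\subseteq\mathbb{R}$, $$\lim_{\substack{N\in 2\mathbb{N}\\ N\to\infty}}\left|\frac{1}{|X|\,N^n}\big|\{i\mid \lambda_{N,i}\in I\}\big|-\int_I d\mu_{\mathrm{KM}}(\lambda)\right|=0,$$ where $\mu_{\mathrm{KM}}$ is the Kesten--McKay distribution, with density $\dfrac{d\sqrt{4(d-1)-\lambda^2}}{2\pi(d^2-\lambda^2)}\mathbf{1}_{[-2\sqrt{d-1},\,2\sqrt{d-1}]}(\lambda)$ with respect to Lebesgue measure (here $d$ is the degree).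
   Context: Graph conventions. $X$ may have self-loops and multiple edges; sums over neighbors $v'\sim v$ are sums over oriented edges, distinct edges counted separately (a self-loop gives two mutually reverse oriented edges). $|X|$ is the number of vertices. The matrix assigned to the reverse of an oriented edge is the inverse of the matrix assigned to the edge. For a loop $\gamma=(v_k,\ldots,v_0)$ with $v_k=v_0$ the base vertex, $\chi(\gamma)=\chi_{v_k,v_{k-1}}\cdots\chi_{v_1,v_0}$; this depends only on the homotopy class of $\gamma$ (loops modulo insertion/removal of immediate backtracking) and defines a homomorphism from the fundamental group of $X$ to $\mathrm{Sp}_{2n}(\mathbb{Z})$. $\mathrm{Sp}_{2n}(\mathbb{Z})$ is the group of integer $2n\times 2n$ matrices preserving $\sigma((y,\eta),(y',\eta'))=\langle\eta,y'\rangle-\langle y,\eta'\rangle$. Quantum states. Let $N$ be a positive even integer, $h=(2\pi N)^{-1}$. For $\omega=(y,\eta)\in\mathbb{R}^{2n}$ let $U_\omega$ act on tempered distributions by $(U_\omega f)(x)=e^{\frac{\sqrt{-1}}{h}\langle y,x\rangle+\frac{\sqrt{-1}}{2h}\langle y,\eta\rangle}f(x+\eta)$. Let $\mathcal{H}_N=\{f\in\mathscr{S}'(\mathbb{R}^n)\mid U_\omega f=e^{N\pi\sqrt{-1}\langle y,\eta\rangle}f\ \forall\,\omega=(y,\eta)\in\mathbb{Z}^{2n}\}$. It has dimension $N^n$ with basis $e_j(x)=N^{-n/2}\sum_{k\in\mathbb{Z}^n}\delta(x-\tfrac{Nk+j}{N})$, $j\in\mathbb{Z}_N^n=(\mathbb{Z}/N)^n$,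 and carries the inner product making $\{e_j\}$ orthonormal. For $\omega=(y,\eta)\in\mathbb{Z}^{2n}$, $U_{\omega/N}$ preserves $\mathcal{H}_N$ and $U_{\omega/N}e_j=e^{\frac{2\pi\sqrt{-1}}{N}\langle y,j\rangle-\frac{\pi\sqrt{-1}}{N}\langle y,\eta\rangle}e_{j-\eta}$. Quantum observables. For $a\in C^\infty(\mathbb{T}^{2n})$, $\mathbb{T}^{2n}=\mathbb{R}^{2n}/\mathbb{Z}^{2n}$, $\mathrm{Op}_N(a)$ is the restriction to $\mathcal{H}_N$ of the semiclassical Weyl quantization of $a$; explicitly $\mathrm{Op}_N(a)=\sum_{\omega\in\mathbb{Z}^{2n}}\widehat a(\omega)U_{\omega/N}$ with $\widehat a(\omega)=\int_{\mathbb{T}^{2n}}e^{-2\pi\sqrt{-1}\langle\omega,z\rangle}a(z)dz$. Quantum cat maps. For $E\in\mathrm{Sp}_{2n}(\mathbb{Z})$, $M_{E,N}$ is a unitary operator on $\mathcal{H}_N$ with $M_{E,N}^{-1}\mathrm{Op}_N(a)M_{E,N}=\mathrm{Op}_N(a\circ E)$ for all $a\in C^\infty(\mathbb{T}^{2n})$; it exists and is unique up to a unit complex scalar. The scalars for the edges of $X$ are chosen so that $M_{\chi_{v',v},N}=M_{\chi_{v,v'},N}^{-1}$ for reverse edges, so $\Delta^N$ is selfadjoint on $C(X,\mathcal{H}_N)$ (the $\mathcal{H}_N$-valued functions on vertices, with norm $\|u\|^2=\sum_{v}\|u(v)\|^2_{\mathcal{H}_N}$).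
   Formalization: The degree d is assumed to be at least 2; for d = 1 (a single edge, [BIV] vacuous) the displayed density has total mass 0 and the claim fails for I = ℝ, and for d = 0 the Kesten–McKay density is undefined. *)

theory Defs
  imports
    "HOL-Analysis.Analysis"
    "HOL-Library.Function_Algebras"
    "Graph_Theory.Graph_Theory"
begin

section \<open>Tempered distributions\<close>

definition partial :: "'m::finite \<Rightarrow> (real^'m \<Rightarrow> complex) \<Rightarrow> real^'m \<Rightarrow> complex" where
  "partial i f x = frechet_derivative f (at x) (axis i 1)"

abbreviation iter_partial :: "'m::finite list \<Rightarrow> (real^'m \<Rightarrow> complex) \<Rightarrow> real^'m \<Rightarrow> complex" where
  "iter_partial is f \<equiv> foldr partial is f"

definition smooth :: "(real^'m::finite \<Rightarrow> complex) \<Rightarrow> bool" where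
  "smooth f \<longleftrightarrow> (\<forall>is x. iter_partial is f differentiable (at x))"

definition schwartz :: "(real^'n::finite \<Rightarrow> complex) \<Rightarrow> bool" where
  "schwartz \<phi> \<longleftrightarrow> smooth \<phi> \<and>
     (\<forall>k is. bounded (range (\<lambda>x. (1 + norm x) ^ k *\<^sub>R iter_partial is \<phi> x)))"

definition schwartz_norm :: "nat \<Rightarrow> (real^'n::finite \<Rightarrow> complex) \<Rightarrow> real" where
  "schwartz_norm m \<phi> =
     (SUP (is, x) \<in> {is. length is \<le> m} \<times> UNIV. (1 + norm x) ^ m * norm (iter_partial is \<phi> x))"

type_synonym 'n dist = "(real^'n \<Rightarrow> complex) \<Rightarrow> complex"

text \<open>The seminorms \<open>schwartz_norm m\<close> increase with \<open>m\<close> and generate the topology of the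
  Schwartz space, so a linear functional is continuous iff it is bounded by a multiple of one of
  them. Functionals are set to 0 off the Schwartz space, so that equality of functions
  is equality of distributions.\<close>

definition tempered :: "'n::finite dist \<Rightarrow> bool" where
  "tempered T \<longleftrightarrow>
     (\<forall>\<phi>. \<not> schwartz \<phi> \<longrightarrow> T \<phi> = 0) \<and>
     (\<forall>\<phi> \<psi>. schwartz \<phi> \<longrightarrow> schwartz \<psi> \<longrightarrow> T (\<lambda>x. \<phi> x + \<psi> x) = T \<phi> + T \<psi>) \<and>
     (\<forall>c \<phi>. schwartz \<phi> \<longrightarrow> T (\<lambda>x. c * \<phi> x) = c * T \<phi>) \<and>
     (\<exists>C m. \<forall>\<phi>. schwartz \<phi> \<longrightarrow> norm (T \<phi>) \<le> C * schwartz_norm m \<phi>)"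

definition dist_scale :: "complex \<Rightarrow> 'n::finite dist \<Rightarrow> 'n dist" where
  "dist_scale c T = (\<lambda>\<phi>. c * T \<phi>)"

lemma vector_space_dist_scale: "vector_space dist_scale"
  by unfold_locales (auto simp: dist_scale_def fun_eq_iff algebra_simps)

section \<open>Quantum states\<close>

text \<open>Phase space \<open>\<real>\<^sup>2\<^sup>n\<close> is indexed by \<open>'n + 'n\<close>: the \<open>Inl\<close> coordinates of \<open>\<omega> = (y, \<eta>)\<close>
  are \<open>y\<close>, the \<open>Inr\<close> coordinates are \<open>\<eta>\<close>.\<close>

definition pos :: "'a^('n::finite + 'n) \<Rightarrow> 'a^'n" where
  "pos \<omega> = (\<chi> i. \<omega> $ Inl i)"

definition mom :: "'a^('n::finite + 'n) \<Rightarrow> 'a^'n" where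
  "mom \<omega> = (\<chi> i. \<omega> $ Inr i)"

definition int_lattice :: "(real^'m::finite) set" where
  "int_lattice = {z. \<forall>i. z $ i \<in> \<int>}"

text \<open>\<open>(U\<^sub>\<omega> f)(x) = exp(i\<langle>y,x\<rangle>/h + i\<langle>y,\<eta>\<rangle>/(2h)) f(x + \<eta>)\<close>, transposed to test functions by the
  substitution \<open>x \<mapsto> x - \<eta>\<close> in the pairing.\<close>

definition U_op :: "real \<Rightarrow> real^('n::finite + 'n) \<Rightarrow> 'n dist \<Rightarrow> 'n dist" where
  "U_op h \<omega> T = (\<lambda>\<phi>. if schwartz \<phi>
     then T (\<lambda>x. cis ((pos \<omega> \<bullet> (x - mom \<omega>)) / h + (pos \<omega> \<bullet> mom \<omega>) / (2 * h)) * \<phi> (x - mom \<omega>))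
     else 0)"

definition planck :: "nat \<Rightarrow> real" where
  "planck N = 1 / (2 * pi * real N)"

definition H_space :: "nat \<Rightarrow> 'n::finite dist set" where
  "H_space N = {f. tempered f \<and>
     (\<forall>\<omega>\<in>int_lattice. U_op (planck N) \<omega> f = dist_scale (cis (real N * pi * (pos \<omega> \<bullet> mom \<omega>))) f)}"

text \<open>Representatives of \<open>\<int>\<^sub>N\<^sup>n\<close>.\<close>

definition ZN :: "nat \<Rightarrow> (real^'n::finite) set" where
  "ZN N = {j \<in> int_lattice. \<forall>i. 0 \<le> j $ i \<and> j $ i < real N}"

definition comb :: "nat \<Rightarrow> real^'n::finite \<Rightarrow> 'n dist" where
  "comb N j = (\<lambda>\<phi>. if schwartz \<phi>
     then of_real (real N powr (- real CARD('n) / 2)) *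
       (\<Sum>\<^sub>\<infinity>k\<in>int_lattice. \<phi> ((1 / real N) *\<^sub>R (real N *\<^sub>R k + j)))
     else 0)"

text \<open>The inner product making the basis \<open>comb N j\<close>, \<open>j \<in> ZN N\<close>, of \<open>H_space N\<close> orthonormal.\<close>

definition H_inner :: "nat \<Rightarrow> 'n::finite dist \<Rightarrow> 'n dist \<Rightarrow> complex" where
  "H_inner N f g = (\<Sum>b \<in> comb N ` ZN N.
     module.representation dist_scale (comb N ` ZN N) f b *
     cnj (module.representation dist_scale (comb N ` ZN N) g b))"

section \<open>Quantum observables and quantum cat maps\<close>

definition smooth_torus :: "(real^'m::finite \<Rightarrow> complex) \<Rightarrow> bool" where
  "smooth_torus a \<longleftrightarrow> smooth a \<and> (\<forall>z. \<forall>\<omega>\<in>int_lattice. a (z + \<omega>) = a z)"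

definition fourier_coeff :: "(real^'m::finite \<Rightarrow> complex) \<Rightarrow> real^'m \<Rightarrow> complex" where
  "fourier_coeff a \<omega> = integral (cbox 0 1) (\<lambda>z. cis (- 2 * pi * (\<omega> \<bullet> z)) * a z)"

definition Op :: "nat \<Rightarrow> (real^('n::finite + 'n) \<Rightarrow> complex) \<Rightarrow> 'n dist \<Rightarrow> 'n dist" where
  "Op N a f = (\<lambda>\<phi>. \<Sum>\<^sub>\<infinity>\<omega>\<in>int_lattice. fourier_coeff a \<omega> * U_op (planck N) ((1 / real N) *\<^sub>R \<omega>) f \<phi>)"

definition symp_form :: "'a::comm_ring_1^('n::finite + 'n) \<Rightarrow> 'a^('n + 'n) \<Rightarrow> 'a" where
  "symp_form z w = (\<Sum>i\<in>UNIV. mom z $ i * pos w $ i) - (\<Sum>i\<in>UNIV. pos z $ i * mom w $ i)"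

definition Sp :: "(int^('n::finite + 'n)^('n + 'n)) set" where
  "Sp = {E. \<forall>z w. symp_form (E *v z) (E *v w) = symp_form z w}"

definition real_matrix :: "int^'m::finite^'k::finite \<Rightarrow> real^'m^'k" where
  "real_matrix E = (\<chi> i j. real_of_int (E $ i $ j))"

definition upper_right :: "'a^('n::finite + 'n)^('n + 'n) \<Rightarrow> 'a^'n^'n" where
  "upper_right E = (\<chi> i j. E $ Inl i $ Inr j)"

definition H_unitary :: "nat \<Rightarrow> ('n::finite dist \<Rightarrow> 'n dist) \<Rightarrow> bool" where
  "H_unitary N M \<longleftrightarrow> bij_betw M (H_space N) (H_space N) \<and>
     (\<forall>f\<in>H_space N. \<forall>g\<in>H_space N. M (f + g) = M f + M g) \<and>
     (\<forall>c. \<forall>f\<in>H_space N. M (dist_scale c f) = dist_scale c (M f)) \<and>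
     (\<forall>f\<in>H_space N. \<forall>g\<in>H_space N. H_inner N (M f) (M g) = H_inner N f g)"

definition quantum_cat_map ::
    "nat \<Rightarrow> int^('n::finite + 'n)^('n + 'n) \<Rightarrow> ('n dist \<Rightarrow> 'n dist) \<Rightarrow> bool" where
  "quantum_cat_map N E M \<longleftrightarrow> H_unitary N M \<and>
     (\<forall>a. smooth_torus a \<longrightarrow>
       (\<forall>f\<in>H_space N. inv_into (H_space N) M (Op N a (M f)) = Op N (a \<circ> (*v) (real_matrix E)) f))"

section \<open>Homotopy classes of loops\<close>

text \<open>A graph is a \<open>bidirected_digraph G arev\<close>: its arcs are the oriented edges and \<open>arev\<close> is the
  fixed-point free orientation reversal, so a self-loop contributes two arcs.
  The list of arcs \<open>[(v\<^sub>k,v\<^sub>k\<^sub>-\<^sub>1), \<dots>, (v\<^sub>1,v\<^sub>0)]\<close> represents the walk \<open>(v\<^sub>k,\<dots>,v\<^sub>0)\<close>.\<close>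

definition loops :: "('v,'e) pre_digraph \<Rightarrow> 'v \<Rightarrow> 'e list set" where
  "loops G v = {p. pre_digraph.awalk G v p v}"

definition backtrack_removal ::
    "('v,'e) pre_digraph \<Rightarrow> ('e \<Rightarrow> 'e) \<Rightarrow> 'v \<Rightarrow> ('e list \<times> 'e list) set" where
  "backtrack_removal G arev v =
     {(p, q). p \<in> loops G v \<and> q \<in> loops G v \<and>
       (\<exists>r s a. a \<in> arcs G \<and> p = r @ [a, arev a] @ s \<and> q = r @ s)}"

definition homotopy ::
    "('v,'e) pre_digraph \<Rightarrow> ('e \<Rightarrow> 'e) \<Rightarrow> 'v \<Rightarrow> ('e list \<times> 'e list) set" where
  "homotopy G arev v = (backtrack_removal G arev v \<union> (backtrack_removal G arev v)\<inverse>)\<^sup>*"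

definition fundamental_group ::
    "('v,'e) pre_digraph \<Rightarrow> ('e \<Rightarrow> 'e) \<Rightarrow> 'v \<Rightarrow> 'e list set set" where
  "fundamental_group G arev v = loops G v // homotopy G arev v"

definition pi1_identity ::
    "('v,'e) pre_digraph \<Rightarrow> ('e \<Rightarrow> 'e) \<Rightarrow> 'v \<Rightarrow> 'e list set" where
  "pi1_identity G arev v = homotopy G arev v `` {[]}"

definition holonomy :: "('e \<Rightarrow> 'a::semiring_1^'m::finite^'m) \<Rightarrow> 'e list \<Rightarrow> 'a^'m^'m" where
  "holonomy chi p = foldr (\<lambda>e A. chi e ** A) p (mat 1)"

text \<open>The holonomy is constant on homotopy classes, so it does not matter that the condition
  is imposed on all representatives of a class.\<close>

definition BIV :: "('v,'e) pre_digraph \<Rightarrow> ('e \<Rightarrow> 'e) \<Rightarrow> 'v \<Rightarrow>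
    ('e \<Rightarrow> int^('n::finite + 'n)^('n + 'n)) \<Rightarrow> bool" where
  "BIV G arev v chi \<longleftrightarrow>
     (\<forall>\<gamma>\<in>fundamental_group G arev v. \<gamma> \<noteq> pi1_identity G arev v \<longrightarrow>
        (\<forall>p\<in>\<gamma>. det (upper_right (holonomy chi p)) \<noteq> 0))"

section \<open>The twisted adjacency operator and its eigenvalues\<close>

text \<open>\<open>H_space N\<close>-valued functions on the vertex set, extended by 0 to the whole vertex type.\<close>

definition C_space :: "('v,'e) pre_digraph \<Rightarrow> nat \<Rightarrow> ('v \<Rightarrow> 'n::finite dist) set" where
  "C_space G N = {u. (\<forall>v\<in>verts G. u v \<in> H_space N) \<and> (\<forall>v. v \<notin> verts G \<longrightarrow> u v = 0)}"

definition C_scale :: "complex \<Rightarrow> ('v \<Rightarrow> 'n::finite dist) \<Rightarrow> 'v \<Rightarrow> 'n dist" where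
  "C_scale c u = (\<lambda>v. dist_scale c (u v))"

lemma vector_space_C_scale: "vector_space C_scale"
  by unfold_locales (auto simp: C_scale_def dist_scale_def fun_eq_iff algebra_simps)

definition twisted_adjacency :: "('v,'e) pre_digraph \<Rightarrow> ('e \<Rightarrow> 'n::finite dist \<Rightarrow> 'n dist) \<Rightarrow>
    ('v \<Rightarrow> 'n dist) \<Rightarrow> 'v \<Rightarrow> 'n dist" where
  "twisted_adjacency G M u =
     (\<lambda>v. if v \<in> verts G then \<Sum>e\<in>out_arcs G v. M e (u (head G e)) else 0)"

definition eigenspace :: "('v,'e) pre_digraph \<Rightarrow> nat \<Rightarrow> ('e \<Rightarrow> 'n::finite dist \<Rightarrow> 'n dist) \<Rightarrow>
    real \<Rightarrow> ('v \<Rightarrow> 'n dist) set" where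
  "eigenspace G N M x = {u \<in> C_space G N. twisted_adjacency G M u = C_scale (of_real x) u}"

text \<open>Number of eigenvalues in \<open>I\<close> with multiplicity. The operator is selfadjoint, so
  its eigenvalues are real and the multiplicity is the complex dimension of the eigenspace.\<close>

definition eigenvalue_count :: "('v,'e) pre_digraph \<Rightarrow> nat \<Rightarrow>
    ('e \<Rightarrow> 'n::finite dist \<Rightarrow> 'n dist) \<Rightarrow> real set \<Rightarrow> nat" where
  "eigenvalue_count G N M I =
     (\<Sum>x \<in> {x \<in> I. eigenspace G N M x \<noteq> {0}}. vector_space.dim C_scale (eigenspace G N M x))"

definition kesten_mckay :: "nat \<Rightarrow> real measure" where
  "kesten_mckay d = density lborel (\<lambda>x. ennreal
     (real d * sqrt (4 * (real d - 1) - x\<^sup>2) / (2 * pi * ((real d)\<^sup>2 - x\<^sup>2)) *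
      indicator {- 2 * sqrt (real d - 1) .. 2 * sqrt (real d - 1)} x))"

end

theory Submission
  imports Defs "HOL-Real_Asymp.Real_Asymp" "Jordan_Normal_Form.Jordan_Normal_Form_Existence"
begin

text \<open>
  The state space \<open>H_space N\<close> is spanned by the \<open>N\<^sup>n\<close> Dirac combs, so the operator is a Hermitian matrix of
  size \<open>D = |X| N\<^sup>n\<close> and the statement is about the empirical distribution of its \<open>D\<close> eigenvalues. All
  eigenvalues lie in \<open>[-d, d]\<close>, so it suffices that the averages of a spanning family of polynomials
  converge to their integrals against the Kesten--McKay distribution. A suitable family is that of the nonbacktracking
  polynomials \<open>P\<^sub>k\<close>: on the one hand \<open>P\<^sub>k\<close> of the operator is the sum of the operators
  \<open>M\<^sub>p\<close> along the walks \<open>p\<close> of length \<open>k\<close> without backtracking (lemma \<open>walk_sum_spectral\<close>), on the other hand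
  they are orthogonal to constants for the limit distribution
  (\<open>kesten_mckay_nonbacktracking\<close>). Hence one has to show that
  \<open>tr M\<^sub>p = o(N\<^sup>n)\<close> for each of the finitely many nonempty closed walks \<open>p\<close> of length \<open>k\<close> without backtracking.

  Conjugating \<open>p\<close> with a walk from the base point gives a loop that is not homotopic to the trivial one
  (\<open>reduce_conjugate_nonempty\<close>, by free reduction), with the same trace. By the blockwise
  invertibility its holonomy \<open>E\<close> is not the identity. The operator \<open>T\<close> along the loop satisfies the exact
  Egorov relation \<open>U\<^bsub>\<omega>/N\<^esub> T = T U\<^bsub>E\<^sup>T\<omega>/N\<^esub>\<close>. With \<open>a\<close> such that \<open>w = E\<^sup>T a - a \<noteq> 0\<close>, the unitary operators
  \<open>A\<^sub>t = U\<^bsub>t E\<^sup>T a/N\<^esub> U\<^bsub>-t a/N\<^esub>\<close> therefore satisfy \<open>tr (T A\<^sub>t) = tr T\<close>, and up to phases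
  they are the translations by \<open>t w / N\<close>, which are orthogonal for the Hilbert--Schmidt inner product as long as \<open>N\<close> is large
  compared to \<open>t w\<close>. Cauchy--Schwarz for \<open>T\<close> and the sum of \<open>L\<close> of them yields \<open>|tr T|\<^sup>2 \<le> N\<^sup>2\<^sup>n / L\<close>
  (\<open>trace_bound_intertwiner\<close>), for every fixed \<open>L\<close> and all large \<open>N\<close>.

  That the combs span \<open>H_space N\<close> is proved by Fourier analysis of the function
  \<open>p \<mapsto> f (\<phi> e\<^bsup>2\<pi>iNpx\<^esup>)\<close> on the unit cube, for \<open>f\<close> in \<open>H_space N\<close> and a test function \<open>\<phi>\<close>: its Fourier
  coefficients are functionals of \<open>\<phi>\<close> killed by multiplication with the coordinates around a point of the lattice,
  hence multiples of point evaluations (\<open>functional_delta\<close>, \<open>H_space_spanned\<close>).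
\<close>

no_notation Matrix.vec_index (infixl "$" 100)
no_notation Matrix.scalar_prod (infix "\<bullet>" 70)

section \<open>Smooth functions\<close>

lemma partial_unique:
  assumes "(f has_derivative f') (at x)"
  shows "partial i f x = f' (axis i 1)"
  unfolding partial_def using frechet_derivative_at[OF assms] by simp

lemma has_derivative_frechet:
  "f differentiable (at x) \<Longrightarrow> (f has_derivative frechet_derivative f (at x)) (at x)"
  by (simp add: frechet_derivative_works)

lemma partial_add:
  assumes "f differentiable (at x)" "g differentiable (at x)"
  shows "partial i (\<lambda>x. f x + g x) x = partial i f x + partial i g x"
proof -
  have "((\<lambda>x. f x + g x) has_derivative
      (\<lambda>h. frechet_derivative f (at x) h + frechet_derivative g (at x) h)) (at x)"
    by (intro has_derivative_add has_derivative_frechet assms)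
  from partial_unique[OF this] show ?thesis by (simp add: partial_def)
qed

lemma partial_mult:
  assumes "f differentiable (at x)" "g differentiable (at x)"
  shows "partial i (\<lambda>x. f x * g x) x = f x * partial i g x + partial i f x * g x"
proof -
  have "((\<lambda>x. f x * g x) has_derivative
      (\<lambda>h. f x * frechet_derivative g (at x) h + frechet_derivative f (at x) h * g x)) (at x)"
    by (intro has_derivative_mult has_derivative_frechet assms)
  from partial_unique[OF this] show ?thesis by (simp add: partial_def)
qed

lemma partial_const: "partial i (\<lambda>x. c) x = 0"
  by (rule partial_unique[where f' = "\<lambda>h. 0", simplified]) simp

lemma partial_affine:
  assumes "f differentiable (at (a *\<^sub>R x + b))"
  shows "partial i (\<lambda>x. f (a *\<^sub>R x + b)) x = of_real a * partial i f (a *\<^sub>R x + b)"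
proof -
  have "((\<lambda>x. f (a *\<^sub>R x + b)) has_derivative
      (\<lambda>h. frechet_derivative f (at (a *\<^sub>R x + b)) (a *\<^sub>R h))) (at x)"
    by (rule has_derivative_compose[where f = "\<lambda>x. a *\<^sub>R x + b" and f' = "\<lambda>h. a *\<^sub>R h"])
      (auto intro!: derivative_eq_intros has_derivative_frechet assms)
  from partial_unique[OF this] show ?thesis
    using linear_frechet_derivative[OF assms]
    by (simp add: partial_def linear_cmul scaleR_conv_of_real[symmetric])
qed

lemma partial_has_vector_derivative:
  assumes "f differentiable (at (x + s *\<^sub>R axis i 1))"
  shows "((\<lambda>s. f (x + s *\<^sub>R axis i 1)) has_vector_derivative partial i f (x + s *\<^sub>R axis i 1)) (at s)"
proof -
  have "((\<lambda>s. f (x + s *\<^sub>R axis i 1)) has_derivative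
      (\<lambda>h. frechet_derivative f (at (x + s *\<^sub>R axis i 1)) (h *\<^sub>R axis i 1))) (at s)"
    by (rule has_derivative_compose[where f = "\<lambda>s. x + s *\<^sub>R axis i 1" and f' = "\<lambda>h. h *\<^sub>R axis i 1"])
      (auto intro!: derivative_eq_intros has_derivative_frechet assms)
  then show ?thesis
    using linear_frechet_derivative[OF assms]
    by (simp add: has_vector_derivative_def partial_def linear_cmul)
qed

lemma frechet_derivative_partial:
  assumes "f differentiable (at x)"
  shows "frechet_derivative f (at x) h = (\<Sum>i\<in>UNIV. of_real (h $ i) * partial i f x)"
proof -
  have lin: "linear (frechet_derivative f (at x))"
    by (rule linear_frechet_derivative[OF assms])
  have "h = (\<Sum>i\<in>UNIV. (h $ i) *\<^sub>R axis i 1)"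
    using basis_expansion[of h] by (simp add: scalar_mult_eq_scaleR)
  then have "frechet_derivative f (at x) h = frechet_derivative f (at x) (\<Sum>i\<in>UNIV. (h $ i) *\<^sub>R axis i 1)"
    by simp
  also have "\<dots> = (\<Sum>i\<in>UNIV. (h $ i) *\<^sub>R frechet_derivative f (at x) (axis i 1))"
    by (simp add: linear_sum[OF lin] linear_cmul[OF lin])
  finally show ?thesis by (simp add: partial_def scaleR_conv_of_real)
qed

lemma smooth_differentiable: "smooth f \<Longrightarrow> f differentiable (at x)"
  unfolding smooth_def by (auto dest: spec[of _ "[]"])

lemma smooth_partial: "smooth f \<Longrightarrow> smooth (partial i f)"
  unfolding smooth_def
proof (intro allI)
  fix "is" x
  assume "\<forall>is x. iter_partial is f differentiable at x"
  then have "iter_partial (is @ [i]) f differentiable at x" by blast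
  then show "iter_partial is (partial i f) differentiable at x" by simp
qed

lemma smooth_iter_partial: "smooth f \<Longrightarrow> smooth (iter_partial is f)"
  by (induction "is") (auto intro: smooth_partial)

lemma iter_partial_invariant:
  assumes "f \<in> C" "\<And>f i. f \<in> C \<Longrightarrow> partial i f \<in> C"
  shows "iter_partial is f \<in> C"
  using assms by (induction "is") auto

lemma smooth_coinduct:
  assumes "f \<in> C" "\<And>f x. f \<in> C \<Longrightarrow> f differentiable (at x)" "\<And>f i. f \<in> C \<Longrightarrow> partial i f \<in> C"
  shows "smooth f"
  unfolding smooth_def using assms(2) iter_partial_invariant[of f C, OF assms(1,3)] by blast

lemma iter_partial_add:
  assumes "smooth f" "smooth g"
  shows "iter_partial is (\<lambda>x. f x + g x) = (\<lambda>x. iter_partial is f x + iter_partial is g x)"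
proof (induction "is")
  case (Cons i "is")
  then show ?case
    using assms by (auto intro!: partial_add ext simp: smooth_def)
qed simp

lemma smooth_add:
  assumes "smooth f" "smooth g"
  shows "smooth (\<lambda>x. f x + g x)"
  using assms unfolding smooth_def iter_partial_add[OF assms] by (auto intro: differentiable_add)

lemma smooth_const: "smooth (\<lambda>x. c)"
  by (rule smooth_coinduct[where C = "{\<lambda>x. c |c. True}"]) (auto simp: partial_const[abs_def])

text \<open>Sums of products are closed under partial derivatives, whereas products alone are not; this is
  what makes the coinductive proofs about products work.\<close>

inductive product_sum ::
    "((real^'n::finite \<Rightarrow> complex) \<Rightarrow> bool) \<Rightarrow> ((real^'n \<Rightarrow> complex) \<Rightarrow> bool) \<Rightarrow> (real^'n \<Rightarrow> complex) \<Rightarrow> bool"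
  for P Q where
  product: "P f \<Longrightarrow> Q g \<Longrightarrow> product_sum P Q (\<lambda>x. f x * g x)"
| sum: "product_sum P Q f \<Longrightarrow> product_sum P Q g \<Longrightarrow> product_sum P Q (\<lambda>x. f x + g x)"

lemma product_sum_differentiable:
  assumes "product_sum P Q f" "\<And>f. P f \<Longrightarrow> smooth f" "\<And>f. Q f \<Longrightarrow> smooth f"
  shows "f differentiable (at x)"
  using assms(1)
proof induction
  case (product f g)
  show ?case
    by (intro differentiable_mult smooth_differentiable assms(2)[OF product(1)] assms(3)[OF product(2)])
qed (auto intro: differentiable_add)

lemma product_sum_partial:
  assumes "product_sum P Q f" "\<And>f. P f \<Longrightarrow> smooth f" "\<And>f. Q f \<Longrightarrow> smooth f"
    "\<And>f i. P f \<Longrightarrow> P (partial i f)" "\<And>f i. Q f \<Longrightarrow> Q (partial i f)"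
  shows "product_sum P Q (partial i f)"
  using assms(1)
proof induction
  case (product f g)
  have "partial i (\<lambda>x. f x * g x) = (\<lambda>x. f x * partial i g x + partial i f x * g x)"
    by (intro ext partial_mult smooth_differentiable assms(2)[OF product(1)] assms(3)[OF product(2)])
  then show ?case
    using product assms(4,5) by (simp add: product_sum.intros)
next
  case (sum f g)
  have "partial i (\<lambda>x. f x + g x) = (\<lambda>x. partial i f x + partial i g x)"
    by (intro ext partial_add product_sum_differentiable[OF sum(1) assms(2,3)]
        product_sum_differentiable[OF sum(2) assms(2,3)])
  then show ?case using sum by (simp add: product_sum.intros)
qed

lemma smooth_mult:
  assumes "smooth f" "smooth g"
  shows "smooth (\<lambda>x. f x * g x)"
proof (rule smooth_coinduct[where C = "Collect (product_sum smooth smooth)"])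
  show "(\<lambda>x. f x * g x) \<in> Collect (product_sum smooth smooth)"
    using assms by (auto intro: product_sum.intros)
qed (simp_all add: product_sum_differentiable[of smooth smooth] product_sum_partial[of smooth smooth] smooth_partial)

lemma iter_partial_affine:
  assumes "smooth f"
  shows "iter_partial is (\<lambda>x. f (a *\<^sub>R x + b)) = (\<lambda>x. of_real (a ^ length is) * iter_partial is f (a *\<^sub>R x + b))"
proof (induction "is")
  case (Cons i "is")
  have d: "iter_partial is f differentiable (at y)" for y
    using assms by (simp add: smooth_def)
  have d': "(\<lambda>x. iter_partial is f (a *\<^sub>R x + b)) differentiable (at x)" for x
    by (rule differentiable_compose[where f = "iter_partial is f" and g = "\<lambda>x. a *\<^sub>R x + b"])
      (auto intro!: d derivative_intros)
  have "partial i (\<lambda>x. of_real (a ^ length is) * iter_partial is f (a *\<^sub>R x + b)) x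
     = of_real (a ^ length is) * (of_real a * iter_partial (i # is) f (a *\<^sub>R x + b))" for x
    by (subst partial_mult) (auto intro!: d' simp: partial_const partial_affine d)
  then show ?case unfolding foldr_Cons comp_apply Cons by (simp add: fun_eq_iff mult.assoc mult.left_commute)
qed simp

lemma smooth_affine:
  assumes "smooth f"
  shows "smooth (\<lambda>x. f (a *\<^sub>R x + b))"
proof -
  have d: "iter_partial is f differentiable (at y)" for y "is"
    using assms by (simp add: smooth_def)
  have "(\<lambda>x. iter_partial is f (a *\<^sub>R x + b)) differentiable (at x)" for x "is"
    by (rule differentiable_compose[where f = "iter_partial is f" and g = "\<lambda>x. a *\<^sub>R x + b"])
      (auto intro!: d derivative_intros)
  then show ?thesis
    unfolding smooth_def iter_partial_affine[OF assms] by (auto intro!: differentiable_mult)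
qed

section \<open>Symmetry of second derivatives\<close>

lemma mixed_difference:
  fixes g gs :: "real \<Rightarrow> real \<Rightarrow> real"
  assumes "h > 0"
    and ds: "\<And>s t. ((\<lambda>s. g s t) has_real_derivative gs s t) (at s)"
    and dt: "\<And>s t. ((\<lambda>t. gs s t) has_real_derivative gst s t) (at t)"
  shows "\<exists>s t. 0 < s \<and> s < h \<and> 0 < t \<and> t < h \<and>
     g h h - g h 0 - g 0 h + g 0 0 = h * h * gst s t"
proof -
  have "\<exists>s>0. s < h \<and> (g h h - g h 0) - (g 0 h - g 0 0) = (h - 0) * (gs s h - gs s 0)"
    using MVT2[of 0 h "\<lambda>s. g s h - g s 0" "\<lambda>s. gs s h - gs s 0"] \<open>h > 0\<close>
    by (simp add: DERIV_diff ds)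
  then obtain s where s: "0 < s" "s < h" "(g h h - g h 0) - (g 0 h - g 0 0) = h * (gs s h - gs s 0)"
    by auto
  have "\<exists>t>0. t < h \<and> gs s h - gs s 0 = (h - 0) * gst s t"
    using MVT2[of 0 h "\<lambda>t. gs s t" "\<lambda>t. gst s t"] \<open>h > 0\<close> by (auto intro!: dt)
  then obtain t where t: "0 < t" "t < h" "gs s h - gs s 0 = h * gst s t" by auto
  show ?thesis using s t by (intro exI[of _ s] exI[of _ t]) (auto simp: algebra_simps)
qed

lemma partial_commute_component:
  fixes f :: "real^'n::finite \<Rightarrow> complex" and R :: "complex \<Rightarrow> real"
  assumes f: "smooth f" and R: "bounded_linear R"
  shows "R (partial i (partial j f) x) = R (partial j (partial i f) x)"
proof -
  define p where "p s t = x + s *\<^sub>R axis i 1 + t *\<^sub>R axis j 1" for s t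
  have sw: "p s t = x + t *\<^sub>R axis j 1 + s *\<^sub>R axis i 1" for s t by (simp add: p_def)
  have di: "((\<lambda>s. R (u (p s t))) has_real_derivative R (partial i u (p s t))) (at s)" if "smooth u" for u s t
  proof -
    have "((\<lambda>s. u (p s t)) has_vector_derivative partial i u (p s t)) (at s)"
      unfolding sw by (intro partial_has_vector_derivative smooth_differentiable that)
    from bounded_linear.has_vector_derivative[OF R this] show ?thesis
      by (simp add: has_real_derivative_iff_has_vector_derivative)
  qed
  have dj: "((\<lambda>t. R (u (p s t))) has_real_derivative R (partial j u (p s t))) (at t)" if "smooth u" for u s t
  proof -
    have "((\<lambda>t. u (p s t)) has_vector_derivative partial j u (p s t)) (at t)"
      unfolding p_def by (intro partial_has_vector_derivative smooth_differentiable that)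
    from bounded_linear.has_vector_derivative[OF R this] show ?thesis
      by (simp add: has_real_derivative_iff_has_vector_derivative)
  qed
  have cont: "isCont (\<lambda>y. R (partial k (partial l f) y)) x" for k l
  proof -
    have "isCont (partial k (partial l f)) x"
      by (intro differentiable_imp_continuous_within smooth_differentiable smooth_partial f)
    then show ?thesis
      using bounded_linear.isCont[OF R] by blast
  qed
  have "dist (R (partial i (partial j f) x)) (R (partial j (partial i f) x)) \<le> 0 + e" if "e > 0" for e
  proof -
    obtain d1 where d1: "d1 > 0" "\<And>y. dist y x < d1 \<Longrightarrow>
        dist (R (partial i (partial j f) y)) (R (partial i (partial j f) x)) < e / 2"
      using cont[of i j] \<open>e > 0\<close> unfolding continuous_at by (metis half_gt_zero lim_def continuous_at_eps_delta cont)
    obtain d2 where d2: "d2 > 0" "\<And>y. dist y x < d2 \<Longrightarrow>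
        dist (R (partial j (partial i f) y)) (R (partial j (partial i f) x)) < e / 2"
      using cont[of j i] \<open>e > 0\<close> unfolding continuous_at by (metis half_gt_zero lim_def continuous_at_eps_delta cont)
    define h where "h = min d1 d2 / 4"
    have h: "h > 0" using d1 d2 by (simp add: h_def)
    have near: "dist (p s t) x < min d1 d2" if "0 < s" "s < h" "0 < t" "t < h" for s t
    proof -
      have "dist (p s t) x = norm (s *\<^sub>R axis i (1::real) + t *\<^sub>R axis j 1)"
        by (simp add: p_def dist_norm)
      also have "\<dots> \<le> s + t"
        using that norm_triangle_ineq[of "s *\<^sub>R axis i (1::real)" "t *\<^sub>R axis j 1"] by simp
      finally show ?thesis using that d1 d2 by (auto simp: h_def)
    qed
    obtain s t where st: "0 < s" "s < h" "0 < t" "t < h"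
      "R (f (p h h)) - R (f (p h 0)) - R (f (p 0 h)) + R (f (p 0 0)) = h * h * R (partial j (partial i f) (p s t))"
      using mixed_difference[OF h, where g = "\<lambda>s t. R (f (p s t))" and gs = "\<lambda>s t. R (partial i f (p s t))"
          and gst = "\<lambda>s t. R (partial j (partial i f) (p s t))"] di[OF f] dj[OF smooth_partial[OF f]] by blast
    obtain t' s' where st': "0 < s'" "s' < h" "0 < t'" "t' < h"
      "R (f (p h h)) - R (f (p 0 h)) - R (f (p h 0)) + R (f (p 0 0)) = h * h * R (partial i (partial j f) (p s' t'))"
      using mixed_difference[OF h, where g = "\<lambda>t s. R (f (p s t))" and gs = "\<lambda>t s. R (partial j f (p s t))"
          and gst = "\<lambda>t s. R (partial i (partial j f) (p s t))"] dj[OF f] di[OF smooth_partial[OF f]] by blast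
    have "h * h * R (partial j (partial i f) (p s t)) = h * h * R (partial i (partial j f) (p s' t'))"
      using st(5) st'(5) by linarith
    then have eq: "R (partial j (partial i f) (p s t)) = R (partial i (partial j f) (p s' t'))"
      using h by simp
    have "\<bar>R (partial i (partial j f) (p s' t')) - R (partial i (partial j f) x)\<bar> < e / 2"
      using d1(2)[of "p s' t'"] near[OF st'(1-4)] by (simp add: dist_real_def)
    moreover have "\<bar>R (partial i (partial j f) (p s' t')) - R (partial j (partial i f) x)\<bar> < e / 2"
      using d2(2)[of "p s t"] near[OF st(1-4)] eq by (simp add: dist_real_def)
    ultimately show ?thesis
      unfolding dist_real_def abs_less_iff abs_le_iff by linarith
  qed
  then have "dist (R (partial i (partial j f) x)) (R (partial j (partial i f) x)) \<le> 0"
    by (rule field_le_epsilon)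
  then show ?thesis by simp
qed

lemma partial_commute:
  assumes "smooth f"
  shows "partial i (partial j f) x = partial j (partial i f) x"
  using partial_commute_component[OF assms bounded_linear_Re, of i j x]
    partial_commute_component[OF assms bounded_linear_Im, of i j x]
  by (rule complex_eqI)

section \<open>Schwartz functions and functions of polynomial growth\<close>

text \<open>Functions all of whose derivatives grow at most polynomially: the multipliers of the
  Schwartz space.\<close>

definition slow :: "(real^'n::finite \<Rightarrow> complex) \<Rightarrow> bool" where
  "slow f \<longleftrightarrow> smooth f \<and> (\<forall>is. \<exists>k C. \<forall>x. norm (iter_partial is f x) \<le> C * (1 + norm x) ^ k)"

lemma schwartz_smooth: "schwartz f \<Longrightarrow> smooth f"
  and slow_smooth: "slow f \<Longrightarrow> smooth f"
  by (simp_all add: schwartz_def slow_def)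

lemma schwartz_iff:
  "schwartz f \<longleftrightarrow> smooth f \<and> (\<forall>k is. \<exists>B. \<forall>x. (1 + norm x) ^ k * norm (iter_partial is f x) \<le> B)"
  by (auto simp: schwartz_def bounded_iff)

lemma schwartzD:
  assumes "schwartz f"
  shows "\<exists>B\<ge>0. \<forall>x. (1 + norm x) ^ k * norm (f x) \<le> B"
proof -
  obtain B where B: "\<And>x. (1 + norm x) ^ k * norm (iter_partial [] f x) \<le> B"
    using assms unfolding schwartz_iff by blast
  moreover have "B \<ge> 0" by (rule order_trans[OF _ B[of 0]]) simp
  ultimately show ?thesis by auto
qed

lemma slowD:
  assumes "slow f"
  shows "\<exists>k C. C \<ge> 0 \<and> (\<forall>x. norm (f x) \<le> C * (1 + norm x) ^ k)"
proof -
  obtain k C where C: "\<And>x. norm (iter_partial [] f x) \<le> C * (1 + norm x) ^ k"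
    using assms unfolding slow_def by blast
  moreover have "C \<ge> 0" using order_trans[OF norm_ge_zero C[of 0]] by simp
  ultimately show ?thesis by auto
qed

lemma schwartz_partial: "schwartz f \<Longrightarrow> schwartz (partial i f)"
proof -
  assume f: "schwartz f"
  have "\<exists>B. \<forall>x. (1 + norm x) ^ k * norm (iter_partial is (partial i f) x) \<le> B" for k "is"
  proof -
    have "\<exists>B. \<forall>x. (1 + norm x) ^ k * norm (iter_partial (is @ [i]) f x) \<le> B"
      using f unfolding schwartz_iff by blast
    then show ?thesis by simp
  qed
  then show ?thesis
    using f by (simp add: schwartz_iff smooth_partial)
qed

lemma slow_partial: "slow f \<Longrightarrow> slow (partial i f)"
proof -
  assume f: "slow f"
  have "\<exists>k C. \<forall>x. norm (iter_partial is (partial i f) x) \<le> C * (1 + norm x) ^ k" for "is"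
  proof -
    have "\<exists>k C. \<forall>x. norm (iter_partial (is @ [i]) f x) \<le> C * (1 + norm x) ^ k"
      using f unfolding slow_def by blast
    then show ?thesis by simp
  qed
  then show ?thesis
    using f by (simp add: slow_def smooth_partial)
qed

lemma schwartz_iter_partial: "schwartz f \<Longrightarrow> schwartz (iter_partial is f)"
  by (induction "is") (auto intro: schwartz_partial)

lemma schwartz_coinduct:
  assumes "f \<in> C" "\<And>f x. f \<in> C \<Longrightarrow> f differentiable (at x)" "\<And>f i. f \<in> C \<Longrightarrow> partial i f \<in> C"
    "\<And>f k. f \<in> C \<Longrightarrow> \<exists>B. \<forall>x. (1 + norm x) ^ k * norm (f x) \<le> B"
  shows "schwartz f"
  unfolding schwartz_iff
  using smooth_coinduct[of f C, OF assms(1-3)] iter_partial_invariant[of f C, OF assms(1,3)] assms(4) by blast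

lemma slow_coinduct:
  assumes "f \<in> C" "\<And>f x. f \<in> C \<Longrightarrow> f differentiable (at x)" "\<And>f i. f \<in> C \<Longrightarrow> partial i f \<in> C"
    "\<And>f. f \<in> C \<Longrightarrow> \<exists>k B. \<forall>x. norm (f x) \<le> B * (1 + norm x) ^ k"
  shows "slow f"
  unfolding slow_def
  using smooth_coinduct[of f C, OF assms(1-3)] iter_partial_invariant[of f C, OF assms(1,3)] assms(4) by blast

lemma schwartz_add:
  assumes "schwartz f" "schwartz g"
  shows "schwartz (\<lambda>x. f x + g x)"
  unfolding schwartz_iff
proof (intro conjI allI)
  show "smooth (\<lambda>x. f x + g x)" using assms by (simp add: smooth_add schwartz_smooth)
  fix k "is"
  obtain A B where A: "\<And>x. (1 + norm x) ^ k * norm (iter_partial is f x) \<le> A"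
    and B: "\<And>x. (1 + norm x) ^ k * norm (iter_partial is g x) \<le> B"
    using assms unfolding schwartz_iff by blast
  have "(1 + norm x) ^ k * norm (iter_partial is (\<lambda>x. f x + g x) x) \<le> A + B" for x
  proof -
    have "(1 + norm x) ^ k * norm (iter_partial is f x + iter_partial is g x)
      \<le> (1 + norm x) ^ k * (norm (iter_partial is f x) + norm (iter_partial is g x))"
      by (intro mult_left_mono norm_triangle_ineq) simp
    also have "\<dots> \<le> A + B" using A[of x] B[of x] by (simp add: distrib_left)
    finally show ?thesis using assms by (simp add: iter_partial_add schwartz_smooth)
  qed
  then show "\<exists>B. \<forall>x. (1 + norm x) ^ k * norm (iter_partial is (\<lambda>x. f x + g x) x) \<le> B" by blast
qed

lemma slow_bound_weaken:
  fixes C :: real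
  assumes "norm y \<le> C * (1 + norm x) ^ k" "C \<ge> 0" "k \<le> l"
  shows "norm y \<le> C * (1 + norm x) ^ l"
  using assms(1) mult_left_mono[OF power_increasing[OF assms(3), of "1 + norm x"] assms(2)]
  by simp

lemma schwartz_mult_slow:
  assumes "schwartz f" "slow g"
  shows "schwartz (\<lambda>x. f x * g x)"
proof (rule schwartz_coinduct[where C = "Collect (product_sum schwartz slow)"])
  show "(\<lambda>x. f x * g x) \<in> Collect (product_sum schwartz slow)"
    using assms by (auto intro: product_sum.intros)
  fix f and k :: nat
  assume "f \<in> Collect (product_sum schwartz slow)"
  then have "product_sum schwartz slow f" by simp
  then show "\<exists>B. \<forall>x. (1 + norm x) ^ k * norm (f x) \<le> B"
  proof induction
    case (product f g)
    obtain l C where g: "C \<ge> 0" "\<And>x. norm (g x) \<le> C * (1 + norm x) ^ l" using slowD[OF product(2)] by blast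
    obtain B where f: "\<And>x. (1 + norm x) ^ (k + l) * norm (f x) \<le> B" using schwartzD[OF product(1), of "k + l"] by blast
    have "(1 + norm x) ^ k * norm (f x * g x) \<le> C * B" for x
    proof -
      have "(1 + norm x) ^ k * norm (f x * g x) \<le> (1 + norm x) ^ k * (norm (f x) * (C * (1 + norm x) ^ l))"
        unfolding norm_mult by (intro mult_left_mono g) auto
      also have "\<dots> = C * ((1 + norm x) ^ (k + l) * norm (f x))" by (simp add: power_add)
      also have "\<dots> \<le> C * B" by (intro mult_left_mono f g)
      finally show ?thesis .
    qed
    then show ?case by blast
  next
    case (sum f g)
    then obtain A B where A: "\<And>x. (1 + norm x) ^ k * norm (f x) \<le> A"
      and B: "\<And>x. (1 + norm x) ^ k * norm (g x) \<le> B" by blast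
    have "(1 + norm x) ^ k * norm (f x + g x) \<le> A + B" for x
    proof -
      have "(1 + norm x) ^ k * norm (f x + g x) \<le> (1 + norm x) ^ k * (norm (f x) + norm (g x))"
        by (intro mult_left_mono norm_triangle_ineq) simp
      also have "\<dots> \<le> A + B" using A[of x] B[of x] by (simp add: distrib_left)
      finally show ?thesis .
    qed
    then show ?case by blast
  qed
qed (simp_all add: product_sum_differentiable[of schwartz slow] product_sum_partial[of schwartz slow]
    schwartz_smooth slow_smooth schwartz_partial slow_partial)

lemma slow_iter_partial: "slow f \<Longrightarrow> slow (iter_partial is f)"
  by (induction "is") (auto intro: slow_partial)

lemma slow_add:
  assumes "slow u" "slow v"
  shows "slow (\<lambda>x. u x + v x)"
  unfolding slow_def
proof (intro conjI allI)
  show "smooth (\<lambda>x. u x + v x)" using assms by (simp add: smooth_add slow_smooth)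
  fix "is"
  obtain k A where A: "A \<ge> 0" "\<And>x. norm (iter_partial is u x) \<le> A * (1 + norm x) ^ k"
    using slowD[OF slow_iter_partial[OF assms(1)]] by blast
  obtain l B where B: "B \<ge> 0" "\<And>x. norm (iter_partial is v x) \<le> B * (1 + norm x) ^ l"
    using slowD[OF slow_iter_partial[OF assms(2)]] by blast
  have "norm (iter_partial is (\<lambda>x. u x + v x) x) \<le> (A + B) * (1 + norm x) ^ (max k l)" for x
  proof -
    have "norm (iter_partial is u x) \<le> A * (1 + norm x) ^ max k l"
      "norm (iter_partial is v x) \<le> B * (1 + norm x) ^ max k l"
      using slow_bound_weaken[OF A(2)[of x] A(1), of "max k l"]
        slow_bound_weaken[OF B(2)[of x] B(1), of "max k l"] by simp_all
    then show ?thesis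
      using norm_triangle_ineq[of "iter_partial is u x" "iter_partial is v x"] assms
      by (simp add: iter_partial_add slow_smooth distrib_right)
  qed
  then show "\<exists>k C. \<forall>x. norm (iter_partial is (\<lambda>x. u x + v x) x) \<le> C * (1 + norm x) ^ k" by blast
qed

lemma slow_mult:
  assumes "slow f" "slow g"
  shows "slow (\<lambda>x. f x * g x)"
proof (rule slow_coinduct[where C = "Collect (product_sum slow slow)"])
  show "(\<lambda>x. f x * g x) \<in> Collect (product_sum slow slow)"
    using assms by (auto intro: product_sum.intros)
  fix f
  assume "f \<in> Collect (product_sum slow slow)"
  then have "product_sum slow slow f" by simp
  then have "\<exists>k C. C \<ge> 0 \<and> (\<forall>x. norm (f x) \<le> C * (1 + norm x) ^ k)"
  proof induction
    case (product f g)
    obtain l C where g: "C \<ge> 0" "\<And>x. norm (g x) \<le> C * (1 + norm x) ^ l" using slowD[OF product(2)] by blast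
    obtain k B where f: "B \<ge> 0" "\<And>x. norm (f x) \<le> B * (1 + norm x) ^ k" using slowD[OF product(1)] by blast
    have "norm (f x * g x) \<le> (B * C) * (1 + norm x) ^ (k + l)" for x
      using mult_mono[OF f(2)[of x] g(2)[of x]] f g by (simp add: norm_mult power_add ac_simps)
    then show ?case using f g by (intro exI[of _ "k + l"] exI[of _ "B * C"]) simp
  next
    case (sum f g)
    then obtain k l A B where A: "A \<ge> 0" "\<And>x. norm (f x) \<le> A * (1 + norm x) ^ k"
      and B: "B \<ge> 0" "\<And>x. norm (g x) \<le> B * (1 + norm x) ^ l" by blast
    have "norm (f x + g x) \<le> (A + B) * (1 + norm x) ^ (max k l)" for x
    proof -
      have "norm (f x) \<le> A * (1 + norm x) ^ max k l" "norm (g x) \<le> B * (1 + norm x) ^ max k l"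
        using slow_bound_weaken[OF A(2)[of x] A(1), of "max k l"]
          slow_bound_weaken[OF B(2)[of x] B(1), of "max k l"] by simp_all
      then show ?thesis using norm_triangle_ineq[of "f x" "g x"] by (simp add: distrib_right)
    qed
    then show ?case using A B by (intro exI[of _ "max k l"] exI[of _ "A + B"]) simp
  qed
  then show "\<exists>k C. \<forall>x. norm (f x) \<le> C * (1 + norm x) ^ k" by blast
qed (simp_all add: product_sum_differentiable[of slow slow] product_sum_partial[of slow slow]
    slow_smooth slow_partial)

lemma schwartz_imp_slow:
  assumes "schwartz f"
  shows "slow f"
proof (rule slow_coinduct[where C = "Collect schwartz"])
  fix f :: "real^'a \<Rightarrow> complex" assume "f \<in> Collect schwartz"
  then obtain B where "\<And>x. (1 + norm x) ^ 0 * norm (f x) \<le> B" using schwartzD[of f 0] by auto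
  then show "\<exists>k B. \<forall>x. norm (f x) \<le> B * (1 + norm x) ^ k"
    by (intro exI[of _ 0] exI[of _ B]) simp
qed (use assms in \<open>auto intro: schwartz_partial schwartz_smooth smooth_differentiable\<close>)

lemma iter_partial_const: "\<exists>c'. iter_partial is (\<lambda>x. c) = (\<lambda>x. c')"
  by (induction "is") (auto simp: partial_const[abs_def])

lemma slow_const: "slow (\<lambda>x. c)"
proof -
  have "\<exists>k C. \<forall>x. norm (iter_partial is (\<lambda>x. c) x) \<le> C * (1 + norm x) ^ k" for "is"
  proof -
    obtain c' where "iter_partial is (\<lambda>x. c) = (\<lambda>x. c')" using iter_partial_const by blast
    then show ?thesis by (intro exI[of _ 0] exI[of _ "norm c'"]) simp
  qed
  then show ?thesis unfolding slow_def by (blast intro: smooth_const)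
qed

lemma schwartz_scale: "schwartz f \<Longrightarrow> schwartz (\<lambda>x. c * f x)"
  using schwartz_mult_slow[OF _ slow_const, of f c] by (simp add: mult.commute)

lemma schwartz_zero: "schwartz (\<lambda>x. 0)"
  by (rule schwartz_coinduct[where C = "{\<lambda>x. 0}"]) (auto simp: partial_const[abs_def] intro!: exI[of _ 0])

lemma schwartz_sum:
  "finite A \<Longrightarrow> (\<And>i. i \<in> A \<Longrightarrow> schwartz (f i)) \<Longrightarrow> schwartz (\<lambda>x. \<Sum>i\<in>A. f i x)"
  by (induction A rule: finite_induct) (auto intro: schwartz_zero schwartz_add)

lemma has_derivative_coord: "((\<lambda>x. complex_of_real (x $ i)) has_derivative (\<lambda>h. of_real (h $ i))) (at x)"
  by (intro bounded_linear_imp_has_derivative bounded_linear_compose[OF bounded_linear_of_real]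
      bounded_linear_vec_nth)

lemma partial_coord: "partial j (\<lambda>x. complex_of_real (x $ i)) x = (if i = j then 1 else 0)"
  using partial_unique[OF has_derivative_coord, of j i x] by (auto simp: axis_def)

lemma slow_coord: "slow (\<lambda>x. complex_of_real (x $ i))"
proof (rule slow_coinduct[where C = "insert (\<lambda>x. complex_of_real (x $ i)) (range (\<lambda>c x. c))"])
  fix f :: "real^'a \<Rightarrow> complex"
  assume "f \<in> insert (\<lambda>x. complex_of_real (x $ i)) (range (\<lambda>c x. c))"
  then show "f differentiable at x" for x
    using has_derivative_coord has_derivative_const unfolding differentiable_def by fast
next
  fix f :: "real^'a \<Rightarrow> complex"
  assume "f \<in> insert (\<lambda>x. complex_of_real (x $ i)) (range (\<lambda>c x. c))"
  then consider "f = (\<lambda>x. complex_of_real (x $ i))" | c where "f = (\<lambda>x. c)" by auto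
  then show "\<exists>k B. \<forall>x. norm (f x) \<le> B * (1 + norm x) ^ k"
  proof cases
    case 1
    have "norm (f x) \<le> 1 * (1 + norm x) ^ 1" for x
      using component_le_norm_cart[of x i] by (simp add: 1)
    then show ?thesis by blast
  next
    case 2
    show ?thesis by (intro exI[of _ 0] exI[of _ "norm c"]) (simp add: 2)
  qed
qed (auto simp: partial_coord[abs_def] partial_const[abs_def])

lemma slow_affine:
  assumes "slow f"
  shows "slow (\<lambda>x. f (a *\<^sub>R x + b))"
  unfolding slow_def
proof (intro conjI allI)
  show "smooth (\<lambda>x. f (a *\<^sub>R x + b))" using assms by (simp add: smooth_affine slow_smooth)
  fix "is"
  obtain k C where C: "C \<ge> 0" "\<And>x. norm (iter_partial is f x) \<le> C * (1 + norm x) ^ k"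
    using slowD[OF slow_iter_partial[OF assms]] by blast
  define A where "A = 1 + \<bar>a\<bar> + norm b"
  have "norm (iter_partial is (\<lambda>x. f (a *\<^sub>R x + b)) x) \<le> (\<bar>a\<bar> ^ length is * (C * A ^ k)) * (1 + norm x) ^ k" for x
  proof -
    have "1 + norm (a *\<^sub>R x + b) \<le> 1 + (\<bar>a\<bar> * norm x + norm b)"
      using norm_triangle_ineq[of "a *\<^sub>R x" b] by simp
    also have "\<dots> \<le> A * (1 + norm x)"
      by (simp add: A_def algebra_simps)
    finally have "(1 + norm (a *\<^sub>R x + b)) ^ k \<le> (A * (1 + norm x)) ^ k"
      by (intro power_mono) auto
    then have "norm (iter_partial is f (a *\<^sub>R x + b)) \<le> C * (A * (1 + norm x)) ^ k"
      using C(2)[of "a *\<^sub>R x + b"] mult_left_mono[OF _ C(1)] by (meson order_trans)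
    then have "\<bar>a\<bar> ^ length is * norm (iter_partial is f (a *\<^sub>R x + b)) \<le> \<bar>a\<bar> ^ length is * (C * (A * (1 + norm x)) ^ k)"
      by (intro mult_left_mono) auto
    then show ?thesis
      unfolding iter_partial_affine[OF slow_smooth[OF assms]]
      by (simp add: norm_mult norm_power power_mult_distrib ac_simps)
  qed
  then show "\<exists>k C. \<forall>x. norm (iter_partial is (\<lambda>x. f (a *\<^sub>R x + b)) x) \<le> C * (1 + norm x) ^ k" by blast
qed

lemma one_plus_norm_shift: "1 + norm x \<le> (1 + norm (x + b)) * (1 + norm (b :: 'a :: real_normed_vector))"
proof -
  have "norm x \<le> norm (x + b) + norm b" using norm_triangle_ineq4[of "x + b" b] by simp
  moreover have "0 \<le> norm (x + b) * norm b" by simp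
  ultimately have "1 + norm x \<le> 1 + (norm (x + b) + norm b + norm (x + b) * norm b)" by linarith
  then show ?thesis by (simp only: distrib_left distrib_right mult_1_left mult_1_right add.assoc add.left_commute)
qed

lemma schwartz_translate:
  assumes "schwartz f"
  shows "schwartz (\<lambda>x. f (x + b))"
  unfolding schwartz_iff
proof (intro conjI allI)
  show "smooth (\<lambda>x. f (x + b))" using assms smooth_affine[of f 1 b] by (simp add: schwartz_smooth)
  fix k "is"
  obtain B where B: "\<And>x. (1 + norm x) ^ k * norm (iter_partial is f x) \<le> B"
    using assms unfolding schwartz_iff by blast
  have "(1 + norm x) ^ k * norm (iter_partial is (\<lambda>x. f (x + b)) x) \<le> (1 + norm b) ^ k * B" for x
  proof -
    have "(1 + norm x) ^ k \<le> ((1 + norm (x + b)) * (1 + norm b)) ^ k"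
      by (intro power_mono one_plus_norm_shift) simp
    then have "(1 + norm x) ^ k * norm (iter_partial is f (x + b))
       \<le> ((1 + norm (x + b)) * (1 + norm b)) ^ k * norm (iter_partial is f (x + b))"
      by (intro mult_right_mono) auto
    also have "\<dots> = (1 + norm b) ^ k * ((1 + norm (x + b)) ^ k * norm (iter_partial is f (x + b)))"
      by (simp add: power_mult_distrib)
    also have "\<dots> \<le> (1 + norm b) ^ k * B" by (intro mult_left_mono B) simp
    finally show ?thesis
      using assms iter_partial_affine[of f "is" 1 b] by (simp add: schwartz_smooth)
  qed
  then show "\<exists>B. \<forall>x. (1 + norm x) ^ k * norm (iter_partial is (\<lambda>x. f (x + b)) x) \<le> B" by blast
qed

subsection \<open>Plane waves and the Gaussian\<close>

definition pw :: "real^'n::finite \<Rightarrow> real^'n \<Rightarrow> complex" where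
  "pw p x = cis (2 * pi * (p \<bullet> x))"

lemma norm_pw [simp]: "norm (pw p x) = 1" by (simp add: pw_def)
lemma pw_0 [simp]: "pw 0 x = 1" "pw p 0 = 1" by (simp_all add: pw_def)
lemma pw_add: "pw (p + q) x = pw p x * pw q x" by (simp add: pw_def cis_mult inner_add_left distrib_left)
lemma pw_add_right: "pw p (x + y) = pw p x * pw p y" by (simp add: pw_def cis_mult inner_add_right distrib_left)
lemma pw_minus: "pw (- p) x = cnj (pw p x)" by (simp add: pw_def cis_cnj)
lemma pw_minus_right: "pw p (- x) = cnj (pw p x)" by (simp add: pw_def cis_cnj)
lemma pw_scaleR: "pw (t *\<^sub>R p) x = pw p (t *\<^sub>R x)" by (simp add: pw_def)
lemma pw_commute: "pw p x = pw x p" by (simp add: pw_def inner_commute)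

lemma has_derivative_pw:
  "(pw p has_derivative (\<lambda>h. (2 * pi * (p \<bullet> h)) *\<^sub>R (\<i> * pw p x))) (at x)"
proof -
  have "((\<lambda>x. cis (2 * pi * (p \<bullet> x))) has_derivative (\<lambda>h. (2 * pi * (p \<bullet> h)) *\<^sub>R (\<i> * cis (2 * pi * (p \<bullet> x))))) (at x)"
    by (intro has_derivative_cis) (auto intro!: derivative_eq_intros)
  then show ?thesis by (simp add: pw_def[abs_def])
qed

lemma partial_pw: "partial i (pw p) x = 2 * pi * \<i> * of_real (p $ i) * pw p x"
  using partial_unique[OF has_derivative_pw, of i p x]
  by (simp add: inner_axis scaleR_conv_of_real ac_simps)

lemma slow_pw: "slow (pw p)"
proof (rule slow_coinduct[where C = "range (\<lambda>c x. c * pw p x)"])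
  show "pw p \<in> range (\<lambda>c x. c * pw p x)" by (rule range_eqI[of _ _ 1]) simp
  have d: "pw p differentiable at x" for x
    using has_derivative_pw by (auto simp: differentiable_def)
  fix f :: "real^'a \<Rightarrow> complex"
  assume "f \<in> range (\<lambda>c x. c * pw p x)"
  then obtain c where f: "f = (\<lambda>x. c * pw p x)" by auto
  show "f differentiable at x" for x unfolding f by (intro differentiable_mult d) simp
  have "partial i f = (\<lambda>x. (c * (2 * pi * \<i> * of_real (p $ i))) * pw p x)" for i
    unfolding f by (rule ext, subst partial_mult) (auto simp: partial_const partial_pw d)
  then show "partial i f \<in> range (\<lambda>c x. c * pw p x)" for i by blast
  show "\<exists>k B. \<forall>x. norm (f x) \<le> B * (1 + norm x) ^ k"
    by (rule exI[of _ 0], rule exI[of _ "norm c"]) (simp add: f norm_mult)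
qed

definition gauss :: "real^'n::finite \<Rightarrow> complex" where
  "gauss x = of_real (exp (- (x \<bullet> x)))"

lemma gauss_0 [simp]: "gauss 0 = 1" by (simp add: gauss_def)

lemma has_derivative_gauss:
  "(gauss has_derivative (\<lambda>h. of_real (- 2 * (x \<bullet> h)) * gauss x)) (at x)"
proof -
  have "((\<lambda>x. exp (- (x \<bullet> x))) has_derivative (\<lambda>h. - 2 * (x \<bullet> h) * exp (- (x \<bullet> x)))) (at x)"
    by (auto intro!: derivative_eq_intros simp: inner_commute algebra_simps)
  then have "((\<lambda>x. complex_of_real (exp (- (x \<bullet> x)))) has_derivative
      (\<lambda>h. complex_of_real (- 2 * (x \<bullet> h) * exp (- (x \<bullet> x))))) (at x)"
    by (rule has_derivative_of_real)
  then show ?thesis by (simp add: gauss_def[abs_def])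
qed

lemma partial_gauss: "partial i gauss x = (of_real (- 2) * of_real (x $ i)) * gauss x"
  using partial_unique[OF has_derivative_gauss, of i x] by (simp add: inner_axis)

lemma gauss_decay: "\<exists>B. \<forall>x::real^'n::finite. (1 + norm x) ^ k * norm (gauss x) \<le> B"
proof -
  have "((\<lambda>r::real. (1 + r) ^ k * exp (- (r\<^sup>2))) \<longlongrightarrow> 0) at_top"
    by real_asymp
  then have "eventually (\<lambda>r::real. (1 + r) ^ k * exp (- (r\<^sup>2)) < 1) at_top"
    by (rule order_tendstoD) simp
  then obtain R where R: "\<And>r::real. r \<ge> R \<Longrightarrow> (1 + r) ^ k * exp (- (r\<^sup>2)) < 1"
    by (auto simp: eventually_at_top_linorder)
  have "(1 + norm x) ^ k * norm (gauss x) \<le> max 1 ((1 + \<bar>R\<bar>) ^ k)" for x :: "real^'n"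
  proof (cases "norm x \<ge> R")
    case True
    then show ?thesis
      using R[of "norm x"] unfolding gauss_def power2_norm_eq_inner
      by (intro max.coboundedI1) simp
  next
    case False
    have "(1 + norm x) ^ k * norm (gauss x) \<le> (1 + \<bar>R\<bar>) ^ k * 1"
      using False by (intro mult_mono power_mono) (auto simp: gauss_def)
    then show ?thesis by simp
  qed
  then show ?thesis by blast
qed

lemma schwartz_gauss: "schwartz gauss"
proof (rule schwartz_coinduct[where C = "{\<lambda>x. f x * gauss x |f. slow f}"])
  show "gauss \<in> {\<lambda>x. f x * gauss x |f. slow f}"
    using slow_const[of 1] by (auto intro!: exI[of _ "\<lambda>x. 1"])
  have d: "gauss differentiable at x" for x
    using has_derivative_gauss by (auto simp: differentiable_def)
  fix g :: "real^'a \<Rightarrow> complex"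
  assume "g \<in> {\<lambda>x. f x * gauss x |f. slow f}"
  then obtain f where f: "slow f" and g: "g = (\<lambda>x. f x * gauss x)" by auto
  have df: "f differentiable at x" for x using f by (simp add: slow_smooth smooth_differentiable)
  show "g differentiable at x" for x unfolding g by (intro differentiable_mult d df)
  show "partial i g \<in> {\<lambda>x. f x * gauss x |f. slow f}" for i
  proof -
    have "partial i g = (\<lambda>x. (f x * (of_real (- 2) * of_real (x $ i)) + partial i f x * 1) * gauss x)"
      unfolding g by (rule ext, subst partial_mult) (auto simp: partial_gauss d df algebra_simps)
    moreover have "slow (\<lambda>x. f x * (of_real (- 2) * of_real (x $ i)))"
      by (intro slow_mult f slow_const slow_coord)
    moreover have "slow (\<lambda>x. partial i f x * 1)" by (simp add: slow_partial f)
    ultimately show ?thesis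
      unfolding mem_Collect_eq
      by (intro exI[of _ "\<lambda>x. f x * (of_real (- 2) * of_real (x $ i)) + partial i f x * 1"] conjI slow_add)
  qed
  fix k :: nat
  obtain l C where C: "C \<ge> 0" "\<And>x. norm (f x) \<le> C * (1 + norm x) ^ l" using slowD[OF f] by blast
  obtain B where B: "\<And>x::real^'a. (1 + norm x) ^ (k + l) * norm (gauss x) \<le> B" using gauss_decay by blast
  have "(1 + norm x) ^ k * norm (g x) \<le> C * B" for x
  proof -
    have "(1 + norm x) ^ k * norm (g x) \<le> (1 + norm x) ^ k * ((C * (1 + norm x) ^ l) * norm (gauss x))"
      unfolding g norm_mult by (intro mult_left_mono mult_right_mono C) auto
    also have "\<dots> = C * ((1 + norm x) ^ (k + l) * norm (gauss x))" by (simp add: power_add)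
    also have "\<dots> \<le> C * B" by (intro mult_left_mono B C)
    finally show ?thesis .
  qed
  then show "\<exists>B. \<forall>x. (1 + norm x) ^ k * norm (g x) \<le> B" by blast
qed

section \<open>Functionals on the Schwartz space\<close>

text \<open>Continuity is expressed by common bounds of the weighted derivatives; this avoids the
  suprema in the seminorms.\<close>

definition schwartz_functional :: "((real^'n::finite \<Rightarrow> complex) \<Rightarrow> complex) \<Rightarrow> bool" where
  "schwartz_functional T \<longleftrightarrow>
     (\<forall>\<phi> \<psi>. schwartz \<phi> \<longrightarrow> schwartz \<psi> \<longrightarrow> T (\<lambda>x. \<phi> x + \<psi> x) = T \<phi> + T \<psi>) \<and>
     (\<forall>c \<phi>. schwartz \<phi> \<longrightarrow> T (\<lambda>x. c * \<phi> x) = c * T \<phi>) \<and>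
     (\<exists>C m. C \<ge> 0 \<and> (\<forall>\<phi> B. schwartz \<phi> \<longrightarrow>
        (\<forall>is x. length is \<le> m \<longrightarrow> (1 + norm x) ^ m * norm (iter_partial is \<phi> x) \<le> B) \<longrightarrow> norm (T \<phi>) \<le> C * B))"

lemma schwartz_functional_add:
  "schwartz_functional T \<Longrightarrow> schwartz \<phi> \<Longrightarrow> schwartz \<psi> \<Longrightarrow> T (\<lambda>x. \<phi> x + \<psi> x) = T \<phi> + T \<psi>"
  and schwartz_functional_scale:
  "schwartz_functional T \<Longrightarrow> schwartz \<phi> \<Longrightarrow> T (\<lambda>x. c * \<phi> x) = c * T \<phi>"
  and schwartz_functional_bound:
  "schwartz_functional T \<Longrightarrow> \<exists>C m. C \<ge> 0 \<and> (\<forall>\<phi> B. schwartz \<phi> \<longrightarrow>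
        (\<forall>is x. length is \<le> m \<longrightarrow> (1 + norm x) ^ m * norm (iter_partial is \<phi> x) \<le> B) \<longrightarrow> norm (T \<phi>) \<le> C * B)"
  by (simp_all add: schwartz_functional_def)

lemma schwartz_functional_zero:
  "schwartz_functional T \<Longrightarrow> T (\<lambda>x. 0) = 0"
  using schwartz_functional_scale[of T "\<lambda>x. 0" 0] by (simp add: schwartz_zero)

lemma schwartz_functional_sum:
  assumes "schwartz_functional T" "finite A" "\<And>i. i \<in> A \<Longrightarrow> schwartz (f i)"
  shows "T (\<lambda>x. \<Sum>i\<in>A. f i x) = (\<Sum>i\<in>A. T (f i))"
  using assms(2,3)
proof (induction A rule: finite_induct)
  case (insert a A)
  then show ?case
    using schwartz_functional_add[OF assms(1), of "f a" "\<lambda>x. \<Sum>i\<in>A. f i x"] by (simp add: schwartz_sum)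
qed (simp add: schwartz_functional_zero[OF assms(1)])

lemma tempered_schwartz_functional:
  assumes "tempered T"
  shows "schwartz_functional T"
proof -
  obtain C m where C: "\<And>\<phi>. schwartz \<phi> \<Longrightarrow> norm (T \<phi>) \<le> C * schwartz_norm m \<phi>"
    using assms unfolding tempered_def by blast
  have "norm (T \<phi>) \<le> \<bar>C\<bar> * B"
    if "schwartz \<phi>" and B: "\<forall>is x. length is \<le> m \<longrightarrow> (1 + norm x) ^ m * norm (iter_partial is \<phi> x) \<le> B" for \<phi> B
  proof -
    have "schwartz_norm m \<phi> \<le> B"
      unfolding schwartz_norm_def using B by (intro cSUP_least) (auto intro!: exI[of _ "[]"])
    moreover have "0 \<le> schwartz_norm m \<phi>"
    proof -
      have "(1 + norm (0::real^'a)) ^ m * norm (iter_partial [] \<phi> 0) \<le> schwartz_norm m \<phi>"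
      proof -
        have "bdd_above ((\<lambda>(is, x). (1 + norm x) ^ m * norm (iter_partial is \<phi> x)) ` ({is. length is \<le> m} \<times> UNIV))"
          using B by (intro bdd_aboveI[of _ B]) auto
        from cSUP_upper[OF _ this, of "([], 0)"] show ?thesis
          by (simp add: schwartz_norm_def)
      qed
      then show ?thesis by (rule order_trans[rotated]) simp
    qed
    ultimately have "C * schwartz_norm m \<phi> \<le> \<bar>C\<bar> * B"
      by (intro mult_mono) auto
    then show ?thesis using C[OF that(1)] by linarith
  qed
  then have "\<exists>C m. C \<ge> 0 \<and> (\<forall>\<phi> B. schwartz \<phi> \<longrightarrow>
        (\<forall>is x. length is \<le> m \<longrightarrow> (1 + norm x) ^ m * norm (iter_partial is \<phi> x) \<le> B) \<longrightarrow> norm (T \<phi>) \<le> C * B)"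
    by (intro exI[of _ "\<bar>C\<bar>"] exI[of _ m]) auto
  then show ?thesis
    using assms unfolding schwartz_functional_def tempered_def by blast
qed

lemma schwartz_functional_tempered:
  assumes T: "schwartz_functional T" and "\<And>\<phi>. \<not> schwartz \<phi> \<Longrightarrow> T \<phi> = 0"
  shows "tempered T"
proof -
  obtain C m where C: "C \<ge> 0" "\<And>\<phi> B. schwartz \<phi> \<Longrightarrow>
      (\<And>is x. length is \<le> m \<Longrightarrow> (1 + norm x) ^ m * norm (iter_partial is \<phi> x) \<le> B) \<Longrightarrow> norm (T \<phi>) \<le> C * B"
    using schwartz_functional_bound[OF T] by blast
  have "norm (T \<phi>) \<le> C * schwartz_norm m \<phi>" if "schwartz \<phi>" for \<phi>
  proof (rule C(2)[OF that])
    fix "is" :: "'a list" and x :: "real^'a"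
    assume len: "length is \<le> m"
    have "\<exists>B. \<forall>x. (1 + norm x) ^ m * norm (iter_partial is \<phi> x) \<le> B" for "is"
      using that unfolding schwartz_iff by blast
    then obtain B where B: "\<And>is x. (1 + norm x) ^ m * norm (iter_partial is \<phi> x) \<le> B is" by metis
    have fin: "finite {is::'a list. length is \<le> m}"
      using finite_lists_length_le[of "UNIV :: 'a set" m] by simp
    have "bdd_above ((\<lambda>(is, x). (1 + norm x) ^ m * norm (iter_partial is \<phi> x)) ` ({is. length is \<le> m} \<times> UNIV))"
    proof (rule bdd_aboveI)
      fix y assume "y \<in> (\<lambda>(is, x). (1 + norm x) ^ m * norm (iter_partial is \<phi> x)) ` ({is. length is \<le> m} \<times> UNIV)"
      then obtain js z where "length js \<le> m" "y = (1 + norm z) ^ m * norm (iter_partial js \<phi> z)" by auto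
      moreover have "(1 + norm z) ^ m * norm (iter_partial js \<phi> z) \<le> B js" by (rule B)
      moreover have "B js \<le> Max (B ` {is. length is \<le> m})"
        using fin calculation(1) by (intro Max_ge) auto
      ultimately show "y \<le> Max (B ` {is. length is \<le> m})" by linarith
    qed
    from cSUP_upper[OF _ this, of "(is, x)"] len
    show "(1 + norm x) ^ m * norm (iter_partial is \<phi> x) \<le> schwartz_norm m \<phi>"
      by (simp add: schwartz_norm_def)
  qed
  then show ?thesis
    using T assms(2) unfolding tempered_def schwartz_functional_def by blast
qed

section \<open>Differentiating a functional along dilations\<close>

text \<open>The products \<open>\<psi>(x) \<theta>(t x)\<close>, together with everything obtained from them by differentiation in \<open>t\<close> and
  in \<open>x\<close>. The powers of \<open>t\<close> come from the chain rule.\<close>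

inductive dilation_family :: "(real \<Rightarrow> real^'n::finite \<Rightarrow> complex) \<Rightarrow> bool" where
  base: "schwartz \<psi> \<Longrightarrow> slow \<theta> \<Longrightarrow> dilation_family (\<lambda>t x. of_real (t ^ a) * \<psi> x * \<theta> (t *\<^sub>R x))"
| sum: "dilation_family u \<Longrightarrow> dilation_family v \<Longrightarrow> dilation_family (\<lambda>t x. u t x + v t x)"

lemma slow_dilate: "slow \<theta> \<Longrightarrow> slow (\<lambda>x. \<theta> (t *\<^sub>R x))"
  using slow_affine[of \<theta> t 0] by simp

lemma dilation_family_schwartz: "dilation_family u \<Longrightarrow> schwartz (u t)"
  by (induction rule: dilation_family.induct)
    (auto intro!: schwartz_add schwartz_mult_slow schwartz_scale slow_dilate)

lemma partial_base:
  assumes "smooth \<psi>" "smooth \<theta>"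
  shows "partial i (\<lambda>x. c * \<psi> x * \<theta> (t *\<^sub>R x)) x =
    c * partial i \<psi> x * \<theta> (t *\<^sub>R x) + (c * of_real t) * \<psi> x * partial i \<theta> (t *\<^sub>R x)"
proof -
  have d: "(\<lambda>x. \<theta> (t *\<^sub>R x)) differentiable (at x)" "\<psi> differentiable (at x)" for x
    using smooth_affine[OF assms(2), of t 0] assms(1) by (auto intro: smooth_differentiable)
  have "partial i (\<lambda>x. \<theta> (t *\<^sub>R x)) x = of_real t * partial i \<theta> (t *\<^sub>R x)"
    using partial_affine[of \<theta> t x 0 i] smooth_differentiable[OF assms(2)] by simp
  moreover have "partial i (\<lambda>x. c * \<psi> x) x = c * partial i \<psi> x"
    by (subst partial_mult) (auto simp: partial_const d)
  ultimately show ?thesis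
    by (subst partial_mult) (auto intro!: d differentiable_mult simp: algebra_simps)
qed

lemma dilation_family_partial:
  "dilation_family u \<Longrightarrow> dilation_family (\<lambda>t. partial i (u t))"
proof (induction rule: dilation_family.induct)
  case (base \<psi> \<theta> a)
  have "dilation_family (\<lambda>t x. of_real (t ^ a) * partial i \<psi> x * \<theta> (t *\<^sub>R x)
      + of_real (t ^ Suc a) * \<psi> x * partial i \<theta> (t *\<^sub>R x))"
    using base by (intro dilation_family.intros schwartz_partial slow_partial)
  moreover have "(\<lambda>t. partial i (\<lambda>x. of_real (t ^ a) * \<psi> x * \<theta> (t *\<^sub>R x))) = \<dots>"
    by (intro ext) (simp add: partial_base[OF schwartz_smooth[OF base(1)] slow_smooth[OF base(2)]] power_Suc2 del: power_Suc)
  ultimately show ?case by metis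
next
  case (sum u v)
  have "(\<lambda>t. partial i (\<lambda>x. u t x + v t x)) = (\<lambda>t x. partial i (u t) x + partial i (v t) x)"
    using dilation_family_schwartz[OF sum(1)] dilation_family_schwartz[OF sum(2)]
    by (intro ext partial_add smooth_differentiable schwartz_smooth)
  then show ?case using sum by (simp add: dilation_family.sum)
qed

lemma dilation_family_iter_partial:
  "dilation_family u \<Longrightarrow> dilation_family (\<lambda>t. iter_partial is (u t))"
  by (induction "is") (auto intro: dilation_family_partial)

lemma dilation_family_sum:
  assumes "finite A" "\<And>j. j \<in> A \<Longrightarrow> dilation_family (u j)"
  shows "dilation_family (\<lambda>t x. \<Sum>j\<in>A. u j t x)"
  using assms
proof (induction A rule: finite_induct)
  case empty
  show ?case using dilation_family.base[OF schwartz_zero slow_const[of 0], of 0] by simp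
qed (auto intro: dilation_family.sum)

lemma has_vector_derivative_dilate:
  assumes "smooth \<theta>"
  shows "((\<lambda>s. \<theta> (s *\<^sub>R x)) has_vector_derivative (\<Sum>j\<in>UNIV. of_real (x $ j) * partial j \<theta> (t *\<^sub>R x))) (at t)"
proof -
  have d: "\<theta> differentiable (at (t *\<^sub>R x))" using assms by (rule smooth_differentiable)
  have "((\<lambda>s. \<theta> (s *\<^sub>R x)) has_derivative (\<lambda>h. frechet_derivative \<theta> (at (t *\<^sub>R x)) (h *\<^sub>R x))) (at t)"
    by (rule has_derivative_compose[where f = "\<lambda>s. s *\<^sub>R x" and f' = "\<lambda>h. h *\<^sub>R x"])
      (auto intro!: derivative_eq_intros has_derivative_frechet d)
  moreover have "frechet_derivative \<theta> (at (t *\<^sub>R x)) (h *\<^sub>R x) =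
      h *\<^sub>R (\<Sum>j\<in>UNIV. of_real (x $ j) * partial j \<theta> (t *\<^sub>R x))" for h
    unfolding linear_cmul[OF linear_frechet_derivative[OF d]] frechet_derivative_partial[OF d, of x] ..
  ultimately show ?thesis by (simp add: has_vector_derivative_def)
qed

lemma has_vector_derivative_eq_rhs':
  "(f has_vector_derivative a) F \<Longrightarrow> f = g \<and> a = b \<Longrightarrow> (g has_vector_derivative b) F"
  by simp

lemma has_vector_derivative_base:
  assumes "smooth \<theta>"
  shows "((\<lambda>s. of_real (s ^ a) * c * \<theta> (s *\<^sub>R x)) has_vector_derivative
     of_real (t ^ (a - 1)) * (of_nat a * c) * \<theta> (t *\<^sub>R x) +
     (\<Sum>j\<in>UNIV. of_real (t ^ a) * (c * of_real (x $ j)) * partial j \<theta> (t *\<^sub>R x))) (at t)"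
proof -
  have "((\<lambda>s. complex_of_real (s ^ a)) has_vector_derivative of_real (of_nat a * t ^ (a - 1))) (at t)"
    using DERIV_pow[of a t UNIV]
    by (intro has_vector_derivative_of_real) (simp add: has_real_derivative_iff_has_vector_derivative)
  then have "((\<lambda>s. of_real (s ^ a) * c) has_vector_derivative of_real (of_nat a * t ^ (a - 1)) * c) (at t)"
    by (rule has_vector_derivative_mult_left)
  from has_vector_derivative_mult[OF this has_vector_derivative_dilate[OF assms, of x t]]
  show ?thesis by (simp add: sum_distrib_left algebra_simps)
qed

lemma partial_sum:
  assumes "finite A" "\<And>j. j \<in> A \<Longrightarrow> smooth (f j)"
  shows "partial i (\<lambda>x. \<Sum>j\<in>A. f j x) x = (\<Sum>j\<in>A. partial i (f j) x)"
    and "(\<lambda>x. \<Sum>j\<in>A. f j x) differentiable (at x)"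
proof -
  have d: "(\<lambda>x. \<Sum>j\<in>A. f j x) differentiable (at x)" if "A \<subseteq> B" "finite B" "\<And>j. j \<in> B \<Longrightarrow> smooth (f j)" for A B
    using finite_subset[OF that(1,2)] that(1,3)
  proof (induction A rule: finite_induct)
    case (insert a A)
    then show ?case using differentiable_add[OF smooth_differentiable[of "f a" x]] by auto
  qed simp
  show "(\<lambda>x. \<Sum>j\<in>A. f j x) differentiable (at x)" using d[of A A] assms by blast
  show "partial i (\<lambda>x. \<Sum>j\<in>A. f j x) x = (\<Sum>j\<in>A. partial i (f j) x)"
    using assms
  proof (induction A rule: finite_induct)
    case (insert a A)
    have "partial i (\<lambda>x. f a x + (\<Sum>j\<in>A. f j x)) x = partial i (f a) x + partial i (\<lambda>x. \<Sum>j\<in>A. f j x) x"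
      using insert d[of A A] by (intro partial_add) (auto intro: smooth_differentiable)
    then show ?case using insert by simp
  qed (simp add: partial_const)
qed

text \<open>A family has a parameter derivative in the same class, and it commutes with the partial
  derivatives in \<open>x\<close>.\<close>

lemma dilation_family_derivative:
  assumes "dilation_family u"
  shows "\<exists>v. dilation_family v \<and> (\<forall>t x. ((\<lambda>s. u s x) has_vector_derivative v t x) (at t)) \<and>
    (\<forall>i t x. ((\<lambda>s. partial i (u s) x) has_vector_derivative partial i (v t) x) (at t))"
  using assms
proof induction
  case (base \<psi> \<theta> a)
  have s: "smooth \<psi>" "smooth \<theta>" "\<And>i. smooth (partial i \<psi>)" "\<And>i. smooth (partial i \<theta>)"
    using base by (auto simp: schwartz_smooth slow_smooth smooth_partial)
  define v where "v t x = of_real (t ^ (a - 1)) * (of_nat a * \<psi> x) * \<theta> (t *\<^sub>R x) +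
     (\<Sum>j\<in>UNIV. of_real (t ^ a) * (\<psi> x * of_real (x $ j)) * partial j \<theta> (t *\<^sub>R x))" for t x
  have fam: "dilation_family v"
    unfolding v_def
    by (intro dilation_family.sum dilation_family_sum dilation_family.base schwartz_scale base
        schwartz_mult_slow slow_coord slow_partial) auto
  have "((\<lambda>s. partial i (\<lambda>x. of_real (s ^ a) * \<psi> x * \<theta> (s *\<^sub>R x)) x) has_vector_derivative partial i (v t) x) (at t)"
    for i t x
  proof -
    have pc: "partial i (\<lambda>x. \<psi> x * of_real (x $ j)) x = \<psi> x * (if j = i then 1 else 0) + partial i \<psi> x * of_real (x $ j)" for j
      using smooth_differentiable[OF slow_smooth[OF slow_coord[of j]]] smooth_differentiable[OF s(1)]
      by (subst partial_mult) (simp_all add: partial_coord)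
    have pn: "partial i (\<lambda>x. of_nat a * \<psi> x) x = of_nat a * partial i \<psi> x"
      using s by (subst partial_mult) (auto simp: partial_const smooth_differentiable)
    have sm: "smooth (\<lambda>x. of_real (t ^ a) * (\<psi> x * of_real (x $ j)) * partial j \<theta> (t *\<^sub>R x))" for j
      by (intro schwartz_smooth schwartz_mult_slow schwartz_scale base slow_coord slow_dilate slow_partial)
    have e1: "partial i (v t) x =
        partial i (\<lambda>x. of_real (t ^ (a - 1)) * (of_nat a * \<psi> x) * \<theta> (t *\<^sub>R x)) x +
        partial i (\<lambda>x. \<Sum>j\<in>UNIV. of_real (t ^ a) * (\<psi> x * of_real (x $ j)) * partial j \<theta> (t *\<^sub>R x)) x"
      unfolding v_def[abs_def]
      by (intro partial_add partial_sum sm smooth_differentiable schwartz_smooth schwartz_mult_slow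
          schwartz_scale base slow_dilate) auto
    have e2: "partial i (\<lambda>x. \<Sum>j\<in>UNIV. of_real (t ^ a) * (\<psi> x * of_real (x $ j)) * partial j \<theta> (t *\<^sub>R x)) x
        = (\<Sum>j\<in>UNIV. partial i (\<lambda>x. of_real (t ^ a) * (\<psi> x * of_real (x $ j)) * partial j \<theta> (t *\<^sub>R x)) x)"
      using sm by (intro partial_sum) auto
    have e3: "partial i (\<lambda>x. of_real (t ^ a) * (\<psi> x * of_real (x $ j)) * partial j \<theta> (t *\<^sub>R x)) x =
        of_real (t ^ a) * (\<psi> x * (if j = i then 1 else 0) + partial i \<psi> x * of_real (x $ j)) * partial j \<theta> (t *\<^sub>R x) +
        (of_real (t ^ a) * of_real t) * (\<psi> x * of_real (x $ j)) * partial j (partial i \<theta>) (t *\<^sub>R x)" for j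
      using partial_base[OF smooth_mult[OF s(1) slow_smooth[OF slow_coord[of j]]] s(4)[of j], of i "of_real (t ^ a)" t x]
        partial_commute[OF s(2), of i j] by (simp add: pc)
    have e4: "partial i (\<lambda>x. of_real (t ^ (a - 1)) * (of_nat a * \<psi> x) * \<theta> (t *\<^sub>R x)) x =
        of_real (t ^ (a - 1)) * (of_nat a * partial i \<psi> x) * \<theta> (t *\<^sub>R x)
        + (of_real (t ^ (a - 1)) * of_real t) * (of_nat a * \<psi> x) * partial i \<theta> (t *\<^sub>R x)"
      using partial_base[OF smooth_mult[OF smooth_const s(1)] s(2), of i "of_real (t ^ (a - 1))" "of_nat a" t x]
      by (simp add: pn)
    have e5: "(of_real (t ^ (a - 1)) * of_real t) * (of_nat a * \<psi> x) = of_real (t ^ a) * (of_nat a * \<psi> x)"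
      by (cases a) auto
    have e6: "(\<Sum>j\<in>UNIV. of_real (t ^ a) * (\<psi> x * (if j = i then 1 else 0) + partial i \<psi> x * of_real (x $ j)) * partial j \<theta> (t *\<^sub>R x) +
        (of_real (t ^ a) * of_real t) * (\<psi> x * of_real (x $ j)) * partial j (partial i \<theta>) (t *\<^sub>R x))
      = of_real (t ^ a) * \<psi> x * partial i \<theta> (t *\<^sub>R x)
        + (\<Sum>j\<in>UNIV. of_real (t ^ a) * (partial i \<psi> x * of_real (x $ j)) * partial j \<theta> (t *\<^sub>R x))
        + (\<Sum>j\<in>UNIV. of_real (t ^ Suc a) * (\<psi> x * of_real (x $ j)) * partial j (partial i \<theta>) (t *\<^sub>R x))"
    proof -
      have "of_real (t ^ a) * \<psi> x * partial i \<theta> (t *\<^sub>R x)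
          = (\<Sum>j\<in>UNIV. if j = i then of_real (t ^ a) * \<psi> x * partial j \<theta> (t *\<^sub>R x) else 0)" by simp
      then show ?thesis
        by (simp only: sum.distrib[symmetric]) (rule sum.cong, auto simp: algebra_simps)
    qed
    have pv: "partial i (v t) x =
        of_real (t ^ (a - 1)) * (of_nat a * partial i \<psi> x) * \<theta> (t *\<^sub>R x)
        + of_real (t ^ a) * (of_nat a * \<psi> x) * partial i \<theta> (t *\<^sub>R x)
        + (of_real (t ^ a) * \<psi> x * partial i \<theta> (t *\<^sub>R x)
        + (\<Sum>j\<in>UNIV. of_real (t ^ a) * (partial i \<psi> x * of_real (x $ j)) * partial j \<theta> (t *\<^sub>R x))
        + (\<Sum>j\<in>UNIV. of_real (t ^ Suc a) * (\<psi> x * of_real (x $ j)) * partial j (partial i \<theta>) (t *\<^sub>R x)))"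
      unfolding e1 e2 e3 e4 e5 e6 ..
    have "((\<lambda>s. of_real (s ^ a) * partial i \<psi> x * \<theta> (s *\<^sub>R x) + of_real (s ^ Suc a) * \<psi> x * partial i \<theta> (s *\<^sub>R x))
        has_vector_derivative
        (of_real (t ^ (a - 1)) * (of_nat a * partial i \<psi> x) * \<theta> (t *\<^sub>R x) +
        (\<Sum>j\<in>UNIV. of_real (t ^ a) * (partial i \<psi> x * of_real (x $ j)) * partial j \<theta> (t *\<^sub>R x))) +
        (of_real (t ^ (Suc a - 1)) * (of_nat (Suc a) * \<psi> x) * partial i \<theta> (t *\<^sub>R x) +
        (\<Sum>j\<in>UNIV. of_real (t ^ Suc a) * (\<psi> x * of_real (x $ j)) * partial j (partial i \<theta>) (t *\<^sub>R x)))) (at t)"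
      by (intro has_vector_derivative_add has_vector_derivative_base s)
    then show ?thesis
      unfolding pv partial_base[OF s(1,2)]
      by (rule has_vector_derivative_eq_rhs') (simp add: algebra_simps)
  qed
  moreover have "((\<lambda>s. of_real (s ^ a) * \<psi> x * \<theta> (s *\<^sub>R x)) has_vector_derivative v t x) (at t)" for t x
    unfolding v_def by (rule has_vector_derivative_base[OF s(2)])
  ultimately show ?case using fam by blast
next
  case (sum u1 u2)
  then obtain v1 v2 where v: "dilation_family v1" "dilation_family v2"
    "\<forall>t x. ((\<lambda>s. u1 s x) has_vector_derivative v1 t x) (at t)"
    "\<forall>t x. ((\<lambda>s. u2 s x) has_vector_derivative v2 t x) (at t)"
    "\<forall>i t x. ((\<lambda>s. partial i (u1 s) x) has_vector_derivative partial i (v1 t) x) (at t)"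
    "\<forall>i t x. ((\<lambda>s. partial i (u2 s) x) has_vector_derivative partial i (v2 t) x) (at t)" by blast
  have pa: "partial i (\<lambda>x. p s x + q s x) x = partial i (p s) x + partial i (q s) x"
    if "dilation_family p" "dilation_family q" for i s x p q
    using that by (intro partial_add smooth_differentiable schwartz_smooth dilation_family_schwartz)
  show ?case
  proof (intro exI[of _ "\<lambda>t x. v1 t x + v2 t x"] conjI allI)
    show "dilation_family (\<lambda>t x. v1 t x + v2 t x)" by (intro dilation_family.sum v(1,2))
    show "((\<lambda>s. u1 s x + u2 s x) has_vector_derivative v1 t x + v2 t x) (at t)" for t x
      by (intro has_vector_derivative_add v(3,4)[rule_format])
    show "((\<lambda>s. partial i (\<lambda>x. u1 s x + u2 s x) x) has_vector_derivative partial i (\<lambda>x. v1 t x + v2 t x) x) (at t)"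
      for i t x
      unfolding pa[OF sum(1,2)] pa[OF v(1,2)]
      by (intro has_vector_derivative_add v(5,6)[rule_format])
  qed
qed

lemma dilation_family_iter_derivative:
  assumes "dilation_family u" "dilation_family v" "\<And>t x. ((\<lambda>s. u s x) has_vector_derivative v t x) (at t)"
  shows "((\<lambda>s. iter_partial is (u s) x) has_vector_derivative iter_partial is (v t) x) (at t)"
proof (induction "is" arbitrary: t x)
  case (Cons i "is")
  obtain w where w: "\<forall>t x. ((\<lambda>s. iter_partial is (u s) x) has_vector_derivative w t x) (at t)"
    "\<forall>i t x. ((\<lambda>s. partial i (iter_partial is (u s)) x) has_vector_derivative partial i (w t) x) (at t)"
    using dilation_family_derivative[OF dilation_family_iter_partial[OF assms(1), of "is"]] by blast
  have "w t x = iter_partial is (v t) x" for t x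
    using w(1) Cons vector_derivative_unique_at by blast
  then have "w t = iter_partial is (v t)" for t by blast
  then show ?case using w(2) by simp
qed (use assms in simp)

lemma dilation_family_bounded:
  assumes "dilation_family u"
  shows "\<exists>C\<ge>0. \<forall>t x. \<bar>t\<bar> \<le> R \<longrightarrow> (1 + norm x) ^ m * norm (u t x) \<le> C"
  using assms
proof induction
  case (base \<psi> \<theta> a)
  obtain k C where C: "C \<ge> 0" "\<And>x. norm (\<theta> x) \<le> C * (1 + norm x) ^ k" using slowD[OF base(2)] by blast
  obtain B where B: "B \<ge> 0" "\<And>x. (1 + norm x) ^ (m + k) * norm (\<psi> x) \<le> B"
    using schwartzD[OF base(1), of "m + k"] by blast
  have "(1 + norm x) ^ m * norm (of_real (t ^ a) * \<psi> x * \<theta> (t *\<^sub>R x)) \<le> \<bar>R\<bar> ^ a * (C * (1 + \<bar>R\<bar>) ^ k) * B"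
    if t: "\<bar>t\<bar> \<le> R" for t x
  proof -
    have "1 + norm (t *\<^sub>R x) \<le> (1 + \<bar>R\<bar>) * (1 + norm x)"
    proof -
      have "\<bar>t\<bar> * norm x \<le> \<bar>R\<bar> * norm x" using t by (intro mult_right_mono) auto
      moreover have "0 \<le> \<bar>R\<bar>" "0 \<le> norm x" by auto
      moreover have "(1 + \<bar>R\<bar>) * (1 + norm x) = 1 + \<bar>R\<bar> + norm x + \<bar>R\<bar> * norm x" by (simp add: algebra_simps)
      ultimately show ?thesis unfolding norm_scaleR by linarith
    qed
    then have "(1 + norm (t *\<^sub>R x)) ^ k \<le> ((1 + \<bar>R\<bar>) * (1 + norm x)) ^ k" by (intro power_mono) auto
    then have chi: "norm (\<theta> (t *\<^sub>R x)) \<le> C * (1 + \<bar>R\<bar>) ^ k * (1 + norm x) ^ k"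
      using C(2)[of "t *\<^sub>R x"] mult_left_mono[OF _ C(1)] unfolding power_mult_distrib mult.assoc
      by (meson order_trans)
    have "\<bar>t\<bar> ^ a \<le> \<bar>R\<bar> ^ a" using t by (intro power_mono) auto
    then have "(1 + norm x) ^ m * (\<bar>t\<bar> ^ a * norm (\<psi> x) * norm (\<theta> (t *\<^sub>R x)))
       \<le> (1 + norm x) ^ m * (\<bar>R\<bar> ^ a * norm (\<psi> x) * (C * (1 + \<bar>R\<bar>) ^ k * (1 + norm x) ^ k))"
      using chi C by (intro mult_left_mono mult_mono) auto
    also have "\<dots> = \<bar>R\<bar> ^ a * (C * (1 + \<bar>R\<bar>) ^ k) * ((1 + norm x) ^ (m + k) * norm (\<psi> x))"
      by (simp add: power_add)
    also have "\<dots> \<le> \<bar>R\<bar> ^ a * (C * (1 + \<bar>R\<bar>) ^ k) * B"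
      using C by (intro mult_left_mono B) auto
    finally show ?thesis by (simp add: norm_mult norm_power)
  qed
  moreover have "\<bar>R\<bar> ^ a * (C * (1 + \<bar>R\<bar>) ^ k) * B \<ge> 0" using B C by simp
  ultimately show ?case by blast
next
  case (sum u v)
  then obtain A B where A: "A \<ge> 0" "\<And>t x. \<bar>t\<bar> \<le> R \<Longrightarrow> (1 + norm x) ^ m * norm (u t x) \<le> A"
    and B: "B \<ge> 0" "\<And>t x. \<bar>t\<bar> \<le> R \<Longrightarrow> (1 + norm x) ^ m * norm (v t x) \<le> B" by blast
  have "(1 + norm x) ^ m * norm (u t x + v t x) \<le> A + B" if "\<bar>t\<bar> \<le> R" for t x
  proof -
    have "(1 + norm x) ^ m * norm (u t x + v t x) \<le> (1 + norm x) ^ m * (norm (u t x) + norm (v t x))"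
      by (intro mult_left_mono norm_triangle_ineq) simp
    also have "\<dots> \<le> A + B" using A(2)[OF that, of x] B(2)[OF that, of x] by (simp add: distrib_left)
    finally show ?thesis .
  qed
  then show ?case using A B by (intro exI[of _ "A + B"]) auto
qed

lemma taylor_bound:
  fixes f g k :: "real \<Rightarrow> complex"
  assumes f: "\<And>t. (f has_vector_derivative g t) (at t)" and g: "\<And>t. (g has_vector_derivative k t) (at t)"
    and k: "\<And>t. t \<in> closed_segment a b \<Longrightarrow> norm (k t) \<le> C"
  shows "norm (f b - f a - (b - a) *\<^sub>R g a) \<le> 3 * C * \<bar>b - a\<bar>\<^sup>2"
proof -
  have C: "C \<ge> 0" using order_trans[OF norm_ge_zero k[of a]] by simp
  have gs: "norm (g s - g a) \<le> 3 * C * \<bar>b - a\<bar>" if s: "s \<in> closed_segment a b" for s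
  proof -
    have sub: "closed_segment a s \<subseteq> closed_segment a b"
      using s by (simp add: subset_closed_segment)
    have "norm (g s - g a - (s - a) *\<^sub>R k a) \<le> norm (s - a) * (2 * C)"
    proof (rule vector_differentiable_bound_linearization[where S = "closed_segment a s"])
      show "norm (k t - k a) \<le> 2 * C" if "t \<in> closed_segment a s" for t
        using norm_triangle_ineq4[of "k t" "k a"] k[of t] k[of a] sub that by auto
    qed (auto intro: has_vector_derivative_at_within g)
    moreover have "norm ((s - a) *\<^sub>R k a) \<le> \<bar>s - a\<bar> * C"
      using k[of a] by (auto intro: mult_left_mono)
    moreover have "norm (g s - g a) \<le> norm (g s - g a - (s - a) *\<^sub>R k a) + norm ((s - a) *\<^sub>R k a)"
      using norm_triangle_ineq[of "g s - g a - (s - a) *\<^sub>R k a" "(s - a) *\<^sub>R k a"] by simp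
    ultimately have "norm (g s - g a) \<le> \<bar>s - a\<bar> * (3 * C)" by (simp add: algebra_simps)
    also have "\<dots> \<le> \<bar>b - a\<bar> * (3 * C)"
      using s C by (intro mult_right_mono) (auto simp: closed_segment_eq_real_ivl split: if_splits)
    finally show ?thesis by (simp add: mult.commute)
  qed
  have "norm (f b - f a - (b - a) *\<^sub>R g a) \<le> norm (b - a) * (3 * C * \<bar>b - a\<bar>)"
    by (rule vector_differentiable_bound_linearization[where S = "closed_segment a b"])
      (auto intro: has_vector_derivative_at_within f gs)
  then show ?thesis by (simp add: power2_eq_square algebra_simps)
qed

lemma has_vector_derivative_quadratic:
  fixes F :: "real \<Rightarrow> complex"
  assumes "\<And>s. \<bar>s - t\<bar> \<le> 1 \<Longrightarrow> norm (F s - F t - (s - t) *\<^sub>R D) \<le> K * \<bar>s - t\<bar>\<^sup>2" "K \<ge> 0"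
  shows "(F has_vector_derivative D) (at t)"
  unfolding has_vector_derivative_def has_derivative_at_alt
proof (intro conjI allI impI)
  fix e :: real assume e: "e > 0"
  define d where "d = min 1 (e / (K + 1))"
  have d: "d > 0" using e assms(2) by (simp add: d_def)
  have "norm (F s - F t - (s - t) *\<^sub>R D) \<le> e * norm (s - t)" if "norm (s - t) < d" for s
  proof -
    have "K * \<bar>s - t\<bar> \<le> (K + 1) * (e / (K + 1))"
      using that assms(2) e by (intro mult_mono) (auto simp: d_def)
    then have "K * \<bar>s - t\<bar> \<le> e" using assms(2) by simp
    then have "K * \<bar>s - t\<bar> * \<bar>s - t\<bar> \<le> e * \<bar>s - t\<bar>" by (intro mult_right_mono) auto
    then show ?thesis using assms(1)[of s] that by (simp add: d_def power2_eq_square mult.assoc)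
  qed
  then show "\<exists>d>0. \<forall>y. norm (y - t) < d \<longrightarrow> norm (F y - F t - (y - t) *\<^sub>R D) \<le> e * norm (y - t)"
    using d by blast
qed (simp add: bounded_linear_scaleR_left)

text \<open>By Taylor's formula the difference quotients converge in every seminorm, as the second
  derivative in the parameter is again a family of the same kind. So a continuous functional can be
  differentiated under the argument.\<close>

lemma functional_derivative:
  assumes T: "schwartz_functional T"
    and u: "dilation_family u" and v: "dilation_family v"
    and uv: "\<And>t x. ((\<lambda>s. u s x) has_vector_derivative v t x) (at t)"
  shows "((\<lambda>t. T (u t)) has_vector_derivative T (v t)) (at t)"
proof -
  obtain C m where C: "C \<ge> 0" "\<And>\<phi> B. schwartz \<phi> \<Longrightarrow>
      (\<And>is x. length is \<le> m \<Longrightarrow> (1 + norm x) ^ m * norm (iter_partial is \<phi> x) \<le> B) \<Longrightarrow> norm (T \<phi>) \<le> C * B"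
    using schwartz_functional_bound[OF T] by blast
  obtain w where w: "dilation_family w" "\<And>t x. ((\<lambda>s. v s x) has_vector_derivative w t x) (at t)"
    using dilation_family_derivative[OF v] by blast
  define R where "R = \<bar>t\<bar> + 1"
  have "\<forall>is. \<exists>B\<ge>0. \<forall>s x. \<bar>s\<bar> \<le> R \<longrightarrow> (1 + norm x) ^ m * norm (iter_partial is (w s) x) \<le> B"
    using dilation_family_bounded[OF dilation_family_iter_partial[OF w(1)], of R m] by blast
  then obtain B where B: "\<And>is. B is \<ge> 0"
    "\<And>is s x. \<bar>s\<bar> \<le> R \<Longrightarrow> (1 + norm x) ^ m * norm (iter_partial is (w s) x) \<le> B is" by metis
  define L where "L = {is :: 'a list. length is \<le> m}"
  have fin: "finite L"
    unfolding L_def using finite_lists_length_le[of "UNIV :: 'a set" m] by simp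
  define b where "b = (\<Sum>is\<in>L. B is)"
  have b: "B is \<le> b" if "length is \<le> m" for "is"
    unfolding b_def using that B(1) fin by (intro member_le_sum) (auto simp: L_def)
  have b0: "b \<ge> 0" using B(1)[of "[]"] b[of "[]"] by simp
  have sch: "schwartz (u s)" "schwartz (v s)" for s
    using u v by (auto intro: dilation_family_schwartz)
  have "norm (T (u s) - T (u t) - (s - t) *\<^sub>R T (v t)) \<le> (C * (3 * b)) * \<bar>s - t\<bar>\<^sup>2" if s: "\<bar>s - t\<bar> \<le> 1" for s
  proof -
    define \<phi> where "\<phi> x = u s x + ((- 1) * u t x + (- of_real (s - t)) * v t x)" for x
    have \<phi>: "schwartz \<phi>"
      unfolding \<phi>_def by (intro schwartz_add schwartz_scale sch)
    have "T \<phi> = T (u s) - T (u t) - (s - t) *\<^sub>R T (v t)"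
      unfolding \<phi>_def
      by (subst schwartz_functional_add[OF T sch(1)] schwartz_functional_add[OF T] schwartz_functional_scale[OF T];
          (intro schwartz_add schwartz_scale sch)?)+
        (simp add: scaleR_conv_of_real algebra_simps)
    moreover have "norm (T \<phi>) \<le> C * (3 * b * \<bar>s - t\<bar>\<^sup>2)"
    proof (rule C(2)[OF \<phi>])
      fix "is" :: "'a list" and x :: "real^'a"
      assume len: "length is \<le> m"
      have sc: "iter_partial is (\<lambda>x. c * f x) = (\<lambda>x. c * iter_partial is f x)" if "smooth f" for c and f :: "real^'a \<Rightarrow> complex"
      proof (induction "is")
        case (Cons i "is")
        have "partial i (\<lambda>x. c * iter_partial is f x) x = c * partial i (iter_partial is f) x" for x
          using smooth_differentiable[OF smooth_iter_partial[OF that, of "is"]]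
          by (subst partial_mult) (auto simp: partial_const)
        then show ?case using Cons by auto
      qed simp
      have it: "iter_partial is \<phi> x = iter_partial is (u s) x - iter_partial is (u t) x - (s - t) *\<^sub>R iter_partial is (v t) x"
      proof -
        have sm: "smooth (u s)" "smooth (u t)" "smooth (v t)" "smooth (\<lambda>x. (- 1) * u t x)"
          "smooth (\<lambda>x. (- of_real (s - t)) * v t x)"
          "smooth (\<lambda>x. (- 1) * u t x + (- of_real (s - t)) * v t x)"
          by (intro schwartz_smooth schwartz_add schwartz_scale sch)+
        show ?thesis
          unfolding \<phi>_def[abs_def] iter_partial_add[OF sm(1,6)] iter_partial_add[OF sm(4,5)] sc[OF sm(2)] sc[OF sm(3)]
          by (simp add: scaleR_conv_of_real algebra_simps)
      qed
      define W where "W = (1 + norm x) ^ m"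
      have W: "W > 0" unfolding W_def by (intro zero_less_power) (simp add: add_pos_nonneg)
      have "norm (iter_partial is (u s) x - iter_partial is (u t) x - (s - t) *\<^sub>R iter_partial is (v t) x)
         \<le> 3 * (b / W) * \<bar>s - t\<bar>\<^sup>2"
      proof (rule taylor_bound[where k = "\<lambda>t. iter_partial is (w t) x"])
        show "((\<lambda>s. iter_partial is (u s) x) has_vector_derivative iter_partial is (v t) x) (at t)" for t
          by (rule dilation_family_iter_derivative[OF u v uv])
        show "((\<lambda>s. iter_partial is (v s) x) has_vector_derivative iter_partial is (w t) x) (at t)" for t
          by (rule dilation_family_iter_derivative[OF v w])
        fix r assume "r \<in> closed_segment t s"
        then have "\<bar>r\<bar> \<le> R" using s by (auto simp: R_def closed_segment_eq_real_ivl split: if_splits)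
        from B(2)[OF this, of x "is"] b[OF len] have "W * norm (iter_partial is (w r) x) \<le> b" by (simp add: W_def)
        then show "norm (iter_partial is (w r) x) \<le> b / W" using W by (simp add: field_simps)
      qed
      then show "(1 + norm x) ^ m * norm (iter_partial is \<phi> x) \<le> 3 * b * \<bar>s - t\<bar>\<^sup>2"
        unfolding it W_def[symmetric] using W by (simp add: field_simps)
    qed
    ultimately show ?thesis by (simp add: mult.assoc)
  qed
  then show ?thesis
    by (rule has_vector_derivative_quadratic) (assumption, intro mult_nonneg_nonneg C(1) b0, simp)
qed

lemma functional_derivative_dilate:
  assumes T: "schwartz_functional T" and "schwartz \<psi>" "slow \<theta>"
  shows "((\<lambda>t. T (\<lambda>x. \<psi> x * \<theta> (t *\<^sub>R x))) has_vector_derivative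
     (\<Sum>j\<in>UNIV. T (\<lambda>x. of_real (x $ j) * (\<psi> x * partial j \<theta> (t *\<^sub>R x))))) (at t)"
proof -
  have fam: "dilation_family (\<lambda>t x. of_real (t ^ 0) * \<psi> x * \<theta> (t *\<^sub>R x))"
    by (intro dilation_family.base assms)
  obtain v where v: "dilation_family v" "\<forall>t x. ((\<lambda>s. of_real (s ^ 0) * \<psi> x * \<theta> (s *\<^sub>R x)) has_vector_derivative v t x) (at t)"
    using dilation_family_derivative[OF fam] by blast
  have "v t x = (\<Sum>j\<in>UNIV. of_real (x $ j) * (\<psi> x * partial j \<theta> (t *\<^sub>R x)))" for x
    using vector_derivative_unique_at[OF v(2)[rule_format, of x t] has_vector_derivative_base[OF slow_smooth[OF assms(3)], of 0 "\<psi> x" x t]]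
    by (simp add: algebra_simps)
  then have vt: "v t = (\<lambda>x. \<Sum>j\<in>UNIV. of_real (x $ j) * (\<psi> x * partial j \<theta> (t *\<^sub>R x)))" by blast
  have "schwartz (\<lambda>x. of_real (x $ j) * (\<psi> x * partial j \<theta> (t *\<^sub>R x)))" for j
    using schwartz_mult_slow[OF schwartz_mult_slow[OF assms(2) slow_dilate[OF slow_partial[OF assms(3)]]] slow_coord, of j t j]
    by (simp add: mult.commute)
  then have "T (v t) = (\<Sum>j\<in>UNIV. T (\<lambda>x. of_real (x $ j) * (\<psi> x * partial j \<theta> (t *\<^sub>R x))))"
    unfolding vt by (intro schwartz_functional_sum[OF T]) auto
  then show ?thesis
    using functional_derivative[OF T fam v(1), of t] v(2) by simp
qed

section \<open>Point evaluations\<close>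

lemma schwartz_coord_mult: "schwartz \<phi> \<Longrightarrow> schwartz (\<lambda>x. of_real (x $ j) * \<phi> x)"
  using schwartz_mult_slow[OF _ slow_coord, of \<phi> j] by (simp add: mult.commute)

lemma zero_derivative_const:
  fixes F :: "real \<Rightarrow> complex"
  assumes "\<And>t. (F has_vector_derivative 0) (at t)"
  shows "F s = F t"
proof -
  have "(F has_vector_derivative 0) (at x within UNIV)" for x
    using assms by simp
  then obtain c where "\<And>x. F x = c"
    using has_vector_derivative_zero_constant[of UNIV F] by (metis UNIV_I convex_UNIV)
  then show ?thesis by simp
qed

text \<open>If \<open>h\<close> kills multiples of the coordinates, the formula for the derivative shows that
  \<open>h (\<lambda>x. f x * g (t x))\<close> is independent of \<open>t\<close>. Comparing \<open>t = 0\<close> with \<open>t = 1\<close>, for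
  the Gaussian in the role of \<open>f\<close> and in the role of \<open>g\<close>, identifies \<open>h\<close> without dividing by coordinates.\<close>

lemma functional_delta:
  assumes h: "schwartz_functional h"
    and kill: "\<And>j \<phi>. schwartz \<phi> \<Longrightarrow> h (\<lambda>x. of_real (x $ j) * \<phi> x) = 0"
    and \<phi>: "schwartz \<phi>"
  shows "h \<phi> = \<phi> 0 * h gauss"
proof -
  have const: "h (\<lambda>x. f x * g (1 *\<^sub>R x)) = h (\<lambda>x. f x * g (0 *\<^sub>R x))"
    if "schwartz f" "schwartz g" for f g
  proof (rule zero_derivative_const)
    fix t :: real
    have "h (\<lambda>x. of_real (x $ j) * (f x * partial j g (t *\<^sub>R x))) = 0" for j
      by (intro kill schwartz_mult_slow that slow_dilate schwartz_imp_slow schwartz_partial)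
    then show "((\<lambda>t. h (\<lambda>x. f x * g (t *\<^sub>R x))) has_vector_derivative 0) (at t)"
      using functional_derivative_dilate[OF h that(1) schwartz_imp_slow[OF that(2)], of t] by simp
  qed
  have "h (\<lambda>x. gauss x * \<phi> x) = \<phi> 0 * h gauss"
    using const[OF schwartz_gauss \<phi>] schwartz_functional_scale[OF h schwartz_gauss, of "\<phi> 0"]
    by (simp add: mult.commute)
  moreover have "h (\<lambda>x. gauss x * \<phi> x) = h \<phi>"
    using const[OF \<phi> schwartz_gauss] by (simp add: mult.commute)
  ultimately show ?thesis by simp
qed

section \<open>Averaging over modulations\<close>

lemma smooth_pw: "smooth (pw p)"
  by (rule slow_smooth[OF slow_pw])

lemma iter_partial_scale:
  assumes "smooth f"
  shows "iter_partial is (\<lambda>x. c * f x) = (\<lambda>x. c * iter_partial is f x)"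
proof (induction "is")
  case (Cons i "is")
  have "partial i (\<lambda>x. c * iter_partial is f x) x = c * partial i (iter_partial is f) x" for x
    using smooth_differentiable[OF smooth_iter_partial[OF assms, of "is"]]
    by (subst partial_mult) (auto simp: partial_const)
  then show ?case using Cons by auto
qed simp

lemma iter_partial_pw_bound:
  assumes "smooth \<phi>" "\<And>js. length js \<le> length is \<Longrightarrow> norm (iter_partial js \<phi> x) \<le> B"
    "2 * pi * norm p \<le> r"
  shows "norm (iter_partial is (\<lambda>x. \<phi> x * pw p x) x) \<le> (1 + r) ^ length is * B"
  using assms(1,2)
proof (induction "is" arbitrary: \<phi> B rule: rev_induct)
  case Nil
  then show ?case using Nil(2)[of "[]"] by (simp add: norm_mult)
next
  case (snoc i "is")
  define c where "c = 2 * pi * \<i> * of_real (p $ i)"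
  define \<psi> where "\<psi> x = c * \<phi> x + partial i \<phi> x" for x
  have r: "r \<ge> 0" using assms(3) by (rule order_trans[rotated]) simp
  have c: "norm c \<le> r"
  proof -
    have "norm c = 2 * pi * \<bar>p $ i\<bar>" by (simp add: c_def norm_mult)
    also have "\<dots> \<le> 2 * pi * norm p" by (intro mult_left_mono component_le_norm_cart) simp
    finally show ?thesis using assms(3) by simp
  qed
  have sm: "smooth (\<lambda>x. c * \<phi> x)" "smooth (partial i \<phi>)"
    using snoc(2) by (auto intro: smooth_mult smooth_const smooth_partial)
  have "partial i (\<lambda>x. \<phi> x * pw p x) = (\<lambda>x. \<psi> x * pw p x)"
  proof
    fix x
    show "partial i (\<lambda>x. \<phi> x * pw p x) x = \<psi> x * pw p x"
      by (subst partial_mult)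
        (auto intro!: smooth_differentiable snoc(2) smooth_pw simp: partial_pw \<psi>_def c_def algebra_simps)
  qed
  then have "norm (iter_partial (is @ [i]) (\<lambda>x. \<phi> x * pw p x) x) = norm (iter_partial is (\<lambda>x. \<psi> x * pw p x) x)"
    by simp
  also have "\<dots> \<le> (1 + r) ^ length is * ((1 + r) * B)"
  proof (rule snoc(1))
    show "smooth \<psi>" unfolding \<psi>_def[abs_def] by (intro smooth_add sm)
    fix js :: "'a list" assume js: "length js \<le> length is"
    have "iter_partial js \<psi> x = c * iter_partial js \<phi> x + iter_partial (js @ [i]) \<phi> x"
      unfolding \<psi>_def[abs_def] by (simp add: iter_partial_add[OF sm] iter_partial_scale[OF snoc(2)])
    then have "norm (iter_partial js \<psi> x) \<le> norm c * norm (iter_partial js \<phi> x) + norm (iter_partial (js @ [i]) \<phi> x)"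
      using norm_triangle_ineq[of "c * iter_partial js \<phi> x" "iter_partial (js @ [i]) \<phi> x"] by (simp add: norm_mult)
    also have "\<dots> \<le> r * B + B"
      using js c r by (intro add_mono mult_mono snoc(3)) auto
    finally show "norm (iter_partial js \<psi> x) \<le> (1 + r) * B" by (simp add: algebra_simps)
  qed
  finally show ?case by (simp add: mult_ac)
qed

lemma functional_pw_bound:
  assumes "schwartz_functional T"
  shows "\<exists>C m. C \<ge> 0 \<and> (\<forall>\<phi> B p. schwartz \<phi> \<longrightarrow>
      (\<forall>is x. length is \<le> m \<longrightarrow> (1 + norm x) ^ m * norm (iter_partial is \<phi> x) \<le> B) \<longrightarrow>
      norm (T (\<lambda>x. \<phi> x * pw p x)) \<le> C * ((1 + 2 * pi * norm p) ^ m * B))"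
proof -
  obtain C m where C: "C \<ge> 0" "\<And>\<phi> B. schwartz \<phi> \<Longrightarrow>
      (\<And>is x. length is \<le> m \<Longrightarrow> (1 + norm x) ^ m * norm (iter_partial is \<phi> x) \<le> B) \<Longrightarrow> norm (T \<phi>) \<le> C * B"
    using schwartz_functional_bound[OF assms] by blast
  have "norm (T (\<lambda>x. \<phi> x * pw p x)) \<le> C * ((1 + 2 * pi * norm p) ^ m * B)"
    if \<phi>: "schwartz \<phi>" and B: "\<And>is x. length is \<le> m \<Longrightarrow> (1 + norm x) ^ m * norm (iter_partial is \<phi> x) \<le> B" for \<phi> B p
  proof (rule C(2))
    show "schwartz (\<lambda>x. \<phi> x * pw p x)" by (intro schwartz_mult_slow \<phi> slow_pw)
    fix "is" :: "'a list" and x :: "real^'a"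
    assume len: "length is \<le> m"
    define W where "W = (1 + norm x) ^ m"
    have W: "W > 0" unfolding W_def by (intro zero_less_power) (simp add: add_pos_nonneg)
    have B0: "0 \<le> B" using B[of "[]" x] by (rule order_trans[rotated, of "(1 + norm x) ^ m * norm (iter_partial [] \<phi> x)"]) auto
    have "norm (iter_partial is (\<lambda>x. \<phi> x * pw p x) x) \<le> (1 + 2 * pi * norm p) ^ length is * (B / W)"
    proof (rule iter_partial_pw_bound)
      fix js :: "'a list" assume "length js \<le> length is"
      then have "W * norm (iter_partial js \<phi> x) \<le> B" using B[of js x] len by (simp add: W_def)
      then show "norm (iter_partial js \<phi> x) \<le> B / W" using W by (simp add: field_simps)
    qed (use \<phi> schwartz_smooth in auto)
    also have "\<dots> \<le> (1 + 2 * pi * norm p) ^ m * (B / W)"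
      using len W B0 by (intro mult_right_mono power_increasing) auto
    finally show "(1 + norm x) ^ m * norm (iter_partial is (\<lambda>x. \<phi> x * pw p x) x) \<le> (1 + 2 * pi * norm p) ^ m * B"
      unfolding W_def[symmetric] using W by (simp add: field_simps)
  qed
  then show ?thesis using C(1) by blast
qed

lemma schwartz_seminorm_bound:
  fixes \<phi> :: "real^'n::finite \<Rightarrow> complex"
  assumes "schwartz \<phi>"
  shows "\<exists>B\<ge>0. \<forall>is x. length is \<le> m \<longrightarrow> (1 + norm x) ^ m * norm (iter_partial is \<phi> x) \<le> B"
proof -
  have "\<forall>is. \<exists>B\<ge>0. \<forall>x. (1 + norm x) ^ m * norm (iter_partial is \<phi> x) \<le> B"
    using schwartzD[OF schwartz_iter_partial[OF assms], of m] by blast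
  then obtain B where B: "\<And>is. B is \<ge> 0" "\<And>is x. (1 + norm x) ^ m * norm (iter_partial is \<phi> x) \<le> B is" by metis
  define L where "L = {is :: 'n list. length is \<le> m}"
  have fin: "finite L"
    unfolding L_def using finite_lists_length_le[of "UNIV :: 'n set" m] by simp
  have "(1 + norm x) ^ m * norm (iter_partial is \<phi> x) \<le> (\<Sum>is\<in>L. B is)" if "length is \<le> m" for "is" x
    using B(2)[of x "is"] member_le_sum[of "is" L B] that B(1) fin by (auto simp: L_def)
  then show ?thesis using B(1) by (intro exI[of _ "\<Sum>is\<in>L. B is"]) (auto intro: sum_nonneg)
qed

lemma functional_pw_locally_bounded:
  assumes "schwartz_functional T" "schwartz \<phi>"
  shows "\<exists>K\<ge>0. \<forall>p. norm p \<le> R \<longrightarrow> norm (T (\<lambda>x. \<phi> x * pw p x)) \<le> K"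
proof -
  obtain C m where C: "C \<ge> 0" "\<And>\<phi> B p. schwartz \<phi> \<Longrightarrow>
      (\<forall>is x. length is \<le> m \<longrightarrow> (1 + norm x) ^ m * norm (iter_partial is \<phi> x) \<le> B) \<Longrightarrow>
      norm (T (\<lambda>x. \<phi> x * pw p x)) \<le> C * ((1 + 2 * pi * norm p) ^ m * B)"
    using functional_pw_bound[OF assms(1)] by blast
  obtain B where B: "B \<ge> 0" "\<forall>is x. length is \<le> m \<longrightarrow> (1 + norm x) ^ m * norm (iter_partial is \<phi> x) \<le> B"
    using schwartz_seminorm_bound[OF assms(2)] by blast
  have "norm (T (\<lambda>x. \<phi> x * pw p x)) \<le> C * ((1 + 2 * pi * \<bar>R\<bar>) ^ m * B)" if "norm p \<le> R" for p
  proof (rule order_trans[OF C(2)[OF assms(2) B(2), of p]])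
    have "2 * pi * norm p \<le> 2 * pi * \<bar>R\<bar>" using that by (intro mult_left_mono) auto
    then have "(1 + 2 * pi * norm p) ^ m \<le> (1 + 2 * pi * \<bar>R\<bar>) ^ m" by (intro power_mono) auto
    then show "C * ((1 + 2 * pi * norm p) ^ m * B) \<le> C * ((1 + 2 * pi * \<bar>R\<bar>) ^ m * B)"
      using C(1) B(1) by (intro mult_left_mono mult_right_mono) auto
  qed
  moreover have "0 \<le> C * ((1 + 2 * pi * \<bar>R\<bar>) ^ m * B)" using C(1) B(1) by simp
  ultimately show ?thesis by blast
qed

lemma functional_pw_derivative:
  assumes T: "schwartz_functional T" and \<phi>: "schwartz \<phi>"
  shows "((\<lambda>t. T (\<lambda>x. \<phi> x * pw (p + t *\<^sub>R v) x)) has_vector_derivative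
     (\<Sum>j\<in>UNIV. 2 * pi * \<i> * of_real (v $ j) * T (\<lambda>x. of_real (x $ j) * \<phi> x * pw (p + t *\<^sub>R v) x))) (at t)"
proof -
  have 1: "(\<lambda>x. \<phi> x * pw (p + t *\<^sub>R v) x) = (\<lambda>x. (\<phi> x * pw p x) * pw v (t *\<^sub>R x))" for t
    by (simp add: pw_add pw_scaleR mult.assoc)
  have 2: "T (\<lambda>x. of_real (x $ j) * ((\<phi> x * pw p x) * partial j (pw v) (t *\<^sub>R x)))
      = 2 * pi * \<i> * of_real (v $ j) * T (\<lambda>x. of_real (x $ j) * \<phi> x * pw (p + t *\<^sub>R v) x)" for j
  proof -
    have "(\<lambda>x. of_real (x $ j) * ((\<phi> x * pw p x) * partial j (pw v) (t *\<^sub>R x)))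
      = (\<lambda>x. (2 * pi * \<i> * of_real (v $ j)) * (of_real (x $ j) * \<phi> x * pw (p + t *\<^sub>R v) x))"
      by (simp add: partial_pw pw_add pw_scaleR algebra_simps)
    then show ?thesis
      by (simp only:) (intro schwartz_functional_scale[OF T] schwartz_mult_slow schwartz_coord_mult \<phi> slow_pw)
  qed
  show ?thesis
    using functional_derivative_dilate[OF T schwartz_mult_slow[OF \<phi> slow_pw, of p] slow_pw[of v], of t]
    unfolding 1[symmetric] 2 .
qed

lemma continuous_on_functional_pw:
  assumes T: "schwartz_functional T" and \<phi>: "schwartz \<phi>"
  shows "continuous_on UNIV (\<lambda>p. T (\<lambda>x. \<phi> x * pw p x))"
proof -
  define Z where "Z p = T (\<lambda>x. \<phi> x * pw p x)" for p
  have "isCont Z p" for p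
  proof -
    have "\<forall>j. \<exists>K\<ge>0. \<forall>q. norm q \<le> norm p + 1 \<longrightarrow> norm (T (\<lambda>x. of_real (x $ j) * \<phi> x * pw q x)) \<le> K"
      using functional_pw_locally_bounded[OF T schwartz_coord_mult[OF \<phi>]] by blast
    then obtain K where K: "\<And>j. K j \<ge> 0"
      "\<And>j q. norm q \<le> norm p + 1 \<Longrightarrow> norm (T (\<lambda>x. of_real (x $ j) * \<phi> x * pw q x)) \<le> K j" by metis
    define L where "L = (\<Sum>j\<in>UNIV. 2 * pi * K j)"
    have L: "L \<ge> 0" unfolding L_def using K(1) by (intro sum_nonneg) auto
    have lip: "norm (Z q - Z p) \<le> 3 * L * norm (q - p)" if q: "norm (q - p) \<le> 1" for q
    proof -
      define v where "v = q - p"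
      define D where "D t = (\<Sum>j\<in>UNIV. 2 * pi * \<i> * of_real (v $ j) * T (\<lambda>x. of_real (x $ j) * \<phi> x * pw (p + t *\<^sub>R v) x))" for t
      have D: "norm (D t) \<le> L * norm v" if "t \<in> {0..1}" for t
      proof -
        have "norm (p + t *\<^sub>R v) \<le> norm p + 1"
        proof -
          have "\<bar>t\<bar> * norm v \<le> 1 * 1" using that q by (intro mult_mono) (auto simp: v_def)
          then show ?thesis using norm_triangle_ineq[of p "t *\<^sub>R v"] by simp
        qed
        then have "norm (2 * pi * \<i> * of_real (v $ j) * T (\<lambda>x. of_real (x $ j) * \<phi> x * pw (p + t *\<^sub>R v) x)) \<le> 2 * pi * norm v * K j" for j
          using component_le_norm_cart[of v j] K by (auto simp: norm_mult intro!: mult_mono)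
        then have "norm (D t) \<le> (\<Sum>j\<in>UNIV. 2 * pi * norm v * K j)"
          unfolding D_def by (intro sum_norm_le) auto
        also have "\<dots> = L * norm v" by (simp add: L_def sum_distrib_left sum_distrib_right mult_ac)
        finally show ?thesis .
      qed
      have "norm (Z (p + 1 *\<^sub>R v) - Z (p + 0 *\<^sub>R v) - (1 - 0) *\<^sub>R D 0) \<le> norm (1 - 0 :: real) * (2 * (L * norm v))"
      proof (rule vector_differentiable_bound_linearization[where S = "{0..1}" and f = "\<lambda>t. Z (p + t *\<^sub>R v)"
            and f' = D and a = 0 and b = 1])
        show "((\<lambda>t. Z (p + t *\<^sub>R v)) has_vector_derivative D t) (at t within {0..1})" for t
          unfolding Z_def D_def by (rule has_vector_derivative_at_within[OF functional_pw_derivative[OF T \<phi>]])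
        show "norm (D t - D 0) \<le> 2 * (L * norm v)" if "t \<in> {0..1}" for t
          using D[OF that] D[of 0] norm_triangle_ineq4[of "D t" "D 0"] by auto
      qed (auto simp: closed_segment_eq_real_ivl)
      then have "norm (Z q - Z p - D 0) \<le> 2 * (L * norm v)" by (simp add: v_def)
      then show ?thesis
        using D[of 0] norm_triangle_ineq[of "Z q - Z p - D 0" "D 0"] by (auto simp: v_def)
    qed
    show ?thesis
      unfolding continuous_at_eps_delta
    proof (intro allI impI)
      fix e :: real assume e: "e > 0"
      have "dist (Z q) (Z p) < e" if "dist q p < min 1 (e / (3 * L + 1))" for q
      proof -
        have "norm (Z q - Z p) \<le> (3 * L) * norm (q - p)" using lip[of q] that by (simp add: dist_norm)
        also have "\<dots> \<le> (3 * L + 1) * norm (q - p)" by (intro mult_right_mono) auto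
        also have "\<dots> < e" using that L by (simp add: dist_norm field_simps)
        finally show ?thesis by (simp add: dist_norm)
      qed
      then show "\<exists>d>0. \<forall>x'. dist x' p < d \<longrightarrow> dist (Z x') (Z p) < e"
        using e L by (intro exI[of _ "min 1 (e / (3 * L + 1))"]) auto
    qed
  qed
  then show ?thesis unfolding Z_def by (simp add: continuous_at_imp_continuous_on)
qed

lemma integral_unit_cube_shift:
  fixes Z :: "real^'n::finite \<Rightarrow> complex"
  assumes cont: "continuous_on UNIV Z" and per: "\<And>p. Z (p + axis i 1) = Z p" and s: "0 \<le> s" "s \<le> 1"
  shows "integral (cbox 0 1) (\<lambda>p. Z (p + s *\<^sub>R axis i 1)) = integral (cbox 0 1) Z"
proof -
  define a :: "real^'n" where "a = axis i 1"
  have int: "Z integrable_on cbox u v" for u v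
    by (intro integrable_continuous continuous_on_subset[OF cont]) auto
  have aB: "a \<in> Basis" by (simp add: a_def)
  have ia: "x \<bullet> a = x $ i" for x by (simp add: a_def inner_axis)
  have box: "x \<in> cbox u v \<longleftrightarrow> (u $ i \<le> x $ i \<and> x $ i \<le> v $ i) \<and> (\<forall>k. k \<noteq> i \<longrightarrow> u $ k \<le> x $ k \<and> x $ k \<le> v $ k)"
    for x u v :: "real^'n"
    unfolding mem_box_cart by metis
  have "integral (cbox 0 1) (\<lambda>p. Z (p + s *\<^sub>R a)) = integral (cbox (s *\<^sub>R a) (1 + s *\<^sub>R a)) Z"
    using integral_shift_cbox[of "s *\<^sub>R a" "s *\<^sub>R a" "1 + s *\<^sub>R a" Z] by simp
  also have "\<dots> = integral (cbox (s *\<^sub>R a) (1 + s *\<^sub>R a) \<inter> {x. x \<bullet> a \<le> 1}) Z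
      + integral (cbox (s *\<^sub>R a) (1 + s *\<^sub>R a) \<inter> {x. x \<bullet> a \<ge> 1}) Z"
    by (rule integral_split[OF int aB])
  also have "cbox (s *\<^sub>R a) (1 + s *\<^sub>R a) \<inter> {x. x \<bullet> a \<le> 1} = cbox 0 1 \<inter> {x. x \<bullet> a \<ge> s}"
    unfolding ia using s by (auto simp: box a_def axis_def)
  also have "integral (cbox (s *\<^sub>R a) (1 + s *\<^sub>R a) \<inter> {x. x \<bullet> a \<ge> 1}) Z = integral (cbox 0 1 \<inter> {x. x \<bullet> a \<le> s}) Z"
  proof -
    define w :: "real^'n" where "w = (\<chi> j. if j = i then s else 1)"
    have 1: "cbox (s *\<^sub>R a) (1 + s *\<^sub>R a) \<inter> {x. x \<bullet> a \<ge> 1} = cbox a (w + a)"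
      unfolding ia using s by (auto simp: box a_def axis_def w_def)
    have 2: "cbox 0 1 \<inter> {x. x \<bullet> a \<le> s} = cbox 0 w"
      unfolding ia using s by (auto simp: box a_def axis_def w_def)
    show ?thesis
      unfolding 1 2 using integral_shift_cbox[of a a "w + a" Z] per by (simp add: a_def)
  qed
  also have "integral (cbox 0 1 \<inter> {x. x \<bullet> a \<ge> s}) Z + integral (cbox 0 1 \<inter> {x. x \<bullet> a \<le> s}) Z = integral (cbox 0 1) Z"
    using integral_split[OF int aB, of 0 1 s] by simp
  finally show ?thesis by (simp add: a_def)
qed

text \<open>On a combination of point masses at the points of \<open>N\<^sup>-\<^sup>1\<int>\<^sup>n\<close>, this averaging keeps only the mass at the origin.\<close>

definition phase_average :: "nat \<Rightarrow> ((real^'n::finite \<Rightarrow> complex) \<Rightarrow> complex) \<Rightarrow> (real^'n \<Rightarrow> complex) \<Rightarrow> complex" where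
  "phase_average N f \<phi> = integral (cbox 0 1) (\<lambda>p. f (\<lambda>x. \<phi> x * pw (real N *\<^sub>R p) x))"

lemma continuous_on_phase:
  assumes "schwartz_functional f" "schwartz \<phi>"
  shows "continuous_on S (\<lambda>p. f (\<lambda>x. \<phi> x * pw (r *\<^sub>R p) x))"
proof -
  have "continuous_on UNIV (\<lambda>p. f (\<lambda>x. \<phi> x * pw (r *\<^sub>R p) x))"
    by (rule continuous_on_compose2[OF continuous_on_functional_pw[OF assms], of _ "\<lambda>p. r *\<^sub>R p"])
      (auto intro!: continuous_intros)
  then show ?thesis by (rule continuous_on_subset) auto
qed

lemma content_unit_cube: "measure lborel (cbox 0 (1::real^'n::finite)) = 1"
  by (subst content_cbox_cart) (auto simp: interval_ne_empty_cart)

lemma schwartz_functional_phase_average: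
  fixes f :: "(real^'n::finite \<Rightarrow> complex) \<Rightarrow> complex"
  assumes f: "schwartz_functional f"
  shows "schwartz_functional (phase_average N f)"
  unfolding schwartz_functional_def
proof (intro conjI allI impI)
  have int: "(\<lambda>p. f (\<lambda>x. \<phi> x * pw (real N *\<^sub>R p) x)) integrable_on cbox 0 1" if "schwartz \<phi>" for \<phi>
    by (intro integrable_continuous continuous_on_phase f that)
  fix \<phi> \<psi> :: "real^'n \<Rightarrow> complex" and c
  assume \<phi>: "schwartz \<phi>"
  show "phase_average N f (\<lambda>x. c * \<phi> x) = c * phase_average N f \<phi>"
  proof -
    have "f (\<lambda>x. (c * \<phi> x) * pw q x) = c * f (\<lambda>x. \<phi> x * pw q x)" for q
      unfolding mult.assoc by (intro schwartz_functional_scale[OF f] schwartz_mult_slow \<phi> slow_pw)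
    then show ?thesis by (simp add: phase_average_def)
  qed
  assume \<psi>: "schwartz \<psi>"
  have "f (\<lambda>x. (\<phi> x + \<psi> x) * pw q x) = f (\<lambda>x. \<phi> x * pw q x) + f (\<lambda>x. \<psi> x * pw q x)" for q
    unfolding distrib_right by (intro schwartz_functional_add[OF f] schwartz_mult_slow \<phi> \<psi> slow_pw)
  then show "phase_average N f (\<lambda>x. \<phi> x + \<psi> x) = phase_average N f \<phi> + phase_average N f \<psi>"
    unfolding phase_average_def by (simp add: integral_add int \<phi> \<psi>)
next
  obtain C m where C: "C \<ge> 0" "\<And>\<phi> B p. schwartz \<phi> \<Longrightarrow>
      (\<forall>is x. length is \<le> m \<longrightarrow> (1 + norm x) ^ m * norm (iter_partial is \<phi> x) \<le> B) \<Longrightarrow>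
      norm (f (\<lambda>x. \<phi> x * pw p x)) \<le> C * ((1 + 2 * pi * norm p) ^ m * B)"
    using functional_pw_bound[OF f] by blast
  define R where "R = real N * norm (1::real^'n)"
  have "norm (phase_average N f \<phi>) \<le> (C * (1 + 2 * pi * R) ^ m) * B"
    if \<phi>: "schwartz \<phi>" and B: "\<forall>is x. length is \<le> m \<longrightarrow> (1 + norm x) ^ m * norm (iter_partial is \<phi> x) \<le> B" for \<phi> B
  proof -
    have B0: "0 \<le> B" using B[rule_format, of "[]" 0] by (rule order_trans[rotated, of "(1 + norm (0::real^'n)) ^ m * norm (iter_partial [] \<phi> 0)"]) auto
    have "norm (f (\<lambda>x. \<phi> x * pw (real N *\<^sub>R p) x)) \<le> (C * (1 + 2 * pi * R) ^ m) * B" if "p \<in> cbox 0 1" for p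
    proof (rule order_trans[OF C(2)[OF \<phi> B]])
      have "norm p \<le> norm (1::real^'n)"
        using that by (intro norm_le_componentwise_cart) (auto simp: mem_box_cart)
      then have "norm (real N *\<^sub>R p) \<le> R" unfolding R_def by (simp add: mult_left_mono)
      then have "2 * pi * norm (real N *\<^sub>R p) \<le> 2 * pi * R" by (intro mult_left_mono) auto
      then have "(1 + 2 * pi * norm (real N *\<^sub>R p)) ^ m \<le> (1 + 2 * pi * R) ^ m" by (intro power_mono) auto
      then show "C * ((1 + 2 * pi * norm (real N *\<^sub>R p)) ^ m * B) \<le> (C * (1 + 2 * pi * R) ^ m) * B"
        using C(1) B0 unfolding mult.assoc by (intro mult_left_mono mult_right_mono) auto
    qed
    then have "norm (phase_average N f \<phi>) \<le> (C * (1 + 2 * pi * R) ^ m) * B * measure lborel (cbox 0 (1::real^'n))"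
      unfolding phase_average_def using C(1) B0
      by (intro has_integral_bound[OF _ integrable_integral] integrable_continuous continuous_on_phase f \<phi>)
        (auto simp: R_def intro!: mult_nonneg_nonneg)
    then show ?thesis by (simp add: content_unit_cube)
  qed
  moreover have "C * (1 + 2 * pi * R) ^ m \<ge> 0" using C(1) by (simp add: R_def)
  ultimately show "\<exists>C m. C \<ge> 0 \<and> (\<forall>\<phi> B. schwartz \<phi> \<longrightarrow>
      (\<forall>is x. length is \<le> m \<longrightarrow> (1 + norm x) ^ m * norm (iter_partial is \<phi> x) \<le> B) \<longrightarrow> norm (phase_average N f \<phi>) \<le> C * B)"
    by blast
qed

text \<open>A functional invariant under the modulations by \<open>N\<int>\<^sup>n\<close> becomes, after averaging over a period of
  modulations, a multiple of the evaluation at the origin.\<close>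

lemma phase_average_delta:
  fixes f :: "(real^'n::finite \<Rightarrow> complex) \<Rightarrow> complex"
  assumes f: "schwartz_functional f" and N: "N > 0"
    and inv: "\<And>\<phi> i. schwartz \<phi> \<Longrightarrow> f (\<lambda>x. \<phi> x * pw (real N *\<^sub>R axis i 1) x) = f \<phi>"
    and \<phi>: "schwartz \<phi>"
  shows "phase_average N f \<phi> = \<phi> 0 * phase_average N f gauss"
proof (rule functional_delta[OF schwartz_functional_phase_average[OF f] _ \<phi>])
  fix j and \<phi> :: "real^'n \<Rightarrow> complex"
  assume \<phi>: "schwartz \<phi>"
  define v :: "real^'n" where "v = real N *\<^sub>R axis j 1"
  define h where "h = phase_average N f"
  have h: "schwartz_functional h" unfolding h_def by (rule schwartz_functional_phase_average[OF f])
  have const: "h (\<lambda>x. \<phi> x * pw (0 + s *\<^sub>R v) x) = h \<phi>" if "s \<in> {0..1}" for s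
  proof -
    have "integral (cbox 0 1) (\<lambda>p. f (\<lambda>x. \<phi> x * pw (real N *\<^sub>R (p + s *\<^sub>R axis j 1)) x))
        = integral (cbox 0 1) (\<lambda>p. f (\<lambda>x. \<phi> x * pw (real N *\<^sub>R p) x))"
    proof (rule integral_unit_cube_shift)
      show "continuous_on UNIV (\<lambda>p. f (\<lambda>x. \<phi> x * pw (real N *\<^sub>R p) x))"
        by (rule continuous_on_phase[OF f \<phi>])
      show "f (\<lambda>x. \<phi> x * pw (real N *\<^sub>R (p + axis j 1)) x) = f (\<lambda>x. \<phi> x * pw (real N *\<^sub>R p) x)" for p
        using inv[OF schwartz_mult_slow[OF \<phi> slow_pw], of "real N *\<^sub>R p" j]
        by (simp add: scaleR_add_right pw_add mult.assoc)
    qed (use that in auto)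
    then show ?thesis
      by (simp add: h_def phase_average_def v_def scaleR_add_right pw_add algebra_simps)
  qed
  have "((\<lambda>s. h (\<lambda>x. \<phi> x * pw (0 + s *\<^sub>R v) x)) has_vector_derivative
     (\<Sum>k\<in>UNIV. 2 * pi * \<i> * of_real (v $ k) * h (\<lambda>x. of_real (x $ k) * \<phi> x * pw (0 + 0 *\<^sub>R v) x))) (at 0 within {0..1})"
    by (rule has_vector_derivative_at_within[OF functional_pw_derivative[OF h \<phi>]])
  moreover have "((\<lambda>s. h (\<lambda>x. \<phi> x * pw (0 + s *\<^sub>R v) x)) has_vector_derivative 0) (at 0 within {0..1})"
    by (rule has_vector_derivative_transform[OF _ _ has_vector_derivative_const[of "h \<phi>"]]) (use const in auto)
  ultimately have "(\<Sum>k\<in>UNIV. 2 * pi * \<i> * of_real (v $ k) * h (\<lambda>x. of_real (x $ k) * \<phi> x * pw (0 + 0 *\<^sub>R v) x)) = 0"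
    by (intro vector_derivative_unique_within_closed_interval[of 0 1 0, unfolded cbox_interval]) auto
  moreover have "(\<Sum>k\<in>UNIV. 2 * pi * \<i> * of_real (v $ k) * h (\<lambda>x. of_real (x $ k) * \<phi> x * pw (0 + 0 *\<^sub>R v) x))
     = (\<Sum>k\<in>UNIV. if k = j then 2 * pi * \<i> * of_real N * h (\<lambda>x. of_real (x $ k) * \<phi> x) else 0)"
    by (intro sum.cong) (auto simp: v_def axis_def)
  ultimately show "phase_average N f (\<lambda>x. of_real (x $ j) * \<phi> x) = 0"
    using N by (simp add: h_def)
qed

section \<open>Uniqueness of Fourier coefficients\<close>

text \<open>For \<open>A = UNIV\<close> this is a combination of finitely many exponentials with integer frequencies whose maximum over the unit
  cube is attained exactly at the centre.\<close>

definition sin_kernel :: "'n::finite set \<Rightarrow> real^'n \<Rightarrow> real" where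
  "sin_kernel A p = (\<Prod>i\<in>A. (sin (pi * p $ i))\<^sup>2)"

lemma sin_kernel_bounds: "0 \<le> sin_kernel A p" "sin_kernel A p \<le> 1"
  unfolding sin_kernel_def
  by (auto intro!: prod_nonneg prod_le_1 simp: abs_square_le_1)

lemma continuous_sin_kernel: "continuous_on S (sin_kernel A)"
  unfolding sin_kernel_def by (intro continuous_intros)

lemma sin_kernel_less_1:
  assumes p: "p \<in> cbox 0 1" "p \<noteq> (\<chi> i. 1/2)"
  shows "sin_kernel UNIV p < 1"
proof -
  obtain i where i: "p $ i \<noteq> 1/2" using p(2) by (auto simp: Finite_Cartesian_Product.vec_eq_iff)
  have "sin_kernel UNIV p = (sin (pi * p $ i))\<^sup>2 * sin_kernel (UNIV - {i}) p"
    unfolding sin_kernel_def by (subst prod.remove[of _ i]) auto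
  also have "\<dots> \<le> (sin (pi * p $ i))\<^sup>2 * 1"
    by (intro mult_left_mono sin_kernel_bounds) auto
  also have "\<dots> < 1"
  proof -
    have b: "0 \<le> p $ i" "p $ i \<le> 1" using p(1) by (auto simp: mem_box_cart)
    define y where "y = \<bar>pi / 2 - pi * p $ i\<bar>"
    have "pi * p $ i \<noteq> pi / 2" using i by auto
    then have y: "0 < y" by (auto simp: y_def)
    have "pi * p $ i \<le> pi * 1" using b by (intro mult_left_mono) auto
    moreover have "0 \<le> pi * p $ i" using b by simp
    ultimately have y2: "y \<le> pi / 2" unfolding y_def by linarith
    have "sin (pi * p $ i) = cos y"
      unfolding y_def cos_abs_real by (simp add: cos_diff)
    moreover have "cos y < cos 0" using y y2 by (intro cos_monotone_0_pi) auto
    moreover have "0 \<le> cos y" using y y2 by (intro cos_ge_zero) auto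
    ultimately show ?thesis by (simp add: power_less_one_iff abs_square_less_1)
  qed
  finally show ?thesis .
qed

lemma axis_int_lattice: "axis i 1 \<in> int_lattice"
  by (auto simp: int_lattice_def axis_def)

lemma int_lattice_closed:
  "0 \<in> int_lattice" "x \<in> int_lattice \<Longrightarrow> y \<in> int_lattice \<Longrightarrow> x + y \<in> int_lattice"
  "x \<in> int_lattice \<Longrightarrow> y \<in> int_lattice \<Longrightarrow> x - y \<in> int_lattice"
  "x \<in> int_lattice \<Longrightarrow> - x \<in> int_lattice"
  "x \<in> int_lattice \<Longrightarrow> of_nat m *\<^sub>R x \<in> int_lattice"
  by (auto simp: int_lattice_def)

lemma int_lattice_inner: "x \<in> int_lattice \<Longrightarrow> y \<in> int_lattice \<Longrightarrow> x \<bullet> y \<in> \<int>"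
  unfolding int_lattice_def inner_vec_def by (auto intro!: Ints_sum)

lemma cis_2pi_Ints: "x \<in> \<int> \<Longrightarrow> cis (2 * pi * x) = 1"
  by (auto simp: cis_multiple_2pi elim!: Ints_cases)

lemma pw_lattice: "x \<in> int_lattice \<Longrightarrow> y \<in> int_lattice \<Longrightarrow> pw x y = 1"
  unfolding pw_def by (intro cis_2pi_Ints int_lattice_inner)

lemma sin_squared_pw: "of_real ((sin (pi * p $ i))\<^sup>2) = 1 / 2 - pw (axis i 1) p / 4 - pw (- axis i 1) p / 4"
proof -
  have "cos (2 * (pi * p $ i)) = 1 - 2 * (sin (pi * p $ i))\<^sup>2" by (rule cos_double_sin)
  then have "(sin (pi * p $ i))\<^sup>2 = 1 / 2 - cos (2 * pi * p $ i) / 2" by (simp add: mult.assoc field_simps)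
  moreover have "pw (axis i 1) p + pw (- axis i 1) p = of_real (2 * cos (2 * pi * p $ i))"
    by (simp add: pw_def inner_axis' complex_eq_iff)
  ultimately have "of_real ((sin (pi * p $ i))\<^sup>2) = 1 / 2 - (pw (axis i 1) p + pw (- axis i 1) p) / 4"
    by simp
  then show ?thesis by (simp add: add_divide_distrib)
qed

lemma sin_kernel_orthogonal:
  fixes Z :: "real^'n::finite \<Rightarrow> complex"
  assumes cont: "continuous_on (cbox 0 1) Z"
    and coeff: "\<And>k. k \<in> int_lattice \<Longrightarrow> integral (cbox 0 1) (\<lambda>p. Z p * pw k p) = 0"
  shows "integral (cbox 0 1) (\<lambda>p. of_real (sin_kernel UNIV p ^ m) * Z p) = 0"
proof -
  define good where "good T \<longleftrightarrow> continuous_on (cbox 0 1) T \<and>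
    (\<forall>k\<in>int_lattice. integral (cbox 0 1) (\<lambda>p. T p * (Z p * pw k p)) = 0)" for T :: "real^'n \<Rightarrow> complex"
  have pwc: "continuous_on S (pw k)" for k :: "real^'n" and S
    unfolding pw_def[abs_def] by (intro continuous_intros)
  have step: "good (\<lambda>p. of_real ((sin (pi * p $ i))\<^sup>2) * T p)" if T: "good T" for T i
    unfolding good_def
  proof (intro conjI ballI)
    have cT: "continuous_on (cbox 0 1) T" using T by (simp add: good_def)
    show "continuous_on (cbox 0 1) (\<lambda>p. of_real ((sin (pi * p $ i))\<^sup>2) * T p)"
      by (intro continuous_intros cT)
    fix k :: "real^'n" assume k: "k \<in> int_lattice"
    define J where "J l = integral (cbox 0 1) (\<lambda>p. T p * (Z p * pw l p))" for l
    have int: "(\<lambda>p. T p * (Z p * pw l p)) integrable_on cbox 0 1" for l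
      by (intro integrable_continuous continuous_intros cT cont pwc)
    have "integral (cbox 0 1) (\<lambda>p. of_real ((sin (pi * p $ i))\<^sup>2) * T p * (Z p * pw k p))
      = integral (cbox 0 1) (\<lambda>p. (1/2) * (T p * (Z p * pw k p)) - (1/4) * (T p * (Z p * pw (k + axis i 1) p))
          - (1/4) * (T p * (Z p * pw (k + - axis i 1) p)))"
      unfolding sin_squared_pw pw_add by (intro integral_cong) (simp add: algebra_simps)
    also have "\<dots> = (1/2) * J k - (1/4) * J (k + axis i 1) - (1/4) * J (k + - axis i 1)"
      unfolding J_def
      by (subst integral_diff; (intro integrable_diff integrable_on_mult_right int)?)+ simp
    also have "\<dots> = 0"
      using T k int_lattice_closed(2)[OF k axis_int_lattice] int_lattice_closed(2)[OF k int_lattice_closed(4)[OF axis_int_lattice]]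
      unfolding good_def J_def by simp
    finally show "integral (cbox 0 1) (\<lambda>p. of_real ((sin (pi * p $ i))\<^sup>2) * T p * (Z p * pw k p)) = 0" .
  qed
  have ker: "good (\<lambda>p. of_real (sin_kernel A p) * T p)" if "good T" "finite A" for A T
    using that(2)
  proof (induction A rule: finite_induct)
    case (insert i A)
    then have "(\<lambda>p. complex_of_real (sin_kernel (insert i A) p) * T p)
      = (\<lambda>p. of_real ((sin (pi * p $ i))\<^sup>2) * (of_real (sin_kernel A p) * T p))"
      by (simp add: sin_kernel_def mult.assoc)
    then show ?case using step[OF insert(3)] by simp
  qed (use that in \<open>simp add: sin_kernel_def\<close>)
  have "good (\<lambda>p. of_real (sin_kernel UNIV p ^ m) * 1)"
  proof (induction m)
    case 0
    show ?case using coeff by (simp add: good_def)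
  next
    case (Suc m)
    from ker[OF this, of UNIV] show ?case by (simp add: mult.assoc)
  qed
  then have "integral (cbox 0 1) (\<lambda>p. of_real (sin_kernel UNIV p ^ m) * 1 * (Z p * pw 0 p)) = 0"
    using int_lattice_closed(1) unfolding good_def by blast
  then show ?thesis by simp
qed

text \<open>If \<open>Z\<close> did not vanish at the centre, its integral against a high power of the kernel would be
  dominated by a neighbourhood of the centre, whereas it vanishes by orthogonality.\<close>

lemma fourier_uniqueness:
  fixes Z :: "real^'n::finite \<Rightarrow> complex"
  assumes cont: "continuous_on (cbox 0 1) Z"
    and coeff: "\<And>k. k \<in> int_lattice \<Longrightarrow> integral (cbox 0 1) (\<lambda>p. Z p * pw k p) = 0"
  shows "Z (\<chi> i. 1/2) = 0"
proof (rule ccontr)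
  define c :: "real^'n" where "c = (\<chi> i. 1/2)"
  define K where "K = (sin_kernel UNIV :: real^'n \<Rightarrow> real)"
  assume "Z (\<chi> i. 1/2) \<noteq> 0"
  then have Zc: "Z c \<noteq> 0" by (simp add: c_def)
  define W where "W p = Re (cnj (Z c) * Z p)" for p
  define a where "a = W c"
  have a: "a > 0" using Zc by (simp add: a_def W_def complex_neq_0 power2_eq_square)
  have cW: "continuous_on (cbox 0 1) W"
    unfolding W_def by (intro continuous_intros cont)
  have c01: "c \<in> cbox 0 1" by (simp add: c_def mem_box_cart)
  have zero: "integral (cbox 0 1) (\<lambda>p. K p ^ m * W p) = 0" for m
  proof -
    have bl: "bounded_linear (\<lambda>z. Re (cnj (Z c) * z))"
      by (intro bounded_linear_compose[OF bounded_linear_Re] bounded_linear_mult_right)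
    have "(\<lambda>p. of_real (K p ^ m) * Z p) integrable_on cbox 0 1"
      unfolding K_def by (intro integrable_continuous continuous_intros cont continuous_sin_kernel)
    from integral_linear[OF this bl]
    have "integral (cbox 0 1) ((\<lambda>z. Re (cnj (Z c) * z)) \<circ> (\<lambda>p. of_real (K p ^ m) * Z p)) = 0"
      using sin_kernel_orthogonal[OF cont coeff, of m] by (simp add: K_def)
    moreover have "((\<lambda>z. Re (cnj (Z c) * z)) \<circ> (\<lambda>p. of_real (K p ^ m) * Z p)) = (\<lambda>p. K p ^ m * W p)"
      by (auto simp: W_def fun_eq_iff algebra_simps simp flip: of_real_power)
    ultimately show ?thesis by simp
  qed
  obtain d where d: "d > 0" "\<And>p. p \<in> cbox 0 1 \<Longrightarrow> dist p c < d \<Longrightarrow> \<bar>W p - a\<bar> < a / 2"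
    using cW c01 a unfolding continuous_on_iff a_def by (metis dist_real_def half_gt_zero)
  obtain B where B: "B \<ge> 0" "\<And>p. p \<in> cbox 0 1 \<Longrightarrow> \<bar>W p\<bar> \<le> B"
  proof -
    have "bounded (W ` cbox 0 1)" by (intro compact_imp_bounded compact_continuous_image cW compact_cbox)
    then obtain B where "\<And>p. p \<in> cbox 0 1 \<Longrightarrow> \<bar>W p\<bar> \<le> B" unfolding bounded_iff by auto
    then show ?thesis using that[of "max 0 B"] by (meson max.cobounded1 max.coboundedI2)
  qed
  define C where "C = cbox 0 1 - ball c d"
  have C: "compact C" unfolding C_def by (intro compact_diff compact_cbox open_ball)
  obtain \<rho> where \<rho>: "0 \<le> \<rho>" "\<rho> < 1" "\<And>p. p \<in> C \<Longrightarrow> K p \<le> \<rho>"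
  proof (cases "C = {}")
    case True
    then show ?thesis using that[of 0] by auto
  next
    case False
    obtain q where q: "q \<in> C" "\<And>p. p \<in> C \<Longrightarrow> K p \<le> K q"
      using continuous_attains_sup[OF C False, of K] continuous_sin_kernel unfolding K_def by blast
    have "q \<noteq> c" using q(1) d by (auto simp: C_def)
    then have "K q < 1" unfolding K_def c_def using q(1) by (intro sin_kernel_less_1) (auto simp: C_def)
    then show ?thesis using that[of "K q"] q(2) sin_kernel_bounds by (auto simp: K_def)
  qed
  define \<rho>' where "\<rho>' = (1 + \<rho>) / 2"
  have \<rho>': "\<rho> < \<rho>'" "\<rho>' < 1" "0 < \<rho>'" using \<rho> by (auto simp: \<rho>'_def)
  have Kc: "K c = 1" by (simp add: K_def c_def sin_kernel_def)
  obtain d' where d': "d' > 0" "\<And>p. dist p c < d' \<Longrightarrow> \<bar>K p - 1\<bar> < 1 - \<rho>'"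
  proof -
    have "continuous_on UNIV K" unfolding K_def by (rule continuous_sin_kernel)
    then have "\<exists>d'>0. \<forall>p\<in>UNIV. dist p c < d' \<longrightarrow> dist (K p) (K c) < 1 - \<rho>'"
      using \<rho>'(2) unfolding continuous_on_iff by auto
    then show ?thesis using that by (auto simp: Kc dist_real_def)
  qed
  define n where "n = real CARD('n)"
  have n: "n > 0" by (simp add: n_def)
  define \<epsilon> where "\<epsilon> = min (1/4) (min d d' / (2 * n))"
  have \<epsilon>: "\<epsilon> > 0" using d(1) d'(1) n by (simp add: \<epsilon>_def)
  define Q where "Q = cbox (c - \<epsilon> *\<^sub>R 1) (c + \<epsilon> *\<^sub>R 1)"
  have Qd: "dist p c < min d d'" if "p \<in> Q" for p
  proof -
    have comp: "\<bar>(p - c) $ i\<bar> \<le> \<epsilon>" for i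
    proof -
      have "c $ i - \<epsilon> \<le> p $ i" "p $ i \<le> c $ i + \<epsilon>" using that by (auto simp: Q_def mem_box_cart)
      then show ?thesis by simp
    qed
    have "dist p c \<le> (\<Sum>i\<in>UNIV. \<bar>(p - c) $ i\<bar>)" unfolding dist_norm by (rule norm_le_l1_cart)
    also have "\<dots> \<le> (\<Sum>i\<in>(UNIV::'n set). \<epsilon>)" by (intro sum_mono comp)
    also have "\<dots> = n * \<epsilon>" by (simp add: n_def)
    also have "\<dots> \<le> n * (min d d' / (2 * n))" using n by (intro mult_left_mono) (auto simp: \<epsilon>_def)
    also have "\<dots> = min d d' / 2" using n by simp
    also have "\<dots> < min d d'" using d(1) d'(1) by (simp only: min_def) simp
    finally show ?thesis .
  qed
  have Q01: "Q \<subseteq> cbox 0 1"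
  proof
    fix p assume "p \<in> Q"
    then have "c $ i - \<epsilon> \<le> p $ i" "p $ i \<le> c $ i + \<epsilon>" for i by (auto simp: Q_def mem_box_cart)
    moreover have "\<epsilon> \<le> 1/4" by (simp add: \<epsilon>_def)
    ultimately have "0 \<le> p $ i \<and> p $ i \<le> 1" for i
      using order_trans[of 0 "c $ i - \<epsilon>" "p $ i"] order_trans[of "p $ i" "c $ i + \<epsilon>" 1] by (simp add: c_def)
    then show "p \<in> cbox 0 1" by (simp add: mem_box_cart)
  qed
  define v where "v = measure lborel Q"
  have v: "v > 0"
  proof -
    have "v = (\<Prod>i\<in>(UNIV::'n set). 2 * \<epsilon>)"
      unfolding v_def Q_def using \<epsilon> by (subst content_cbox_cart) (auto simp: interval_ne_empty_cart)
    then show ?thesis using \<epsilon> by simp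
  qed
  have main: "a / 2 * \<rho>' ^ m * v \<le> B * \<rho> ^ m" for m
  proof -
    have "((\<lambda>_. a / 2 * \<rho>' ^ m) has_integral v *\<^sub>R (a / 2 * \<rho>' ^ m)) Q"
      unfolding v_def Q_def by (rule has_integral_const)
    then have 1: "((\<lambda>p. if p \<in> Q then a / 2 * \<rho>' ^ m else 0) has_integral v *\<^sub>R (a / 2 * \<rho>' ^ m)) (cbox 0 1)"
      using Q01 by simp
    have 2: "((\<lambda>_. B * \<rho> ^ m) has_integral measure lborel (cbox 0 (1::real^'n)) *\<^sub>R (B * \<rho> ^ m)) (cbox 0 (1::real^'n))"
      by (rule has_integral_const)
    have vol: "measure lborel (cbox 0 (1::real^'n)) = 1" by (subst content_cbox_cart) (auto simp: interval_ne_empty_cart)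
    have "(\<lambda>p. K p ^ m * W p) integrable_on cbox 0 1"
      unfolding K_def by (intro integrable_continuous continuous_intros cW continuous_sin_kernel)
    then have 3: "((\<lambda>p. K p ^ m * W p) has_integral 0) (cbox 0 1)"
      using zero[of m] by (metis integrable_integral)
    have "v *\<^sub>R (a / 2 * \<rho>' ^ m) - measure lborel (cbox 0 (1::real^'n)) *\<^sub>R (B * \<rho> ^ m) \<le> 0"
    proof (rule has_integral_le[OF has_integral_diff[OF 1 2] 3])
      fix p :: "real^'n" assume p: "p \<in> cbox 0 1"
      have K0: "0 \<le> K p" "K p \<le> 1" unfolding K_def by (rule sin_kernel_bounds)+
      have Br: "0 \<le> B * \<rho> ^ m" using B \<rho> by simp
      consider "p \<in> Q" | "p \<notin> Q" "dist p c < d" | "p \<notin> Q" "p \<in> C" using p by (auto simp: C_def dist_commute)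
      then show "(if p \<in> Q then a / 2 * \<rho>' ^ m else 0) - B * \<rho> ^ m \<le> K p ^ m * W p"
      proof cases
        case 1
        have near: "dist p c < d" "dist p c < d'" using Qd[OF 1] by auto
        have "a / 2 \<le> W p" using d(2)[OF p near(1)] unfolding abs_less_iff by linarith
        moreover have "\<rho>' \<le> K p" using d'(2)[OF near(2)] unfolding abs_less_iff by linarith
        ultimately have "\<rho>' ^ m * (a / 2) \<le> K p ^ m * W p"
          using \<rho>' a K0 by (intro mult_mono power_mono) auto
        then show ?thesis using 1 Br by (simp add: mult.commute)
      next
        case 2
        have "0 \<le> W p" using d(2)[OF p 2(2)] a unfolding abs_less_iff by linarith
        then show ?thesis using 2 Br K0 by (auto intro: order_trans[of _ 0])
      next
        case 3
        have "K p ^ m \<le> \<rho> ^ m" using \<rho>(3)[OF 3(2)] K0 by (intro power_mono)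
        then have "K p ^ m * \<bar>W p\<bar> \<le> \<rho> ^ m * B" using K0 \<rho> B(2)[OF p] by (intro mult_mono) auto
        then have "\<bar>K p ^ m * W p\<bar> \<le> \<rho> ^ m * B" using K0 by (simp add: abs_mult)
        then show ?thesis using 3 by (simp add: mult.commute abs_le_iff)
      qed
    qed
    then show ?thesis using vol by (simp add: mult_ac)
  qed
  have "(\<lambda>m. B * (\<rho> / \<rho>') ^ m) \<longlonglongrightarrow> B * 0"
    using \<rho> \<rho>' by (intro tendsto_intros LIMSEQ_power_zero) auto
  then have "eventually (\<lambda>m. B * (\<rho> / \<rho>') ^ m < a / 2 * v) sequentially"
    using a v by (intro order_tendstoD) auto
  then obtain m where m: "B * (\<rho> / \<rho>') ^ m < a / 2 * v" by (auto dest: eventually_happens)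
  have "a / 2 * \<rho>' ^ m * v \<le> B * (\<rho> / \<rho>') ^ m * \<rho>' ^ m"
    using main[of m] \<rho>' by (simp add: power_divide)
  also have "\<dots> < a / 2 * v * \<rho>' ^ m" using m \<rho>' by (intro mult_strict_right_mono) auto
  finally show False by simp
qed

section \<open>Lattice sums\<close>

lemma int_inverse_square_bound:
  fixes c :: real
  shows "\<exists>S\<ge>0. \<forall>F. finite F \<longrightarrow> (\<Sum>z\<in>F. 1 / (1 + \<bar>of_int z + c\<bar>)\<^sup>2) \<le> S"
proof -
  have sm: "summable (\<lambda>n. 1 / (1 + real n)\<^sup>2)"
  proof -
    have "summable (\<lambda>n. inverse (real (Suc n) ^ 2))"
      using inverse_power_summable[of 2, where ?'a = real] by (subst summable_Suc_iff) auto
    then show ?thesis by (simp add: inverse_eq_divide add.commute)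
  qed
  define s where "s = (\<Sum>n. 1 / (1 + real n)\<^sup>2)"
  have fin: "(\<Sum>n\<in>A. 1 / (1 + real n)\<^sup>2) \<le> s" if "finite A" for A
    unfolding s_def using that by (intro sum_le_suminf sm) auto
  have s0: "s \<ge> 0" using fin[of "{}"] by simp
  have "(\<Sum>z\<in>F. 1 / (1 + \<bar>of_int z + c\<bar>)\<^sup>2) \<le> (1 + \<bar>c\<bar>)\<^sup>2 * (2 * s)" if F: "finite F" for F
  proof -
    have "(\<Sum>z\<in>F. 1 / (1 + \<bar>of_int z + c\<bar>)\<^sup>2) \<le> (\<Sum>z\<in>F. (1 + \<bar>c\<bar>)\<^sup>2 * (1 / (1 + \<bar>real_of_int z\<bar>)\<^sup>2))"
    proof (rule sum_mono)
      fix z :: int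
      have "1 + \<bar>real_of_int z\<bar> \<le> (1 + \<bar>of_int z + c\<bar>) * (1 + \<bar>c\<bar>)"
        using one_plus_norm_shift[of "real_of_int z" c] by simp
      then have "(1 + \<bar>real_of_int z\<bar>)\<^sup>2 \<le> ((1 + \<bar>of_int z + c\<bar>) * (1 + \<bar>c\<bar>))\<^sup>2"
        by (intro power_mono) auto
      then have "(1 + \<bar>real_of_int z\<bar>)\<^sup>2 \<le> (1 + \<bar>of_int z + c\<bar>)\<^sup>2 * (1 + \<bar>c\<bar>)\<^sup>2"
        by (simp add: power_mult_distrib)
      moreover have "0 < (1 + \<bar>of_int z + c\<bar>)\<^sup>2" "0 < (1 + \<bar>real_of_int z\<bar>)\<^sup>2" by (auto intro!: zero_less_power add_pos_nonneg)
      ultimately show "1 / (1 + \<bar>of_int z + c\<bar>)\<^sup>2 \<le> (1 + \<bar>c\<bar>)\<^sup>2 * (1 / (1 + \<bar>real_of_int z\<bar>)\<^sup>2)"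
        by (simp add: field_simps)
    qed
    also have "\<dots> = (1 + \<bar>c\<bar>)\<^sup>2 * (\<Sum>z\<in>F. 1 / (1 + \<bar>real_of_int z\<bar>)\<^sup>2)" by (simp add: sum_distrib_left)
    also have "(\<Sum>z\<in>F. 1 / (1 + \<bar>real_of_int z\<bar>)\<^sup>2) =
        (\<Sum>z\<in>{z\<in>F. z \<ge> 0}. 1 / (1 + \<bar>real_of_int z\<bar>)\<^sup>2) + (\<Sum>z\<in>{z\<in>F. z < 0}. 1 / (1 + \<bar>real_of_int z\<bar>)\<^sup>2)"
      using F by (subst sum.union_disjoint[symmetric]) (auto intro!: sum.cong)
    also have "(\<Sum>z\<in>{z\<in>F. z \<ge> 0}. 1 / (1 + \<bar>real_of_int z\<bar>)\<^sup>2) = (\<Sum>n\<in>nat ` {z\<in>F. z \<ge> 0}. 1 / (1 + real n)\<^sup>2)"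
      by (subst sum.reindex) (auto simp: inj_on_def intro!: sum.cong)
    also have "(\<Sum>z\<in>{z\<in>F. z < 0}. 1 / (1 + \<bar>real_of_int z\<bar>)\<^sup>2) = (\<Sum>n\<in>(\<lambda>z. nat (- z)) ` {z\<in>F. z < 0}. 1 / (1 + real n)\<^sup>2)"
      by (subst sum.reindex) (auto simp: inj_on_def intro!: sum.cong)
    also have "(\<Sum>n\<in>nat ` {z\<in>F. z \<ge> 0}. 1 / (1 + real n)\<^sup>2) + \<dots> \<le> s + s"
      using F by (intro add_mono fin) auto
    finally show ?thesis by (simp add: mult_left_mono)
  qed
  then show ?thesis using s0 by (intro exI[of _ "(1 + \<bar>c\<bar>)\<^sup>2 * (2 * s)"]) auto
qed

lemma lattice_summable:
  fixes c :: "real^'n::finite"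
  shows "(\<lambda>k. 1 / (1 + norm (k + c)) ^ (2 * CARD('n))) summable_on int_lattice"
proof (rule nonneg_bdd_above_summable_on)
  show "0 \<le> 1 / (1 + norm (k + c)) ^ (2 * CARD('n))" for k by simp
  have "\<forall>i. \<exists>S\<ge>0. \<forall>F. finite F \<longrightarrow> (\<Sum>z\<in>F. 1 / (1 + \<bar>of_int z + c $ i\<bar>)\<^sup>2) \<le> S"
    using int_inverse_square_bound by blast
  then obtain S where S: "\<And>i. S i \<ge> 0" "\<And>i F. finite F \<Longrightarrow> (\<Sum>z\<in>F. 1 / (1 + \<bar>of_int z + c $ i\<bar>)\<^sup>2) \<le> S i" by metis
  show "bdd_above (sum (\<lambda>k. 1 / (1 + norm (k + c)) ^ (2 * CARD('n))) ` {F. F \<subseteq> int_lattice \<and> finite F})"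
  proof (rule bdd_aboveI2)
    fix F :: "(real^'n) set" assume "F \<in> {F. F \<subseteq> int_lattice \<and> finite F}"
    then have F: "F \<subseteq> int_lattice" "finite F" by auto
    define fl where "fl k = (\<lambda>i. \<lfloor>k $ i\<rfloor>)" for k :: "real^'n"
    have flr: "real_of_int (fl k i) = k $ i" if "k \<in> F" for k i
      using that F(1) by (auto simp: fl_def int_lattice_def elim!: Ints_cases dest!: subsetD)
    have inj: "inj_on fl F"
      by (rule inj_onI) (metis flr Finite_Cartesian_Product.vec_eq_iff)
    define P where "P = (\<Union>k\<in>F. range (fl k))"
    have P: "finite P" unfolding P_def using F by auto
    have "sum (\<lambda>k. 1 / (1 + norm (k + c)) ^ (2 * CARD('n))) F \<le> (\<Sum>k\<in>F. \<Prod>i\<in>UNIV. 1 / (1 + \<bar>of_int (fl k i) + c $ i\<bar>)\<^sup>2)"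
    proof (rule sum_mono)
      fix k assume k: "k \<in> F"
      have "(\<Prod>i\<in>UNIV. (1 + \<bar>of_int (fl k i) + c $ i\<bar>)\<^sup>2) \<le> (\<Prod>i\<in>(UNIV::'n set). (1 + norm (k + c))\<^sup>2)"
        using component_le_norm_cart[of "k + c"] flr[OF k] by (intro prod_mono conjI power_mono) auto
      then have "(\<Prod>i\<in>UNIV. (1 + \<bar>of_int (fl k i) + c $ i\<bar>)\<^sup>2) \<le> (1 + norm (k + c)) ^ (2 * CARD('n))"
        by (simp add: power_mult)
      moreover have "0 < (\<Prod>i\<in>UNIV. (1 + \<bar>of_int (fl k i) + c $ i\<bar>)\<^sup>2)"
        by (intro prod_pos) (auto intro!: zero_less_power add_pos_nonneg)
      ultimately show "1 / (1 + norm (k + c)) ^ (2 * CARD('n)) \<le> (\<Prod>i\<in>UNIV. 1 / (1 + \<bar>of_int (fl k i) + c $ i\<bar>)\<^sup>2)"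
        by (simp add: prod_dividef frac_le)
    qed
    also have "\<dots> = (\<Sum>g\<in>fl ` F. \<Prod>i\<in>UNIV. 1 / (1 + \<bar>of_int (g i) + c $ i\<bar>)\<^sup>2)"
      by (simp add: sum.reindex[OF inj])
    also have "\<dots> \<le> (\<Sum>g\<in>PiE UNIV (\<lambda>_. P). \<Prod>i\<in>UNIV. 1 / (1 + \<bar>of_int (g i) + c $ i\<bar>)\<^sup>2)"
      using P by (intro sum_mono2 finite_PiE) (auto simp: P_def PiE_def intro!: prod_nonneg)
    also have "\<dots> = (\<Prod>i\<in>UNIV. \<Sum>z\<in>P. 1 / (1 + \<bar>of_int z + c $ i\<bar>)\<^sup>2)"
      using P by (subst prod_sum_PiE) auto
    also have "\<dots> \<le> (\<Prod>i\<in>UNIV. S i)"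
      using S(2) P by (intro prod_mono conjI sum_nonneg) auto
    finally show "sum (\<lambda>k. 1 / (1 + norm (k + c)) ^ (2 * CARD('n))) F \<le> (\<Prod>i\<in>UNIV. S i)" .
  qed
qed

section \<open>Residues of lattice points\<close>

definition residue_point :: "nat \<Rightarrow> real^'n::finite \<Rightarrow> real^'n" where
  "residue_point N k = (\<chi> i. of_int (\<lfloor>k $ i\<rfloor> mod int N))"

lemma residue_point_ZN: "N > 0 \<Longrightarrow> residue_point N k \<in> ZN N"
proof -
  assume N: "N > 0"
  have "real_of_int (\<lfloor>k $ i\<rfloor> mod int N) < real N" for i
  proof -
    have "\<lfloor>k $ i\<rfloor> mod int N < int N" using N by simp
    then show ?thesis by linarith
  qed
  then show ?thesis using N by (auto simp: ZN_def residue_point_def int_lattice_def)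
qed

lemma residue_point_decomp:
  assumes "k \<in> int_lattice"
  shows "\<exists>l\<in>int_lattice. k = residue_point N k + real N *\<^sub>R l"
proof
  define l :: "real^'a" where "l = (\<chi> i. of_int (\<lfloor>k $ i\<rfloor> div int N))"
  show "l \<in> int_lattice" by (simp add: l_def int_lattice_def)
  have "k $ i = of_int (\<lfloor>k $ i\<rfloor> mod int N) + real N * of_int (\<lfloor>k $ i\<rfloor> div int N)" for i
  proof -
    have "k $ i = of_int \<lfloor>k $ i\<rfloor>" using assms by (auto simp: int_lattice_def elim!: Ints_cases)
    also have "\<lfloor>k $ i\<rfloor> = \<lfloor>k $ i\<rfloor> mod int N + int N * (\<lfloor>k $ i\<rfloor> div int N)" by simp
    finally show ?thesis by (metis of_int_add of_int_mult of_int_of_nat_eq)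
  qed
  then show "k = residue_point N k + real N *\<^sub>R l"
    by (simp add: Finite_Cartesian_Product.vec_eq_iff l_def residue_point_def)
qed

lemma ZN_int_lattice: "j \<in> ZN N \<Longrightarrow> j \<in> int_lattice"
  by (simp add: ZN_def)

lemma ZN_eq_mod:
  assumes "j \<in> ZN N" "j' \<in> ZN N" "l \<in> int_lattice" "j = j' + real N *\<^sub>R l"
  shows "j = j'"
proof -
  have "l $ i = 0" for i
  proof -
    obtain z where z: "l $ i = of_int z" using assms(3) by (auto simp: int_lattice_def elim: Ints_cases)
    have "\<bar>j $ i - j' $ i\<bar> < real N" 
    proof -
      have "0 \<le> j $ i" "j $ i < real N" "0 \<le> j' $ i" "j' $ i < real N" using assms(1,2) by (auto simp: ZN_def)
      then show ?thesis by linarith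
    qed
    then have "real N * \<bar>of_int z\<bar> < real N * 1" using assms(4) z by (simp add: abs_mult)
    then have "\<bar>real_of_int z\<bar> < 1" by (rule mult_left_less_imp_less) simp
    then show ?thesis using z by auto
  qed
  then show ?thesis using assms(4) by (simp add: Finite_Cartesian_Product.vec_eq_iff)
qed

lemma bij_betw_ZN: "bij_betw (\<lambda>g. \<chi> i. real (g i)) (PiE UNIV (\<lambda>_. {..<N})) (ZN N :: (real^'n::finite) set)"
  unfolding bij_betw_def
proof
  show "inj_on (\<lambda>g. \<chi> i. real (g i)) (PiE UNIV (\<lambda>_. {..<N}))"
    by (rule inj_onI) (auto simp: Finite_Cartesian_Product.vec_eq_iff fun_eq_iff)
  show "(\<lambda>g. \<chi> i. real (g i)) ` PiE UNIV (\<lambda>_. {..<N}) = (ZN N :: (real^'n) set)"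
  proof (intro equalityI subsetI)
    fix j :: "real^'n" assume j: "j \<in> ZN N"
    define g where "g = (\<lambda>i. nat \<lfloor>j $ i\<rfloor>)"
    have g: "real (g i) = j $ i" for i
    proof -
      have "j $ i \<in> \<int>" "0 \<le> j $ i" using j by (auto simp: ZN_def int_lattice_def)
      then show ?thesis by (auto simp: g_def elim!: Ints_cases)
    qed
    have "g i < N" for i using g[of i] j unfolding ZN_def by (metis (mono_tags, lifting) mem_Collect_eq of_nat_less_iff)
    then show "j \<in> (\<lambda>g. \<chi> i. real (g i)) ` PiE UNIV (\<lambda>_. {..<N})"
      using g by (intro image_eqI[of _ _ g]) (auto simp: Finite_Cartesian_Product.vec_eq_iff)
  qed (auto simp: ZN_def int_lattice_def)
qed

lemma finite_ZN: "finite (ZN N :: (real^'n::finite) set)"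
  using bij_betw_finite[OF bij_betw_ZN[of N]] by (simp add: finite_PiE)

lemma card_ZN: "card (ZN N :: (real^'n::finite) set) = N ^ CARD('n)"
proof -
  have "card (PiE (UNIV::'n set) (\<lambda>_. {..<N})) = card (ZN N :: (real^'n) set)"
    by (rule bij_betw_same_card[OF bij_betw_ZN])
  then show ?thesis by (simp add: card_PiE)
qed

lemma residue_point_add_eq:
  assumes "N > 0" "k \<in> int_lattice" "j \<in> ZN N" "l \<in> int_lattice" "k = j + real N *\<^sub>R l"
  shows "residue_point N k = j"
proof -
  obtain l' where l': "l' \<in> int_lattice" "k = residue_point N k + real N *\<^sub>R l'"
    using residue_point_decomp[OF assms(2)] by blast
  have "residue_point N k + real N *\<^sub>R l' = j + real N *\<^sub>R l"
    using trans[OF l'(2)[symmetric] assms(5)] .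
  then have "residue_point N k = j + real N *\<^sub>R (l - l')"
    by (simp add: scaleR_diff_right algebra_simps)
  then show ?thesis
    using ZN_eq_mod[OF residue_point_ZN[OF assms(1)] assms(3)] int_lattice_closed(3)[OF assms(4) l'(1)] by blast
qed

lemma residue_point_shift_bij:
  assumes N: "N > 0" and a: "a \<in> int_lattice"
  shows "bij_betw (\<lambda>j. residue_point N (j + a)) (ZN N) (ZN N)"
proof -
  have "inj_on (\<lambda>j. residue_point N (j + a)) (ZN N)"
  proof (rule inj_onI)
    fix x y assume xy: "x \<in> ZN N" "y \<in> ZN N" "residue_point N (x + a) = residue_point N (y + a)"
    obtain l where l: "l \<in> int_lattice" "x + a = residue_point N (x + a) + real N *\<^sub>R l"
      using residue_point_decomp[of "x + a" N] xy a int_lattice_closed(2) ZN_int_lattice by blast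
    obtain l' where l': "l' \<in> int_lattice" "y + a = residue_point N (y + a) + real N *\<^sub>R l'"
      using residue_point_decomp[of "y + a" N] xy a int_lattice_closed(2) ZN_int_lattice by blast
    have "(x + a) - (y + a) = real N *\<^sub>R l - real N *\<^sub>R l'"
      unfolding arg_cong2[OF l(2) l'(2), of "(-)"] xy(3) by simp
    then have "x = y + real N *\<^sub>R (l - l')"
      by (simp add: scaleR_diff_right algebra_simps)
    then show "x = y" using ZN_eq_mod[OF xy(1,2)] int_lattice_closed(3)[OF l(1) l'(1)] by blast
  qed
  moreover have "(\<lambda>j. residue_point N (j + a)) ` ZN N \<subseteq> ZN N"
    using residue_point_ZN[OF N] by auto
  ultimately show ?thesis
    unfolding bij_betw_def using endo_inj_surj[OF finite_ZN] by blast
qed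

lemma cis_2pi_eq_1: "cis (2 * pi * x) = 1 \<Longrightarrow> x \<in> \<int>"
proof -
  assume "cis (2 * pi * x) = 1"
  then have "cos (2 * pi * x) = 1" by (simp add: complex_eq_iff)
  then obtain n :: int where "2 * pi * x = of_int n * 2 * pi"
    by (auto simp: cos_one_2pi_int)
  then have "x = of_int n" by simp
  then show ?thesis by simp
qed

lemma pw_residue:
  assumes "N > 0" "r \<in> int_lattice" "k \<in> int_lattice"
  shows "pw (residue_point N r) ((1 / real N) *\<^sub>R k) = pw r ((1 / real N) *\<^sub>R k)"
proof -
  obtain l where l: "l \<in> int_lattice" "r = residue_point N r + real N *\<^sub>R l"
    using residue_point_decomp[OF assms(2)] by blast
  have "pw (real N *\<^sub>R l) ((1 / real N) *\<^sub>R k) = pw l k"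
    using assms(1) by (simp add: pw_scaleR)
  then show ?thesis
    using pw_lattice[OF l(1) assms(3)] by (subst (2) l(2)) (simp add: pw_add)
qed

lemma pw_sum_ZN:
  fixes k :: "real^'n::finite"
  assumes N: "N > 0" and k: "k \<in> int_lattice" and nz: "(1 / real N) *\<^sub>R k \<notin> int_lattice"
  shows "(\<Sum>r\<in>ZN N. pw r ((1 / real N) *\<^sub>R k)) = 0"
proof -
  obtain i where i: "k $ i / real N \<notin> \<int>" using nz by (auto simp: int_lattice_def)
  define a :: "real^'n" where "a = axis i 1"
  have a: "a \<in> int_lattice" by (simp add: a_def axis_int_lattice)
  define S where "S = (\<Sum>r\<in>ZN N. pw r ((1 / real N) *\<^sub>R k))"
  have "S = (\<Sum>r\<in>ZN N. pw (residue_point N (r + a)) ((1 / real N) *\<^sub>R k))"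
    unfolding S_def by (rule sum.reindex_bij_betw[OF residue_point_shift_bij[OF N a], symmetric])
  also have "\<dots> = (\<Sum>r\<in>ZN N. pw r ((1 / real N) *\<^sub>R k) * pw a ((1 / real N) *\<^sub>R k))"
  proof (rule sum.cong[OF refl])
    fix r :: "real^'n" assume "r \<in> ZN N"
    then have "r + a \<in> int_lattice" by (intro int_lattice_closed a ZN_int_lattice)
    from pw_residue[OF N this k]
    show "pw (residue_point N (r + a)) ((1 / real N) *\<^sub>R k) = pw r ((1 / real N) *\<^sub>R k) * pw a ((1 / real N) *\<^sub>R k)"
      by (simp add: pw_add)
  qed
  also have "\<dots> = S * pw a ((1 / real N) *\<^sub>R k)" by (simp add: S_def sum_distrib_right)
  finally have "S * (1 - pw a ((1 / real N) *\<^sub>R k)) = 0" by (simp add: algebra_simps)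
  moreover have "pw a ((1 / real N) *\<^sub>R k) \<noteq> 1"
    using cis_2pi_eq_1[of "k $ i / real N"] i by (auto simp: pw_def a_def inner_axis')
  ultimately show ?thesis by (simp add: S_def)
qed

section \<open>The combs\<close>

lemma schwartz_lattice_summable:
  fixes \<phi> :: "real^'n::finite \<Rightarrow> complex"
  assumes "schwartz \<phi>"
  shows "(\<lambda>k. norm (\<phi> (k + c))) summable_on int_lattice"
proof -
  obtain B where B: "B \<ge> 0" "\<And>x. (1 + norm x) ^ (2 * CARD('n)) * norm (\<phi> x) \<le> B"
    using schwartzD[OF assms] by blast
  have "norm (\<phi> x) \<le> B * (1 / (1 + norm x) ^ (2 * CARD('n)))" for x
  proof -
    have "0 < (1 + norm x) ^ (2 * CARD('n))" by (intro zero_less_power) (simp add: add_pos_nonneg)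
    then show ?thesis using B(2)[of x] by (simp add: field_simps)
  qed
  then show ?thesis
    by (intro Infinite_Sum.abs_summable_on_comparison_test'[OF summable_on_cmult_right[OF lattice_summable]])
qed

lemma schwartz_lattice_summable_on: "schwartz \<phi> \<Longrightarrow> (\<lambda>k. \<phi> (k + c)) summable_on int_lattice"
  by (rule Infinite_Sum.abs_summable_summable[OF schwartz_lattice_summable])

lemma comb_eq:
  fixes \<phi> :: "real^'n::finite \<Rightarrow> complex"
  assumes "N > 0" "schwartz \<phi>"
  shows "comb N j \<phi> = of_real (real N powr (- real CARD('n) / 2)) *
    (\<Sum>\<^sub>\<infinity>k\<in>int_lattice. \<phi> (k + (1 / real N) *\<^sub>R j))"
  using assms by (simp add: comb_def scaleR_add_right)

lemma schwartz_functional_comb: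
  assumes N: "N > 0"
  shows "schwartz_functional (comb N (j :: real^'n::finite))"
  unfolding schwartz_functional_def
proof (intro conjI allI impI)
  fix \<phi> \<psi> :: "real^'n \<Rightarrow> complex" and c
  assume \<phi>: "schwartz \<phi>"
  have s: "(\<lambda>k. \<theta> (k + (1 / real N) *\<^sub>R j)) summable_on int_lattice" if "schwartz \<theta>" for \<theta> :: "real^'n \<Rightarrow> complex"
    by (intro schwartz_lattice_summable_on that)
  show "comb N j (\<lambda>x. c * \<phi> x) = c * comb N j \<phi>"
    using s[OF \<phi>] by (simp add: comb_eq N \<phi> schwartz_scale infsum_cmult_right)
  assume \<psi>: "schwartz \<psi>"
  show "comb N j (\<lambda>x. \<phi> x + \<psi> x) = comb N j \<phi> + comb N j \<psi>"
    using s[OF \<phi>] s[OF \<psi>] by (simp add: comb_eq N \<phi> \<psi> schwartz_add infsum_add distrib_left)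
next
  define w where "w = real N powr (- real CARD('n) / 2)"
  define c where "c = (1 / real N) *\<^sub>R j"
  define S where "S = (\<Sum>\<^sub>\<infinity>k\<in>int_lattice. 1 / (1 + norm (k + c)) ^ (2 * CARD('n)))"
  have S: "S \<ge> 0" unfolding S_def by (intro infsum_nonneg) simp
  have w: "w \<ge> 0" by (simp add: w_def)
  have "norm (comb N j \<phi>) \<le> (w * S) * B"
    if \<phi>: "schwartz \<phi>" and B: "\<forall>is x. length is \<le> 2 * CARD('n) \<longrightarrow> (1 + norm x) ^ (2 * CARD('n)) * norm (iter_partial is \<phi> x) \<le> B" for \<phi> :: "real^'n \<Rightarrow> complex" and B
  proof -
    have b: "norm (\<phi> x) \<le> B * (1 / (1 + norm x) ^ (2 * CARD('n)))" for x
    proof -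
      have "0 < (1 + norm x) ^ (2 * CARD('n))" by (intro zero_less_power) (simp add: add_pos_nonneg)
      then show ?thesis using B[rule_format, of "[]" x] by (simp add: field_simps)
    qed
    have "norm (\<Sum>\<^sub>\<infinity>k\<in>int_lattice. \<phi> (k + c)) \<le> (\<Sum>\<^sub>\<infinity>k\<in>int_lattice. norm (\<phi> (k + c)))"
      by (intro norm_infsum_bound schwartz_lattice_summable \<phi>)
    also have "\<dots> \<le> (\<Sum>\<^sub>\<infinity>k\<in>int_lattice. B * (1 / (1 + norm (k + c)) ^ (2 * CARD('n))))"
      by (intro infsum_mono schwartz_lattice_summable \<phi> summable_on_cmult_right lattice_summable b)
    also have "\<dots> = B * S" unfolding S_def by (intro infsum_cmult_right lattice_summable)
    finally have "w * norm (\<Sum>\<^sub>\<infinity>k\<in>int_lattice. \<phi> (k + c)) \<le> w * (B * S)" using w by (intro mult_left_mono) auto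
    then show ?thesis by (simp add: comb_eq N \<phi> norm_mult w_def c_def mult_ac)
  qed
  then show "\<exists>C m. C \<ge> 0 \<and> (\<forall>\<phi> B. schwartz \<phi> \<longrightarrow>
      (\<forall>is x. length is \<le> m \<longrightarrow> (1 + norm x) ^ m * norm (iter_partial is \<phi> x) \<le> B) \<longrightarrow> norm (comb N j \<phi>) \<le> C * B)"
    using S w by (intro exI[of _ "w * S"] exI[of _ "2 * CARD('n)"]) simp
qed

lemma tempered_comb: "N > 0 \<Longrightarrow> tempered (comb N j)"
  by (intro schwartz_functional_tempered schwartz_functional_comb) (auto simp: comb_def)

lemma infsum_lattice_shift:
  assumes "l \<in> int_lattice"
  shows "(\<Sum>\<^sub>\<infinity>k\<in>int_lattice. f (k + l)) = (\<Sum>\<^sub>\<infinity>k\<in>int_lattice. f k)"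
proof (rule infsum_reindex_bij_betw)
  show "bij_betw (\<lambda>k. k + l) int_lattice int_lattice"
    by (rule bij_betw_byWitness[of _ "\<lambda>k. k - l"]) (use assms int_lattice_closed in auto)
qed

lemma schwartz_translate_minus: "schwartz \<phi> \<Longrightarrow> schwartz (\<lambda>x. \<phi> (x - b))"
  using schwartz_translate[of \<phi> "- b"] by simp

lemma comb_translate:
  assumes "N > 0" "schwartz \<phi>"
  shows "comb N j (\<lambda>x. \<phi> (x - (1 / real N) *\<^sub>R \<eta>)) = comb N (j - \<eta>) \<phi>"
  using assms by (simp add: comb_eq schwartz_translate_minus scaleR_diff_right add_diff_eq)

lemma comb_periodic:
  fixes j :: "real^'n::finite"
  assumes N: "N > 0" and l: "l \<in> int_lattice"
  shows "comb N (j + real N *\<^sub>R l) = comb N j"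
proof
  fix \<phi> :: "real^'n \<Rightarrow> complex"
  show "comb N (j + real N *\<^sub>R l) \<phi> = comb N j \<phi>"
  proof (cases "schwartz \<phi>")
    case True
    have "k + (1 / real N) *\<^sub>R (j + real N *\<^sub>R l) = k + l + (1 / real N) *\<^sub>R j" for k
      using N by (simp add: scaleR_add_right)
    then show ?thesis
      using infsum_lattice_shift[OF l, of "\<lambda>k. \<phi> (k + (1 / real N) *\<^sub>R j)"] N by (simp add: comb_eq True add.assoc)
  qed (simp add: comb_def)
qed

lemma comb_translate_lattice:
  assumes "N > 0" "schwartz \<phi>" "l \<in> int_lattice"
  shows "comb N j (\<lambda>x. \<phi> (x - l)) = comb N j \<phi>"
  using comb_translate[OF assms(1,2), of j "real N *\<^sub>R l"] comb_periodic[OF assms(1) int_lattice_closed(4)[OF assms(3)], of j]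
    assms(1) by simp

lemma comb_modulate:
  assumes N: "N > 0" and \<phi>: "schwartz \<phi>" and m: "m \<in> int_lattice"
  shows "comb N j (\<lambda>x. \<phi> x * pw m x) = pw m ((1 / real N) *\<^sub>R j) * comb N j \<phi>"
proof -
  have "(\<Sum>\<^sub>\<infinity>k\<in>int_lattice. \<phi> (k + (1 / real N) *\<^sub>R j) * pw m (k + (1 / real N) *\<^sub>R j))
      = (\<Sum>\<^sub>\<infinity>k\<in>int_lattice. \<phi> (k + (1 / real N) *\<^sub>R j) * pw m ((1 / real N) *\<^sub>R j))"
    using pw_lattice[OF m] by (intro infsum_cong) (simp add: pw_add_right)
  also have "\<dots> = (\<Sum>\<^sub>\<infinity>k\<in>int_lattice. \<phi> (k + (1 / real N) *\<^sub>R j)) * pw m ((1 / real N) *\<^sub>R j)"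
    by (intro infsum_cmult_left schwartz_lattice_summable_on \<phi>)
  finally show ?thesis
    by (simp add: comb_eq N \<phi> schwartz_mult_slow slow_pw)
qed

lemma comb_gauss_nonzero:
  assumes "N > 0"
  shows "comb N (j :: real^'n::finite) gauss \<noteq> 0"
proof -
  define c where "c = (1 / real N) *\<^sub>R j"
  have s: "(\<lambda>k. exp (- ((k + c) \<bullet> (k + c)))) summable_on int_lattice"
    using schwartz_lattice_summable[OF schwartz_gauss, of c] by (simp add: gauss_def)
  have "exp (- ((0 + c) \<bullet> (0 + c))) \<le> (\<Sum>\<^sub>\<infinity>k\<in>int_lattice. exp (- ((k + c) \<bullet> (k + c))))"
    using finite_sum_le_infsum[OF s, of "{0}"] int_lattice_closed(1) by simp
  then have "(\<Sum>\<^sub>\<infinity>k\<in>int_lattice. exp (- ((k + c) \<bullet> (k + c)))) > 0"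
    by (rule less_le_trans[rotated]) simp
  moreover have "(\<Sum>\<^sub>\<infinity>k\<in>int_lattice. gauss (k + c)) = of_real (\<Sum>\<^sub>\<infinity>k\<in>int_lattice. exp (- ((k + c) \<bullet> (k + c))))"
    unfolding gauss_def by (rule infsumI[OF has_sum_bounded_linear[OF bounded_linear_of_real has_sum_infsum[OF s]]])
  ultimately show ?thesis using assms by (simp add: comb_eq schwartz_gauss c_def)
qed

section \<open>The combs form a basis of the state space\<close>

definition lattice_invariant :: "nat \<Rightarrow> 'n::finite dist \<Rightarrow> bool" where
  "lattice_invariant N f \<longleftrightarrow> (\<forall>\<phi>. schwartz \<phi> \<longrightarrow> (\<forall>l\<in>int_lattice.
     f (\<lambda>x. \<phi> (x - l)) = f \<phi> \<and> f (\<lambda>x. \<phi> x * pw (real N *\<^sub>R l) x) = f \<phi>))"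

lemma lattice_invariantD:
  assumes "lattice_invariant N f" "schwartz \<phi>" "l \<in> int_lattice"
  shows "f (\<lambda>x. \<phi> (x - l)) = f \<phi>" "f (\<lambda>x. \<phi> x * pw (real N *\<^sub>R l) x) = f \<phi>"
  using assms by (auto simp: lattice_invariant_def)

lemma lattice_invariant_comb:
  assumes "N > 0" "j \<in> int_lattice"
  shows "lattice_invariant N (comb N j)"
  unfolding lattice_invariant_def
proof (intro allI impI ballI conjI)
  fix \<phi> :: "real^'a \<Rightarrow> complex" and l :: "real^'a" assume *: "schwartz \<phi>" "l \<in> int_lattice"
  show "comb N j (\<lambda>x. \<phi> (x - l)) = comb N j \<phi>" using * assms by (intro comb_translate_lattice)
  have "pw (real N *\<^sub>R l) ((1 / real N) *\<^sub>R j) = 1"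
    using assms pw_lattice[OF *(2) assms(2)] by (simp add: pw_scaleR)
  then show "comb N j (\<lambda>x. \<phi> x * pw (real N *\<^sub>R l) x) = comb N j \<phi>"
    using comb_modulate[OF assms(1) *(1) int_lattice_closed(5)[OF *(2)], of j N] by simp
qed

lemma U_op_eq:
  assumes T: "schwartz_functional T" and \<phi>: "schwartz \<phi>" and N: "N > 0"
  shows "U_op (planck N) \<omega> T \<phi> = cis (real N * pi * (pos \<omega> \<bullet> mom \<omega>)) *
     T (\<lambda>x. \<phi> (x - mom \<omega>) * pw (real N *\<^sub>R pos \<omega>) (x - mom \<omega>))"
proof -
  have "(\<lambda>x. cis ((pos \<omega> \<bullet> (x - mom \<omega>)) / planck N + (pos \<omega> \<bullet> mom \<omega>) / (2 * planck N)) * \<phi> (x - mom \<omega>)) =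
    (\<lambda>x. cis (real N * pi * (pos \<omega> \<bullet> mom \<omega>)) * (\<phi> (x - mom \<omega>) * pw (real N *\<^sub>R pos \<omega>) (x - mom \<omega>)))"
    by (rule ext) (simp add: planck_def pw_def cis_mult[symmetric] mult_ac)
  moreover have "schwartz (\<lambda>x. \<phi> (x - mom \<omega>) * pw (real N *\<^sub>R pos \<omega>) (x - mom \<omega>))"
    using schwartz_translate_minus[OF schwartz_mult_slow[OF \<phi> slow_pw]] .
  ultimately show ?thesis
    using \<phi> schwartz_functional_scale[OF T] by (simp add: U_op_def)
qed

lemma int_lattice_pos_mom: "\<omega> \<in> int_lattice \<Longrightarrow> pos \<omega> \<in> int_lattice" "\<omega> \<in> int_lattice \<Longrightarrow> mom \<omega> \<in> int_lattice"
  by (auto simp: int_lattice_def pos_def mom_def)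

definition phase_point :: "real^'n \<Rightarrow> real^'n \<Rightarrow> real^('n::finite + 'n)" where
  "phase_point y \<eta> = (\<chi> s. case s of Inl i \<Rightarrow> y $ i | Inr i \<Rightarrow> \<eta> $ i)"

lemma phase_point [simp]: "pos (phase_point y \<eta>) = y" "mom (phase_point y \<eta>) = \<eta>"
  by (simp_all add: phase_point_def pos_def mom_def Finite_Cartesian_Product.vec_eq_iff)

lemma phase_point_lattice: "y \<in> int_lattice \<Longrightarrow> \<eta> \<in> int_lattice \<Longrightarrow> phase_point y \<eta> \<in> int_lattice"
  by (auto simp: int_lattice_def phase_point_def split: sum.splits)

lemma H_space_iff:
  assumes N: "N > 0"
  shows "f \<in> H_space N \<longleftrightarrow> tempered f \<and> lattice_invariant N f"
proof
  assume f: "f \<in> H_space N"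
  then have t: "tempered f" and
    inv: "\<And>\<omega>. \<omega> \<in> int_lattice \<Longrightarrow> U_op (planck N) \<omega> f = dist_scale (cis (real N * pi * (pos \<omega> \<bullet> mom \<omega>))) f"
    by (auto simp: H_space_def)
  note T = tempered_schwartz_functional[OF t]
  have "f (\<lambda>x. \<phi> (x - l)) = f \<phi> \<and> f (\<lambda>x. \<phi> x * pw (real N *\<^sub>R l) x) = f \<phi>"
    if \<phi>: "schwartz \<phi>" and l: "l \<in> int_lattice" for \<phi> l
  proof
    have 1: "phase_point 0 l \<in> int_lattice" "phase_point l 0 \<in> int_lattice"
      using l int_lattice_closed(1) by (auto intro: phase_point_lattice)
    show "f (\<lambda>x. \<phi> (x - l)) = f \<phi>"
      using fun_cong[OF inv[OF 1(1)], of \<phi>] U_op_eq[OF T \<phi> N, of "phase_point 0 l"] by (simp add: dist_scale_def)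
    show "f (\<lambda>x. \<phi> x * pw (real N *\<^sub>R l) x) = f \<phi>"
      using fun_cong[OF inv[OF 1(2)], of \<phi>] U_op_eq[OF T \<phi> N, of "phase_point l 0"] by (simp add: dist_scale_def)
  qed
  then show "tempered f \<and> lattice_invariant N f" using t by (simp add: lattice_invariant_def)
next
  assume f: "tempered f \<and> lattice_invariant N f"
  then have T: "schwartz_functional f" by (simp add: tempered_schwartz_functional)
  have "U_op (planck N) \<omega> f = dist_scale (cis (real N * pi * (pos \<omega> \<bullet> mom \<omega>))) f" if \<omega>: "\<omega> \<in> int_lattice" for \<omega>
  proof
    fix \<phi>
    show "U_op (planck N) \<omega> f \<phi> = dist_scale (cis (real N * pi * (pos \<omega> \<bullet> mom \<omega>))) f \<phi>"
    proof (cases "schwartz \<phi>")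
      case True
      have "f (\<lambda>x. \<phi> (x - mom \<omega>) * pw (real N *\<^sub>R pos \<omega>) (x - mom \<omega>)) = f \<phi>"
        using lattice_invariantD(1)[OF conjunct2[OF f] schwartz_mult_slow[OF True slow_pw] int_lattice_pos_mom(2)[OF \<omega>], of "real N *\<^sub>R pos \<omega>"]
          lattice_invariantD(2)[OF conjunct2[OF f] True int_lattice_pos_mom(1)[OF \<omega>]] by simp
      then show ?thesis using U_op_eq[OF T True N, of \<omega>] by (simp add: dist_scale_def)
    next
      case False
      then show ?thesis using f by (simp add: U_op_def dist_scale_def tempered_def)
    qed
  qed
  then show "f \<in> H_space N" using f by (simp add: H_space_def)
qed

lemma comb_in_H_space: "N > 0 \<Longrightarrow> j \<in> int_lattice \<Longrightarrow> comb N j \<in> H_space N"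
  by (simp add: H_space_iff tempered_comb lattice_invariant_comb)

text \<open>For a combination of point masses on \<open>N\<^sup>-\<^sup>1\<int>\<^sup>n\<close> this is the mass at \<open>k / N\<close>; the Gaussian is a test function
  with value one at the origin.\<close>

definition fourier_weight :: "nat \<Rightarrow> 'n::finite dist \<Rightarrow> real^'n \<Rightarrow> complex" where
  "fourier_weight N f k = phase_average N (\<lambda>\<psi>. f (\<lambda>x. \<psi> (x - (1 / real N) *\<^sub>R k))) gauss"

lemma schwartz_functional_translate:
  assumes T: "schwartz_functional T"
  shows "schwartz_functional (\<lambda>\<psi>. T (\<lambda>x. \<psi> (x - b)))"
  unfolding schwartz_functional_def
proof (intro conjI allI impI)
  show "T (\<lambda>x. \<phi> (x - b) + \<psi> (x - b)) = T (\<lambda>x. \<phi> (x - b)) + T (\<lambda>x. \<psi> (x - b))" if "schwartz \<phi>" "schwartz \<psi>" for \<phi> \<psi>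
    by (intro schwartz_functional_add[OF T] schwartz_translate_minus that)
  show "T (\<lambda>x. c * \<phi> (x - b)) = c * T (\<lambda>x. \<phi> (x - b))" if "schwartz \<phi>" for \<phi> c
    by (intro schwartz_functional_scale[OF T] schwartz_translate_minus that)
  obtain C m where C: "C \<ge> 0" "\<And>\<phi> B. schwartz \<phi> \<Longrightarrow>
      (\<And>is x. length is \<le> m \<Longrightarrow> (1 + norm x) ^ m * norm (iter_partial is \<phi> x) \<le> B) \<Longrightarrow> norm (T \<phi>) \<le> C * B"
    using schwartz_functional_bound[OF T] by blast
  have "norm (T (\<lambda>x. \<phi> (x - b))) \<le> (C * (1 + norm b) ^ m) * B"
    if \<phi>: "schwartz \<phi>" and B: "\<forall>is x. length is \<le> m \<longrightarrow> (1 + norm x) ^ m * norm (iter_partial is \<phi> x) \<le> B" for \<phi> B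
  proof -
    have "norm (T (\<lambda>x. \<phi> (x - b))) \<le> C * ((1 + norm b) ^ m * B)"
    proof (rule C(2))
      fix "is" :: "'a list" and x :: "real^'a" assume len: "length is \<le> m"
      have "(1 + norm x) ^ m \<le> ((1 + norm (x + - b)) * (1 + norm (- b))) ^ m"
        by (intro power_mono one_plus_norm_shift) simp
      then have "(1 + norm x) ^ m * norm (iter_partial is \<phi> (x - b))
         \<le> ((1 + norm (x - b)) * (1 + norm b)) ^ m * norm (iter_partial is \<phi> (x - b))"
        by (intro mult_right_mono) auto
      also have "\<dots> = (1 + norm b) ^ m * ((1 + norm (x - b)) ^ m * norm (iter_partial is \<phi> (x - b)))"
        by (simp add: power_mult_distrib)
      also have "\<dots> \<le> (1 + norm b) ^ m * B" using B len by (intro mult_left_mono) auto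
      finally show "(1 + norm x) ^ m * norm (iter_partial is (\<lambda>x. \<phi> (x - b)) x) \<le> (1 + norm b) ^ m * B"
        using iter_partial_affine[OF schwartz_smooth[OF \<phi>], of "is" 1 "- b"] by simp
    qed (intro schwartz_translate_minus \<phi>)
    then show ?thesis by (simp add: mult.assoc)
  qed
  moreover have "0 \<le> C * (1 + norm b) ^ m" using C(1) by simp
  ultimately show "\<exists>C m. C \<ge> 0 \<and> (\<forall>\<phi> B. schwartz \<phi> \<longrightarrow>
      (\<forall>is x. length is \<le> m \<longrightarrow> (1 + norm x) ^ m * norm (iter_partial is \<phi> x) \<le> B) \<longrightarrow> norm (T (\<lambda>x. \<phi> (x - b))) \<le> C * B)"
    by blast
qed

lemma translate_delta:
  assumes N: "N > 0" and T: "schwartz_functional f" and inv: "lattice_invariant N f"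
    and k: "k \<in> int_lattice" and \<psi>: "schwartz \<psi>"
  shows "phase_average N (\<lambda>\<psi>. f (\<lambda>x. \<psi> (x - (1 / real N) *\<^sub>R k))) \<psi> = \<psi> 0 * fourier_weight N f k"
  unfolding fourier_weight_def
proof (rule phase_average_delta[OF schwartz_functional_translate[OF T] N _ \<psi>])
  fix \<phi> :: "real^'a \<Rightarrow> complex" and i assume \<phi>: "schwartz \<phi>"
  define \<kappa> where "\<kappa> = (1 / real N) *\<^sub>R k"
  define q :: "real^'a" where "q = real N *\<^sub>R axis i 1"
  have "pw q (- \<kappa>) = 1"
    using N pw_lattice[OF axis_int_lattice k, of i] by (simp add: q_def \<kappa>_def pw_scaleR pw_minus_right)
  then have "f (\<lambda>x. \<phi> (x - \<kappa>) * pw q (x - \<kappa>)) = f (\<lambda>x. \<phi> (x - \<kappa>) * pw q x)"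
    by (simp add: diff_conv_add_uminus pw_add_right del: add_uminus_conv_diff)
  also have "\<dots> = f (\<lambda>x. \<phi> (x - \<kappa>))"
    unfolding q_def by (intro lattice_invariantD(2)[OF inv] schwartz_translate_minus \<phi> axis_int_lattice)
  finally show "f (\<lambda>x. \<phi> (x - (1 / real N) *\<^sub>R k) * pw (real N *\<^sub>R axis i 1) (x - (1 / real N) *\<^sub>R k)) = f (\<lambda>x. \<phi> (x - (1 / real N) *\<^sub>R k))"
    by (simp add: q_def \<kappa>_def)
qed

lemma fourier_coefficient:
  assumes N: "N > 0" and T: "schwartz_functional f" and inv: "lattice_invariant N f"
    and k: "k \<in> int_lattice" and \<phi>: "schwartz \<phi>"
  shows "integral (cbox 0 1) (\<lambda>p. f (\<lambda>x. \<phi> x * pw (real N *\<^sub>R p) x) * pw (- k) p)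
    = \<phi> ((1 / real N) *\<^sub>R k) * fourier_weight N f k"
proof -
  define \<kappa> where "\<kappa> = (1 / real N) *\<^sub>R k"
  have e: "f (\<lambda>x. \<phi> (x - \<kappa> + \<kappa>) * pw (real N *\<^sub>R p) (x - \<kappa>)) = f (\<lambda>x. \<phi> x * pw (real N *\<^sub>R p) x) * pw (- k) p" for p
  proof -
    have "pw (real N *\<^sub>R p) (- \<kappa>) = pw (- k) p"
      using N by (simp add: \<kappa>_def pw_scaleR pw_minus_right pw_minus pw_commute[of k])
    then have "(\<lambda>x. \<phi> (x - \<kappa> + \<kappa>) * pw (real N *\<^sub>R p) (x - \<kappa>)) = (\<lambda>x. pw (- k) p * (\<phi> x * pw (real N *\<^sub>R p) x))"
      by (simp add: diff_conv_add_uminus pw_add_right mult_ac del: add_uminus_conv_diff)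
    then show ?thesis
      using schwartz_functional_scale[OF T schwartz_mult_slow[OF \<phi> slow_pw], of "pw (- k) p" "real N *\<^sub>R p"] by simp
  qed
  show ?thesis
    using translate_delta[OF N T inv k schwartz_translate[OF \<phi>, of \<kappa>]]
    unfolding phase_average_def \<kappa>_def[symmetric] e by simp
qed

lemma functional_zero_by_coefficients:
  fixes f :: "'n::finite dist"
  assumes T: "schwartz_functional f" and \<phi>: "schwartz \<phi>"
    and zero: "\<And>\<phi> k. schwartz \<phi> \<Longrightarrow> k \<in> int_lattice \<Longrightarrow>
      integral (cbox 0 1) (\<lambda>p. f (\<lambda>x. \<phi> x * pw (real N *\<^sub>R p) x) * pw (- k) p) = 0"
  shows "f \<phi> = 0"
proof -
  define c :: "real^'n" where "c = (\<chi> i. 1/2)"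
  define \<psi> where "\<psi> x = \<phi> x * pw (- (real N *\<^sub>R c)) x" for x
  have \<psi>: "schwartz \<psi>" unfolding \<psi>_def[abs_def] by (intro schwartz_mult_slow \<phi> slow_pw)
  have "f (\<lambda>x. \<psi> x * pw (real N *\<^sub>R c) x) = 0"
    unfolding c_def
  proof (rule fourier_uniqueness)
    show "continuous_on (cbox 0 1) (\<lambda>p. f (\<lambda>x. \<psi> x * pw (real N *\<^sub>R p) x))"
      by (rule continuous_on_phase[OF T \<psi>])
    show "integral (cbox 0 1) (\<lambda>p. f (\<lambda>x. \<psi> x * pw (real N *\<^sub>R p) x) * pw k p) = 0" if "k \<in> int_lattice" for k
      using zero[OF \<psi> int_lattice_closed(4)[OF that]] by simp
  qed
  moreover have "\<psi> x * pw (real N *\<^sub>R c) x = \<phi> x" for x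
    using pw_add[of "- (real N *\<^sub>R c)" "real N *\<^sub>R c" x] by (simp add: \<psi>_def mult.assoc)
  ultimately show ?thesis by simp
qed

lemma fourier_weight_periodic:
  assumes N: "N > 0" and inv: "lattice_invariant N f" and l: "l \<in> int_lattice"
  shows "fourier_weight N f (k + real N *\<^sub>R l) = fourier_weight N f k"
proof -
  have "f (\<lambda>x. (gauss (x - (1 / real N) *\<^sub>R (k + real N *\<^sub>R l))) * pw q (x - (1 / real N) *\<^sub>R (k + real N *\<^sub>R l)))
     = f (\<lambda>x. gauss (x - (1 / real N) *\<^sub>R k) * pw q (x - (1 / real N) *\<^sub>R k))" for q
  proof -
    have "(1 / real N) *\<^sub>R (k + real N *\<^sub>R l) = l + (1 / real N) *\<^sub>R k" using N by (simp add: scaleR_add_right)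
    then show ?thesis
      using lattice_invariantD(1)[OF inv _ l, of "\<lambda>x. gauss (x - (1 / real N) *\<^sub>R k) * pw q (x - (1 / real N) *\<^sub>R k)"]
        schwartz_translate_minus[OF schwartz_mult_slow[OF schwartz_gauss slow_pw[of q]], of "(1 / real N) *\<^sub>R k"]
      by (simp add: diff_diff_add)
  qed
  then show ?thesis by (simp add: fourier_weight_def phase_average_def)
qed

lemma fourier_weight_comb_off:
  assumes N: "N > 0" and j: "j \<in> int_lattice" and k: "k \<in> int_lattice"
    and ne: "(1 / real N) *\<^sub>R (j - k) \<notin> int_lattice"
  shows "fourier_weight N (comb N j) k = 0"
proof -
  obtain i where i: "(j - k) $ i / real N \<notin> \<int>" using ne by (auto simp: int_lattice_def)
  define a :: "real^'a" where "a = axis i 1"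
  have a: "a \<in> int_lattice" by (simp add: a_def axis_int_lattice)
  define \<kappa> where "\<kappa> = (1 / real N) *\<^sub>R k"
  define \<zeta> where "\<zeta> = pw a ((1 / real N) *\<^sub>R (j - k))"
  have \<zeta>: "\<zeta> \<noteq> 1"
    using cis_2pi_eq_1[of "(j - k) $ i / real N"] i by (auto simp: \<zeta>_def pw_def a_def inner_axis')
  have sch: "schwartz (\<lambda>x. gauss x * pw a x)" by (intro schwartz_mult_slow schwartz_gauss slow_pw)
  have "comb N j (\<lambda>x. (gauss (x - \<kappa>) * pw a (x - \<kappa>)) * pw q (x - \<kappa>)) = \<zeta> * comb N j (\<lambda>x. gauss (x - \<kappa>) * pw q (x - \<kappa>))" for q
  proof -
    define \<theta> where "\<theta> x = gauss (x - \<kappa>) * pw q (x - \<kappa>)" for x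
    have \<theta>: "schwartz \<theta>" unfolding \<theta>_def[abs_def]
      by (rule schwartz_translate_minus[OF schwartz_mult_slow[OF schwartz_gauss slow_pw]])
    have "comb N j (\<lambda>x. (gauss (x - \<kappa>) * pw a (x - \<kappa>)) * pw q (x - \<kappa>)) = comb N j (\<lambda>x. pw a (- \<kappa>) * (\<theta> x * pw a x))"
      by (simp add: \<theta>_def diff_conv_add_uminus pw_add_right mult_ac del: add_uminus_conv_diff)
    also have "\<dots> = pw a (- \<kappa>) * (pw a ((1 / real N) *\<^sub>R j) * comb N j \<theta>)"
      by (simp add: schwartz_functional_scale[OF schwartz_functional_comb[OF N] schwartz_mult_slow[OF \<theta> slow_pw]] comb_modulate[OF N \<theta> a])
    also have "\<dots> = \<zeta> * comb N j \<theta>"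
      using pw_add_right[of a "(1 / real N) *\<^sub>R j" "- \<kappa>"] by (simp add: \<zeta>_def \<kappa>_def scaleR_diff_right)
    finally show ?thesis by (simp add: \<theta>_def[abs_def])
  qed
  then have "phase_average N (\<lambda>\<psi>. comb N j (\<lambda>x. \<psi> (x - \<kappa>))) (\<lambda>x. gauss x * pw a x)
      = \<zeta> * fourier_weight N (comb N j) k"
    by (simp add: fourier_weight_def phase_average_def \<kappa>_def)
  moreover have "phase_average N (\<lambda>\<psi>. comb N j (\<lambda>x. \<psi> (x - \<kappa>))) (\<lambda>x. gauss x * pw a x)
      = fourier_weight N (comb N j) k"
    using translate_delta[OF N schwartz_functional_comb[OF N] lattice_invariant_comb[OF N j] k sch] by (simp add: \<kappa>_def)
  ultimately have "(\<zeta> - 1) * fourier_weight N (comb N j) k = 0" by (simp add: algebra_simps)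
  then show ?thesis using \<zeta> by simp
qed

lemma ZN_diff_not_lattice:
  assumes "N > 0" "j \<in> ZN N" "j' \<in> ZN N" "j \<noteq> j'"
  shows "(1 / real N) *\<^sub>R (j - j') \<notin> int_lattice"
proof
  assume l: "(1 / real N) *\<^sub>R (j - j') \<in> int_lattice"
  have "j = j' + real N *\<^sub>R ((1 / real N) *\<^sub>R (j - j'))" using assms(1) by simp
  then show False using ZN_eq_mod[OF assms(2,3) l] assms(4) by blast
qed

lemma fourier_weight_residue:
  assumes N: "N > 0" and inv: "lattice_invariant N f" and k: "k \<in> int_lattice"
  shows "fourier_weight N f k = fourier_weight N f (residue_point N k)"
  using residue_point_decomp[OF k, of N] fourier_weight_periodic[OF N inv] by metis

lemma fourier_weight_comb_on:
  assumes N: "N > 0" and j: "j \<in> ZN N"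
  shows "fourier_weight N (comb N j) j \<noteq> 0"
proof
  assume zero: "fourier_weight N (comb N j) j = 0"
  note jl = ZN_int_lattice[OF j]
  note inv = lattice_invariant_comb[OF N jl]
  have "fourier_weight N (comb N j) k = 0" if k: "k \<in> int_lattice" for k
  proof (cases "residue_point N k = j")
    case False
    then have "fourier_weight N (comb N j) (residue_point N k) = 0"
      using j residue_point_ZN[OF N, of k] ZN_diff_not_lattice[OF N, of j "residue_point N k"]
      by (intro fourier_weight_comb_off[OF N]) (auto intro: ZN_int_lattice)
    then show ?thesis using fourier_weight_residue[OF N inv k] by simp
  qed (use fourier_weight_residue[OF N inv k] zero in simp)
  then have "comb N j gauss = 0"
    by (intro functional_zero_by_coefficients[OF schwartz_functional_comb[OF N] schwartz_gauss, where N = N])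
      (simp add: fourier_coefficient[OF N schwartz_functional_comb[OF N] inv])
  then show False using comb_gauss_nonzero[OF N] by blast
qed

lemma schwartz_functional_plus:
  assumes S: "schwartz_functional S" and T: "schwartz_functional T"
  shows "schwartz_functional (\<lambda>\<phi>. S \<phi> + T \<phi>)"
  unfolding schwartz_functional_def
proof (intro conjI allI impI)
  fix \<phi> \<psi> :: "real^'a \<Rightarrow> complex" and c assume \<phi>: "schwartz \<phi>"
  show "S (\<lambda>x. c * \<phi> x) + T (\<lambda>x. c * \<phi> x) = c * (S \<phi> + T \<phi>)"
    by (simp add: schwartz_functional_scale[OF S \<phi>] schwartz_functional_scale[OF T \<phi>] distrib_left)
  assume \<psi>: "schwartz \<psi>"
  show "S (\<lambda>x. \<phi> x + \<psi> x) + T (\<lambda>x. \<phi> x + \<psi> x) = S \<phi> + T \<phi> + (S \<psi> + T \<psi>)"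
    by (simp add: schwartz_functional_add[OF S \<phi> \<psi>] schwartz_functional_add[OF T \<phi> \<psi>])
next
  obtain C m where C: "C \<ge> 0" "\<And>\<phi> B. schwartz \<phi> \<Longrightarrow>
      (\<And>is x. length is \<le> m \<Longrightarrow> (1 + norm x) ^ m * norm (iter_partial is \<phi> x) \<le> B) \<Longrightarrow> norm (S \<phi>) \<le> C * B"
    using schwartz_functional_bound[OF S] by blast
  obtain D l where D: "D \<ge> 0" "\<And>\<phi> B. schwartz \<phi> \<Longrightarrow>
      (\<And>is x. length is \<le> l \<Longrightarrow> (1 + norm x) ^ l * norm (iter_partial is \<phi> x) \<le> B) \<Longrightarrow> norm (T \<phi>) \<le> D * B"
    using schwartz_functional_bound[OF T] by blast
  have "norm (S \<phi> + T \<phi>) \<le> (C + D) * B"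
    if \<phi>: "schwartz \<phi>" and B: "\<forall>is x. length is \<le> max m l \<longrightarrow> (1 + norm x) ^ max m l * norm (iter_partial is \<phi> x) \<le> B" for \<phi> B
  proof -
    have le: "(1 + norm x) ^ k * norm (iter_partial is \<phi> x) \<le> B" if "length is \<le> k" "k \<le> max m l" for k "is" x
    proof -
      have "(1 + norm x) ^ k * norm (iter_partial is \<phi> x) \<le> (1 + norm x) ^ max m l * norm (iter_partial is \<phi> x)"
        using that by (intro mult_right_mono power_increasing) auto
      also have "\<dots> \<le> B" using B that by auto
      finally show ?thesis .
    qed
    have "norm (S \<phi>) \<le> C * B" by (rule C(2)[OF \<phi> le]) auto
    moreover have "norm (T \<phi>) \<le> D * B" by (rule D(2)[OF \<phi> le]) auto
    ultimately show ?thesis using norm_triangle_ineq[of "S \<phi>" "T \<phi>"] by (simp add: distrib_right)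
  qed
  then show "\<exists>C m. C \<ge> 0 \<and> (\<forall>\<phi> B. schwartz \<phi> \<longrightarrow>
      (\<forall>is x. length is \<le> m \<longrightarrow> (1 + norm x) ^ m * norm (iter_partial is \<phi> x) \<le> B) \<longrightarrow> norm (S \<phi> + T \<phi>) \<le> C * B)"
    using C(1) D(1) by (intro exI[of _ "C + D"] exI[of _ "max m l"]) auto
qed

lemma schwartz_functional_times:
  assumes T: "schwartz_functional T"
  shows "schwartz_functional (\<lambda>\<phi>. a * T \<phi>)"
  unfolding schwartz_functional_def
proof (intro conjI allI impI)
  fix \<phi> \<psi> :: "real^'a \<Rightarrow> complex" and c assume \<phi>: "schwartz \<phi>"
  show "a * T (\<lambda>x. c * \<phi> x) = c * (a * T \<phi>)"
    by (simp add: schwartz_functional_scale[OF T \<phi>])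
  assume \<psi>: "schwartz \<psi>"
  show "a * T (\<lambda>x. \<phi> x + \<psi> x) = a * T \<phi> + a * T \<psi>"
    by (simp add: schwartz_functional_add[OF T \<phi> \<psi>] distrib_left)
next
  obtain C m where C: "C \<ge> 0" "\<And>\<phi> B. schwartz \<phi> \<Longrightarrow>
      (\<forall>is x. length is \<le> m \<longrightarrow> (1 + norm x) ^ m * norm (iter_partial is \<phi> x) \<le> B) \<Longrightarrow> norm (T \<phi>) \<le> C * B"
    using schwartz_functional_bound[OF T] by blast
  then have "norm (a * T \<phi>) \<le> (norm a * C) * B" if "schwartz \<phi>"
      "\<forall>is x. length is \<le> m \<longrightarrow> (1 + norm x) ^ m * norm (iter_partial is \<phi> x) \<le> B" for \<phi> B
    using C(2)[OF that] by (simp add: norm_mult mult.assoc mult_left_mono)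
  then show "\<exists>C m. C \<ge> 0 \<and> (\<forall>\<phi> B. schwartz \<phi> \<longrightarrow>
      (\<forall>is x. length is \<le> m \<longrightarrow> (1 + norm x) ^ m * norm (iter_partial is \<phi> x) \<le> B) \<longrightarrow> norm (a * T \<phi>) \<le> C * B)"
    using C(1) by (intro exI[of _ "norm a * C"] exI[of _ m]) auto
qed

lemma schwartz_functional_lincomb:
  assumes "finite A" "\<And>j. j \<in> A \<Longrightarrow> schwartz_functional (T j)"
  shows "schwartz_functional (\<lambda>\<phi>. \<Sum>j\<in>A. a j * T j \<phi>)"
  using assms
proof (induction A rule: finite_induct)
  case empty
  have "0 \<le> (0::real)" by simp
  then show ?case by (auto simp: schwartz_functional_def intro!: exI[of _ 0])
next
  case (insert j A)
  then show ?case by (simp add: schwartz_functional_plus schwartz_functional_times)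
qed

text \<open>The Fourier coefficients in \<open>p\<close> of \<open>f (\<phi> e\<^bsup>2\<pi>iNpx\<^esup>)\<close> are the values \<open>\<phi> (k / N)\<close> times the weights of \<open>f\<close>, which
  are periodic in \<open>k\<close>. After subtraction of the combination of combs with the same weights, all
  coefficients vanish, so the difference is zero.\<close>

theorem H_space_spanned:
  fixes f :: "'n::finite dist"
  assumes N: "N > 0" and f: "f \<in> H_space N"
  shows "\<exists>\<beta>. f = (\<lambda>\<phi>. \<Sum>j\<in>ZN N. \<beta> j * comb N j \<phi>)"
proof -
  have t: "tempered f" and inv: "lattice_invariant N f" using f H_space_iff[OF N] by auto
  note T = tempered_schwartz_functional[OF t]
  define \<beta> where "\<beta> j = fourier_weight N f j / fourier_weight N (comb N j) j" for j
  define E where "E \<phi> = f \<phi> + (\<Sum>j\<in>ZN N. - \<beta> j * comb N j \<phi>)" for \<phi>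
  have E: "schwartz_functional E"
    unfolding E_def[abs_def]
    by (intro schwartz_functional_plus[OF T] schwartz_functional_lincomb finite_ZN schwartz_functional_comb N)
  have zero: "integral (cbox 0 1) (\<lambda>p. E (\<lambda>x. \<phi> x * pw (real N *\<^sub>R p) x) * pw (- k) p) = 0"
    if \<phi>: "schwartz \<phi>" and k: "k \<in> int_lattice" for \<phi> k
  proof -
    have pwc: "continuous_on S (pw k)" for k :: "real^'n" and S
      unfolding pw_def[abs_def] by (intro continuous_intros)
    have int: "(\<lambda>p. g (\<lambda>x. \<phi> x * pw (real N *\<^sub>R p) x) * pw (- k) p) integrable_on cbox 0 1"
      if "schwartz_functional g" for g
      by (intro integrable_continuous continuous_intros continuous_on_phase that \<phi> pwc)
    define j0 where "j0 = residue_point N k"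
    have j0: "j0 \<in> ZN N" by (simp add: j0_def residue_point_ZN N)
    have w: "fourier_weight N (comb N j) k = (if j = j0 then fourier_weight N (comb N j) j else 0)" if j: "j \<in> ZN N" for j
      using fourier_weight_residue[OF N lattice_invariant_comb[OF N ZN_int_lattice[OF j]] k]
        fourier_weight_comb_off[OF N ZN_int_lattice[OF j] ZN_int_lattice[OF j0]] ZN_diff_not_lattice[OF N j j0]
      by (auto simp: j0_def)
    have "integral (cbox 0 1) (\<lambda>p. E (\<lambda>x. \<phi> x * pw (real N *\<^sub>R p) x) * pw (- k) p)
      = integral (cbox 0 1) (\<lambda>p. f (\<lambda>x. \<phi> x * pw (real N *\<^sub>R p) x) * pw (- k) p
          + (\<Sum>j\<in>ZN N. - \<beta> j * (comb N j (\<lambda>x. \<phi> x * pw (real N *\<^sub>R p) x) * pw (- k) p)))"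
      by (intro integral_cong) (simp add: E_def distrib_left sum_distrib_left mult_ac)
    also have "\<dots> = \<phi> ((1 / real N) *\<^sub>R k) * fourier_weight N f k
        + (\<Sum>j\<in>ZN N. - \<beta> j * (\<phi> ((1 / real N) *\<^sub>R k) * fourier_weight N (comb N j) k))"
    proof -
      have "integral (cbox 0 1) (\<lambda>p. \<Sum>j\<in>ZN N. - \<beta> j * (comb N j (\<lambda>x. \<phi> x * pw (real N *\<^sub>R p) x) * pw (- k) p))
        = (\<Sum>j\<in>ZN N. integral (cbox 0 1) (\<lambda>p. - \<beta> j * (comb N j (\<lambda>x. \<phi> x * pw (real N *\<^sub>R p) x) * pw (- k) p)))"
        by (intro integral_sum finite_ZN integrable_on_mult_right int schwartz_functional_comb N)
      also have "\<dots> = (\<Sum>j\<in>ZN N. - \<beta> j * (\<phi> ((1 / real N) *\<^sub>R k) * fourier_weight N (comb N j) k))"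
      proof (rule sum.cong[OF refl])
        fix j :: "real^'n" assume j: "j \<in> ZN N"
        show "integral (cbox 0 1) (\<lambda>p. - \<beta> j * (comb N j (\<lambda>x. \<phi> x * pw (real N *\<^sub>R p) x) * pw (- k) p))
          = - \<beta> j * (\<phi> ((1 / real N) *\<^sub>R k) * fourier_weight N (comb N j) k)"
          using fourier_coefficient[OF N schwartz_functional_comb[OF N] lattice_invariant_comb[OF N ZN_int_lattice[OF j]] k \<phi>]
          by simp
      qed
      moreover have "(\<lambda>p. \<Sum>j\<in>ZN N. - \<beta> j * (comb N j (\<lambda>x. \<phi> x * pw (real N *\<^sub>R p) x) * pw (- k) p)) integrable_on cbox 0 1"
        by (intro integrable_sum finite_ZN integrable_on_mult_right int schwartz_functional_comb N)
      ultimately show ?thesis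
        using fourier_coefficient[OF N T inv k \<phi>] integral_add[OF int[OF T]] by simp
    qed
    also have "(\<Sum>j\<in>ZN N. - \<beta> j * (\<phi> ((1 / real N) *\<^sub>R k) * fourier_weight N (comb N j) k))
       = (\<Sum>j\<in>ZN N. if j = j0 then - \<beta> j * (\<phi> ((1 / real N) *\<^sub>R k) * fourier_weight N (comb N j) j) else 0)"
      by (intro sum.cong refl) (simp add: w)
    also have "\<dots> = - \<phi> ((1 / real N) *\<^sub>R k) * fourier_weight N f j0"
      using j0 fourier_weight_comb_on[OF N j0] by (simp add: finite_ZN \<beta>_def)
    also have "fourier_weight N f k = fourier_weight N f j0"
      using fourier_weight_residue[OF N inv k] by (simp add: j0_def)
    finally show ?thesis by simp
  qed
  have "f \<phi> = (\<Sum>j\<in>ZN N. \<beta> j * comb N j \<phi>)" for \<phi>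
  proof (cases "schwartz \<phi>")
    case True
    have "E \<phi> = 0" by (rule functional_zero_by_coefficients[OF E True zero])
    then show ?thesis by (simp add: E_def sum_negf add_eq_0_iff2)
  next
    case False
    then show ?thesis using t by (simp add: tempered_def comb_def)
  qed
  then show ?thesis by blast
qed

text \<open>Summing the modulations by representatives of all residues picks out a single residue, by
  orthogonality of characters.\<close>

lemma comb_dual:
  fixes j :: "real^'n::finite"
  assumes N: "N > 0" and j: "j \<in> ZN N"
  shows "\<exists>\<phi>. schwartz \<phi> \<and> (\<forall>j'\<in>ZN N. comb N j' \<phi> = (if j' = j then 1 else 0))"
proof -
  define g :: "real^'n \<Rightarrow> complex" where "g x = (\<Sum>r\<in>ZN N. gauss x * pw r x)" for x
  have sg: "schwartz (\<lambda>x. gauss x * pw r x)" for r :: "real^'n" by (intro schwartz_mult_slow schwartz_gauss slow_pw)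
  have g: "schwartz g" unfolding g_def[abs_def] by (intro schwartz_sum finite_ZN sg)
  have val: "comb N k g = (\<Sum>r\<in>ZN N. pw r ((1 / real N) *\<^sub>R k)) * comb N k gauss" for k
    unfolding g_def[abs_def]
    by (simp add: schwartz_functional_sum[OF schwartz_functional_comb[OF N] finite_ZN sg]
        comb_modulate[OF N schwartz_gauss ZN_int_lattice] sum_distrib_right)
  define c where "c = of_nat (N ^ CARD('n)) * comb N (0::real^'n) gauss"
  have c: "c \<noteq> 0" using comb_gauss_nonzero[OF N, of 0] N by (simp add: c_def)
  have "comb N j' (\<lambda>x. inverse c * g (x - (1 / real N) *\<^sub>R j)) = (if j' = j then 1 else 0)" if j': "j' \<in> ZN N" for j'
  proof -
    have "comb N j' (\<lambda>x. inverse c * g (x - (1 / real N) *\<^sub>R j)) = inverse c * comb N (j' - j) g"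
      by (simp add: schwartz_functional_scale[OF schwartz_functional_comb[OF N] schwartz_translate_minus[OF g]] comb_translate[OF N g])
    moreover have "comb N (j' - j) g = (if j' = j then c else 0)"
    proof (cases "j' = j")
      case True
      then show ?thesis by (simp add: val c_def card_ZN)
    next
      case False
      have "(\<Sum>r\<in>ZN N. pw r ((1 / real N) *\<^sub>R (j' - j))) = 0"
        using ZN_diff_not_lattice[OF N j' j False] j j' by (intro pw_sum_ZN N int_lattice_closed ZN_int_lattice)
      then show ?thesis using False by (simp add: val)
    qed
    ultimately show ?thesis using c by simp
  qed
  then show ?thesis
    by (intro exI[of _ "\<lambda>x. inverse c * g (x - (1 / real N) *\<^sub>R j)"]) (auto intro!: schwartz_scale schwartz_translate_minus g)
qed

section \<open>Coordinates\<close>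

lemma sum_fun_apply: "(\<Sum>i\<in>A. f i) x = (\<Sum>i\<in>A. f i x)"
  by (induction A rule: infinite_finite_induct) auto

definition comb_sum :: "nat \<Rightarrow> (real^'n::finite \<Rightarrow> complex) \<Rightarrow> 'n dist" where
  "comb_sum N \<beta> = (\<Sum>j\<in>ZN N. dist_scale (\<beta> j) (comb N j))"

lemma comb_sum_apply: "comb_sum N \<beta> \<phi> = (\<Sum>j\<in>ZN N. \<beta> j * comb N j \<phi>)"
  by (simp add: comb_sum_def sum_fun_apply dist_scale_def)

definition coord :: "nat \<Rightarrow> 'n::finite dist \<Rightarrow> real^'n \<Rightarrow> complex" where
  "coord N f j = module.representation dist_scale (comb N ` ZN N) f (comb N j)"

lemma inj_on_comb:
  assumes N: "N > 0"
  shows "inj_on (comb N) (ZN N)"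
proof (rule inj_onI)
  fix j j' :: "real^'a" assume *: "j \<in> ZN N" "j' \<in> ZN N" "comb N j = comb N j'"
  obtain \<phi> where \<phi>: "\<forall>k\<in>ZN N. comb N k \<phi> = (if k = j then 1 else 0)" using comb_dual[OF N *(1)] by blast
  show "j = j'" using * \<phi> by (metis zero_neq_one)
qed

lemma comb_independent:
  assumes N: "N > 0"
  shows "\<not> module.dependent dist_scale (comb N ` (ZN N :: (real^'n::finite) set))"
proof -
  interpret vs: vector_space "dist_scale :: complex \<Rightarrow> 'n dist \<Rightarrow> 'n dist" by (rule vector_space_dist_scale)
  define B where "B = comb N ` (ZN N :: (real^'n) set)"
  have main: "a f = 0" if zero: "(\<Sum>x\<in>B. dist_scale (a x) x) = 0" and f: "f \<in> B" for a f
  proof -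
    obtain j where j: "j \<in> ZN N" "f = comb N j" using f unfolding B_def by blast
    obtain \<phi> :: "real^'n \<Rightarrow> complex" where \<phi>: "\<forall>k\<in>ZN N. comb N k \<phi> = (if k = j then 1 else 0)"
      using comb_dual[OF N j(1)] by blast
    have "(\<Sum>x\<in>B. dist_scale (a x) x) \<phi> = (\<Sum>k\<in>ZN N. a (comb N k) * comb N k \<phi>)"
      by (simp add: B_def sum.reindex[OF inj_on_comb[OF N]] sum_fun_apply dist_scale_def)
    also have "\<dots> = (\<Sum>k\<in>ZN N. if k = j then a (comb N j) else 0)"
      using \<phi> by (intro sum.cong) auto
    also have "\<dots> = a f" using j by (simp add: finite_ZN)
    finally show "a f = 0" unfolding zero by simp
  qed
  have fin: "finite B" by (simp add: B_def finite_ZN)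
  have "vs.independent B"
  proof
    assume "vs.dependent B"
    then obtain u v where uv: "v \<in> B" "u v \<noteq> 0" "(\<Sum>v\<in>B. dist_scale (u v) v) = 0"
      unfolding vs.dependent_finite[OF fin] by blast
    show False using main[OF uv(3,1)] uv(2) by (rule notE[rotated])
  qed
  then show ?thesis by (simp add: B_def)
qed

lemma coord_comb_sum:
  fixes \<beta> :: "real^'n::finite \<Rightarrow> complex"
  assumes N: "N > 0" and j: "j \<in> ZN N"
  shows "coord N (comb_sum N \<beta>) j = \<beta> j"
proof -
  interpret vs: vector_space "dist_scale :: complex \<Rightarrow> 'n dist \<Rightarrow> 'n dist" by (rule vector_space_dist_scale)
  define B where "B = comb N ` (ZN N :: (real^'n) set)"
  define g where "g f = (if f \<in> B then \<beta> (the_inv_into (ZN N) (comb N) f) else 0)" for f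
  have fin: "finite B" by (simp add: B_def finite_ZN)
  have gc: "g (comb N k) = \<beta> k" if "k \<in> ZN N" for k
    using that by (simp add: g_def B_def the_inv_into_f_f[OF inj_on_comb[OF N]])
  have sum: "(\<Sum>b\<in>B. dist_scale (g b) b) = comb_sum N \<beta>"
    unfolding B_def comb_sum_def by (simp add: sum.reindex[OF inj_on_comb[OF N]] gc)
  have "vs.representation B (comb_sum N \<beta>) = g"
  proof (rule vs.representation_eqI)
    show "vs.independent B" unfolding B_def by (rule comb_independent[OF N])
    show "comb_sum N \<beta> \<in> vs.span B"
      unfolding sum[symmetric] by (intro vs.span_sum vs.span_scale vs.span_base)
    show "b \<in> B" if "g b \<noteq> 0" for b using that by (auto simp: g_def split: if_splits)
    show "finite {b. g b \<noteq> 0}" by (rule finite_subset[OF _ fin]) (auto simp: g_def split: if_splits)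
    have "(\<Sum>b\<in>{b. g b \<noteq> 0}. dist_scale (g b) b) = (\<Sum>b\<in>B. dist_scale (g b) b)"
      using fin by (intro sum.mono_neutral_left) (auto simp: g_def split: if_splits)
    then show "(\<Sum>b | g b \<noteq> 0. dist_scale (g b) b) = comb_sum N \<beta>" using sum by simp
  qed
  then show ?thesis using gc[OF j] by (simp add: coord_def B_def)
qed

lemma H_space_functional:
  assumes "N > 0" "f \<in> H_space N"
  shows "schwartz_functional f" "\<not> schwartz \<phi> \<Longrightarrow> f \<phi> = 0"
proof -
  have "tempered f" using assms by (simp add: H_space_iff)
  then show "schwartz_functional f" "\<not> schwartz \<phi> \<Longrightarrow> f \<phi> = 0"
    by (simp_all add: tempered_schwartz_functional) (simp add: tempered_def)
qed

lemma H_space_add: "N > 0 \<Longrightarrow> f \<in> H_space N \<Longrightarrow> g \<in> H_space N \<Longrightarrow> f + g \<in> H_space N"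
  and H_space_scale: "N > 0 \<Longrightarrow> h \<in> H_space N \<Longrightarrow> dist_scale c h \<in> H_space N"
  and H_space_zero: "N > 0 \<Longrightarrow> 0 \<in> H_space N"
proof -
  note sf = H_space_functional
  show "f + g \<in> H_space N" if "N > 0" "f \<in> H_space N" "g \<in> H_space N"
  proof -
    have "tempered (f + g)"
      using schwartz_functional_plus[OF sf(1)[OF that(1,2)] sf(1)[OF that(1,3)]] sf(2)[OF that(1,2)] sf(2)[OF that(1,3)]
      by (intro schwartz_functional_tempered) (auto simp: plus_fun_def)
    then show ?thesis using that by (auto simp: H_space_iff lattice_invariant_def)
  qed
  show sc: "dist_scale c f \<in> H_space N" if "N > 0" "f \<in> H_space N" for c f
  proof -
    have "tempered (dist_scale c f)"
      using schwartz_functional_times[OF sf(1)[OF that]] sf(2)[OF that]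
      by (intro schwartz_functional_tempered) (auto simp: dist_scale_def)
    then show ?thesis using that by (auto simp: H_space_iff lattice_invariant_def dist_scale_def)
  qed
  show "0 \<in> H_space N" if "N > 0"
    using sc[OF that comb_in_H_space[OF that int_lattice_closed(1)], of 0] by (simp add: dist_scale_def zero_fun_def)
qed

lemma comb_H: "N > 0 \<Longrightarrow> j \<in> ZN N \<Longrightarrow> comb N j \<in> H_space N"
  by (rule comb_in_H_space[OF _ ZN_int_lattice])

lemma H_space_sum: "N > 0 \<Longrightarrow> (\<And>i. i \<in> A \<Longrightarrow> f i \<in> H_space N) \<Longrightarrow> (\<Sum>i\<in>A. f i) \<in> H_space N"
  by (induction A rule: infinite_finite_induct) (auto intro: H_space_add H_space_zero)

lemma comb_sum_H: "N > 0 \<Longrightarrow> comb_sum N \<beta> \<in> H_space N"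
  unfolding comb_sum_def by (intro H_space_sum H_space_scale comb_H)

lemma comb_sum_coord:
  assumes N: "N > 0" and f: "f \<in> H_space N"
  shows "comb_sum N (coord N f) = f"
proof -
  obtain \<beta> where "f = (\<lambda>\<phi>. \<Sum>j\<in>ZN N. \<beta> j * comb N j \<phi>)" using H_space_spanned[OF N f] by blast
  then have f\<beta>: "f = comb_sum N \<beta>" by (simp add: fun_eq_iff comb_sum_apply)
  have "comb_sum N (coord N (comb_sum N \<beta>)) = comb_sum N \<beta>"
    by (rule ext) (simp add: comb_sum_apply coord_comb_sum[OF N])
  then show ?thesis by (simp add: f\<beta>)
qed

lemma coord_eqI:
  assumes "N > 0" "f \<in> H_space N" "g \<in> H_space N" "\<And>j. j \<in> ZN N \<Longrightarrow> coord N f j = coord N g j"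
  shows "f = g"
proof -
  have "comb_sum N (coord N f) = comb_sum N (coord N g)"
    unfolding comb_sum_def using assms(4) by (intro sum.cong) auto
  then show ?thesis using assms(1-3) by (simp add: comb_sum_coord)
qed

lemma coord_add:
  assumes N: "N > 0" and "f \<in> H_space N" "g \<in> H_space N" "j \<in> ZN N"
  shows "coord N (f + g) j = coord N f j + coord N g j"
proof -
  have "f + g = comb_sum N (coord N f) + comb_sum N (coord N g)" using assms by (simp add: comb_sum_coord)
  also have "\<dots> = comb_sum N (\<lambda>j. coord N f j + coord N g j)"
    by (simp add: fun_eq_iff comb_sum_apply distrib_right sum.distrib)
  finally show ?thesis using coord_comb_sum[OF N assms(4)] by simp
qed

lemma coord_scale:
  assumes N: "N > 0" and "f \<in> H_space N" "j \<in> ZN N"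
  shows "coord N (dist_scale c f) j = c * coord N f j"
proof -
  have "dist_scale c f = dist_scale c (comb_sum N (coord N f))" using assms by (simp add: comb_sum_coord)
  also have "\<dots> = comb_sum N (\<lambda>j. c * coord N f j)"
    by (simp add: fun_eq_iff comb_sum_apply dist_scale_def sum_distrib_left mult.assoc)
  finally show ?thesis using coord_comb_sum[OF N assms(3)] by simp
qed

lemma coord_zero: "N > 0 \<Longrightarrow> j \<in> ZN N \<Longrightarrow> coord N 0 j = 0"
proof -
  assume *: "N > 0" "j \<in> ZN N"
  have "comb_sum N (\<lambda>_. 0) = (0 :: 'a dist)" by (rule ext) (simp add: comb_sum_apply)
  then show "coord N 0 j = 0" using coord_comb_sum[OF *, of "\<lambda>_. 0"] by simp
qed

lemma coord_sum:
  assumes N: "N > 0" and j: "j \<in> ZN N"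
  shows "(\<And>i. i \<in> A \<Longrightarrow> f i \<in> H_space N) \<Longrightarrow> coord N (\<Sum>i\<in>A. f i) j = (\<Sum>i\<in>A. coord N (f i) j)"
  by (induction A rule: infinite_finite_induct) (auto simp: coord_zero[OF N j] coord_add[OF N _ _ j] H_space_sum[OF N])

lemma coord_comb:
  assumes "N > 0" "j \<in> ZN N" "k \<in> ZN N"
  shows "coord N (comb N k) j = (if j = k then 1 else 0)"
proof -
  have "comb_sum N (\<lambda>j. if j = k then 1 else 0) = comb N k"
    using assms(3) by (simp add: fun_eq_iff comb_sum_apply finite_ZN if_distrib[of "\<lambda>x. x * _"] cong: if_cong)
  then show ?thesis using coord_comb_sum[OF assms(1,2), of "\<lambda>j. if j = k then 1 else 0"] by simp
qed

lemma H_inner_coord: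
  assumes N: "N > 0"
  shows "H_inner N f g = (\<Sum>j\<in>ZN N. coord N f j * cnj (coord N g j))"
  unfolding H_inner_def coord_def by (simp add: sum.reindex[OF inj_on_comb[OF N]])

section \<open>Linear operators on the state space and their matrices\<close>

definition H_linear :: "nat \<Rightarrow> ('n::finite dist \<Rightarrow> 'n dist) \<Rightarrow> bool" where
  "H_linear N T \<longleftrightarrow> (\<forall>f\<in>H_space N. T f \<in> H_space N) \<and>
     (\<forall>f\<in>H_space N. \<forall>g\<in>H_space N. T (f + g) = T f + T g) \<and>
     (\<forall>c. \<forall>f\<in>H_space N. T (dist_scale c f) = dist_scale c (T f))"

definition op_matrix :: "nat \<Rightarrow> ('n::finite dist \<Rightarrow> 'n dist) \<Rightarrow> real^'n \<Rightarrow> real^'n \<Rightarrow> complex" where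
  "op_matrix N T j k = coord N (T (comb N k)) j"

lemma H_linear_H: "H_linear N T \<Longrightarrow> f \<in> H_space N \<Longrightarrow> T f \<in> H_space N"
  by (simp add: H_linear_def)

lemma H_linear_comp: "H_linear N S \<Longrightarrow> H_linear N T \<Longrightarrow> H_linear N (\<lambda>f. S (T f))"
  by (simp add: H_linear_def)

lemma H_linear_add: "H_linear N T \<Longrightarrow> f \<in> H_space N \<Longrightarrow> g \<in> H_space N \<Longrightarrow> T (f + g) = T f + T g"
  and H_linear_scale: "H_linear N T \<Longrightarrow> f \<in> H_space N \<Longrightarrow> T (dist_scale c f) = dist_scale c (T f)"
  unfolding H_linear_def by blast+

lemma dist_scale_0: "dist_scale 0 f = 0"
  by (rule ext) (simp add: dist_scale_def)

lemma H_linear_zero: "N > 0 \<Longrightarrow> H_linear N T \<Longrightarrow> T 0 = 0"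
  by (metis H_linear_scale H_space_zero dist_scale_0)

lemma H_linear_sum:
  assumes N: "N > 0" and T: "H_linear N T"
  shows "(\<And>i. i \<in> A \<Longrightarrow> f i \<in> H_space N) \<Longrightarrow> T (\<Sum>i\<in>A. f i) = (\<Sum>i\<in>A. T (f i))"
proof (induction A rule: infinite_finite_induct)
  case (insert i A)
  have "T (f i + (\<Sum>i\<in>A. f i)) = T (f i) + T (\<Sum>i\<in>A. f i)"
    by (intro H_linear_add[OF T] H_space_sum[OF N] insert.prems) auto
  moreover have "T (\<Sum>i\<in>A. f i) = (\<Sum>i\<in>A. T (f i))" by (intro insert.IH insert.prems) auto
  ultimately show ?case by (simp only: sum.insert[OF insert(1,2)])
qed (simp_all only: sum.infinite sum.empty H_linear_zero[OF N T] simp_thms)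

lemma coord_H_linear:
  assumes N: "N > 0" and T: "H_linear N T" and f: "f \<in> H_space N" and j: "j \<in> ZN N"
  shows "coord N (T f) j = (\<Sum>k\<in>ZN N. op_matrix N T j k * coord N f k)"
proof -
  have "T f = T (\<Sum>k\<in>ZN N. dist_scale (coord N f k) (comb N k))"
    using comb_sum_coord[OF N f] by (simp add: comb_sum_def)
  also have "\<dots> = (\<Sum>k\<in>ZN N. T (dist_scale (coord N f k) (comb N k)))"
    by (intro H_linear_sum[OF N T] H_space_scale[OF N] comb_H[OF N])
  also have "\<dots> = (\<Sum>k\<in>ZN N. dist_scale (coord N f k) (T (comb N k)))"
    by (intro sum.cong refl H_linear_scale[OF T] comb_H[OF N])
  finally have "coord N (T f) j = coord N (\<Sum>k\<in>ZN N. dist_scale (coord N f k) (T (comb N k))) j" by simp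
  also have "\<dots> = (\<Sum>k\<in>ZN N. coord N (dist_scale (coord N f k) (T (comb N k))) j)"
    by (intro coord_sum[OF N j] H_space_scale[OF N] H_linear_H[OF T] comb_H[OF N])
  also have "\<dots> = (\<Sum>k\<in>ZN N. op_matrix N T j k * coord N f k)"
    by (intro sum.cong refl) (simp add: coord_scale[OF N H_linear_H[OF T comb_H[OF N]] j] op_matrix_def)
  finally show ?thesis .
qed

lemma op_matrix_comp:
  assumes N: "N > 0" and S: "H_linear N S" and T: "H_linear N T" and "j \<in> ZN N" "k \<in> ZN N"
  shows "op_matrix N (\<lambda>f. S (T f)) j k = (\<Sum>l\<in>ZN N. op_matrix N S j l * op_matrix N T l k)"
  unfolding op_matrix_def[of N "\<lambda>f. S (T f)"]
  by (simp add: coord_H_linear[OF N S H_linear_H[OF T comb_H[OF N assms(5)]] assms(4)] op_matrix_def[of N T])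

definition op_trace :: "nat \<Rightarrow> ('n::finite dist \<Rightarrow> 'n dist) \<Rightarrow> complex" where
  "op_trace N T = (\<Sum>j\<in>ZN N. op_matrix N T j j)"

lemma op_trace_commute:
  assumes N: "N > 0" and S: "H_linear N S" and T: "H_linear N T"
  shows "op_trace N (\<lambda>f. S (T f)) = op_trace N (\<lambda>f. T (S f))"
proof -
  have "op_trace N (\<lambda>f. S (T f)) = (\<Sum>j\<in>ZN N. \<Sum>l\<in>ZN N. op_matrix N S j l * op_matrix N T l j)"
    unfolding op_trace_def by (intro sum.cong refl op_matrix_comp[OF N S T])
  also have "\<dots> = (\<Sum>l\<in>ZN N. \<Sum>j\<in>ZN N. op_matrix N T l j * op_matrix N S j l)"
    by (subst sum.swap) (simp add: mult.commute)
  also have "\<dots> = op_trace N (\<lambda>f. T (S f))"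
    unfolding op_trace_def by (intro sum.cong refl op_matrix_comp[OF N T S, symmetric])
  finally show ?thesis .
qed

lemma op_trace_cong:
  assumes "N > 0" "\<And>f. f \<in> H_space N \<Longrightarrow> S f = T f"
  shows "op_trace N S = op_trace N T"
  unfolding op_trace_def op_matrix_def by (intro sum.cong refl) (simp add: assms(2) comb_H[OF assms(1)])

section \<open>Translations in phase space\<close>

definition phase_shift :: "nat \<Rightarrow> real^('n::finite + 'n) \<Rightarrow> 'n dist \<Rightarrow> 'n dist" where
  "phase_shift N \<omega> = U_op (planck N) ((1 / real N) *\<^sub>R \<omega>)"

lemma pos_mom_linear:
  "pos (c *\<^sub>R \<omega>) = c *\<^sub>R pos \<omega>" "mom (c *\<^sub>R \<omega>) = c *\<^sub>R mom \<omega>"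
  "pos (\<omega> + \<omega>') = pos \<omega> + pos \<omega>'" "mom (\<omega> + \<omega>') = mom \<omega> + mom \<omega>'"
  "pos (- \<omega>) = - pos \<omega>" "mom (- \<omega>) = - mom \<omega>"
  for \<omega> \<omega>' :: "real^('n::finite + 'n)"
  by (simp_all add: pos_def mom_def Finite_Cartesian_Product.vec_eq_iff)

lemma phase_shift_comb:
  assumes N: "N > 0" and \<omega>: "\<omega> \<in> int_lattice"
  shows "phase_shift N \<omega> (comb N j) =
    dist_scale (cis (pi * (pos \<omega> \<bullet> mom \<omega>) / real N) * pw (pos \<omega>) ((1 / real N) *\<^sub>R (j - mom \<omega>))) (comb N (j - mom \<omega>))"
proof
  fix \<phi>
  show "phase_shift N \<omega> (comb N j) \<phi> =
    dist_scale (cis (pi * (pos \<omega> \<bullet> mom \<omega>) / real N) * pw (pos \<omega>) ((1 / real N) *\<^sub>R (j - mom \<omega>))) (comb N (j - mom \<omega>)) \<phi>"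
  proof (cases "schwartz \<phi>")
    case True
    have "real N *\<^sub>R ((1 / real N) *\<^sub>R pos \<omega>) = pos \<omega>" using N by simp
    moreover have "real N * pi * (((1 / real N) *\<^sub>R pos \<omega>) \<bullet> ((1 / real N) *\<^sub>R mom \<omega>)) = pi * (pos \<omega> \<bullet> mom \<omega>) / real N"
      using N by (simp add: field_simps)
    ultimately have "phase_shift N \<omega> (comb N j) \<phi> = cis (pi * (pos \<omega> \<bullet> mom \<omega>) / real N) *
      comb N j (\<lambda>x. \<phi> (x - (1 / real N) *\<^sub>R mom \<omega>) * pw (pos \<omega>) (x - (1 / real N) *\<^sub>R mom \<omega>))"
      unfolding phase_shift_def U_op_eq[OF schwartz_functional_comb[OF N] True N] by (simp only: pos_mom_linear)
    also have "comb N j (\<lambda>x. \<phi> (x - (1 / real N) *\<^sub>R mom \<omega>) * pw (pos \<omega>) (x - (1 / real N) *\<^sub>R mom \<omega>))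
      = comb N (j - mom \<omega>) (\<lambda>x. \<phi> x * pw (pos \<omega>) x)"
      using comb_translate[OF N schwartz_mult_slow[OF True slow_pw]] .
    also have "\<dots> = pw (pos \<omega>) ((1 / real N) *\<^sub>R (j - mom \<omega>)) * comb N (j - mom \<omega>) \<phi>"
      by (rule comb_modulate[OF N True int_lattice_pos_mom(1)[OF \<omega>]])
    finally show ?thesis by (simp add: dist_scale_def mult.assoc)
  next
    case False
    then show ?thesis by (simp add: phase_shift_def U_op_def dist_scale_def comb_def)
  qed
qed

lemma H_linear_phase_shift:
  assumes N: "N > 0" and \<omega>: "\<omega> \<in> int_lattice"
  shows "H_linear N (phase_shift N \<omega>)"
proof -
  have add: "phase_shift N \<omega> (f + g) = phase_shift N \<omega> f + phase_shift N \<omega> g" for f g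
    by (auto simp: phase_shift_def U_op_def fun_eq_iff)
  have scale: "phase_shift N \<omega> (dist_scale c f) = dist_scale c (phase_shift N \<omega> f)" for c f
    by (auto simp: phase_shift_def U_op_def dist_scale_def fun_eq_iff)
  have zero: "phase_shift N \<omega> 0 = 0" using scale[of 0 0] by (simp only: dist_scale_0)
  have sum: "phase_shift N \<omega> (\<Sum>i\<in>A. f i) = (\<Sum>i\<in>A. phase_shift N \<omega> (f i))" for A and f :: "real^'a \<Rightarrow> 'a dist"
    by (induction A rule: infinite_finite_induct) (simp_all only: sum.infinite sum.empty sum.insert zero add simp_thms)
  have "phase_shift N \<omega> f \<in> H_space N" if f: "f \<in> H_space N" for f
  proof -
    have "phase_shift N \<omega> (comb N j) \<in> H_space N" if "j \<in> ZN N" for j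
      unfolding phase_shift_comb[OF N \<omega>]
      by (intro H_space_scale[OF N] comb_in_H_space[OF N] int_lattice_closed ZN_int_lattice[OF that] int_lattice_pos_mom \<omega>)
    then have "phase_shift N \<omega> (comb_sum N (coord N f)) \<in> H_space N"
      unfolding comb_sum_def sum scale by (intro H_space_sum[OF N] H_space_scale[OF N])
    then show ?thesis by (simp add: comb_sum_coord[OF N f])
  qed
  then show ?thesis by (auto simp: H_linear_def add scale)
qed

section \<open>Quantization of exponentials\<close>

lemma integral_pw:
  fixes k :: "real^'m::finite"
  assumes k: "k \<in> int_lattice"
  shows "integral (cbox 0 1) (pw k) = (if k = 0 then 1 else 0)"
proof (cases "k = 0")
  case True
  then have "pw k = (\<lambda>_. 1)" by (simp add: fun_eq_iff)
  then show ?thesis using True by (simp add: content_unit_cube)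
next
  case False
  then obtain i where i: "k $ i \<noteq> 0" by (auto simp: Finite_Cartesian_Product.vec_eq_iff)
  have "1 \<le> \<bar>k $ i\<bar>" using i k Ints_nonzero_abs_ge1[of "k $ i"] by (auto simp: int_lattice_def)
  define s where "s = 1 / (2 * \<bar>k $ i\<bar>)"
  have s: "0 \<le> s" "s \<le> 1" using \<open>1 \<le> \<bar>k $ i\<bar>\<close> by (auto simp: s_def field_simps)
  have "cis (2 * pi * (k \<bullet> (s *\<^sub>R axis i 1))) = - 1"
  proof -
    have "2 * pi * (k \<bullet> (s *\<^sub>R axis i 1)) = pi * sgn (k $ i)"
      using i by (simp add: s_def inner_axis sgn_real_def)
    then have "cis (2 * pi * (k \<bullet> (s *\<^sub>R axis i 1))) = cis (pi * sgn (k $ i))" by (simp only:)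
    also have "\<dots> = - 1" using i by (auto simp: sgn_real_def complex_eq_iff)
    finally show ?thesis .
  qed
  then have half: "pw k (p + s *\<^sub>R axis i 1) = - pw k p" for p
    unfolding pw_add_right by (simp add: pw_def)
  have "integral (cbox 0 1) (\<lambda>p. pw k (p + s *\<^sub>R axis i 1)) = integral (cbox 0 1) (pw k)"
  proof (rule integral_unit_cube_shift)
    show "continuous_on UNIV (pw k)" unfolding pw_def[abs_def] by (intro continuous_intros)
    show "pw k (p + axis i 1) = pw k p" for p
      using pw_lattice[OF k axis_int_lattice] by (simp add: pw_add_right)
  qed (use s in auto)
  then have "- integral (cbox 0 1) (pw k) = integral (cbox 0 1) (pw k)"
    unfolding half by (simp add: integral_neg)
  then show ?thesis using False by simp
qed

lemma fourier_coeff_pw: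
  assumes "\<omega> \<in> int_lattice" "\<omega>' \<in> int_lattice"
  shows "fourier_coeff (pw \<omega>) \<omega>' = (if \<omega>' = \<omega> then 1 else 0)"
proof -
  have "cis (- 2 * pi * (\<omega>' \<bullet> z)) * pw \<omega> z = pw (\<omega> - \<omega>') z" for z
    by (simp add: pw_def cis_mult inner_diff_left algebra_simps)
  then show ?thesis
    using integral_pw[OF int_lattice_closed(3)[OF assms]] by (auto simp: fourier_coeff_def)
qed

lemma Op_pw:
  fixes \<omega> :: "real^('n::finite + 'n)"
  assumes \<omega>: "\<omega> \<in> int_lattice"
  shows "Op N (pw \<omega>) f = phase_shift N \<omega> f"
proof
  fix \<phi>
  have "Op N (pw \<omega>) f \<phi> = (\<Sum>\<^sub>\<infinity>\<omega>'\<in>int_lattice. fourier_coeff (pw \<omega>) \<omega>' * U_op (planck N) ((1 / real N) *\<^sub>R \<omega>') f \<phi>)"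
    by (simp add: Op_def)
  also have "\<dots> = (\<Sum>\<^sub>\<infinity>\<omega>'\<in>{\<omega>}. fourier_coeff (pw \<omega>) \<omega>' * U_op (planck N) ((1 / real N) *\<^sub>R \<omega>') f \<phi>)"
    using \<omega> by (intro infsum_cong_neutral) (auto simp: fourier_coeff_pw)
  also have "\<dots> = phase_shift N \<omega> f \<phi>"
    by (simp add: fourier_coeff_pw[OF \<omega> \<omega>] phase_shift_def)
  finally show "Op N (pw \<omega>) f \<phi> = phase_shift N \<omega> f \<phi>" .
qed

lemma smooth_torus_pw: "\<omega> \<in> int_lattice \<Longrightarrow> smooth_torus (pw \<omega>)"
  by (auto simp: smooth_torus_def smooth_pw pw_add_right pw_lattice)

definition dual_action :: "int^'m::finite^'m \<Rightarrow> real^'m \<Rightarrow> real^'m" where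
  "dual_action E \<omega> = transpose (real_matrix E) *v \<omega>"

lemma pw_matrix: "pw \<omega> \<circ> (*v) (real_matrix E) = pw (dual_action E \<omega>)"
  by (rule ext) (simp add: pw_def dual_action_def dot_lmul_matrix)

lemma dual_action_lattice: "\<omega> \<in> int_lattice \<Longrightarrow> dual_action E \<omega> \<in> int_lattice"
  by (auto simp: int_lattice_def dual_action_def matrix_vector_mult_def transpose_def real_matrix_def intro!: Ints_sum)

lemma H_unitary_H_linear: "H_unitary N M \<Longrightarrow> H_linear N M"
  by (auto simp: H_unitary_def H_linear_def bij_betw_def)

text \<open>The exact Egorov property for the exponential with frequency \<open>\<omega>\<close>, whose quantization is the translation by
  \<open>\<omega> / N\<close>.\<close>

lemma quantum_cat_map_intertwines:
  assumes N: "N > 0" and M: "quantum_cat_map N E M" and \<omega>: "\<omega> \<in> int_lattice" and f: "f \<in> H_space N"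
  shows "phase_shift N \<omega> (M f) = M (phase_shift N (dual_action E \<omega>) f)"
proof -
  have u: "H_unitary N M" using M by (simp add: quantum_cat_map_def)
  then have bij: "M ` H_space N = H_space N" by (auto simp: H_unitary_def bij_betw_def)
  have "inv_into (H_space N) M (Op N (pw \<omega>) (M f)) = Op N (pw \<omega> \<circ> (*v) (real_matrix E)) f"
    using M smooth_torus_pw[OF \<omega>] f by (simp add: quantum_cat_map_def)
  then have "inv_into (H_space N) M (phase_shift N \<omega> (M f)) = phase_shift N (dual_action E \<omega>) f"
    by (simp add: Op_pw[OF \<omega>] Op_pw[OF dual_action_lattice[OF \<omega>]] pw_matrix)
  moreover have "phase_shift N \<omega> (M f) \<in> M ` H_space N"
    unfolding bij by (intro H_linear_H[OF H_linear_phase_shift[OF N \<omega>]] H_linear_H[OF H_unitary_H_linear[OF u]] f)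
  ultimately show ?thesis by (metis f_inv_into_f)
qed

section \<open>Traces of operators that intertwine translations\<close>

text \<open>Pairing \<open>T\<close> with the sum of \<open>L\<close> orthogonal operators and applying Cauchy--Schwarz gains a factor
  \<open>sqrt L\<close> over the trivial bound \<open>card J\<close>.\<close>

lemma trace_bound_orthogonal:
  fixes T :: "'j \<Rightarrow> 'j \<Rightarrow> complex" and A :: "nat \<Rightarrow> 'j \<Rightarrow> 'j \<Rightarrow> complex"
  assumes J: "finite J" and T: "\<And>k. k \<in> J \<Longrightarrow> (\<Sum>j\<in>J. (norm (T j k))\<^sup>2) = 1"
    and orth: "\<And>s t. s < L \<Longrightarrow> t < L \<Longrightarrow>
      (\<Sum>j\<in>J. \<Sum>k\<in>J. A s k j * cnj (A t k j)) = (if s = t then of_nat (card J) else 0)"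
    and tr: "\<And>t. t < L \<Longrightarrow> (\<Sum>j\<in>J. \<Sum>k\<in>J. T j k * A t k j) = \<tau>"
  shows "real L * (norm \<tau>)\<^sup>2 \<le> (real (card J))\<^sup>2"
proof (cases "L = 0")
  case False
  define S where "S k j = (\<Sum>t<L. A t k j)" for k j
  define X where "X = J \<times> J"
  have "of_nat L * \<tau> = (\<Sum>t<L. \<Sum>j\<in>J. \<Sum>k\<in>J. T j k * A t k j)" using tr by simp
  also have "\<dots> = (\<Sum>j\<in>J. \<Sum>k\<in>J. T j k * S k j)"
    unfolding S_def sum_distrib_left by (subst sum.swap) (intro sum.cong refl sum.swap)
  also have "\<dots> = (\<Sum>(j, k)\<in>X. T j k * S k j)" unfolding X_def by (rule sum.cartesian_product)
  finally have "norm (of_nat L * \<tau>) \<le> (\<Sum>(j, k)\<in>X. norm (T j k) * norm (S k j))"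
    by (simp only:) (rule sum_norm_le, auto simp: norm_mult)
  then have "(real L * norm \<tau>)\<^sup>2 \<le> (\<Sum>x\<in>X. norm (T (fst x) (snd x)) * norm (S (snd x) (fst x)))\<^sup>2"
    by (intro power_mono) (auto simp: norm_mult case_prod_beta)
  also have "\<dots> \<le> (\<Sum>x\<in>X. (norm (T (fst x) (snd x)))\<^sup>2) * (\<Sum>x\<in>X. (norm (S (snd x) (fst x)))\<^sup>2)"
    by (rule Cauchy_Schwarz_ineq_sum)
  also have "(\<Sum>x\<in>X. (norm (T (fst x) (snd x)))\<^sup>2) = (\<Sum>j\<in>J. \<Sum>k\<in>J. (norm (T j k))\<^sup>2)"
    unfolding X_def by (subst sum.cartesian_product) (simp add: case_prod_beta)
  also have "\<dots> = real (card J)" by (subst sum.swap) (simp add: T)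
  also have "(\<Sum>x\<in>X. (norm (S (snd x) (fst x)))\<^sup>2) = real L * real (card J)"
  proof -
    have "complex_of_real (\<Sum>x\<in>X. (norm (S (snd x) (fst x)))\<^sup>2) = (\<Sum>j\<in>J. \<Sum>k\<in>J. S k j * cnj (S k j))"
      unfolding X_def of_real_sum complex_norm_square by (subst sum.cartesian_product) (simp add: case_prod_beta)
    also have "\<dots> = (\<Sum>j\<in>J. \<Sum>k\<in>J. \<Sum>s<L. \<Sum>t<L. A s k j * cnj (A t k j))"
      by (simp add: S_def sum_product)
    also have "\<dots> = (\<Sum>s<L. \<Sum>t<L. \<Sum>j\<in>J. \<Sum>k\<in>J. A s k j * cnj (A t k j))"
    proof -
      have "(\<Sum>j\<in>J. \<Sum>k\<in>J. \<Sum>s<L. \<Sum>t<L. A s k j * cnj (A t k j))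
        = (\<Sum>j\<in>J. \<Sum>s<L. \<Sum>t<L. \<Sum>k\<in>J. A s k j * cnj (A t k j))"
        by (intro sum.cong refl) (subst sum.swap, intro sum.cong refl sum.swap)
      also have "\<dots> = (\<Sum>s<L. \<Sum>t<L. \<Sum>j\<in>J. \<Sum>k\<in>J. A s k j * cnj (A t k j))"
        by (subst sum.swap) (intro sum.cong refl sum.swap)
      finally show ?thesis .
    qed
    also have "\<dots> = (\<Sum>s<L. \<Sum>t<L. if s = t then of_nat (card J) else 0)"
      by (intro sum.cong refl orth) auto
    also have "\<dots> = of_nat L * of_nat (card J)" by simp
    finally have "complex_of_real (\<Sum>x\<in>X. (norm (S (snd x) (fst x)))\<^sup>2) = complex_of_real (real L * real (card J))" by simp
    then show ?thesis by (simp only: of_real_eq_iff)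
  qed
  finally have "real L * (real L * (norm \<tau>)\<^sup>2) \<le> real L * (real (card J))\<^sup>2"
    by (simp add: power2_eq_square mult_ac)
  then show ?thesis using False by simp
qed simp

lemma comb_residue: "N > 0 \<Longrightarrow> x \<in> int_lattice \<Longrightarrow> comb N (residue_point N x) = comb N x"
  using residue_point_decomp[of x N] comb_periodic[of N] by metis


lemma dist_scale_dist_scale: "dist_scale a (dist_scale b f) = dist_scale (a * b) f"
  by (rule ext) (simp add: dist_scale_def)

lemma dist_scale_1: "dist_scale 1 f = f"
  by (rule ext) (simp add: dist_scale_def)

text \<open>Two translations compose to the translation by the sum, up to a phase that does not depend on the comb.\<close>

lemma phase_shift_phase_shift_comb:
  fixes \<omega> \<omega>' :: "real^('n::finite + 'n)"
  assumes N: "N > 0" and \<omega>: "\<omega> \<in> int_lattice" "\<omega>' \<in> int_lattice"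
  defines "c \<equiv> cis (pi * (pos \<omega>' \<bullet> mom \<omega>') / real N) * cis (pi * (pos \<omega> \<bullet> mom \<omega>) / real N)
    * pw (pos \<omega>') ((1 / real N) *\<^sub>R (- mom \<omega>')) * pw (pos \<omega>) ((1 / real N) *\<^sub>R (- mom \<omega>' - mom \<omega>))"
  assumes j: "j \<in> int_lattice"
  shows "phase_shift N \<omega> (phase_shift N \<omega>' (comb N j)) =
     dist_scale (c * pw (pos (\<omega> + \<omega>')) ((1 / real N) *\<^sub>R j)) (comb N (j - mom (\<omega> + \<omega>')))"
proof -
  have jl: "j - mom \<omega>' \<in> int_lattice" by (intro int_lattice_closed j int_lattice_pos_mom \<omega>)
  have s: "(1 / real N) *\<^sub>R (j - mom \<omega>') = (1 / real N) *\<^sub>R j + (1 / real N) *\<^sub>R (- mom \<omega>')"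
    "(1 / real N) *\<^sub>R (j - mom \<omega>' - mom \<omega>) = (1 / real N) *\<^sub>R j + (1 / real N) *\<^sub>R (- mom \<omega>' - mom \<omega>)"
    by (simp_all add: scaleR_diff_right)
  have m: "j - mom \<omega>' - mom \<omega> = j - mom (\<omega> + \<omega>')" by (simp add: pos_mom_linear)
  show ?thesis
    unfolding phase_shift_comb[OF N \<omega>(2)] H_linear_scale[OF H_linear_phase_shift[OF N \<omega>(1)] comb_in_H_space[OF N jl]]
      phase_shift_comb[OF N \<omega>(1)] dist_scale_dist_scale m[symmetric]
    by (rule arg_cong[where f = "\<lambda>a. dist_scale a (comb N (j - mom \<omega>' - mom \<omega>))"])
      (simp only: s pw_add_right pos_mom_linear(3) pw_add c_def mult_ac)
qed

lemma phase_shift_phase_shift_comb_ex: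
  fixes \<omega> \<omega>' :: "real^('n::finite + 'n)"
  assumes N: "N > 0" and \<omega>: "\<omega> \<in> int_lattice" "\<omega>' \<in> int_lattice"
  shows "\<exists>c. norm c = 1 \<and> (\<forall>j\<in>int_lattice. phase_shift N \<omega> (phase_shift N \<omega>' (comb N j)) =
     dist_scale (c * pw (pos (\<omega> + \<omega>')) ((1 / real N) *\<^sub>R j)) (comb N (j - mom (\<omega> + \<omega>'))))"
  using phase_shift_phase_shift_comb[OF N \<omega>]
  by (intro exI[of _ "cis (pi * (pos \<omega>' \<bullet> mom \<omega>') / real N) * cis (pi * (pos \<omega> \<bullet> mom \<omega>) / real N)
    * pw (pos \<omega>') ((1 / real N) *\<^sub>R (- mom \<omega>')) * pw (pos \<omega>) ((1 / real N) *\<^sub>R (- mom \<omega>' - mom \<omega>))"] conjI ballI)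
    (simp_all only: norm_mult norm_pw norm_cis mult_1)

lemma H_linear_eqI:
  fixes S T :: "'n::finite dist \<Rightarrow> 'n dist"
  assumes N: "N > 0" and S: "H_linear N S" and T: "H_linear N T"
    and eq: "\<And>j. j \<in> ZN N \<Longrightarrow> S (comb N j) = T (comb N j)" and f: "f \<in> H_space N"
  shows "S f = T f"
proof (rule coord_eqI[OF N H_linear_H[OF S f] H_linear_H[OF T f]])
  fix j :: "real^'n" assume "j \<in> ZN N"
  then show "coord N (S f) j = coord N (T f) j"
    by (simp add: coord_H_linear[OF N _ f] S T op_matrix_def eq)
qed

lemma H_linear_id: "H_linear N (\<lambda>f. f)"
  by (simp add: H_linear_def)

lemma phase_shift_inverse:
  fixes \<omega> :: "real^('n::finite + 'n)"
  assumes N: "N > 0" and \<omega>: "\<omega> \<in> int_lattice" and f: "f \<in> H_space N"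
  shows "phase_shift N (- \<omega>) (phase_shift N \<omega> f) = f"
proof (rule H_linear_eqI[OF N _ H_linear_id _ f])
  have m\<omega>: "- \<omega> \<in> int_lattice" using \<omega> by (intro int_lattice_closed)
  show "H_linear N (\<lambda>f. phase_shift N (- \<omega>) (phase_shift N \<omega> f))"
    by (rule H_linear_comp[OF H_linear_phase_shift[OF N m\<omega>] H_linear_phase_shift[OF N \<omega>]])
  fix j :: "real^'n" assume j: "j \<in> ZN N"
  have "cis (pi * (pos \<omega> \<bullet> mom \<omega>) / real N) * cis (pi * (pos (- \<omega>) \<bullet> mom (- \<omega>)) / real N)
    * pw (pos \<omega>) ((1 / real N) *\<^sub>R (- mom \<omega>)) * pw (pos (- \<omega>)) ((1 / real N) *\<^sub>R (- mom \<omega> - mom (- \<omega>))) = 1"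
    by (simp add: pos_mom_linear pw_def cis_mult)
  moreover have "pos (0 :: real^('n + 'n)) = 0" "mom (0 :: real^('n + 'n)) = 0"
    by (simp_all add: pos_def mom_def Finite_Cartesian_Product.vec_eq_iff)
  ultimately show "phase_shift N (- \<omega>) (phase_shift N \<omega> (comb N j)) = comb N j"
    using phase_shift_phase_shift_comb[OF N m\<omega> \<omega> ZN_int_lattice[OF j]]
    by (simp add: pos_mom_linear dist_scale_1)
qed

definition H_isometry :: "nat \<Rightarrow> ('n::finite dist \<Rightarrow> 'n dist) \<Rightarrow> bool" where
  "H_isometry N T \<longleftrightarrow> H_linear N T \<and> (\<forall>f\<in>H_space N. \<forall>g\<in>H_space N. H_inner N (T f) (T g) = H_inner N f g)"

lemma op_matrix_isometry:
  assumes N: "N > 0" and T: "H_isometry N T" and k: "k \<in> ZN N" "k' \<in> ZN N"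
  shows "(\<Sum>j\<in>ZN N. op_matrix N T j k * cnj (op_matrix N T j k')) = (if k = k' then 1 else 0)"
proof -
  have "(\<Sum>j\<in>ZN N. op_matrix N T j k * cnj (op_matrix N T j k')) = H_inner N (T (comb N k)) (T (comb N k'))"
    by (simp add: H_inner_coord[OF N] op_matrix_def)
  also have "\<dots> = H_inner N (comb N k) (comb N k')" using T by (simp add: H_isometry_def comb_H[OF N] k)
  also have "\<dots> = (\<Sum>j\<in>ZN N. if j = k then if k = k' then 1 else 0 else 0)"
    unfolding H_inner_coord[OF N] by (intro sum.cong refl) (simp add: coord_comb[OF N] k)
  also have "\<dots> = (if k = k' then 1 else 0)" using k by (simp add: finite_ZN)
  finally show ?thesis .
qed

lemma small_multiple_not_lattice:
  fixes v :: "real^'m::finite"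
  assumes v: "v \<in> int_lattice" "v \<noteq> 0" and r: "r \<noteq> (0::real)" and N: "\<bar>r\<bar> * norm v < real N"
  shows "(1 / real N) *\<^sub>R (r *\<^sub>R v) \<notin> int_lattice"
proof
  assume l: "(1 / real N) *\<^sub>R (r *\<^sub>R v) \<in> int_lattice"
  obtain i where i: "v $ i \<noteq> 0" using v(2) by (auto simp: Finite_Cartesian_Product.vec_eq_iff)
  define x where "x = r * v $ i / real N"
  have N0: "real N > 0" 
  proof -
    have "0 \<le> \<bar>r\<bar> * norm v" by simp
    then show ?thesis using N by linarith
  qed
  have "x \<in> \<int>" using l by (auto simp: int_lattice_def x_def)
  moreover have "x \<noteq> 0" using i r N0 by (simp add: x_def)
  ultimately have "1 \<le> \<bar>x\<bar>" by (rule Ints_nonzero_abs_ge1)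
  moreover have "\<bar>r\<bar> * \<bar>v $ i\<bar> \<le> \<bar>r\<bar> * norm v" by (intro mult_left_mono component_le_norm_cart) auto
  then have "\<bar>r\<bar> * \<bar>v $ i\<bar> / real N < 1" using N N0 by simp
  then have "\<bar>x\<bar> < 1" by (simp add: x_def abs_mult abs_divide)
  ultimately show False by simp
qed

lemma norm_pos_mom_le: "norm (pos \<omega>) \<le> norm \<omega>" "norm (mom \<omega>) \<le> norm \<omega>"
  for \<omega> :: "real^('n::finite + 'n)"
proof -
  have a: "(\<Sum>i\<in>UNIV. (\<omega> $ Inl i)\<^sup>2) + (\<Sum>i\<in>UNIV. (\<omega> $ Inr i)\<^sup>2) = (\<Sum>i\<in>UNIV. (\<omega> $ i)\<^sup>2)"
    unfolding UNIV_Plus_UNIV[symmetric] by (subst sum.Plus) auto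
  have "0 \<le> (\<Sum>i\<in>UNIV. (\<omega> $ Inl i)\<^sup>2)" "0 \<le> (\<Sum>i\<in>UNIV. (\<omega> $ Inr i)\<^sup>2)" by (auto intro: sum_nonneg)
  then show "norm (pos \<omega>) \<le> norm \<omega>" "norm (mom \<omega>) \<le> norm \<omega>"
    using a unfolding norm_vec_def L2_set_def by (simp_all add: pos_def mom_def)
qed

text \<open>The products \<open>A\<^sub>t\<close> of the translations by \<open>t E\<^sup>T a\<close> and \<open>- t a\<close> do not change the trace of \<open>T\<close>, by the
  intertwining relation and the cyclicity of the trace. Up to phases they are the translations by
  \<open>t (E\<^sup>T a - a)\<close>, which are orthogonal as long as these vectors are distinct modulo \<open>N\<close>.\<close>

lemma trace_bound_intertwiner:
  fixes T :: "'n::finite dist \<Rightarrow> 'n dist" and a :: "real^('n + 'n)"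
  assumes N: "N > 0" and T: "H_isometry N T"
    and egorov: "\<And>\<omega> f. \<omega> \<in> int_lattice \<Longrightarrow> f \<in> H_space N \<Longrightarrow>
      phase_shift N \<omega> (T f) = T (phase_shift N (dual_action E \<omega>) f)"
    and a: "a \<in> int_lattice" and w: "w = dual_action E a - a" "w \<noteq> 0"
    and L: "real L * norm w < real N"
  shows "real L * (norm (op_trace N T))\<^sup>2 \<le> (real (N ^ CARD('n)))\<^sup>2"
proof -
  have Tl: "H_linear N T" using T by (simp add: H_isometry_def)
  have al: "real t *\<^sub>R a \<in> int_lattice" "real t *\<^sub>R dual_action E a \<in> int_lattice" "- (real t *\<^sub>R a) \<in> int_lattice" for t
    using a by (auto intro!: int_lattice_closed dual_action_lattice)
  have wl: "w \<in> int_lattice" unfolding w(1) by (intro int_lattice_closed dual_action_lattice a)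
  define A where "A t = (\<lambda>f. phase_shift N (real t *\<^sub>R dual_action E a) (phase_shift N (- (real t *\<^sub>R a)) f))" for t :: nat
  have Al: "H_linear N (A t)" for t
    unfolding A_def by (rule H_linear_comp[OF H_linear_phase_shift[OF N al(2)] H_linear_phase_shift[OF N al(3)]])
  have wt: "real t *\<^sub>R dual_action E a + - (real t *\<^sub>R a) = real t *\<^sub>R w" for t
    by (simp add: w(1) scaleR_diff_right)
  have "\<exists>c. norm c = 1 \<and> (\<forall>j\<in>int_lattice. A t (comb N j) =
     dist_scale (c * pw (pos (real t *\<^sub>R w)) ((1 / real N) *\<^sub>R j)) (comb N (j - mom (real t *\<^sub>R w))))" for t
    using phase_shift_phase_shift_comb_ex[OF N al(2,3), of t t] unfolding wt A_def .
  then obtain c where c: "\<And>t. norm (c t) = 1" "\<And>t j. j \<in> int_lattice \<Longrightarrow> A t (comb N j) =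
     dist_scale (c t * pw (pos (real t *\<^sub>R w)) ((1 / real N) *\<^sub>R j)) (comb N (j - mom (real t *\<^sub>R w)))" by metis
  define \<rho> where "\<rho> t j = residue_point N (j - mom (real t *\<^sub>R w))" for t j
  define p where "p t j = c t * pw (pos (real t *\<^sub>R w)) ((1 / real N) *\<^sub>R j)" for t j
  have tw: "mom (real t *\<^sub>R w) \<in> int_lattice" for t by (intro int_lattice_pos_mom int_lattice_closed wl)
  have \<rho>Z: "\<rho> t j \<in> ZN N" for t j unfolding \<rho>_def by (rule residue_point_ZN[OF N])
  have Am: "op_matrix N (A t) k j = (if k = \<rho> t j then p t j else 0)" if "j \<in> ZN N" "k \<in> ZN N" for t j k
  proof -
    have jl: "j \<in> int_lattice" by (rule ZN_int_lattice[OF that(1)])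
    have "A t (comb N j) = dist_scale (p t j) (comb N (\<rho> t j))"
      unfolding c(2)[OF jl] p_def \<rho>_def using comb_residue[OF N int_lattice_closed(3)[OF jl tw]] by simp
    then show ?thesis
      unfolding op_matrix_def using that by (simp add: coord_scale[OF N comb_H[OF N \<rho>Z]] coord_comb[OF N _ \<rho>Z])
  qed
  have tr: "op_trace N (\<lambda>f. T (A t f)) = op_trace N T" for t
  proof -
    have "op_trace N (\<lambda>f. T (A t f)) = op_trace N (\<lambda>f. phase_shift N (real t *\<^sub>R a) (T (phase_shift N (- (real t *\<^sub>R a)) f)))"
    proof (rule op_trace_cong[OF N])
      fix f :: "'n dist" assume f: "f \<in> H_space N"
      have "real t *\<^sub>R dual_action E a = dual_action E (real t *\<^sub>R a)" by (simp add: dual_action_def matrix_vector_mult_scaleR)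
      then show "T (A t f) = phase_shift N (real t *\<^sub>R a) (T (phase_shift N (- (real t *\<^sub>R a)) f))"
        unfolding A_def using egorov[OF al(1) H_linear_H[OF H_linear_phase_shift[OF N al(3)] f]] by simp
    qed
    also have "\<dots> = op_trace N (\<lambda>f. T (phase_shift N (- (real t *\<^sub>R a)) (phase_shift N (real t *\<^sub>R a) f)))"
      by (rule op_trace_commute[OF N H_linear_phase_shift[OF N al(1)] H_linear_comp[OF Tl H_linear_phase_shift[OF N al(3)]]])
    also have "\<dots> = op_trace N T"
      by (rule op_trace_cong[OF N]) (simp add: phase_shift_inverse[OF N al(1)])
    finally show ?thesis .
  qed
  have "real L * (norm (op_trace N T))\<^sup>2 \<le> (real (card (ZN N :: (real^'n) set)))\<^sup>2"
  proof (rule trace_bound_orthogonal[where T = "op_matrix N T" and A = "\<lambda>t. op_matrix N (A t)"])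
    show "finite (ZN N :: (real^'n) set)" by (rule finite_ZN)
    show "(\<Sum>j\<in>ZN N. (norm (op_matrix N T j k))\<^sup>2) = 1" if k: "k \<in> ZN N" for k
    proof -
      have "complex_of_real (\<Sum>j\<in>ZN N. (norm (op_matrix N T j k))\<^sup>2) = complex_of_real 1"
        unfolding of_real_sum complex_norm_square using op_matrix_isometry[OF N T k k] by simp
      then show ?thesis by (simp only: of_real_eq_iff)
    qed
    show "(\<Sum>j\<in>ZN N. \<Sum>k\<in>ZN N. op_matrix N T j k * op_matrix N (A t) k j) = op_trace N T" for t
      unfolding tr[of t, symmetric] unfolding op_trace_def by (intro sum.cong refl op_matrix_comp[OF N Tl Al, symmetric])
    show "(\<Sum>j\<in>ZN N. \<Sum>k\<in>ZN N. op_matrix N (A s) k j * cnj (op_matrix N (A t) k j))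
      = (if s = t then of_nat (card (ZN N :: (real^'n) set)) else 0)" if st: "s < L" "t < L" for s t
    proof -
      have "(\<Sum>j\<in>ZN N. \<Sum>k\<in>ZN N. op_matrix N (A s) k j * cnj (op_matrix N (A t) k j))
        = (\<Sum>j\<in>ZN N. \<Sum>k\<in>ZN N. if k = \<rho> s j then if \<rho> s j = \<rho> t j then p s j * cnj (p t j) else 0 else 0)"
        by (intro sum.cong refl) (simp add: Am)
      also have "\<dots> = (\<Sum>j\<in>ZN N. if \<rho> s j = \<rho> t j then p s j * cnj (p t j) else 0)"
        by (intro sum.cong refl) (simp add: finite_ZN \<rho>Z)
      also have "\<dots> = (if s = t then of_nat (card (ZN N :: (real^'n) set)) else 0)"
      proof (cases "s = t")
        case True
        have "p t j * cnj (p t j) = 1" for j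
        proof -
          have "norm (p t j) = 1" by (simp add: p_def norm_mult norm_pw c(1))
          then show ?thesis using complex_norm_square[of "p t j"] by simp
        qed
        then show ?thesis using True by simp
      next
        case False
        define r where "r = real s - real t"
        have r: "r \<noteq> 0" "\<bar>r\<bar> * norm w < real N"
        proof -
          show "r \<noteq> 0" using False by (simp add: r_def)
          have "\<bar>r\<bar> * norm w \<le> real L * norm w" using st by (intro mult_right_mono) (auto simp: r_def)
          then show "\<bar>r\<bar> * norm w < real N" using L by simp
        qed
        have small: "\<bar>r\<bar> * norm (pos w) < real N" "\<bar>r\<bar> * norm (mom w) < real N"
          using mult_left_mono[OF norm_pos_mom_le(1)[of w], of "\<bar>r\<bar>"] mult_left_mono[OF norm_pos_mom_le(2)[of w], of "\<bar>r\<bar>"] r(2)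
          by auto
        have pl: "pos w \<in> int_lattice" "mom w \<in> int_lattice" by (intro int_lattice_pos_mom wl)+
        show ?thesis
        proof (cases "mom w = 0")
          case False
          have "\<rho> s j \<noteq> \<rho> t j" if j: "j \<in> ZN N" for j
          proof
            assume eq: "\<rho> s j = \<rho> t j"
            have jl: "j \<in> int_lattice" by (rule ZN_int_lattice[OF j])
            obtain l where l: "l \<in> int_lattice" "j - mom (real s *\<^sub>R w) = \<rho> s j + real N *\<^sub>R l"
              using residue_point_decomp[OF int_lattice_closed(3)[OF jl tw[of s]], of N] unfolding \<rho>_def by blast
            obtain l' where l': "l' \<in> int_lattice" "j - mom (real t *\<^sub>R w) = \<rho> t j + real N *\<^sub>R l'"
              using residue_point_decomp[OF int_lattice_closed(3)[OF jl tw[of t]], of N] unfolding \<rho>_def by blast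
            have "r *\<^sub>R mom w = mom (real s *\<^sub>R w) - mom (real t *\<^sub>R w)"
              by (simp add: r_def pos_mom_linear scaleR_diff_left)
            also have "\<dots> = (j - mom (real t *\<^sub>R w)) - (j - mom (real s *\<^sub>R w))" by simp
            also have "\<dots> = real N *\<^sub>R (l' - l)" unfolding l(2) l'(2) eq by (simp add: scaleR_diff_right)
            finally have "(1 / real N) *\<^sub>R (r *\<^sub>R mom w) = l' - l" using N by simp
            moreover have "l' - l \<in> int_lattice" by (intro int_lattice_closed l l')
            ultimately show False using small_multiple_not_lattice[OF pl(2) False r(1) small(2)] by simp
          qed
          then have "(\<Sum>j\<in>ZN N. if \<rho> s j = \<rho> t j then p s j * cnj (p t j) else 0) = 0"
            by (intro sum.neutral) auto
          then show ?thesis using \<open>s \<noteq> t\<close> by simp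
        next
          case True
          have pw0: "pos w \<noteq> 0"
          proof
            assume "pos w = 0"
            have "w $ s = 0" for s
            proof (cases s)
              case (Inl i)
              then show ?thesis using arg_cong[OF \<open>pos w = 0\<close>, of "\<lambda>v. v $ i"] by (simp add: pos_def)
            next
              case (Inr i)
              then show ?thesis using arg_cong[OF True, of "\<lambda>v. v $ i"] by (simp add: mom_def)
            qed
            then have "w = 0" by (simp add: Finite_Cartesian_Product.vec_eq_iff)
            then show False using w(2) by simp
          qed
          have \<rho>eq: "\<rho> s j = \<rho> t j" for j by (simp add: \<rho>_def pos_mom_linear True)
          have pp: "p s j * cnj (p t j) = (c s * cnj (c t)) * pw j ((1 / real N) *\<^sub>R (r *\<^sub>R pos w))" for j
          proof -
            have "pw (pos (real s *\<^sub>R w)) y * cnj (pw (pos (real t *\<^sub>R w)) y) = pw (r *\<^sub>R pos w) y" for y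
              unfolding pw_minus[symmetric] pw_add[symmetric] by (simp add: pos_mom_linear r_def scaleR_diff_left)
            moreover have "pw (r *\<^sub>R pos w) ((1 / real N) *\<^sub>R j) = pw j ((1 / real N) *\<^sub>R (r *\<^sub>R pos w))"
              by (simp add: pw_def inner_commute)
            ultimately show ?thesis by (simp add: p_def mult_ac)
          qed
          have rl: "r *\<^sub>R pos w \<in> int_lattice"
            using int_lattice_closed(3)[OF int_lattice_closed(5)[OF pl(1)] int_lattice_closed(5)[OF pl(1)], of s t]
            by (simp add: r_def scaleR_diff_left)
          have "(\<Sum>j\<in>ZN N. if \<rho> s j = \<rho> t j then p s j * cnj (p t j) else 0)
            = (c s * cnj (c t)) * (\<Sum>j\<in>ZN N. pw j ((1 / real N) *\<^sub>R (r *\<^sub>R pos w)))"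
            by (simp add: \<rho>eq pp sum_distrib_left)
          also have "\<dots> = 0"
            using pw_sum_ZN[OF N rl small_multiple_not_lattice[OF pl(1) pw0 r(1) small(1)]] by simp
          finally show ?thesis using False by simp
        qed
      qed
      finally show ?thesis .
    qed
  qed
  then show ?thesis by (simp add: card_ZN)
qed

lemma dual_action_nontrivial:
  assumes "E \<noteq> Finite_Cartesian_Product.mat 1"
  obtains i where "dual_action E (axis i 1) \<noteq> axis i 1"
proof -
  obtain i j where ij: "E $ i $ j \<noteq> Finite_Cartesian_Product.mat 1 $ i $ j" using assms by (auto simp: Finite_Cartesian_Product.vec_eq_iff)
  have "dual_action E (axis i 1) $ j = real_of_int (E $ i $ j)"
    by (simp add: dual_action_def matrix_vector_mult_basis column_def transpose_def real_matrix_def)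
  moreover have "(axis i 1 :: real^_) $ j = real_of_int (Finite_Cartesian_Product.mat 1 $ i $ j)" by (simp add: axis_def Finite_Cartesian_Product.mat_def)
  ultimately have "dual_action E (axis i 1) \<noteq> axis i 1" using ij by (metis of_int_eq_iff)
  then show ?thesis by (rule that)
qed

text \<open>The walk operators along a fixed walk with nontrivial holonomy have traces of size \<open>o(N\<^sup>n)\<close>.\<close>

lemma trace_small:
  fixes T :: "nat \<Rightarrow> 'n::finite dist \<Rightarrow> 'n dist" and E :: "int^('n + 'n)^('n + 'n)"
  assumes E: "E \<noteq> Finite_Cartesian_Product.mat 1"
    and T: "\<And>N. N > 0 \<Longrightarrow> even N \<Longrightarrow> H_isometry N (T N)"
    and egorov: "\<And>N \<omega> f. N > 0 \<Longrightarrow> even N \<Longrightarrow> \<omega> \<in> int_lattice \<Longrightarrow> f \<in> H_space N \<Longrightarrow>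
      phase_shift N \<omega> (T N f) = T N (phase_shift N (dual_action E \<omega>) f)"
  shows "((\<lambda>N. norm (op_trace N (T N)) / real (N ^ CARD('n))) \<longlongrightarrow> 0) (inf at_top (principal {N. even N}))"
proof -
  obtain i where i: "dual_action E (axis i 1) \<noteq> axis i 1" using dual_action_nontrivial[OF E] .
  define w where "w = dual_action E (axis i 1) - axis i 1"
  have w: "w \<noteq> 0" using i by (simp add: w_def)
  show ?thesis
    unfolding tendsto_iff
  proof (intro allI impI)
    fix \<epsilon> :: real assume \<epsilon>: "\<epsilon> > 0"
    obtain L :: nat where L: "1 / \<epsilon>\<^sup>2 < real L" using reals_Archimedean2 by blast
    have L0: "real L > 0" 
    proof -
      have "0 < 1 / \<epsilon>\<^sup>2" using \<epsilon> by simp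
      then show ?thesis using L by linarith
    qed
    obtain N0 :: nat where N0: "real L * norm w < real N0" using reals_Archimedean2 by blast
    have "\<forall>\<^sub>F N in at_top. even N \<longrightarrow> dist (norm (op_trace N (T N)) / real (N ^ CARD('n))) 0 < \<epsilon>"
      using eventually_ge_at_top[of "max 1 N0"]
    proof eventually_elim
      case (elim N)
      show ?case
      proof
        assume ev: "even N"
        have N: "N > 0" using elim by simp
        define \<tau> where "\<tau> = norm (op_trace N (T N))"
        define D where "D = real (N ^ CARD('n))"
        have D: "D > 0" using N by (simp add: D_def)
        have "real L * \<tau>\<^sup>2 \<le> D\<^sup>2"
          unfolding \<tau>_def D_def
          by (rule trace_bound_intertwiner[OF N T[OF N ev] egorov[OF N ev] axis_int_lattice w_def w]) (use N0 elim in auto)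
        then have "\<tau>\<^sup>2 \<le> D\<^sup>2 * (1 / real L)" using L0 by (simp add: field_simps)
        also have "\<dots> < D\<^sup>2 * \<epsilon>\<^sup>2"
          using L L0 \<epsilon> D by (intro mult_strict_left_mono) (auto simp: field_simps)
        finally have "\<tau>\<^sup>2 < (D * \<epsilon>)\<^sup>2" by (simp add: power_mult_distrib)
        then have "\<tau> < D * \<epsilon>" by (rule power_less_imp_less_base) (use D \<epsilon> in auto)
        then have "\<tau> / D < \<epsilon>" using D by (simp add: divide_less_eq mult.commute)
        moreover have "0 \<le> \<tau> / D" using D by (simp add: \<tau>_def)
        ultimately show "dist (norm (op_trace N (T N)) / real (N ^ CARD('n))) 0 < \<epsilon>"
          by (simp add: \<tau>_def D_def)
      qed
    qed
    then show "\<forall>\<^sub>F N in inf at_top (principal {N. even N}). dist (norm (op_trace N (T N)) / real (N ^ CARD('n))) 0 < \<epsilon>"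
      by (simp add: eventually_inf_principal)
  qed
qed

section \<open>Operators along walks\<close>

lemma real_matrix_mult: "real_matrix (A ** B) = real_matrix A ** real_matrix B"
  by (simp add: real_matrix_def matrix_matrix_mult_def Finite_Cartesian_Product.vec_eq_iff)

lemma dual_action_mult: "dual_action (A ** B) \<omega> = dual_action B (dual_action A \<omega>)"
  by (simp only: dual_action_def real_matrix_mult matrix_transpose_mul matrix_vector_mul_assoc)

lemma dual_action_one: "dual_action (Finite_Cartesian_Product.mat 1) \<omega> = \<omega>" for \<omega> :: "real^'m::finite"
proof -
  have "real_matrix (Finite_Cartesian_Product.mat 1 :: int^'m^'m) = Finite_Cartesian_Product.mat 1" by (simp add: real_matrix_def Finite_Cartesian_Product.mat_def Finite_Cartesian_Product.vec_eq_iff)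
  then show ?thesis by (simp only: dual_action_def Finite_Cartesian_Product.transpose_mat matrix_vector_mul_lid)
qed

lemma H_isometry_id: "H_isometry N (\<lambda>f. f)"
  by (simp add: H_isometry_def H_linear_id)

lemma H_isometry_comp: "H_isometry N S \<Longrightarrow> H_isometry N T \<Longrightarrow> H_isometry N (\<lambda>f. S (T f))"
  by (auto simp: H_isometry_def H_linear_comp H_linear_H)

lemma quantum_cat_map_isometry: "quantum_cat_map N E M \<Longrightarrow> H_isometry N M"
  by (auto simp: quantum_cat_map_def H_isometry_def H_unitary_H_linear) (auto simp: H_unitary_def)

lemma H_isometry_walk:
  assumes "\<And>e. e \<in> set p \<Longrightarrow> H_isometry N (M e)"
  shows "H_isometry N (foldr M p)"
  using assms
proof (induction p)
  case (Cons e p)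
  have eq: "foldr M (e # p) = (\<lambda>f. M e (foldr M p f))" by (simp add: fun_eq_iff)
  have "H_isometry N (M e)" "H_isometry N (foldr M p)" by (simp_all add: Cons)
  then show ?case unfolding eq by (rule H_isometry_comp)
qed (simp add: id_def H_isometry_id)

lemma walk_intertwines:
  assumes N: "N > 0" and M: "\<And>e. e \<in> set p \<Longrightarrow> quantum_cat_map N (chi e) (M e)"
    and "\<omega> \<in> int_lattice" and f: "f \<in> H_space N"
  shows "phase_shift N \<omega> (foldr M p f) = foldr M p (phase_shift N (dual_action (holonomy chi p) \<omega>) f)"
  using M \<open>\<omega> \<in> int_lattice\<close>
proof (induction p arbitrary: \<omega>)
  case Nil
  then show ?case by (simp add: holonomy_def dual_action_one)
next
  case (Cons e p)
  have "H_isometry N (foldr M p)" using Cons.prems(1) by (intro H_isometry_walk quantum_cat_map_isometry) auto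
  then have "H_linear N (foldr M p)" unfolding H_isometry_def by (rule conjunct1)
  then have g: "foldr M p f \<in> H_space N" by (rule H_linear_H[OF _ f])
  have "phase_shift N \<omega> (foldr M (e # p) f) = M e (phase_shift N (dual_action (chi e) \<omega>) (foldr M p f))"
    using quantum_cat_map_intertwines[OF N _ Cons.prems(2) g, of "chi e" "M e"] Cons.prems(1) by simp
  also have "phase_shift N (dual_action (chi e) \<omega>) (foldr M p f)
     = foldr M p (phase_shift N (dual_action (holonomy chi p) (dual_action (chi e) \<omega>)) f)"
    using Cons.prems by (intro Cons.IH dual_action_lattice) auto
  also have "dual_action (holonomy chi p) (dual_action (chi e) \<omega>) = dual_action (holonomy chi (e # p)) \<omega>"
    by (simp add: holonomy_def dual_action_mult)
  finally show ?case by simp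
qed

section \<open>Diagonalization of Hermitian matrices\<close>

lemma jordan_matrix_entries:
  assumes "i < sum_list (map fst n_as)" "j < sum_list (map fst n_as)" "jordan_matrix n_as $$ (i, j) \<noteq> 0"
  shows "i = j \<or> (Suc i = j \<and> jordan_matrix n_as $$ (i, j) = (1::complex) \<and>
    jordan_matrix n_as $$ (i, i) = jordan_matrix n_as $$ (j, j))"
  using assms
proof (induction n_as arbitrary: i j)
  case (Cons na n_as)
  obtain n a where na: "na = (n, a)" by (cases na)
  define s where "s = sum_list (map fst n_as)"
  have idx: "jordan_matrix (na # n_as) $$ (k, l) =
      (if k < n then if l < n then jordan_block n a $$ (k, l) else 0
       else if l < n then 0 else jordan_matrix n_as $$ (k - n, l - n))" if "k < n + s" "l < n + s" for k l
    using that unfolding na jordan_matrix_Cons s_def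
    by (subst index_mat_four_block) auto
  have ij: "i < n + s" "j < n + s" using Cons.prems by (auto simp: na s_def)
  show ?case
  proof (cases "i < n")
    case True
    then have "j < n" using Cons.prems(3) idx[OF ij] by (auto split: if_splits)
    then show ?thesis using True Cons.prems(3) idx ij by (auto split: if_splits)
  next
    case False
    then have j: "\<not> j < n" using Cons.prems(3) idx[OF ij] by (auto split: if_splits)
    have "jordan_matrix n_as $$ (i - n, j - n) \<noteq> 0" using False j Cons.prems(3) idx[OF ij] by simp
    moreover have "i - n < s" "j - n < s" using ij False j by auto
    ultimately have "i - n = j - n \<or> (Suc (i - n) = j - n \<and> jordan_matrix n_as $$ (i - n, j - n) = 1 \<and>
        jordan_matrix n_as $$ (i - n, i - n) = jordan_matrix n_as $$ (j - n, j - n))"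
      using Cons.IH unfolding s_def by blast
    then show ?thesis using False j idx ij by auto
  qed
qed simp

text \<open>A Jordan block of size at least two would give a vector \<open>v\<close> with
  \<open>(A - x)\<^sup>2 v = 0 \<noteq> (A - x) v\<close>, which is impossible for a Hermitian \<open>A\<close>.\<close>

lemma hermitian_jordan_diagonal:
  fixes a p b q :: "nat \<Rightarrow> nat \<Rightarrow> complex"
  assumes herm: "\<And>r s. r < n \<Longrightarrow> s < n \<Longrightarrow> a r s = cnj (a s r)"
    and ap: "\<And>r j. r < n \<Longrightarrow> j < n \<Longrightarrow> (\<Sum>s<n. a r s * p s j) = (\<Sum>i<n. p r i * b i j)"
    and qp: "\<And>i j. i < n \<Longrightarrow> j < n \<Longrightarrow> (\<Sum>r<n. q i r * p r j) = (if i = j then 1 else 0)"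
    and b: "\<And>i j. i < n \<Longrightarrow> j < n \<Longrightarrow> b i j \<noteq> 0 \<Longrightarrow> i = j \<or> (Suc i = j \<and> b i j = 1 \<and> b i i = b j j)"
  shows "(\<forall>i<n. \<forall>j<n. i \<noteq> j \<longrightarrow> b i j = 0) \<and> (\<forall>i<n. b i i \<in> \<real>)"
proof -
  define ip where "ip u v = (\<Sum>r<n. u r * cnj (v r))" for u v :: "nat \<Rightarrow> complex"
  define A where "A u r = (\<Sum>s<n. a r s * u s)" for u :: "nat \<Rightarrow> complex" and r
  have sym: "ip (A u) v = ip u (A v)" for u v
  proof -
    have "ip (A u) v = (\<Sum>r<n. \<Sum>s<n. a r s * u s * cnj (v r))"
      by (simp add: ip_def A_def sum_distrib_right)
    also have "\<dots> = (\<Sum>s<n. \<Sum>r<n. a r s * u s * cnj (v r))" by (rule sum.swap)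
    also have "\<dots> = (\<Sum>s<n. \<Sum>r<n. u s * cnj (a s r * v r))"
    proof (intro sum.cong refl)
      fix s r assume "s \<in> {..<n}" "r \<in> {..<n}"
      then have e: "a r s = cnj (a s r)" by (intro herm) auto
      show "a r s * u s * cnj (v r) = u s * cnj (a s r * v r)" unfolding e by simp
    qed
    also have "\<dots> = ip u (A v)" by (simp add: ip_def A_def sum_distrib_left)
    finally show ?thesis .
  qed
  have pos: "ip (\<lambda>r. p r i) (\<lambda>r. p r i) \<noteq> 0" if i: "i < n" for i
  proof
    assume "ip (\<lambda>r. p r i) (\<lambda>r. p r i) = 0"
    then have "of_real (\<Sum>r<n. (norm (p r i))\<^sup>2) = (0::complex)"
      unfolding ip_def of_real_sum complex_norm_square by simp
    then have "(\<Sum>r<n. (norm (p r i))\<^sup>2) = 0" by (simp only: of_real_eq_0_iff)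
    then have "\<And>r. r < n \<Longrightarrow> p r i = 0" by (subst (asm) sum_nonneg_eq_0_iff) auto
    then have "(\<Sum>r<n. q i r * p r i) = 0" by simp
    then show False using qp[OF i i] by simp
  qed
  have real: "x \<in> \<real>" if i: "i < n" and eig: "\<And>r. r < n \<Longrightarrow> A (\<lambda>r. p r i) r = x * p r i" for i x
  proof -
    have "ip (A (\<lambda>r. p r i)) (\<lambda>r. p r i) = x * ip (\<lambda>r. p r i) (\<lambda>r. p r i)"
      using eig by (simp add: ip_def sum_distrib_left mult.assoc)
    moreover have "ip (\<lambda>r. p r i) (A (\<lambda>r. p r i)) = cnj x * ip (\<lambda>r. p r i) (\<lambda>r. p r i)"
      using eig by (simp add: ip_def sum_distrib_left mult_ac)
    ultimately have "x = cnj x" using sym pos[OF i] by simp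
    then show ?thesis by (simp add: Reals_cnj_iff eq_commute)
  qed
  have no_super: "b i (Suc i) = 0" if "Suc i < n" for i
    using that
  proof (induction i rule: less_induct)
    case (less i)
    show ?case
    proof (rule ccontr)
      assume ne: "b i (Suc i) \<noteq> 0"
      define x where "x = b i i"
      have i: "i < n" using less.prems by simp
      have sup: "b i (Suc i) = 1" "b (Suc i) (Suc i) = x" using b[OF i less.prems ne] by (auto simp: x_def)
      have bi: "b k i = (if k = i then x else 0)" if "k < n" for k
      proof (cases "k = i \<or> b k i = 0")
        case False
        then have "Suc k = i" using b[OF that i] by auto
        then show ?thesis using less.IH[of k] i False by auto
      qed (auto simp: x_def)
      have bs: "b k (Suc i) = (if k = i then 1 else if k = Suc i then x else 0)" if "k < n" for k
        using b[OF that less.prems] sup by auto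
      have Ai: "A (\<lambda>r. p r i) r = x * p r i" if "r < n" for r
      proof -
        have "A (\<lambda>r. p r i) r = (\<Sum>k<n. p r k * b k i)" unfolding A_def by (rule ap[OF that i])
        also have "\<dots> = (\<Sum>k<n. if k = i then p r k * x else 0)" by (intro sum.cong) (auto simp: bi)
        finally show ?thesis using i by simp
      qed
      have As: "A (\<lambda>r. p r (Suc i)) r = p r i + x * p r (Suc i)" if "r < n" for r
      proof -
        have "A (\<lambda>r. p r (Suc i)) r = (\<Sum>k<n. p r k * b k (Suc i))" unfolding A_def by (rule ap[OF that less.prems])
        also have "\<dots> = (\<Sum>k<n. (if k = i then p r k else 0) + (if k = Suc i then p r k * x else 0))"
          by (intro sum.cong) (auto simp: bs)
        finally show ?thesis using i less.prems by (simp add: sum.distrib)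
      qed
      have x: "cnj x = x" using real[OF i Ai] by (simp add: Reals_cnj_iff)
      have "ip (A (\<lambda>r. p r (Suc i))) (\<lambda>r. p r i) = ip (\<lambda>r. p r i) (\<lambda>r. p r i) + x * ip (\<lambda>r. p r (Suc i)) (\<lambda>r. p r i)"
        using As by (simp add: ip_def distrib_right sum.distrib sum_distrib_left mult.assoc)
      moreover have "ip (\<lambda>r. p r (Suc i)) (A (\<lambda>r. p r i)) = x * ip (\<lambda>r. p r (Suc i)) (\<lambda>r. p r i)"
        using Ai x by (simp add: ip_def sum_distrib_left mult_ac)
      ultimately show False using sym pos[OF i] by simp
    qed
  qed
  have diag: "b i j = 0" if "i < n" "j < n" "i \<noteq> j" for i j
    using b[OF that(1,2)] that no_super by metis
  moreover have "b i i \<in> \<real>" if i: "i < n" for i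
  proof (rule real[OF i])
    fix r assume r: "r < n"
    have "A (\<lambda>r. p r i) r = (\<Sum>k<n. p r k * b k i)" unfolding A_def by (rule ap[OF r i])
    also have "\<dots> = (\<Sum>k<n. if k = i then p r k * b i i else 0)" using diag i by (intro sum.cong) auto
    finally show "A (\<lambda>r. p r i) r = b i i * p r i" using i by simp
  qed
  ultimately show ?thesis by blast
qed

lemma mat_mult_entry:
  fixes X Y :: "complex mat"
  assumes "X \<in> carrier_mat n n" "Y \<in> carrier_mat n n" "i < n" "j < n"
  shows "(X * Y) $$ (i, j) = (\<Sum>k<n. X $$ (i, k) * Y $$ (k, j))"
  using assms by (simp add: scalar_prod_def atLeast0LessThan)

theorem hermitian_diagonalization:
  fixes a :: "'j \<Rightarrow> 'j \<Rightarrow> complex"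
  assumes J: "finite J" and herm: "\<And>j k. j \<in> J \<Longrightarrow> k \<in> J \<Longrightarrow> a j k = cnj (a k j)"
  shows "\<exists>(l :: nat \<Rightarrow> real) p q.
    (\<forall>j\<in>J. \<forall>k\<in>J. (\<Sum>i<card J. p j i * q i k) = (if j = k then 1 else 0)) \<and>
    (\<forall>i<card J. \<forall>i'<card J. (\<Sum>j\<in>J. q i j * p j i') = (if i = i' then 1 else 0)) \<and>
    (\<forall>j\<in>J. \<forall>k\<in>J. a j k = (\<Sum>i<card J. p j i * of_real (l i) * q i k))"
proof -
  define n where "n = card J"
  obtain f where f: "bij_betw f {..<n} J"
    using ex_bij_betw_nat_finite[OF J] by (auto simp: n_def atLeast0LessThan)
  define g where "g = the_inv_into {..<n} f"
  have fg: "f (g j) = j" "g j < n" if "j \<in> J" for j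
    using that f f_the_inv_into_f_bij_betw[OF f] bij_betw_apply[OF bij_betw_the_inv_into[OF f]] by (auto simp: g_def)
  have gf: "g (f i) = i" "f i \<in> J" if "i < n" for i
    using that f by (auto simp: g_def bij_betw_def the_inv_into_f_f)
  define A where "A = mat n n (\<lambda>(i, j). a (f i) (f j))"
  have A: "A \<in> carrier_mat n n" by (simp add: A_def)
  obtain as where as: "char_poly A = (\<Prod>a\<leftarrow>as. [:- a, 1:])" using char_poly_factorized[OF A] by blast
  obtain n_as where "jordan_nf A n_as" using jordan_nf_exists[OF A as] by blast
  then obtain P Q where "similar_mat_wit A (jordan_matrix n_as) P Q"
    by (auto simp: jordan_nf_def similar_mat_def)
  from similar_mat_witD2[OF A this] have PQ: "P * Q = 1\<^sub>m n" "Q * P = 1\<^sub>m n" "A = P * jordan_matrix n_as * Q"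
    and c: "jordan_matrix n_as \<in> carrier_mat n n" "P \<in> carrier_mat n n" "Q \<in> carrier_mat n n" by auto
  define B where "B = jordan_matrix n_as"
  have nsum: "sum_list (map fst n_as) = n" using c(1) by auto
  have AP: "A * P = P * B"
  proof -
    have "A * P = P * B * (Q * P)" unfolding PQ(3) B_def using c by (simp add: assoc_mult_mat[of _ n n _ n _ n])
    then show ?thesis
      unfolding PQ(2) B_def using right_mult_one_mat[OF mult_carrier_mat[OF c(2) c(1)]] by simp
  qed
  have Bc: "B \<in> carrier_mat n n" using c by (simp add: B_def)
  have ap: "(\<Sum>s<n. a (f r) (f s) * P $$ (s, j)) = (\<Sum>i<n. P $$ (r, i) * B $$ (i, j))" if "r < n" "j < n" for r j
  proof -
    have "(\<Sum>s<n. A $$ (r, s) * P $$ (s, j)) = (\<Sum>i<n. P $$ (r, i) * B $$ (i, j))"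
      using arg_cong[OF AP, of "\<lambda>M. M $$ (r, j)"] mat_mult_entry[OF A c(2) that] mat_mult_entry[OF c(2) Bc that] by simp
    then show ?thesis using that by (simp add: A_def)
  qed
  have qp: "(\<Sum>r<n. Q $$ (i, r) * P $$ (r, j)) = (if i = j then 1 else 0)" if "i < n" "j < n" for i j
    using arg_cong[OF PQ(2), of "\<lambda>M. M $$ (i, j)"] mat_mult_entry[OF c(3,2) that] that by simp
  have pq: "(\<Sum>r<n. P $$ (i, r) * Q $$ (r, j)) = (if i = j then 1 else 0)" if "i < n" "j < n" for i j
    using arg_cong[OF PQ(1), of "\<lambda>M. M $$ (i, j)"] mat_mult_entry[OF c(2,3) that] that by simp
  have b: "i = j \<or> (Suc i = j \<and> B $$ (i, j) = 1 \<and> B $$ (i, i) = B $$ (j, j))" if "i < n" "j < n" "B $$ (i, j) \<noteq> 0" for i j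
    using jordan_matrix_entries[of i n_as j] that by (simp add: nsum B_def)
  have hr: "a (f r) (f s) = cnj (a (f s) (f r))" if "r < n" "s < n" for r s
    using herm gf that by blast
  have "(\<forall>i<n. \<forall>j<n. i \<noteq> j \<longrightarrow> B $$ (i, j) = 0) \<and> (\<forall>i<n. B $$ (i, i) \<in> \<real>)"
    by (rule hermitian_jordan_diagonal[where a = "\<lambda>r s. a (f r) (f s)" and p = "\<lambda>s j. P $$ (s, j)"
        and q = "\<lambda>i r. Q $$ (i, r)" and b = "\<lambda>i j. B $$ (i, j)"])
      (rule hr ap qp b; assumption)+
  then have diag: "\<And>i j. i < n \<Longrightarrow> j < n \<Longrightarrow> i \<noteq> j \<Longrightarrow> B $$ (i, j) = 0" "\<And>i. i < n \<Longrightarrow> B $$ (i, i) \<in> \<real>"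
    by blast+
  define l where "l i = Re (B $$ (i, i))" for i
  have l: "of_real (l i) = B $$ (i, i)" if "i < n" for i
    using diag(2)[OF that] by (simp add: l_def)
  have dec: "a j k = (\<Sum>i<n. P $$ (g j, i) * of_real (l i) * Q $$ (i, g k))" if j: "j \<in> J" and k: "k \<in> J" for j k
  proof -
    have "a j k = A $$ (g j, g k)" using fg[OF j] fg[OF k] by (simp add: A_def)
    also have "\<dots> = (P * B * Q) $$ (g j, g k)" using PQ(3) by (simp add: B_def)
    also have "\<dots> = (\<Sum>i<n. (P * B) $$ (g j, i) * Q $$ (i, g k))"
      using fg[OF j] fg[OF k] c Bc by (intro mat_mult_entry) auto
    also have "\<dots> = (\<Sum>i<n. P $$ (g j, i) * of_real (l i) * Q $$ (i, g k))"
    proof (rule sum.cong[OF refl])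
      fix i assume "i \<in> {..<n}"
      then have i: "i < n" by simp
      have "(P * B) $$ (g j, i) = (\<Sum>s<n. P $$ (g j, s) * B $$ (s, i))"
        using fg[OF j] i by (intro mat_mult_entry c Bc)
      also have "\<dots> = (\<Sum>s<n. if s = i then P $$ (g j, s) * B $$ (i, i) else 0)"
        using diag(1) i by (intro sum.cong) auto
      also have "\<dots> = P $$ (g j, i) * of_real (l i)" using i l[OF i] by simp
      finally show "(P * B) $$ (g j, i) * Q $$ (i, g k) = P $$ (g j, i) * of_real (l i) * Q $$ (i, g k)" by simp
    qed
    finally show ?thesis .
  qed
  have pq': "(\<Sum>i<n. P $$ (g j, i) * Q $$ (i, g k)) = (if j = k then 1 else 0)" if "j \<in> J" "k \<in> J" for j k
  proof -
    have "g j = g k \<longleftrightarrow> j = k" using fg(1)[OF that(1)] fg(1)[OF that(2)] by metis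
    then show ?thesis using pq[OF fg(2)[OF that(1)] fg(2)[OF that(2)]] by simp
  qed
  have qp': "(\<Sum>j\<in>J. Q $$ (i, g j) * P $$ (g j, i')) = (if i = i' then 1 else 0)" if "i < n" "i' < n" for i i'
  proof -
    have "(\<Sum>j\<in>J. Q $$ (i, g j) * P $$ (g j, i')) = (\<Sum>r<n. Q $$ (i, g (f r)) * P $$ (g (f r), i'))"
      by (rule sum.reindex_bij_betw[OF f, symmetric])
    also have "\<dots> = (\<Sum>r<n. Q $$ (i, r) * P $$ (r, i'))" by (intro sum.cong) (auto simp: gf)
    finally show ?thesis using qp[OF that] by simp
  qed
  show ?thesis
    unfolding n_def[symmetric]
  proof (intro exI[of _ l] exI[of _ "\<lambda>j i. P $$ (g j, i)"] exI[of _ "\<lambda>i k. Q $$ (i, g k)"] conjI ballI allI impI)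
    show "(\<Sum>i<n. P $$ (g j, i) * Q $$ (i, g k)) = (if j = k then 1 else 0)" if "j \<in> J" "k \<in> J" for j k
      by (rule pq'[OF that])
    show "(\<Sum>j\<in>J. Q $$ (i, g j) * P $$ (g j, i')) = (if i = i' then 1 else 0)" if "i < n" "i' < n" for i i'
      by (rule qp'[OF that])
    show "a j k = (\<Sum>i<n. P $$ (g j, i) * of_real (l i) * Q $$ (i, g k))" if "j \<in> J" "k \<in> J" for j k
      by (rule dec[OF that])
  qed
qed

section \<open>Nonbacktracking polynomials and the Kesten--McKay distribution\<close>

text \<open>The polynomials in the adjacency operator of a \<open>d\<close>-regular graph that count walks without backtracking.
  The first step of the recursion differs from the others since all \<open>d\<close> edges at
  a vertex backtrack to the empty walk.\<close>

fun nonbacktracking_poly :: "nat \<Rightarrow> nat \<Rightarrow> real \<Rightarrow> real" where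
  "nonbacktracking_poly d 0 x = 1"
| "nonbacktracking_poly d (Suc 0) x = x"
| "nonbacktracking_poly d (Suc (Suc l)) x =
     x * nonbacktracking_poly d (Suc l) x - (if l = 0 then real d else real d - 1) * nonbacktracking_poly d l x"

lemma sin_step: "sin (a + t) + sin (a - t) = 2 * cos t * sin (a::real)"
  by (simp add: sin_add sin_diff)

text \<open>With \<open>x = 2 s cos t\<close> the recursion becomes the addition formula for the sine. The shape of the
  right-hand side is that of a difference of Chebyshev polynomials of the second kind.\<close>

lemma nonbacktracking_poly_trig:
  assumes q: "q = real d - 1" "q > 0" and s: "s\<^sup>2 = q"
  shows "sin t * nonbacktracking_poly d (Suc l) (2 * s * cos t)
    = s ^ Suc l * (sin ((real l + 2) * t) - sin (real l * t) / q)"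
proof (induction l rule: less_induct)
  case (less l)
  consider "l = 0" | "l = 1" | m where "l = Suc (Suc m)" by (metis One_nat_def not0_implies_Suc)
  then show ?case
  proof cases
    case 1
    then show ?thesis by (simp add: sin_double)
  next
    case 2
    have "sin (3 * t) = sin (2 * t + t)" by (simp add: algebra_simps)
    also have "\<dots> = 2 * cos t * sin (2 * t) - sin (2 * t - t)" using sin_step[of "2 * t" t] by simp
    also have "\<dots> = sin t * (4 * (cos t)\<^sup>2 - 1)"
      unfolding sin_double by (simp add: power2_eq_square algebra_simps)
    finally have s3: "sin (3 * t) = sin t * (4 * (cos t)\<^sup>2 - 1)" .
    have "nonbacktracking_poly d (Suc (Suc 0)) (2 * s * cos t) = 4 * s\<^sup>2 * (cos t)\<^sup>2 - (q + 1)"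
      using q(1) by (simp add: power2_eq_square)
    moreover have "s\<^sup>2 * (sin (3 * t) - sin t / q) = sin t * (4 * s\<^sup>2 * (cos t)\<^sup>2 - (q + 1))"
      unfolding s3 s using q(2) by (simp add: field_simps)
    ultimately show ?thesis using 2 by (simp add: power2_eq_square[symmetric])
  next
    case 3
    define S where "S k = sin ((real k + 2) * t) - sin (real k * t) / q" for k
    have rec: "S (Suc (Suc m)) = 2 * cos t * S (Suc m) - S m"
    proof -
      have a: "sin ((real m + 4) * t) = 2 * cos t * sin ((real m + 3) * t) - sin ((real m + 2) * t)"
        using sin_step[of "(real m + 3) * t" t] by (simp add: algebra_simps)
      have b: "sin ((real m + 2) * t) = 2 * cos t * sin ((real m + 1) * t) - sin (real m * t)"
        using sin_step[of "(real m + 1) * t" t] by (simp add: algebra_simps)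
      have "S (Suc (Suc m)) = sin ((real m + 4) * t) - sin ((real m + 2) * t) / q" by (simp add: S_def add.commute)
      also have "\<dots> = 2 * cos t * sin ((real m + 3) * t) - sin ((real m + 2) * t)
          - (2 * cos t * sin ((real m + 1) * t) - sin (real m * t)) / q"
        using a b by (simp only:)
      also have "\<dots> = 2 * cos t * S (Suc m) - S m"
        by (simp add: S_def add.commute diff_divide_distrib algebra_simps)
      finally show ?thesis .
    qed
    have qd: "real d = q + 1" using q(1) by simp
    have IH1: "sin t * nonbacktracking_poly d (Suc (Suc m)) (2 * s * cos t) = s ^ Suc (Suc m) * S (Suc m)"
      using less.IH[of "Suc m"] 3 by (simp only: S_def; simp?)
    have IH2: "sin t * nonbacktracking_poly d (Suc m) (2 * s * cos t) = s ^ Suc m * S m"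
      using less.IH[of m] 3 by (simp only: S_def; simp?)
    have "sin t * nonbacktracking_poly d (Suc (Suc (Suc m))) (2 * s * cos t)
      = 2 * s * cos t * (sin t * nonbacktracking_poly d (Suc (Suc m)) (2 * s * cos t))
        - q * (sin t * nonbacktracking_poly d (Suc m) (2 * s * cos t))"
      by (simp add: qd algebra_simps)
    also have "\<dots> = 2 * s * cos t * (s ^ Suc (Suc m) * S (Suc m)) - s\<^sup>2 * (s ^ Suc m * S m)"
      unfolding IH1 IH2 s ..
    also have "\<dots> = s ^ Suc (Suc (Suc m)) * (2 * cos t * S (Suc m) - S m)"
      by (simp add: power2_eq_square algebra_simps)
    finally show ?thesis unfolding rec[symmetric] using 3 by (simp only: S_def)
  qed
qed

lemma integral_sin_sin:
  "integral {0..pi} (\<lambda>t. sin t * sin (real m * t)) = (if m = 1 then pi / 2 else 0)"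
proof -
  have ftc: "integral {0..pi} f = F pi - F 0" if "\<And>t. (F has_real_derivative f t) (at t)" for f F :: "real \<Rightarrow> real"
    using that by (intro integral_unique fundamental_theorem_of_calculus)
      (auto simp: has_real_derivative_iff_has_vector_derivative[symmetric] intro: has_field_derivative_at_within)
  consider "m = 0" | "m = 1" | "m \<ge> 2" by linarith
  then show ?thesis
  proof cases
    case 2
    have "integral {0..pi} (\<lambda>t. sin t * sin t) = (pi / 2 - sin (2 * pi) / 4) - (0 / 2 - sin (2 * 0) / 4)"
    proof (rule ftc)
      show "((\<lambda>t. t / 2 - sin (2 * t) / 4) has_real_derivative sin t * sin t) (at t)" for t
      proof -
        have "((\<lambda>t. t / 2 - sin (2 * t) / 4) has_real_derivative 1 / 2 - cos (2 * t) * 2 / 4) (at t)"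
          by (auto intro!: derivative_eq_intros)
        moreover have "1 / 2 - cos (2 * t) * 2 / 4 = sin t * sin t"
          unfolding cos_double_sin by (simp add: power2_eq_square field_simps)
        ultimately show ?thesis by (simp only:)
      qed
    qed
    then show ?thesis using 2 by simp
  next
    case 3
    define F where "F t = sin ((real m - 1) * t) / (2 * (real m - 1)) - sin ((real m + 1) * t) / (2 * (real m + 1))" for t
    have m: "real m - 1 \<noteq> 0" "real m + 1 \<noteq> 0" using 3 by auto
    have "integral {0..pi} (\<lambda>t. sin t * sin (real m * t)) = F pi - F 0"
    proof (rule ftc)
      fix t
      have "cos ((real m - 1) * t) - cos ((real m + 1) * t) = 2 * (sin t * sin (real m * t))"
        by (simp add: left_diff_distrib distrib_right cos_diff cos_add)
      moreover have "(x * (real m - 1)) / (2 * (real m - 1)) - (y * (real m + 1)) / (2 * (real m + 1)) = (x - y) / 2" for x y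
        using nonzero_mult_divide_mult_cancel_right[OF m(1), of x 2] nonzero_mult_divide_mult_cancel_right[OF m(2), of y 2]
        by (simp only: diff_divide_distrib)
      ultimately have "(cos ((real m - 1) * t) * (real m - 1)) / (2 * (real m - 1)) - (cos ((real m + 1) * t) * (real m + 1)) / (2 * (real m + 1))
          = sin t * sin (real m * t)"
        by (simp only:; simp?)
      moreover have "(F has_real_derivative (cos ((real m - 1) * t) * (real m - 1)) / (2 * (real m - 1)) - (cos ((real m + 1) * t) * (real m + 1)) / (2 * (real m + 1))) (at t)"
        unfolding F_def by (intro DERIV_diff DERIV_cdivide) (auto intro!: derivative_eq_intros)
      ultimately show "(F has_real_derivative sin t * sin (real m * t)) (at t)" by simp
    qed
    also have "F pi = 0"
    proof -
      have "sin ((real m - 1) * pi) = 0" using sin_npi[of "m - 1"] 3 by (simp add: of_nat_diff)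
      moreover have "sin ((real m + 1) * pi) = 0" using sin_npi[of "m + 1"] by (simp add: add.commute)
      ultimately show ?thesis by (simp add: F_def)
    qed
    finally show ?thesis using 3 by (simp add: F_def)
  qed simp
qed

definition km_denom :: "real \<Rightarrow> real \<Rightarrow> real" where
  "km_denom q t = 1 + q\<^sup>2 - 2 * q * cos (2 * t)"

lemma km_denom_lower:
  assumes "q > 0"
  shows "(q - 1)\<^sup>2 \<le> km_denom q t"
proof -
  have "2 * q * cos (2 * t) \<le> 2 * q * 1" using assms by (intro mult_left_mono) auto
  then show ?thesis by (simp add: km_denom_def power2_eq_square algebra_simps)
qed

definition km_integral :: "real \<Rightarrow> nat \<Rightarrow> real" where
  "km_integral q m = integral {0..pi} (\<lambda>t. sin t * sin (real m * t) / km_denom q t)"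

context
  fixes q :: real
  assumes q: "q > 1"
begin

lemma km_denom_pos: "km_denom q t > 0"
  using km_denom_lower[of q t] q by (auto intro: less_le_trans[rotated])

lemma km_integrable:
  assumes "continuous_on {0..pi} f"
  shows "(\<lambda>t. f t / km_denom q t) integrable_on {0..pi}"
proof (rule integrable_continuous_real)
  have "continuous_on {0..pi} (km_denom q)" unfolding km_denom_def by (intro continuous_intros)
  then show "continuous_on {0..pi} (\<lambda>t. f t / km_denom q t)"
    using km_denom_pos by (intro continuous_on_divide assms) (auto simp: less_imp_neq[symmetric])
qed

lemma km_ss: "(\<lambda>t. sin t * sin (a * t) / km_denom q t) integrable_on {0..pi}"
  by (intro km_integrable continuous_intros)

lemma km_has_integral: "((\<lambda>t. sin t * sin (real m * t) / km_denom q t) has_integral km_integral q m) {0..pi}"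
  unfolding km_integral_def by (rule integrable_integral[OF km_ss])

text \<open>The factor \<open>1 + q\<^sup>2 - 2 q cos (2 t)\<close> acts on \<open>sin (m t)\<close> by shifts of \<open>m\<close> by two and cancels the denominator, which leaves an
  elementary integral.\<close>

lemma km_integral_rec:
  "(1 + q\<^sup>2) * km_integral q (m + 2) = q * (km_integral q (m + 4) + km_integral q m)"
proof -
  have "(1 + q\<^sup>2) * km_integral q (m + 2) - q * (km_integral q (m + 4) + km_integral q m)
    = integral {0..pi} (\<lambda>t. (1 + q\<^sup>2) * (sin t * sin (real (m + 2) * t) / km_denom q t)
        - q * (sin t * sin (real (m + 4) * t) / km_denom q t + sin t * sin (real m * t) / km_denom q t))"
    by (rule integral_unique[symmetric]) (intro has_integral_diff has_integral_add has_integral_mult_right km_has_integral)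
  also have "\<dots> = integral {0..pi} (\<lambda>t. sin t * sin (real (m + 2) * t))"
  proof (rule integral_cong)
    fix t
    have "sin (real (m + 4) * t) + sin (real m * t) = 2 * cos (2 * t) * sin (real (m + 2) * t)"
      using sin_step[of "real (m + 2) * t" "2 * t"] by (simp add: algebra_simps)
    then have "(1 + q\<^sup>2) * (sin t * sin (real (m + 2) * t)) - q * (sin t * sin (real (m + 4) * t) + sin t * sin (real m * t))
      = sin t * sin (real (m + 2) * t) * km_denom q t"
      unfolding km_denom_def distrib_left[of "sin t", symmetric] by (simp add: algebra_simps)
    then show "(1 + q\<^sup>2) * (sin t * sin (real (m + 2) * t) / km_denom q t)
        - q * (sin t * sin (real (m + 4) * t) / km_denom q t + sin t * sin (real m * t) / km_denom q t)
      = sin t * sin (real (m + 2) * t)"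
      using km_denom_pos[of t] by (simp add: field_simps)
  qed
  also have "\<dots> = 0" using integral_sin_sin[of "m + 2"] by simp
  finally show ?thesis by simp
qed

lemma km_integral_bound: "\<bar>km_integral q m\<bar> \<le> pi / (q - 1)\<^sup>2"
proof -
  have "norm (integral {0..pi} (\<lambda>t. sin t * sin (real m * t) / km_denom q t)) \<le> 1 / (q - 1)\<^sup>2 * (pi - 0)"
  proof (rule integral_bound)
    show "continuous_on {0..pi} (\<lambda>t. sin t * sin (real m * t) / km_denom q t)"
      unfolding km_denom_def using km_denom_pos by (intro continuous_intros) (auto simp: km_denom_def less_imp_neq[symmetric])
    fix t
    have "\<bar>sin t\<bar> * \<bar>sin (real m * t)\<bar> \<le> 1 * 1" by (intro mult_mono) auto
    then show "norm (sin t * sin (real m * t) / km_denom q t) \<le> 1 / (q - 1)\<^sup>2"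
      using km_denom_lower[of q t] km_denom_pos[of t] q by (auto simp: abs_mult intro!: frac_le)
  qed simp
  then show ?thesis by (simp add: km_integral_def)
qed

text \<open>The recursion has the characteristic roots \<open>q\<close> and \<open>1/q\<close>; boundedness excludes the first.\<close>

lemma km_integral_step: "km_integral q (m + 2) = km_integral q m / q"
proof -
  define K where "K m = km_integral q (m + 2) - km_integral q m / q" for m
  have K: "K (m + 2) = q * K m" for m
  proof -
    have "y - x / q = q * (x - z / q)" if "(1 + q\<^sup>2) * x = q * (y + z)" for x y z
      using that q by (simp add: power2_eq_square field_simps)
    from this[OF km_integral_rec[of m]] show ?thesis
      unfolding K_def add.assoc by (simp only: numeral_Bit0 add.assoc)
  qed
  have K': "K (m + 2 * i) = q ^ i * K m" for i
  proof (induction i)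
    case (Suc i)
    then show ?case using K[of "m + 2 * i"] by (simp add: mult.assoc add.assoc)
  qed simp
  define B where "B = 2 * (pi / (q - 1)\<^sup>2)"
  have B: "\<bar>K m\<bar> \<le> B" for m
  proof -
    have "\<bar>km_integral q m / q\<bar> \<le> \<bar>km_integral q m\<bar>"
    proof -
      have "1 * \<bar>km_integral q m\<bar> \<le> q * \<bar>km_integral q m\<bar>" using q by (intro mult_right_mono) auto
      then show ?thesis using q by (simp add: abs_divide divide_le_eq mult.commute)
    qed
    then show ?thesis
      unfolding K_def B_def using km_integral_bound[of m] km_integral_bound[of "m + 2"] by linarith
  qed
  have "K m = 0"
  proof (rule ccontr)
    assume "K m \<noteq> 0"
    then obtain i where "B / \<bar>K m\<bar> < q ^ i" using real_arch_pow[OF q] by blast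
    then have "B < q ^ i * \<bar>K m\<bar>" using \<open>K m \<noteq> 0\<close> by (simp add: divide_less_eq)
    then have "B < \<bar>K (m + 2 * i)\<bar>" unfolding K' using q by (simp add: abs_mult)
    then show False using B[of "m + 2 * i"] by simp
  qed
  then show ?thesis by (simp add: K_def)
qed

lemma km_integral_1: "km_integral q 1 = pi / (2 * q * (q + 1))"
proof -
  have "(1 + q\<^sup>2) * km_integral q 1 - q * (km_integral q 3 - km_integral q 1)
    = integral {0..pi} (\<lambda>t. (1 + q\<^sup>2) * (sin t * sin (real 1 * t) / km_denom q t)
        - q * (sin t * sin (real 3 * t) / km_denom q t - sin t * sin (real 1 * t) / km_denom q t))"
    by (rule integral_unique[symmetric]) (intro has_integral_diff has_integral_mult_right km_has_integral)
  also have "\<dots> = integral {0..pi} (\<lambda>t. sin t * sin (real 1 * t))"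
  proof (rule integral_cong)
    fix t :: real
    have "sin (3 * t) = 2 * cos (2 * t) * sin t + sin t"
      using sin_step[of t "2 * t"] by simp
    then have "(1 + q\<^sup>2) * (sin t * sin (real 1 * t)) - q * (sin t * sin (real 3 * t) - sin t * sin (real 1 * t))
      = sin t * sin (real 1 * t) * km_denom q t"
      unfolding km_denom_def by (simp add: algebra_simps)
    moreover have "(1 + q\<^sup>2) * (a / D) - q * (b / D - c / D) = ((1 + q\<^sup>2) * a - q * (b - c)) / D" for a b c D
      by (simp add: diff_divide_distrib right_diff_distrib)
    ultimately show "(1 + q\<^sup>2) * (sin t * sin (real 1 * t) / km_denom q t)
        - q * (sin t * sin (real 3 * t) / km_denom q t - sin t * sin (real 1 * t) / km_denom q t)
      = sin t * sin (real 1 * t)"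
      using km_denom_pos[of t] by (simp only:; simp?)
  qed
  also have "\<dots> = pi / 2" using integral_sin_sin[of 1] by simp
  finally have "(1 + q\<^sup>2) * km_integral q 1 - q * (km_integral q 3 - km_integral q 1) = pi / 2" .
  moreover have "km_integral q 3 = km_integral q 1 / q" using km_integral_step[of 1] by (simp add: eval_nat_numeral)
  ultimately have "(1 + q\<^sup>2) * km_integral q 1 - q * (km_integral q 1 / q - km_integral q 1) = pi / 2" by simp
  moreover have "(1 + q\<^sup>2) * k - q * (k / q - k) = q * (q + 1) * k" for k
    using q by (simp add: power2_eq_square algebra_simps)
  ultimately have "q * (q + 1) * km_integral q 1 = pi / 2" by (simp only:)
  then have "km_integral q 1 = (pi / 2) / (q * (q + 1))" using q by (intro eq_divide_imp) (auto simp: mult_ac)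
  then show ?thesis by simp
qed

end

text \<open>The density of the distribution after the substitution \<open>x = - 2 sqrt q cos t\<close>. For \<open>q = 1\<close> it is
  constant, up to the removable singularities at the end points.\<close>

definition km_weight :: "real \<Rightarrow> real \<Rightarrow> real" where
  "km_weight q t = (if q = 1 then 1 / pi else 2 * (q + 1) * q * (sin t)\<^sup>2 / (pi * km_denom q t))"

lemma continuous_km_weight: "q \<ge> 1 \<Longrightarrow> continuous_on S (km_weight q)"
proof (cases "q = 1")
  case False
  assume "q \<ge> 1"
  then have "q > 1" using False by simp
  then have "km_denom q t \<noteq> 0" for t using km_denom_pos[of q t] by simp
  then show ?thesis
    unfolding km_weight_def km_denom_def using False by (simp, intro continuous_intros) auto
qed (simp add: km_weight_def)

lemma integral_nonbacktracking_weight: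
  assumes d: "d \<ge> 2" and q: "q = real d - 1"
  shows "integral {0..pi} (\<lambda>t. nonbacktracking_poly d l (- (2 * sqrt q) * cos t) * km_weight q t) = (if l = 0 then 1 else 0)"
proof -
  have q1: "q \<ge> 1" using d q by auto
  define s where "s = - sqrt q"
  have s: "s\<^sup>2 = q" using q1 by (simp add: s_def)
  have xs: "- (2 * sqrt q) * cos t = 2 * s * cos t" for t by (simp add: s_def)
  show ?thesis
  proof (cases "q = 1")
    case True
    have spike: "integral {0..pi} f = integral {0..pi} g" if "\<And>t. 0 < t \<Longrightarrow> t < pi \<Longrightarrow> f t = g t" for f g :: "real \<Rightarrow> real"
      by (rule integral_spike[of "{0, pi}"]) (use that in auto)
    show ?thesis
    proof (cases l)
      case (Suc m)
      have "integral {0..pi} (\<lambda>t. nonbacktracking_poly d l (- (2 * sqrt q) * cos t) * km_weight q t)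
        = integral {0..pi} (\<lambda>t. (2 * s ^ l / pi) * cos (real l * t))"
      proof (rule spike)
        fix t assume t: "0 < t" "t < pi"
        have "sin t * nonbacktracking_poly d l (2 * s * cos t) = s ^ l * (sin ((real m + 2) * t) - sin (real m * t))"
          using nonbacktracking_poly_trig[OF q _ s, of t m] True Suc by simp
        also have "sin ((real m + 2) * t) - sin (real m * t) = 2 * sin t * cos (real l * t)"
          using Suc sin_add[of "real l * t" t] sin_diff[of "real l * t" t] by (simp add: algebra_simps)
        finally have "sin t * nonbacktracking_poly d l (2 * s * cos t) = sin t * (2 * s ^ l * cos (real l * t))" by (simp add: mult_ac)
        then have "nonbacktracking_poly d l (2 * s * cos t) = 2 * s ^ l * cos (real l * t)"
          using sin_gt_zero[OF t] by simp
        then show "nonbacktracking_poly d l (- (2 * sqrt q) * cos t) * km_weight q t = (2 * s ^ l / pi) * cos (real l * t)"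
          unfolding xs using True by (simp add: km_weight_def)
      qed
      also have "integral {0..pi} (\<lambda>t. cos (real l * t)) = sin (real l * pi) / real l - sin (real l * 0) / real l"
        using Suc by (intro integral_unique fundamental_theorem_of_calculus)
          (auto simp: has_real_derivative_iff_has_vector_derivative[symmetric] intro!: derivative_eq_intros)
      then have "integral {0..pi} (\<lambda>t. (2 * s ^ l / pi) * cos (real l * t)) = 0" by simp
      finally show ?thesis using Suc by simp
    qed (simp add: True km_weight_def)
  next
    case False
    then have q2: "q > 1" using q1 by simp
    have w: "f t * km_weight q t = (2 * (q + 1) * q / pi) * (sin t * (sin t * f t) / km_denom q t)" for f t
      using False by (simp add: km_weight_def power2_eq_square)
    show ?thesis
    proof (cases l)
      case 0
      have "integral {0..pi} (\<lambda>t. km_weight q t) = (2 * (q + 1) * q / pi) * km_integral q 1"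
      proof -
        have "(\<lambda>t. km_weight q t) = (\<lambda>t. (2 * (q + 1) * q / pi) * (sin t * sin (real 1 * t) / km_denom q t))"
          using w[of "\<lambda>_. 1"] by simp
        then show ?thesis unfolding km_integral_def by (simp only: integral_mult_right)
      qed
      also have "\<dots> = 1"
      proof -
        have "q \<noteq> 0" "q + 1 \<noteq> 0" using q2 by auto
        then show ?thesis unfolding km_integral_1[OF q2] by (simp add: divide_simps) (simp add: mult_ac)?
      qed
      finally show ?thesis using 0 by simp
    next
      case (Suc m)
      have "nonbacktracking_poly d l (- (2 * sqrt q) * cos t) * km_weight q t = (2 * (q + 1) * q / pi * s ^ l) *
        (sin t * sin (real (m + 2) * t) / km_denom q t - sin t * sin (real m * t) / km_denom q t / q)" for t
      proof -
        have "sin t * nonbacktracking_poly d l (2 * s * cos t) = s ^ l * (sin ((real m + 2) * t) - sin (real m * t) / q)"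
          using nonbacktracking_poly_trig[OF q _ s, of t m] q1 Suc by simp
        moreover have "C * (x * (S * (a - b / q)) / D) = (C * S) * (x * a / D - x * b / D / q)" for C x S a b D
          by (simp add: divide_inverse algebra_simps)
        moreover have "real m + 2 = real (m + 2)" by simp
        ultimately show ?thesis
          unfolding xs w[of "\<lambda>t. nonbacktracking_poly d l (2 * s * cos t)"] by (simp only:)
      qed
      then have "integral {0..pi} (\<lambda>t. nonbacktracking_poly d l (- (2 * sqrt q) * cos t) * km_weight q t)
        = (2 * (q + 1) * q / pi * s ^ l) * (km_integral q (m + 2) - km_integral q m / q)"
        by (simp only:) (intro integral_unique has_integral_mult_right has_integral_diff has_integral_divide km_has_integral[OF q2])
      then show ?thesis using km_integral_step[OF q2, of m] Suc by simp
    qed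
  qed
qed

definition km_density :: "nat \<Rightarrow> real \<Rightarrow> real" where
  "km_density d x = real d * sqrt (4 * (real d - 1) - x\<^sup>2) / (2 * pi * ((real d)\<^sup>2 - x\<^sup>2))"

abbreviation km_radius :: "nat \<Rightarrow> real" where
  "km_radius d \<equiv> 2 * sqrt (real d - 1)"

lemma kesten_mckay_density:
  "kesten_mckay d = density lborel (\<lambda>x. ennreal (km_density d x * indicator {- km_radius d..km_radius d} x))"
  by (simp add: kesten_mckay_def km_density_def)

lemma km_density_measurable [measurable]: "km_density d \<in> borel_measurable borel"
  unfolding km_density_def by measurable

lemma km_density_nonneg:
  assumes "d \<ge> 2" "x \<in> {- km_radius d..km_radius d}"
  shows "km_density d x \<ge> 0"
proof -
  have "\<bar>x\<bar> \<le> km_radius d" using assms(2) by auto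
  then have "\<bar>x\<bar>\<^sup>2 \<le> (km_radius d)\<^sup>2" by (intro power_mono) auto
  then have x: "x\<^sup>2 \<le> 4 * (real d - 1)" using assms(1) by (simp add: power_mult_distrib)
  have "0 \<le> (real d - 2)\<^sup>2" by simp
  then have "4 * (real d - 1) \<le> (real d)\<^sup>2" by (simp add: power2_eq_square algebra_simps)
  then show ?thesis using x by (simp add: km_density_def)
qed

lemma km_density_substitution:
  assumes d: "d \<ge> 2" and q: "q = real d - 1" and t: "0 < t" "t < pi"
  shows "km_density d (- (2 * sqrt q) * cos t) * (2 * sqrt q * sin t) = km_weight q t"
proof -
  have q1: "q \<ge> 1" using d q by auto
  have st: "sin t > 0" using sin_gt_zero[OF t] .
  have sq: "(- (2 * sqrt q) * cos t)\<^sup>2 = 4 * q * (cos t)\<^sup>2" using q1 by (simp add: power_mult_distrib)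
  have "4 * q - 4 * q * (cos t)\<^sup>2 = (2 * sqrt q * sin t)\<^sup>2"
    using q1 by (simp add: power_mult_distrib sin_squared_eq algebra_simps)
  then have root: "sqrt (4 * q - 4 * q * (cos t)\<^sup>2) = 2 * sqrt q * sin t"
    using q1 st by (simp add: real_sqrt_mult)
  have den: "(real d)\<^sup>2 - 4 * q * (cos t)\<^sup>2 = km_denom q t"
  proof -
    have "real d = q + 1" using q by simp
    then show ?thesis unfolding km_denom_def cos_double_cos by (simp add: power2_eq_square algebra_simps)
  qed
  have "km_density d (- (2 * sqrt q) * cos t) * (2 * sqrt q * sin t)
     = (q + 1) * (2 * sqrt q * sin t) * (2 * sqrt q * sin t) / (2 * pi * km_denom q t)"
    unfolding km_density_def sq q[symmetric] root den using q by simp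
  also have "\<dots> = (q + 1) * (4 * q * (sin t)\<^sup>2) / (2 * pi * km_denom q t)"
    using q1 by (simp add: power2_eq_square)
  also have "\<dots> = km_weight q t"
  proof (cases "q = 1")
    case True
    have "km_denom 1 t = 4 * (sin t)\<^sup>2" by (simp add: km_denom_def cos_double_sin)
    then show ?thesis using True st by (simp add: km_weight_def)
  qed (simp add: km_weight_def)
  finally show ?thesis .
qed

text \<open>The substitution \<open>x = - 2 sqrt q cos t\<close> removes the square roots in the density.\<close>

lemma kesten_mckay_integral:
  assumes d: "d \<ge> 2" and q: "q = real d - 1" and f: "continuous_on UNIV f"
  shows "integrable (kesten_mckay d) f"
    and "integral\<^sup>L (kesten_mckay d) f = integral {0..pi} (\<lambda>t. f (- (2 * sqrt q) * cos t) * km_weight q t)"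
proof -
  have q1: "q \<ge> 1" using d q by auto
  define r where "r = km_radius d"
  have r: "r = 2 * sqrt q" using q by (simp add: r_def)
  define g where "g t = - (2 * sqrt q) * cos t" for t
  define g' where "g' t = 2 * sqrt q * sin t" for t
  have gr: "g 0 = - r" "g pi = r" by (simp_all add: g_def r)
  have dg: "(g has_real_derivative g' t) (at t)" for t
    unfolding g_def g'_def by (auto intro!: derivative_eq_intros)
  have cg: "continuous_on S g'" for S unfolding g'_def by (intro continuous_intros)
  have g0: "g' t \<ge> 0" if "t \<in> {0..pi}" for t
    using that q1 by (auto simp: g'_def intro!: mult_nonneg_nonneg sin_ge_zero)
  have ae: "AE t in lborel. t \<notin> {0, pi}"
    by (rule AE_not_in) (auto intro!: countable_imp_null_set_lborel)
  have sub: "km_density d (g t) * g' t = km_weight q t" if "0 < t" "t < pi" for t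
    using km_density_substitution[OF d q that] by (simp add: g_def g'_def)
  have intw: "set_integrable lborel {0..pi} (km_weight q)"
    by (intro borel_integrable_atLeastAtMost' continuous_km_weight q1)
  have dens: "set_integrable lborel {- r..r} (km_density d)"
    unfolding set_integrable_def
  proof (rule integrableI_nonneg)
    show "(\<lambda>x. indicator {- r..r} x *\<^sub>R km_density d x) \<in> borel_measurable lborel" by measurable
    show "AE x in lborel. 0 \<le> indicator {- r..r} x *\<^sub>R km_density d x"
      using km_density_nonneg[OF d] by (auto simp: r_def indicator_def)
    have "(\<integral>\<^sup>+x. ennreal (indicator {- r..r} x *\<^sub>R km_density d x) \<partial>lborel)
      = (\<integral>\<^sup>+x. ennreal (km_density d x * indicator {g 0..g pi} x) \<partial>lborel)"
      by (simp add: gr mult.commute)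
    also have "\<dots> = (\<integral>\<^sup>+t. ennreal (km_density d (g t) * g' t * indicator {0..pi} t) \<partial>lborel)"
      by (rule nn_integral_substitution) (auto simp: set_borel_measurable_def dg cg g0)
    also have "\<dots> = (\<integral>\<^sup>+t. ennreal (indicator {0..pi} t *\<^sub>R km_weight q t) \<partial>lborel)"
      using ae by (intro nn_integral_cong_AE) (auto simp: sub indicator_def)
    also have "\<dots> < \<infinity>"
    proof -
      have "(\<integral>\<^sup>+t. ennreal (indicator {0..pi} t *\<^sub>R km_weight q t) \<partial>lborel)
          \<le> (\<integral>\<^sup>+t. ennreal (norm (indicator {0..pi} t *\<^sub>R km_weight q t)) \<partial>lborel)"
        by (intro nn_integral_mono ennreal_leI) auto
      also have "\<dots> < \<infinity>"
        using intw unfolding set_integrable_def integrable_iff_bounded by blast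
      finally show ?thesis .
    qed
    finally show "(\<integral>\<^sup>+x. ennreal (indicator {- r..r} x *\<^sub>R km_density d x) \<partial>lborel) < \<infinity>" .
  qed
  have "bounded (f ` {- r..r})"
    by (intro compact_imp_bounded compact_continuous_image continuous_on_subset[OF f]) auto
  then obtain B where "\<forall>y\<in>f ` {- r..r}. norm y \<le> B" unfolding bounded_iff by blast
  then have B: "\<bar>f x\<bar> \<le> B" if "x \<in> {- r..r}" for x using that by simp
  have [measurable]: "f \<in> borel_measurable borel" by (rule borel_measurable_continuous_onI[OF f])
  have fd: "set_integrable lborel {- r..r} (\<lambda>x. f x * km_density d x)"
    unfolding set_integrable_def
  proof (rule Bochner_Integration.integrable_bound)
    show "integrable lborel (\<lambda>x. B *\<^sub>R (indicator {- r..r} x *\<^sub>R km_density d x))"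
      using dens unfolding set_integrable_def by (rule integrable_scaleR_right)
    show "(\<lambda>x. indicator {- r..r} x *\<^sub>R (f x * km_density d x)) \<in> borel_measurable lborel" by measurable
    show "AE x in lborel. norm (indicator {- r..r} x *\<^sub>R (f x * km_density d x)) \<le> norm (B *\<^sub>R (indicator {- r..r} x *\<^sub>R km_density d x))"
    proof (rule AE_I2)
      fix x
      show "norm (indicator {- r..r} x *\<^sub>R (f x * km_density d x)) \<le> norm (B *\<^sub>R (indicator {- r..r} x *\<^sub>R km_density d x))"
      proof (cases "x \<in> {- r..r}")
        case True
        have "\<bar>f x\<bar> * \<bar>km_density d x\<bar> \<le> \<bar>B\<bar> * \<bar>km_density d x\<bar>"
          using B[OF True] by (intro mult_right_mono) auto
        then show ?thesis using True by (simp add: abs_mult)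
      qed simp
    qed
  qed
  have nn: "AE x in lborel. 0 \<le> km_density d x * indicator {- r..r} x"
    using km_density_nonneg[OF d] by (auto simp: r_def indicator_def)
  have km: "kesten_mckay d = density lborel (\<lambda>x. ennreal (km_density d x * indicator {- r..r} x))"
    by (simp add: kesten_mckay_density r_def)
  show "integrable (kesten_mckay d) f"
    unfolding km using fd unfolding set_integrable_def
    by (subst integrable_density) (use nn in \<open>auto simp: mult_ac\<close>)
  have "integral\<^sup>L (kesten_mckay d) f = integral\<^sup>L lborel (\<lambda>x. (f x * km_density d x) * indicator {g 0..g pi} x)"
    unfolding km gr by (subst integral_density) (use nn in \<open>auto simp: mult_ac\<close>)
  also have "\<dots> = integral\<^sup>L lborel (\<lambda>t. (f (g t) * km_density d (g t)) * g' t * indicator {0..pi} t)"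
    by (rule integral_substitution) (use fd in \<open>auto simp: gr dg cg g0\<close>)
  also have "\<dots> = integral\<^sup>L lborel (\<lambda>t. indicator {0..pi} t *\<^sub>R (f (g t) * km_weight q t))"
  proof (rule integral_cong_AE)
    have cgg: "continuous_on UNIV g" unfolding g_def by (intro continuous_intros)
    have [measurable]: "g \<in> borel_measurable borel" "g' \<in> borel_measurable borel" "km_weight q \<in> borel_measurable borel"
      by (auto intro!: borel_measurable_continuous_onI cgg cg continuous_km_weight q1)
    show "(\<lambda>t. (f (g t) * km_density d (g t)) * g' t * indicator {0..pi} t) \<in> borel_measurable lborel" by measurable
    show "(\<lambda>t. indicator {0..pi} t *\<^sub>R (f (g t) * km_weight q t)) \<in> borel_measurable lborel" by measurable
    show "AE t in lborel. (f (g t) * km_density d (g t)) * g' t * indicator {0..pi} t = indicator {0..pi} t *\<^sub>R (f (g t) * km_weight q t)"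
      using ae by eventually_elim (auto simp: indicator_def sub[symmetric])
  qed
  also have "\<dots> = integral {0..pi} (\<lambda>t. f (g t) * km_weight q t)"
  proof -
    have "continuous_on {0..pi} (\<lambda>t. f (g t) * km_weight q t)"
      unfolding g_def by (intro continuous_intros continuous_km_weight q1 continuous_on_compose2[OF f]) auto
    from set_borel_integral_eq_integral(2)[OF borel_integrable_atLeastAtMost'[OF this]]
    show ?thesis by (simp add: set_lebesgue_integral_def)
  qed
  finally show "integral\<^sup>L (kesten_mckay d) f = integral {0..pi} (\<lambda>t. f (- (2 * sqrt q) * cos t) * km_weight q t)"
    by (simp add: g_def)
qed

lemma continuous_nonbacktracking_poly: "continuous_on UNIV (nonbacktracking_poly d l)"
  by (induction l rule: induct_nat_012) (auto intro!: continuous_intros)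

theorem kesten_mckay_nonbacktracking:
  assumes "d \<ge> 2"
  shows "integral\<^sup>L (kesten_mckay d) (nonbacktracking_poly d l) = (if l = 0 then 1 else 0)"
  using kesten_mckay_integral(2)[OF assms refl continuous_nonbacktracking_poly[of d l]]
    integral_nonbacktracking_weight[OF assms refl, of l] by simp

section \<open>Closed walks without backtracking\<close>

definition nonbacktracking :: "('e \<Rightarrow> 'e) \<Rightarrow> 'e list \<Rightarrow> bool" where
  "nonbacktracking arev p \<longleftrightarrow> successively (\<lambda>e f. f \<noteq> arev e) p"

lemma nonbacktracking_simps [simp]:
  "nonbacktracking arev []" "nonbacktracking arev [e]"
  "nonbacktracking arev (e # f # p) \<longleftrightarrow> f \<noteq> arev e \<and> nonbacktracking arev (f # p)"
  by (simp_all add: nonbacktracking_def)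

lemma nonbacktracking_Cons:
  "nonbacktracking arev (e # p) \<longleftrightarrow> (p = [] \<or> hd p \<noteq> arev e) \<and> nonbacktracking arev p"
  by (cases p) auto

text \<open>Left multiplication by a generator, acting on reduced words.\<close>

definition cancel_Cons :: "('e \<Rightarrow> 'e) \<Rightarrow> 'e \<Rightarrow> 'e list \<Rightarrow> 'e list" where
  "cancel_Cons arev e p = (if p \<noteq> [] \<and> hd p = arev e then tl p else e # p)"

text \<open>The free reduction of a walk.\<close>

abbreviation reduce :: "('e \<Rightarrow> 'e) \<Rightarrow> 'e list \<Rightarrow> 'e list" where
  "reduce arev p \<equiv> foldr (cancel_Cons arev) p []"

lemma nonbacktracking_cancel_Cons:
  "nonbacktracking arev p \<Longrightarrow> nonbacktracking arev (cancel_Cons arev e p)"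
  by (cases p) (auto simp: cancel_Cons_def nonbacktracking_Cons)

lemma nonbacktracking_foldr:
  "nonbacktracking arev q \<Longrightarrow> nonbacktracking arev (foldr (cancel_Cons arev) p q)"
  by (induction p) (auto intro: nonbacktracking_cancel_Cons)

lemma reduce_nonbacktracking: "nonbacktracking arev p \<Longrightarrow> reduce arev p = p"
  by (induction p) (auto simp: cancel_Cons_def nonbacktracking_Cons)

context bidirected_digraph
begin

lemma cancel_Cons_arev:
  assumes "nonbacktracking arev p"
  shows "cancel_Cons arev e (cancel_Cons arev (arev e) p) = p"
proof (cases p)
  case (Cons x xs)
  then show ?thesis
    using assms by (cases xs) (auto simp: cancel_Cons_def)
qed (simp add: cancel_Cons_def)

text \<open>The action of a word on reduced words depends only on its free reduction.\<close>

lemma foldr_cancel_Cons_reduce: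
  assumes q: "nonbacktracking arev q"
  shows "foldr (cancel_Cons arev) (reduce arev p) q = foldr (cancel_Cons arev) p q"
proof (induction p)
  case (Cons e p)
  have "foldr (cancel_Cons arev) (cancel_Cons arev e r) q = cancel_Cons arev e (foldr (cancel_Cons arev) r q)" for r
  proof (cases "r \<noteq> [] \<and> hd r = arev e")
    case True
    then obtain r' where "r = arev e # r'" by (cases r) auto
    then show ?thesis
      using cancel_Cons_arev[OF nonbacktracking_foldr[OF q], of e r'] by (simp add: cancel_Cons_def[of _ e "_ # _"])
  qed (auto simp: cancel_Cons_def[of _ e r])
  then show ?case using Cons.IH by simp
qed simp

lemma foldr_cancel_Cons_inverse:
  "nonbacktracking arev r \<Longrightarrow> foldr (cancel_Cons arev) (q @ map arev (rev q)) r = r"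
proof (induction q arbitrary: r)
  case (Cons e q)
  have "foldr (cancel_Cons arev) ((e # q) @ map arev (rev (e # q))) r
    = cancel_Cons arev e (foldr (cancel_Cons arev) (q @ map arev (rev q)) (cancel_Cons arev (arev e) r))" by simp
  also have "\<dots> = r"
    using Cons.IH[OF nonbacktracking_cancel_Cons[OF Cons.prems]] cancel_Cons_arev[OF Cons.prems] by simp
  finally show ?case .
qed simp

lemma reduce_homotopy:
  assumes "(p, q) \<in> homotopy G arev v"
  shows "reduce arev p = reduce arev q"
  using assms unfolding homotopy_def
proof (induction rule: rtrancl_induct)
  case (step y z)
  have "reduce arev y = reduce arev z" if "(y, z) \<in> backtrack_removal G arev v" for y z
  proof -
    obtain r s a where "y = r @ [a, arev a] @ s" "z = r @ s"
      using \<open>(y, z) \<in> backtrack_removal G arev v\<close> by (auto simp: backtrack_removal_def)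
    then show ?thesis
      using cancel_Cons_arev[OF nonbacktracking_foldr[OF nonbacktracking_simps(1)], of a s] by simp
  qed
  then show ?case using step by auto
qed simp

text \<open>A nonempty closed walk without backtracking is not conjugate to the identity in the free group on the
  oriented edges.\<close>

lemma reduce_conjugate_nonempty:
  assumes p: "nonbacktracking arev p" "p \<noteq> []"
  shows "reduce arev (q @ p @ map arev (rev q)) \<noteq> []"
proof
  assume empty: "reduce arev (q @ p @ map arev (rev q)) = []"
  define q' where "q' = map arev (rev q)"
  have qq: "map arev (rev q') = q" by (simp add: q'_def rev_map comp_def)
  note nb = nonbacktracking_foldr[OF nonbacktracking_simps(1)]
  have "foldr (cancel_Cons arev) (q' @ map arev (rev q')) (reduce arev (p @ q')) = reduce arev (p @ q')"
    by (rule foldr_cancel_Cons_inverse[OF nb])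
  then have "reduce arev q' = reduce arev (p @ q')"
    using empty unfolding qq by (simp add: q'_def)
  then have "foldr (cancel_Cons arev) (reduce arev (p @ q')) (reduce arev q)
    = foldr (cancel_Cons arev) (reduce arev q') (reduce arev q)" by simp
  then have "reduce arev (p @ (q' @ q)) = reduce arev (q' @ q)"
    unfolding foldr_cancel_Cons_reduce[OF nb] by simp
  moreover have "reduce arev (q' @ q) = []"
    using foldr_cancel_Cons_inverse[of "[]" q'] unfolding qq by simp
  ultimately have "reduce arev p = []" by simp
  then show False using reduce_nonbacktracking[OF p(1)] p(2) by simp
qed

lemma awalk_reverse: "awalk u p v \<Longrightarrow> awalk v (map arev (rev p)) u"
proof (induction p arbitrary: u)
  case (Cons e p)
  then have e: "e \<in> arcs G" "u = tail G e" "awalk (head G e) p v" by (auto simp: awalk_Cons_iff)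
  have "awalk v (map arev (rev p)) (head G e)" by (rule Cons.IH[OF e(3)])
  moreover have "awalk (head G e) [arev e] u"
    using e by (simp add: awalk_Cons_iff awalk_Nil_iff)
  ultimately show ?case by (auto intro: awalk_appendI)
qed (auto simp: awalk_Nil_iff)

lemma connected_awalk:
  assumes "Digraph_Component.connected G" "u \<in> verts G" "v \<in> verts G"
  obtains q where "awalk u q v"
proof -
  have sym: "symmetric G"
    unfolding symmetric_def
  proof (rule symI)
    fix a b assume "(a, b) \<in> arcs_ends G"
    then obtain e where e: "e \<in> arcs G" "a = tail G e" "b = head G e" by (auto simp: arcs_ends_conv)
    then have "arev e \<in> arcs G" "tail G (arev e) = b" "head G (arev e) = a" by simp_all
    then show "(b, a) \<in> arcs_ends G" using in_arcs_imp_in_arcs_ends by metis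
  qed
  have "reachable (with_proj (mk_symmetric G)) u v"
    using assms by (auto simp: connected_def strongly_connected_def)
  then have "reachable G u v" by (simp add: reachable_mk_symmetric_eq[OF sym])
  then show ?thesis using that by (auto simp: reachable_awalk)
qed

text \<open>Conjugating with a walk from the base point turns the condition on loops at the base point
  into one on all closed walks.\<close>

lemma BIV_holonomy:
  assumes "BIV G arev v0 chi" and p: "nonbacktracking arev p" "p \<noteq> []" "awalk v p v" and q: "awalk v0 q v"
  shows "holonomy chi (q @ p @ map arev (rev q)) \<noteq> Finite_Cartesian_Product.mat 1"
proof
  define l where "l = q @ p @ map arev (rev q)"
  assume id: "holonomy chi (q @ p @ map arev (rev q)) = Finite_Cartesian_Product.mat 1"
  have lv: "l \<in> loops G v0"
    unfolding loops_def l_def using q p(3) awalk_reverse[OF q] by (auto intro!: awalk_appendI)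
  define \<gamma> where "\<gamma> = homotopy G arev v0 `` {l}"
  have refl: "l \<in> \<gamma>" by (simp add: \<gamma>_def homotopy_def)
  have "\<gamma> \<in> fundamental_group G arev v0"
    unfolding \<gamma>_def fundamental_group_def by (rule quotientI[OF lv])
  moreover have "\<gamma> \<noteq> pi1_identity G arev v0"
  proof
    assume "\<gamma> = pi1_identity G arev v0"
    then have "([], l) \<in> homotopy G arev v0" using refl by (simp add: pi1_identity_def)
    from reduce_homotopy[OF this] show False
      using reduce_conjugate_nonempty[OF p(1,2), of q] by (simp add: l_def)
  qed
  ultimately have "Determinants.det (upper_right (holonomy chi l)) \<noteq> 0" using assms(1) refl by (auto simp: BIV_def)
  moreover have "upper_right (Finite_Cartesian_Product.mat 1 :: int^('c + 'c)^('c + 'c)) = 0"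
    by (simp add: upper_right_def Finite_Cartesian_Product.mat_def Finite_Cartesian_Product.vec_eq_iff)
  ultimately show False
    using id Determinants.det_0[where 'a = int and 'n = 'c] by (simp add: l_def)
qed

end

section \<open>The sums over walks without backtracking\<close>

definition nb_walks :: "('v,'e) pre_digraph \<Rightarrow> ('e \<Rightarrow> 'e) \<Rightarrow> nat \<Rightarrow> 'v \<Rightarrow> 'v \<Rightarrow> 'e list set" where
  "nb_walks G arev k v w = {p. pre_digraph.awalk G v p w \<and> nonbacktracking arev p \<and> length p = k}"

locale finite_bidirected = fin_digraph G + bidirected_digraph G arev for G :: "('v,'e) pre_digraph" and arev
begin

lemma finite_out [simp]: "finite (out_arcs G v)"
  by (rule finite_subset[OF _ finite_arcs]) auto

lemma finite_nb_walks: "finite (nb_walks G arev k v w)"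
proof (rule finite_subset)
  show "nb_walks G arev k v w \<subseteq> {p. set p \<subseteq> arcs G \<and> length p = k}" by (auto simp: nb_walks_def)
  show "finite {p. set p \<subseteq> arcs G \<and> length p = k}" by (rule finite_lists_length_eq) simp
qed

lemma nb_walks_0: "v \<in> verts G \<Longrightarrow> nb_walks G arev 0 v w = (if v = w then {[]} else {})"
  by (auto simp: nb_walks_def awalk_Nil_iff)

lemma nb_walks_1: "nb_walks G arev (Suc 0) v w = (\<lambda>e. [e]) ` {e \<in> out_arcs G v. head G e = w}"
  by (auto simp: nb_walks_def awalk_Cons_iff awalk_Nil_iff length_Suc_conv)

text \<open>Prepending an edge \<open>e\<close> to a walk without backtracking either gives such a walk, or backtracks. Each
  walk \<open>p\<close> arises as the result of the cancellation from all edges \<open>e\<close> at its start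
  except its first edge.\<close>

lemma sum_nb_walks_step:
  fixes F :: "'e list \<Rightarrow> complex"
  assumes deg: "out_degree G v = d" and v: "v \<in> verts G"
    and F: "\<And>e p. e \<in> out_arcs G v \<Longrightarrow> p \<in> nb_walks G arev k v w \<Longrightarrow> F (e # arev e # p) = F p"
  shows "(\<Sum>e\<in>out_arcs G v. \<Sum>p\<in>nb_walks G arev (Suc k) (head G e) w. F (e # p)) =
    (\<Sum>p\<in>nb_walks G arev (Suc (Suc k)) v w. F p) +
    of_real (if k = 0 then real d else real d - 1) * (\<Sum>p\<in>nb_walks G arev k v w. F p)"
proof -
  define X where "X = (SIGMA e:out_arcs G v. nb_walks G arev (Suc k) (head G e) w)"
  define X1 where "X1 = {(e, p) \<in> X. hd p \<noteq> arev e}"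
  define X2 where "X2 = {(e, p) \<in> X. hd p = arev e}"
  define Y where "Y = (SIGMA p:nb_walks G arev k v w. {e \<in> out_arcs G v. p = [] \<or> hd p \<noteq> e})"
  have fin: "finite X" unfolding X_def by (intro finite_SigmaI finite_nb_walks) simp
  have "(\<Sum>e\<in>out_arcs G v. \<Sum>p\<in>nb_walks G arev (Suc k) (head G e) w. F (e # p)) = (\<Sum>(e, p)\<in>X. F (e # p))"
    unfolding X_def by (rule sum.Sigma) (auto intro: finite_nb_walks)
  also have "X = X1 \<union> X2" by (auto simp: X1_def X2_def)
  also have "(\<Sum>(e, p)\<in>X1 \<union> X2. F (e # p)) = (\<Sum>(e, p)\<in>X1. F (e # p)) + (\<Sum>(e, p)\<in>X2. F (e # p))"
    by (rule sum.union_disjoint) (auto simp: X1_def X2_def intro: finite_subset[OF _ fin])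
  also have "(\<Sum>(e, p)\<in>X1. F (e # p)) = (\<Sum>p\<in>nb_walks G arev (Suc (Suc k)) v w. F p)"
  proof (rule sum.reindex_bij_witness[where i = "\<lambda>p. (hd p, tl p)" and j = "\<lambda>(e, p). e # p"])
    fix p assume "p \<in> nb_walks G arev (Suc (Suc k)) v w"
    then show "(hd p, tl p) \<in> X1" "(case (hd p, tl p) of (e, p) \<Rightarrow> e # p) = p"
      by (cases p; auto simp: X1_def X_def nb_walks_def awalk_Cons_iff nonbacktracking_Cons)+
  next
    fix x assume "x \<in> X1"
    then show "(case x of (e, p) \<Rightarrow> e # p) \<in> nb_walks G arev (Suc (Suc k)) v w"
      by (auto simp: X1_def X_def nb_walks_def awalk_Cons_iff nonbacktracking_Cons)
  qed auto
  also have "(\<Sum>(e, p)\<in>X2. F (e # p)) = (\<Sum>(p, e)\<in>Y. F p)"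
  proof (rule sum.reindex_bij_witness[where i = "\<lambda>(p, e). (e, arev e # p)" and j = "\<lambda>(e, p). (tl p, e)"])
    fix x assume x: "x \<in> X2"
    then obtain e p where ep: "x = (e, arev e # p)" "e \<in> out_arcs G v" "arev e # p \<in> nb_walks G arev (Suc k) (head G e) w"
      by (cases x; cases "snd x") (auto simp: X2_def X_def nb_walks_def)
    then have p: "p \<in> nb_walks G arev k v w" "p = [] \<or> hd p \<noteq> e"
      by (auto simp: nb_walks_def awalk_Cons_iff nonbacktracking_Cons)
    show "(case case x of (e, p) \<Rightarrow> (tl p, e) of (p, e) \<Rightarrow> (e, arev e # p)) = x" using ep by simp
    show "(case x of (e, p) \<Rightarrow> (tl p, e)) \<in> Y" using ep p by (simp add: Y_def)
    show "(case case x of (e, p) \<Rightarrow> (tl p, e) of (p, e) \<Rightarrow> F p) = (case x of (e, p) \<Rightarrow> F (e # p))"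
      using F[OF ep(2) p(1)] ep by simp
  next
    fix y assume "y \<in> Y"
    then show "(case case y of (p, e) \<Rightarrow> (e, arev e # p) of (e, p) \<Rightarrow> (tl p, e)) = y"
      "(case y of (p, e) \<Rightarrow> (e, arev e # p)) \<in> X2"
      by (auto simp: Y_def X2_def X_def nb_walks_def awalk_Cons_iff nonbacktracking_Cons)
  qed
  also have "(\<Sum>(p, e)\<in>Y. F p) = (\<Sum>p\<in>nb_walks G arev k v w. \<Sum>e | e \<in> out_arcs G v \<and> (p = [] \<or> hd p \<noteq> e). F p)"
    unfolding Y_def by (rule sum.Sigma[symmetric]) (auto intro: finite_nb_walks)
  also have "\<dots> = (\<Sum>p\<in>nb_walks G arev k v w. of_real (if k = 0 then real d else real d - 1) * F p)"
  proof (rule sum.cong[OF refl])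
    fix p assume p: "p \<in> nb_walks G arev k v w"
    have d: "card (out_arcs G v) = d" using deg by (simp add: out_degree_def)
    have count: "real (card {e \<in> out_arcs G v. p = [] \<or> hd p \<noteq> e}) = (if k = 0 then real d else real d - 1)"
    proof (cases p)
      case Nil
      then have "{e \<in> out_arcs G v. p = [] \<or> hd p \<noteq> e} = out_arcs G v" by auto
      moreover have "k = 0" using p Nil by (auto simp: nb_walks_def)
      ultimately show ?thesis using d by (simp only: simp_thms if_True)
    next
      case (Cons f p')
      have f: "f \<in> out_arcs G v" using p Cons by (simp add: nb_walks_def awalk_Cons_iff)
      have "{e \<in> out_arcs G v. p = [] \<or> hd p \<noteq> e} = out_arcs G v - {f}" using Cons by auto
      moreover have "real (card (out_arcs G v - {f})) = real d - 1"
      proof -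
        have "card (out_arcs G v) > 0" unfolding card_gt_0_iff using f finite_out[of v] by blast
        then show ?thesis unfolding card_Diff_singleton[OF f] d by (simp add: of_nat_diff Suc_leI)
      qed
      ultimately show ?thesis using p Cons by (auto simp: nb_walks_def)
    qed
    have "(\<Sum>e | e \<in> out_arcs G v \<and> (p = [] \<or> hd p \<noteq> e). F p)
      = complex_of_real (real (card {e \<in> out_arcs G v. p = [] \<or> hd p \<noteq> e})) * F p" by (simp only: sum_constant of_real_of_nat_eq)
    also have "\<dots> = of_real (if k = 0 then real d else real d - 1) * F p" by (simp only: count)
    finally show "(\<Sum>e | e \<in> out_arcs G v \<and> (p = [] \<or> hd p \<noteq> e). F p) = of_real (if k = 0 then real d else real d - 1) * F p" .
  qed
  finally show ?thesis by (simp only: sum_distrib_left)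
qed

end

section \<open>The twisted adjacency matrix\<close>

locale quantum_graph = finite_bidirected G arev for G :: "('v,'e) pre_digraph" and arev +
  fixes d N :: nat and M :: "'e \<Rightarrow> 'n::finite dist \<Rightarrow> 'n dist"
  assumes N: "N > 0" and regular: "v \<in> verts G \<Longrightarrow> out_degree G v = d"
    and isometry: "e \<in> arcs G \<Longrightarrow> H_isometry N (M e)"
    and inverse: "e \<in> arcs G \<Longrightarrow> f \<in> H_space N \<Longrightarrow> M e (M (arev e) f) = f"
begin

lemma linear: "e \<in> arcs G \<Longrightarrow> H_linear N (M e)"
  using isometry by (simp add: H_isometry_def)

lemma walk_linear: "set p \<subseteq> arcs G \<Longrightarrow> H_linear N (foldr M p)"
  using H_isometry_walk[of p N M] isometry by (auto simp: H_isometry_def)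

lemma op_matrix_arev:
  assumes e: "e \<in> arcs G" and jk: "j \<in> ZN N" "k \<in> ZN N"
  shows "op_matrix N (M (arev e)) k j = cnj (op_matrix N (M e) j k)"
proof -
  define m m' where "m = op_matrix N (M e)" and "m' = op_matrix N (M (arev e))"
  have inv: "(\<Sum>l\<in>ZN N. m i l * m' l j) = (if i = j then 1 else 0)" if i: "i \<in> ZN N" for i
  proof -
    have "(\<Sum>l\<in>ZN N. m i l * m' l j) = op_matrix N (\<lambda>f. M e (M (arev e) f)) i j"
      unfolding m_def m'_def by (rule op_matrix_comp[OF N linear linear i jk(1), symmetric]) (use e in auto)
    also have "\<dots> = (if i = j then 1 else 0)"
      by (simp add: op_matrix_def inverse[OF e comb_H[OF N jk(1)]] coord_comb[OF N i jk(1)])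
    finally show ?thesis .
  qed
  have "m' k j = (\<Sum>l\<in>ZN N. if l = k then m' l j else 0)" using jk by (simp add: finite_ZN)
  also have "\<dots> = (\<Sum>l\<in>ZN N. (\<Sum>i\<in>ZN N. m i l * cnj (m i k)) * m' l j)"
    unfolding m_def by (intro sum.cong refl) (simp add: op_matrix_isometry[OF N isometry[OF e] _ jk(2)])
  also have "\<dots> = (\<Sum>i\<in>ZN N. cnj (m i k) * (\<Sum>l\<in>ZN N. m i l * m' l j))"
    unfolding sum_distrib_right sum_distrib_left by (subst sum.swap) (simp add: mult_ac)
  also have "\<dots> = (\<Sum>i\<in>ZN N. if i = j then cnj (m i k) else 0)"
    by (intro sum.cong refl) (simp add: inv)
  also have "\<dots> = cnj (m j k)" using jk by (simp add: finite_ZN)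
  finally show ?thesis by (simp add: m_def m'_def)
qed

definition index :: "('v \<times> (real^'n)) set" where
  "index = verts G \<times> ZN N"

definition adj :: "'v \<times> (real^'n) \<Rightarrow> 'v \<times> (real^'n) \<Rightarrow> complex" where
  "adj x y = (\<Sum>e | e \<in> out_arcs G (fst x) \<and> head G e = fst y. op_matrix N (M e) (snd x) (snd y))"

lemma finite_index: "finite index"
  by (simp add: index_def finite_ZN)

lemma card_index: "card index = card (verts G) * N ^ CARD('n)"
  by (simp add: index_def card_cartesian_product card_ZN)

lemma adj_hermitian:
  assumes "x \<in> index" "y \<in> index"
  shows "adj x y = cnj (adj y x)"
proof -
  have z: "snd x \<in> ZN N" "snd y \<in> ZN N" using assms by (auto simp: index_def)
  have "cnj (adj y x) = (\<Sum>e | e \<in> out_arcs G (fst y) \<and> head G e = fst x. cnj (op_matrix N (M e) (snd y) (snd x)))"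
    by (simp add: adj_def)
  also have "\<dots> = (\<Sum>e | e \<in> out_arcs G (fst y) \<and> head G e = fst x. op_matrix N (M (arev e)) (snd x) (snd y))"
    by (intro sum.cong refl) (simp add: op_matrix_arev z)
  also have "\<dots> = adj x y"
    unfolding adj_def by (rule sum.reindex_bij_witness[where i = arev and j = arev]) auto
  finally show ?thesis by simp
qed

lemma sum_adj:
  assumes x: "x \<in> index"
  shows "(\<Sum>y\<in>index. adj x y * g y) = (\<Sum>e\<in>out_arcs G (fst x). \<Sum>l\<in>ZN N. op_matrix N (M e) (snd x) l * g (head G e, l))"
proof -
  have "(\<Sum>y\<in>index. adj x y * g y) = (\<Sum>v\<in>verts G. \<Sum>l\<in>ZN N. adj x (v, l) * g (v, l))"
    unfolding index_def by (subst sum.cartesian_product) (simp add: case_prod_beta)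
  also have "\<dots> = (\<Sum>v\<in>verts G. \<Sum>l\<in>ZN N. \<Sum>e | e \<in> out_arcs G (fst x) \<and> head G e = v. op_matrix N (M e) (snd x) l * g (v, l))"
    by (simp add: adj_def sum_distrib_right)
  also have "\<dots> = (\<Sum>v\<in>verts G. \<Sum>e | e \<in> out_arcs G (fst x) \<and> head G e = v. \<Sum>l\<in>ZN N. op_matrix N (M e) (snd x) l * g (head G e, l))"
    by (intro sum.cong refl, subst sum.swap) (intro sum.cong refl, auto)
  also have "\<dots> = (\<Sum>e\<in>out_arcs G (fst x). \<Sum>l\<in>ZN N. op_matrix N (M e) (snd x) l * g (head G e, l))"
    by (rule sum.group) auto
  finally show ?thesis .
qed

definition walk_sum :: "nat \<Rightarrow> 'v \<times> (real^'n) \<Rightarrow> 'v \<times> (real^'n) \<Rightarrow> complex" where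
  "walk_sum k x y = (\<Sum>p\<in>nb_walks G arev k (fst x) (fst y). op_matrix N (foldr M p) (snd x) (snd y))"

lemma walk_sum_0: "x \<in> index \<Longrightarrow> y \<in> index \<Longrightarrow> walk_sum 0 x y = (if x = y then 1 else 0)"
  by (auto simp: walk_sum_def nb_walks_0 index_def op_matrix_def coord_comb[OF N] prod_eq_iff)

lemma walk_sum_1: "walk_sum (Suc 0) x y = adj x y"
  unfolding walk_sum_def nb_walks_1 adj_def by (subst sum.reindex) (auto simp: inj_on_def)

text \<open>Backtracking along an edge and its reversal cancels since their operators are inverse to each other.\<close>

lemma walk_sum_rec:
  assumes xy: "x \<in> index" "y \<in> index"
  shows "(\<Sum>z\<in>index. adj x z * walk_sum (Suc k) z y)
    = walk_sum (Suc (Suc k)) x y + of_real (if k = 0 then real d else real d - 1) * walk_sum k x y"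
proof -
  define F where "F p = op_matrix N (foldr M p) (snd x) (snd y)" for p
  have z: "snd x \<in> ZN N" "snd y \<in> ZN N" "fst x \<in> verts G" using xy by (auto simp: index_def)
  have "(\<Sum>z\<in>index. adj x z * walk_sum (Suc k) z y)
    = (\<Sum>e\<in>out_arcs G (fst x). \<Sum>l\<in>ZN N. op_matrix N (M e) (snd x) l * walk_sum (Suc k) (head G e, l) y)"
    by (rule sum_adj[OF xy(1)])
  also have "\<dots> = (\<Sum>e\<in>out_arcs G (fst x). \<Sum>p\<in>nb_walks G arev (Suc k) (head G e) (fst y). F (e # p))"
  proof (rule sum.cong[OF refl])
    fix e assume e: "e \<in> out_arcs G (fst x)"
    have "F (e # p) = (\<Sum>l\<in>ZN N. op_matrix N (M e) (snd x) l * op_matrix N (foldr M p) l (snd y))"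
      if "p \<in> nb_walks G arev (Suc k) (head G e) (fst y)" for p
    proof -
      have "set p \<subseteq> arcs G" using that by (auto simp: nb_walks_def)
      moreover have "foldr M (e # p) = (\<lambda>f. M e (foldr M p f))" by (simp add: fun_eq_iff)
      ultimately show ?thesis
        unfolding F_def using e op_matrix_comp[OF N linear[of e] walk_linear[of p] z(1,2)] by simp
    qed
    then show "(\<Sum>l\<in>ZN N. op_matrix N (M e) (snd x) l * walk_sum (Suc k) (head G e, l) y)
      = (\<Sum>p\<in>nb_walks G arev (Suc k) (head G e) (fst y). F (e # p))"
      unfolding walk_sum_def sum_distrib_left fst_conv snd_conv by (subst sum.swap) simp
  qed
  also have "\<dots> = (\<Sum>p\<in>nb_walks G arev (Suc (Suc k)) (fst x) (fst y). F p) +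
    of_real (if k = 0 then real d else real d - 1) * (\<Sum>p\<in>nb_walks G arev k (fst x) (fst y). F p)"
  proof (rule sum_nb_walks_step[OF regular[OF z(3)] z(3)])
    fix e p assume e: "e \<in> out_arcs G (fst x)" and p: "p \<in> nb_walks G arev k (fst x) (fst y)"
    have "set p \<subseteq> arcs G" using p by (auto simp: nb_walks_def)
    then have "foldr M p (comb N (snd y)) \<in> H_space N"
      by (intro H_linear_H[OF walk_linear] comb_H[OF N] z(2))
    then show "F (e # arev e # p) = F p"
      unfolding F_def op_matrix_def using inverse[of e] e by simp
  qed
  finally show ?thesis by (simp only: F_def walk_sum_def)
qed

lemma walk_sum_trace:
  "(\<Sum>x\<in>index. walk_sum k x x) = (\<Sum>v\<in>verts G. \<Sum>p\<in>nb_walks G arev k v v. op_trace N (foldr M p))"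
proof -
  have "(\<Sum>x\<in>index. walk_sum k x x) = (\<Sum>v\<in>verts G. \<Sum>j\<in>ZN N. walk_sum k (v, j) (v, j))"
    unfolding index_def by (subst sum.cartesian_product) (simp add: case_prod_beta)
  also have "\<dots> = (\<Sum>v\<in>verts G. \<Sum>p\<in>nb_walks G arev k v v. op_trace N (foldr M p))"
    unfolding walk_sum_def op_trace_def fst_conv snd_conv by (intro sum.cong refl sum.swap)
  finally show ?thesis .
qed

lemma walk_inverse:
  "set q \<subseteq> arcs G \<Longrightarrow> f \<in> H_space N \<Longrightarrow> foldr M (map arev (rev q)) (foldr M q f) = f"
proof (induction q arbitrary: f)
  case (Cons e q)
  have "foldr M q f \<in> H_space N" using Cons.prems by (intro H_linear_H[OF walk_linear]) auto
  then have "M (arev e) (M e (foldr M q f)) = foldr M q f" using inverse[of "arev e"] Cons.prems by simp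
  then show ?case using Cons by simp
qed simp

lemma op_trace_conjugate:
  assumes "set p \<subseteq> arcs G" "set q \<subseteq> arcs G"
  shows "op_trace N (foldr M (q @ p @ map arev (rev q))) = op_trace N (foldr M p)"
proof -
  define q' where "q' = map arev (rev q)"
  have q': "set q' \<subseteq> arcs G" using assms(2) by (auto simp: q'_def)
  have "foldr M (q @ p @ q') = (\<lambda>f. foldr M q (foldr M (p @ q') f))" by (simp add: fun_eq_iff)
  then have "op_trace N (foldr M (q @ p @ q')) = op_trace N (\<lambda>f. foldr M q (foldr M (p @ q') f))" by (simp only:)
  also have "\<dots> = op_trace N (\<lambda>f. foldr M (p @ q') (foldr M q f))"
    by (rule op_trace_commute[OF N walk_linear[of q] walk_linear[of "p @ q'"]]) (use assms q' in auto)
  also have "\<dots> = op_trace N (foldr M p)"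
    by (rule op_trace_cong[OF N]) (simp add: walk_inverse[OF assms(2), folded q'_def])
  finally show ?thesis by (simp add: q'_def)
qed

end

section \<open>Eigenvalues and traces\<close>

definition hnorm :: "nat \<Rightarrow> 'n::finite dist \<Rightarrow> real" where
  "hnorm N f = L2_set (\<lambda>j. norm (coord N f j)) (ZN N)"

lemma hnorm_nonneg: "0 \<le> hnorm N f"
  by (simp add: hnorm_def)

lemma hnorm_inner: "N > 0 \<Longrightarrow> H_inner N f f = of_real ((hnorm N f)\<^sup>2)"
proof -
  assume N: "N > 0"
  have "(hnorm N f)\<^sup>2 = (\<Sum>j\<in>ZN N. (norm (coord N f j))\<^sup>2)"
    unfolding hnorm_def L2_set_def by (rule real_sqrt_pow2) (auto intro: sum_nonneg)
  then show ?thesis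
    by (simp only: H_inner_coord[OF N] of_real_sum complex_norm_square)
qed

lemma hnorm_isometry:
  assumes "N > 0" "H_isometry N T" "f \<in> H_space N"
  shows "hnorm N (T f) = hnorm N f"
proof -
  have "H_inner N (T f) (T f) = H_inner N f f" using assms(2,3) unfolding H_isometry_def by blast
  then have "(hnorm N (T f))\<^sup>2 = (hnorm N f)\<^sup>2"
    unfolding hnorm_inner[OF assms(1)] by (simp only: of_real_eq_iff)
  then show ?thesis using hnorm_nonneg[of N f] hnorm_nonneg[of N "T f"] by (simp add: power2_eq_iff_nonneg)
qed

lemma hnorm_add:
  assumes "N > 0" "f \<in> H_space N" "g \<in> H_space N"
  shows "hnorm N (f + g) \<le> hnorm N f + hnorm N g"
proof -
  have "hnorm N (f + g) \<le> L2_set (\<lambda>j. norm (coord N f j) + norm (coord N g j)) (ZN N)"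
    unfolding hnorm_def by (intro L2_set_mono) (auto simp: coord_add[OF assms] norm_triangle_ineq)
  also have "\<dots> \<le> hnorm N f + hnorm N g" unfolding hnorm_def by (rule L2_set_triangle_ineq)
  finally show ?thesis .
qed

lemma hnorm_zero: "N > 0 \<Longrightarrow> hnorm N 0 = 0"
  by (simp add: hnorm_def L2_set_def coord_zero)

lemma hnorm_sum:
  assumes N: "N > 0"
  shows "(\<And>i. i \<in> A \<Longrightarrow> f i \<in> H_space N) \<Longrightarrow> hnorm N (\<Sum>i\<in>A. f i) \<le> (\<Sum>i\<in>A. hnorm N (f i))"
proof (induction A rule: infinite_finite_induct)
  case (insert i A)
  have "hnorm N (f i + (\<Sum>i\<in>A. f i)) \<le> hnorm N (f i) + hnorm N (\<Sum>i\<in>A. f i)"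
    by (intro hnorm_add[OF N] H_space_sum[OF N] insert.prems) auto
  moreover have "hnorm N (\<Sum>i\<in>A. f i) \<le> (\<Sum>i\<in>A. hnorm N (f i))"
    by (intro insert.IH insert.prems) auto
  ultimately show ?case by (simp only: sum.insert[OF insert(1,2)])
qed (simp_all only: sum.infinite sum.empty hnorm_zero[OF N] order_refl not_False_eq_True)

lemma hnorm_scale:
  assumes "N > 0" "f \<in> H_space N"
  shows "hnorm N (dist_scale c f) = norm c * hnorm N f"
proof -
  have "hnorm N (dist_scale c f) = L2_set (\<lambda>j. norm c * norm (coord N f j)) (ZN N)"
    unfolding hnorm_def by (intro L2_set_cong refl) (simp add: coord_scale[OF assms] norm_mult)
  also have "\<dots> = norm c * hnorm N f"
    unfolding hnorm_def by (rule L2_set_right_distrib[symmetric]) simp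
  finally show ?thesis .
qed

lemma hnorm_eq_0:
  fixes f :: "'n::finite dist"
  assumes "N > 0" "f \<in> H_space N" "hnorm N f = 0"
  shows "f = 0"
proof (rule coord_eqI[OF assms(1,2) H_space_zero[OF assms(1)]])
  fix j :: "real^'n" assume j: "j \<in> ZN N"
  then show "coord N f j = coord N 0 j"
    using assms(3) by (simp add: hnorm_def L2_set_eq_0_iff[OF finite_ZN] coord_zero[OF assms(1) j])
qed

context quantum_graph
begin

definition coords :: "('v \<Rightarrow> 'n dist) \<Rightarrow> 'v \<times> (real^'n) \<Rightarrow> complex" where
  "coords u x = coord N (u (fst x)) (snd x)"

definition state :: "('v \<times> (real^'n) \<Rightarrow> complex) \<Rightarrow> 'v \<Rightarrow> 'n dist" where
  "state c v = (if v \<in> verts G then comb_sum N (\<lambda>j. c (v, j)) else 0)"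

lemma state_C_space: "state c \<in> C_space G N"
  by (simp add: state_def C_space_def comb_sum_H[OF N])

lemma coords_state: "x \<in> index \<Longrightarrow> coords (state c) x = c x"
  by (auto simp: coords_def state_def index_def coord_comb_sum[OF N])

lemma C_space_eqI:
  assumes "u \<in> C_space G N" "w \<in> C_space G N" "\<And>x. x \<in> index \<Longrightarrow> coords u x = coords w x"
  shows "u = w"
proof
  fix v
  show "u v = w v"
  proof (cases "v \<in> verts G")
    case True
    show ?thesis
    proof (rule coord_eqI[OF N])
      show "u v \<in> H_space N" "w v \<in> H_space N" using assms(1,2) True by (auto simp: C_space_def)
      show "coord N (u v) j = coord N (w v) j" if "j \<in> ZN N" for j
        using assms(3)[of "(v, j)"] True that by (simp add: index_def coords_def)
    qed
  qed (use assms(1,2) in \<open>simp add: C_space_def\<close>)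
qed

lemma C_scale_C_space: "u \<in> C_space G N \<Longrightarrow> C_scale c u \<in> C_space G N" for u :: "'v \<Rightarrow> 'n dist"
proof -
  have "dist_scale c 0 = (0 :: 'n dist)" by (rule ext) (simp add: dist_scale_def)
  then show "u \<in> C_space G N \<Longrightarrow> C_scale c u \<in> C_space G N"
    by (auto simp: C_space_def C_scale_def H_space_scale[OF N])
qed

lemma zero_C_space: "(0 :: 'v \<Rightarrow> 'n dist) \<in> C_space G N"
proof -
  have "(0 :: 'n dist) \<in> H_space N" by (rule H_space_zero[OF N])
  then show ?thesis by (simp add: C_space_def)
qed

lemma sum_C_space:
  assumes "\<And>i. i \<in> A \<Longrightarrow> f i \<in> C_space G N"
  shows "(\<Sum>i\<in>A. f i) \<in> C_space G N"
proof -
  have "(\<Sum>i\<in>A. f i v) \<in> H_space N" if "v \<in> verts G" for v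
    using assms that by (intro H_space_sum[OF N]) (auto simp: C_space_def)
  moreover have "(\<Sum>i\<in>A. f i v) = 0" if "v \<notin> verts G" for v
    using assms that by (intro sum.neutral) (auto simp: C_space_def)
  moreover have "(\<Sum>i\<in>A. f i) v = (\<Sum>i\<in>A. f i v)" for v by (rule sum_fun_apply)
  ultimately show ?thesis unfolding C_space_def by simp
qed

lemma coords_sum:
  assumes "\<And>i. i \<in> A \<Longrightarrow> f i \<in> C_space G N" and x: "x \<in> index"
  shows "coords (\<Sum>i\<in>A. f i) x = (\<Sum>i\<in>A. coords (f i) x)"
proof -
  have "(\<Sum>i\<in>A. f i) (fst x) = (\<Sum>i\<in>A. f i (fst x))" by (rule sum_fun_apply)
  moreover have "coord N (\<Sum>i\<in>A. f i (fst x)) (snd x) = (\<Sum>i\<in>A. coord N (f i (fst x)) (snd x))"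
    using assms by (intro coord_sum[OF N]) (auto simp: C_space_def index_def)
  ultimately show ?thesis by (simp only: coords_def)
qed

lemma coords_scale: "u \<in> C_space G N \<Longrightarrow> x \<in> index \<Longrightarrow> coords (C_scale c u) x = c * coords u x"
  by (auto simp: coords_def C_scale_def C_space_def index_def coord_scale[OF N])

lemma coords_zero: "x \<in> index \<Longrightarrow> coords 0 x = 0"
proof -
  assume "x \<in> index"
  then have "snd x \<in> ZN N" by (auto simp: index_def)
  moreover have "(0 :: 'v \<Rightarrow> 'n dist) (fst x) = 0" by (rule zero_fun_apply)
  ultimately show ?thesis by (simp only: coords_def coord_zero[OF N])
qed

lemma head_C_space: "u \<in> C_space G N \<Longrightarrow> e \<in> out_arcs G v \<Longrightarrow> M e (u (head G e)) \<in> H_space N"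
  by (rule H_linear_H[OF linear]) (auto simp: C_space_def)

lemma twisted_adjacency_C_space:
  assumes "u \<in> C_space G N"
  shows "twisted_adjacency G M u \<in> C_space G N"
  unfolding C_space_def twisted_adjacency_def
  by (auto intro!: H_space_sum[OF N] head_C_space[OF assms])

lemma coords_twisted_adjacency:
  assumes u: "u \<in> C_space G N" and x: "x \<in> index"
  shows "coords (twisted_adjacency G M u) x = (\<Sum>y\<in>index. adj x y * coords u y)"
proof -
  have z: "snd x \<in> ZN N" "fst x \<in> verts G" using x by (auto simp: index_def)
  have "coords (twisted_adjacency G M u) x = coord N (\<Sum>e\<in>out_arcs G (fst x). M e (u (head G e))) (snd x)"
    using z by (simp only: coords_def twisted_adjacency_def if_True)
  also have "\<dots> = (\<Sum>e\<in>out_arcs G (fst x). coord N (M e (u (head G e))) (snd x))"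
    by (intro coord_sum[OF N z(1)] head_C_space[OF u])
  also have "\<dots> = (\<Sum>e\<in>out_arcs G (fst x). \<Sum>l\<in>ZN N. op_matrix N (M e) (snd x) l * coords u (head G e, l))"
  proof (rule sum.cong[OF refl])
    fix e assume e: "e \<in> out_arcs G (fst x)"
    then have "u (head G e) \<in> H_space N" using u by (auto simp: C_space_def)
    then show "coord N (M e (u (head G e))) (snd x) = (\<Sum>l\<in>ZN N. op_matrix N (M e) (snd x) l * coords u (head G e, l))"
      using e coord_H_linear[OF N linear[of e] _ z(1)] by (simp add: coords_def)
  qed
  also have "\<dots> = (\<Sum>y\<in>index. adj x y * coords u y)" by (rule sum_adj[OF x, symmetric])
  finally show ?thesis .
qed

lemma eigenspace_iff:
  "u \<in> eigenspace G N M z \<longleftrightarrow>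
     u \<in> C_space G N \<and> (\<forall>x\<in>index. (\<Sum>y\<in>index. adj x y * coords u y) = of_real z * coords u x)"
proof (cases "u \<in> C_space G N")
  case True
  have "twisted_adjacency G M u = C_scale (of_real z) u \<longleftrightarrow>
      (\<forall>x\<in>index. coords (twisted_adjacency G M u) x = coords (C_scale (of_real z) u) x)"
    using C_space_eqI[OF twisted_adjacency_C_space[OF True] C_scale_C_space[OF True]] by auto
  then show ?thesis
    using True by (simp add: eigenspace_def coords_twisted_adjacency coords_scale)
qed (simp add: eigenspace_def)

lemma zero_eigenspace: "0 \<in> eigenspace G N M z"
  unfolding eigenspace_iff by (simp add: zero_C_space coords_zero)

text \<open>Since all edge operators are isometries, a vertex at which an eigenfunction has maximal norm bounds the eigenvalue.\<close>

lemma eigenvalue_bound: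
  assumes u: "u \<in> eigenspace G N M z" and nz: "u \<noteq> 0"
  shows "\<bar>z\<bar> \<le> real d"
proof -
  have uC: "u \<in> C_space G N" and eig: "twisted_adjacency G M u = C_scale (of_real z) u"
    using u by (auto simp: eigenspace_def)
  have uH: "u v \<in> H_space N" if "v \<in> verts G" for v using uC that by (simp add: C_space_def)
  obtain v1 where v1: "u v1 \<noteq> 0" using nz by (auto simp: fun_eq_iff)
  have v1G: "v1 \<in> verts G" using uC v1 by (auto simp: C_space_def)
  define R where "R = Max ((\<lambda>v. hnorm N (u v)) ` verts G)"
  have "R \<in> (\<lambda>v. hnorm N (u v)) ` verts G" unfolding R_def using v1G by (intro Max_in) auto
  then obtain v where v: "v \<in> verts G" "R = hnorm N (u v)" by blast
  have R: "hnorm N (u w) \<le> R" if "w \<in> verts G" for w unfolding R_def using that by (intro Max_ge) auto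
  have "hnorm N (u v1) \<noteq> 0" using hnorm_eq_0[OF N uH[OF v1G]] v1 by blast
  then have pos: "R > 0" using R[OF v1G] hnorm_nonneg[of N "u v1"] by linarith
  have "\<bar>z\<bar> * R = hnorm N (C_scale (of_real z) u v)"
    by (simp add: C_scale_def hnorm_scale[OF N uH[OF v(1)]] v(2))
  also have "\<dots> = hnorm N (\<Sum>e\<in>out_arcs G v. M e (u (head G e)))"
    using v(1) by (simp only: eig[symmetric] twisted_adjacency_def if_True)
  also have "\<dots> \<le> (\<Sum>e\<in>out_arcs G v. hnorm N (M e (u (head G e))))"
    by (intro hnorm_sum[OF N] head_C_space[OF uC])
  also have "\<dots> \<le> (\<Sum>e\<in>out_arcs G v. R)"
  proof (rule sum_mono)
    fix e assume "e \<in> out_arcs G v"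
    then have e: "e \<in> arcs G" "head G e \<in> verts G" by auto
    show "hnorm N (M e (u (head G e))) \<le> R"
      using R[OF e(2)] by (simp add: hnorm_isometry[OF N isometry[OF e(1)] uH[OF e(2)]])
  qed
  also have "\<dots> = real d * R" using regular[OF v(1)] by (simp add: out_degree_def)
  finally show ?thesis using pos by simp
qed

context
  fixes l :: "nat \<Rightarrow> real" and p :: "'v \<times> (real^'n) \<Rightarrow> nat \<Rightarrow> complex" and q :: "nat \<Rightarrow> 'v \<times> (real^'n) \<Rightarrow> complex"
  assumes pq: "\<And>x y. x \<in> index \<Longrightarrow> y \<in> index \<Longrightarrow> (\<Sum>i<card index. p x i * q i y) = (if x = y then 1 else 0)"
    and qp: "\<And>i i'. i < card index \<Longrightarrow> i' < card index \<Longrightarrow> (\<Sum>x\<in>index. q i x * p x i') = (if i = i' then 1 else 0)"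
    and dec: "\<And>x y. x \<in> index \<Longrightarrow> y \<in> index \<Longrightarrow> adj x y = (\<Sum>i<card index. p x i * of_real (l i) * q i y)"
begin

lemma adj_p:
  assumes x: "x \<in> index" and i: "i < card index"
  shows "(\<Sum>z\<in>index. adj x z * p z i) = of_real (l i) * p x i"
proof -
  have "(\<Sum>z\<in>index. adj x z * p z i) = (\<Sum>z\<in>index. \<Sum>i'<card index. p x i' * of_real (l i') * (q i' z * p z i))"
    by (intro sum.cong refl) (simp add: dec[OF x] sum_distrib_right sum_distrib_left mult_ac)
  also have "\<dots> = (\<Sum>i'<card index. p x i' * of_real (l i') * (\<Sum>z\<in>index. q i' z * p z i))"
    by (subst sum.swap) (simp add: sum_distrib_left)
  also have "\<dots> = (\<Sum>i'<card index. if i' = i then p x i' * of_real (l i') else 0)"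
    by (intro sum.cong refl) (simp add: qp i)
  also have "\<dots> = of_real (l i) * p x i" using i by simp
  finally show ?thesis .
qed

lemma q_adj:
  assumes y: "y \<in> index" and i: "i < card index"
  shows "(\<Sum>z\<in>index. q i z * adj z y) = of_real (l i) * q i y"
proof -
  have "(\<Sum>z\<in>index. q i z * adj z y) = (\<Sum>z\<in>index. \<Sum>i'<card index. (q i z * p z i') * (of_real (l i') * q i' y))"
    by (intro sum.cong refl) (simp add: dec[OF _ y] sum_distrib_left mult_ac)
  also have "\<dots> = (\<Sum>i'<card index. (\<Sum>z\<in>index. q i z * p z i') * (of_real (l i') * q i' y))"
    by (subst sum.swap) (simp add: sum_distrib_right)
  also have "\<dots> = (\<Sum>i'<card index. if i' = i then of_real (l i') * q i' y else 0)"
    by (intro sum.cong refl) (simp add: qp i)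
  also have "\<dots> = of_real (l i) * q i y" using i by simp
  finally show ?thesis .
qed

lemma walk_sum_spectral:
  assumes x: "x \<in> index" and y: "y \<in> index"
  shows "walk_sum k x y = (\<Sum>i<card index. p x i * of_real (nonbacktracking_poly d k (l i)) * q i y)"
  using x
proof (induction k arbitrary: x rule: induct_nat_012)
  case 0
  then show ?case by (simp add: walk_sum_0 y pq)
next
  case 1
  then show ?case by (simp add: walk_sum_1 y dec)
next
  case (ge2 k)
  define c where "c = (if k = 0 then real d else real d - 1)"
  have "walk_sum (Suc (Suc k)) x y = (\<Sum>z\<in>index. adj x z * walk_sum (Suc k) z y) - of_real c * walk_sum k x y"
    using walk_sum_rec[OF ge2.prems y, of k] by (simp only: c_def) simp
  also have "(\<Sum>z\<in>index. adj x z * walk_sum (Suc k) z y)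
     = (\<Sum>z\<in>index. \<Sum>i<card index. (adj x z * p z i) * (of_real (nonbacktracking_poly d (Suc k) (l i)) * q i y))"
    by (intro sum.cong refl) (simp add: ge2.IH(2) sum_distrib_left mult_ac)
  also have "\<dots> = (\<Sum>i<card index. (\<Sum>z\<in>index. adj x z * p z i) * (of_real (nonbacktracking_poly d (Suc k) (l i)) * q i y))"
    by (subst sum.swap) (simp add: sum_distrib_right)
  also have "\<dots> = (\<Sum>i<card index. p x i * of_real (l i * nonbacktracking_poly d (Suc k) (l i)) * q i y)"
    by (intro sum.cong refl, simp only: adj_p[OF ge2.prems] lessThan_iff) (simp add: mult_ac)
  also have "\<dots> - of_real c * walk_sum k x y
    = (\<Sum>i<card index. p x i * of_real (l i * nonbacktracking_poly d (Suc k) (l i)) * q i y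
       - of_real c * (p x i * of_real (nonbacktracking_poly d k (l i)) * q i y))"
    by (simp only: ge2.IH(1)[OF ge2.prems] sum_subtractf sum_distrib_left)
  also have "\<dots> = (\<Sum>i<card index. p x i * of_real (nonbacktracking_poly d (Suc (Suc k)) (l i)) * q i y)"
    unfolding nonbacktracking_poly.simps c_def[symmetric] by (intro sum.cong refl) (simp add: algebra_simps)
  finally show ?case .
qed

text \<open>The trace of \<open>P\<^sub>k\<close> of the operator, computed from the eigenvalues.\<close>

lemma trace_spectral:
  "(\<Sum>x\<in>index. walk_sum k x x) = of_real (\<Sum>i<card index. nonbacktracking_poly d k (l i))"
proof -
  have "(\<Sum>x\<in>index. walk_sum k x x)
    = (\<Sum>x\<in>index. \<Sum>i<card index. of_real (nonbacktracking_poly d k (l i)) * (q i x * p x i))"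
    by (intro sum.cong refl) (simp add: walk_sum_spectral mult_ac)
  also have "\<dots> = (\<Sum>i<card index. of_real (nonbacktracking_poly d k (l i)) * (\<Sum>x\<in>index. q i x * p x i))"
    by (subst sum.swap) (simp add: sum_distrib_left)
  also have "\<dots> = (\<Sum>i<card index. of_real (nonbacktracking_poly d k (l i)))"
    by (intro sum.cong refl) (simp add: qp)
  finally show ?thesis by simp
qed

definition eigvec :: "nat \<Rightarrow> 'v \<Rightarrow> 'n dist" where
  "eigvec i = state (\<lambda>x. p x i)"

lemma eigvec_eigenspace: "i < card index \<Longrightarrow> eigvec i \<in> eigenspace G N M (l i)"
  unfolding eigenspace_iff eigvec_def
  using adj_p by (simp add: state_C_space coords_state cong: sum.cong)

lemma coords_eigvec_sum:
  assumes "x \<in> index"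
  shows "coords (\<Sum>i\<in>A. C_scale (b i) (eigvec i)) x = (\<Sum>i\<in>A. b i * p x i)"
  unfolding eigvec_def
  by (subst coords_sum) (auto simp: assms C_scale_C_space state_C_space coords_scale coords_state)

lemma eigvec_coefficient:
  assumes "A \<subseteq> {..<card index}" "i \<in> A"
  shows "(\<Sum>x\<in>index. q i x * coords (\<Sum>i'\<in>A. C_scale (b i') (eigvec i')) x) = b i"
proof -
  have fin: "finite A" using assms(1) by (rule finite_subset) simp
  have "(\<Sum>x\<in>index. q i x * coords (\<Sum>i'\<in>A. C_scale (b i') (eigvec i')) x)
    = (\<Sum>x\<in>index. \<Sum>i'\<in>A. b i' * (q i x * p x i'))"
    by (intro sum.cong refl) (simp add: coords_eigvec_sum sum_distrib_left mult_ac)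
  also have "\<dots> = (\<Sum>i'\<in>A. b i' * (\<Sum>x\<in>index. q i x * p x i'))"
    by (subst sum.swap) (simp add: sum_distrib_left)
  also have "\<dots> = (\<Sum>i'\<in>A. if i' = i then b i' else 0)"
    using assms by (intro sum.cong refl) (auto simp: qp subset_eq)
  also have "\<dots> = b i" using assms(2) fin by simp
  finally show ?thesis .
qed

lemma inj_on_eigvec: "inj_on eigvec {..<card index}"
proof (rule inj_onI)
  fix i i' assume ii: "i \<in> {..<card index}" "i' \<in> {..<card index}" "eigvec i = eigvec i'"
  have "p x i = p x i'" if "x \<in> index" for x
    using arg_cong[OF ii(3), of "\<lambda>u. coords u x"] that by (simp add: eigvec_def coords_state)
  then have "(\<Sum>x\<in>index. q i x * p x i) = (\<Sum>x\<in>index. q i x * p x i')" by (intro sum.cong) auto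
  then show "i = i'" using ii by (simp add: qp split: if_splits)
qed

lemma eigenspace_coefficient:
  assumes u: "u \<in> eigenspace G N M z" and i: "i < card index" "l i \<noteq> z"
  shows "(\<Sum>x\<in>index. q i x * coords u x) = 0"
proof -
  have eig: "(\<Sum>y\<in>index. adj x y * coords u y) = of_real z * coords u x" if "x \<in> index" for x
    using u that by (auto simp: eigenspace_iff)
  have "of_real z * (\<Sum>x\<in>index. q i x * coords u x) = (\<Sum>x\<in>index. q i x * (of_real z * coords u x))"
    by (simp add: sum_distrib_left mult_ac)
  also have "\<dots> = (\<Sum>x\<in>index. q i x * (\<Sum>y\<in>index. adj x y * coords u y))"
    by (intro sum.cong refl) (simp only: eig)
  also have "\<dots> = (\<Sum>y\<in>index. (\<Sum>x\<in>index. q i x * adj x y) * coords u y)"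
    unfolding sum_distrib_left sum_distrib_right by (subst sum.swap) (simp add: mult_ac)
  also have "\<dots> = of_real (l i) * (\<Sum>x\<in>index. q i x * coords u x)"
    unfolding sum_distrib_left by (intro sum.cong refl) (simp add: q_adj i mult_ac)
  finally show ?thesis using i by auto
qed

lemma coords_expansion:
  assumes x: "x \<in> index"
  shows "coords u x = (\<Sum>i<card index. p x i * (\<Sum>y\<in>index. q i y * coords u y))"
proof -
  have "coords u x = (\<Sum>y\<in>index. if y = x then coords u y else 0)" using x by (simp add: finite_index)
  also have "\<dots> = (\<Sum>y\<in>index. (\<Sum>i<card index. p x i * q i y) * coords u y)"
    by (intro sum.cong refl) (auto simp: pq[OF x])
  also have "\<dots> = (\<Sum>i<card index. p x i * (\<Sum>y\<in>index. q i y * coords u y))"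
    unfolding sum_distrib_right sum_distrib_left by (subst sum.swap) (simp add: mult_ac)
  finally show ?thesis .
qed

lemma eigenspace_dim: "vector_space.dim C_scale (eigenspace G N M z) = card {i. i < card index \<and> l i = z}"
proof -
  interpret vs: vector_space "C_scale :: complex \<Rightarrow> ('v \<Rightarrow> 'n dist) \<Rightarrow> 'v \<Rightarrow> 'n dist" by (rule vector_space_C_scale)
  define A where "A = {i. i < card index \<and> l i = z}"
  have A: "A \<subseteq> {..<card index}" "finite A" by (auto simp: A_def)
  have inj: "inj_on eigvec A" using inj_on_eigvec A(1) by (rule inj_on_subset)
  show ?thesis
  proof (rule vs.dim_unique)
    show "eigvec ` A \<subseteq> eigenspace G N M z" using eigvec_eigenspace by (auto simp: A_def)
    show "card (eigvec ` A) = card {i. i < card index \<and> l i = z}" using card_image[OF inj] by (simp add: A_def)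
    show "eigenspace G N M z \<subseteq> vs.span (eigvec ` A)"
    proof
      fix u assume "u \<in> eigenspace G N M z"
      then have u: "u \<in> C_space G N" by (simp add: eigenspace_iff)
      define b where "b i = (\<Sum>x\<in>index. q i x * coords u x)" for i
      have b0: "b i = 0" if "i < card index" "i \<notin> A" for i
        unfolding b_def using that by (intro eigenspace_coefficient[OF \<open>u \<in> eigenspace G N M z\<close>]) (auto simp: A_def)
      have "u = (\<Sum>i\<in>A. C_scale (b i) (eigvec i))"
      proof (rule C_space_eqI[OF u])
        show "(\<Sum>i\<in>A. C_scale (b i) (eigvec i)) \<in> C_space G N"
          by (intro sum_C_space C_scale_C_space) (simp add: eigvec_def state_C_space)
        fix x assume x: "x \<in> index"
        have "coords u x = (\<Sum>i<card index. p x i * b i)" unfolding b_def by (rule coords_expansion[OF x])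
        also have "\<dots> = (\<Sum>i\<in>A. p x i * b i)"
          by (rule sum.mono_neutral_right) (use A b0 in auto)
        also have "\<dots> = coords (\<Sum>i\<in>A. C_scale (b i) (eigvec i)) x" by (simp add: coords_eigvec_sum[OF x] mult.commute)
        finally show "coords u x = coords (\<Sum>i\<in>A. C_scale (b i) (eigvec i)) x" .
      qed
      then show "u \<in> vs.span (eigvec ` A)"
        by (simp only:) (intro vs.span_sum vs.span_scale vs.span_base imageI)
    qed
    show "vs.independent (eigvec ` A)"
    proof
      assume "vs.dependent (eigvec ` A)"
      then obtain g w where gw: "w \<in> eigvec ` A" "g w \<noteq> 0" "(\<Sum>w\<in>eigvec ` A. C_scale (g w) w) = 0"
        unfolding vs.dependent_finite[OF finite_imageI[OF A(2)]] by blast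
      then obtain i where i: "i \<in> A" "w = eigvec i" by blast
      have zero: "(\<Sum>i\<in>A. C_scale (g (eigvec i)) (eigvec i)) = 0"
        using gw(3) by (simp only: sum.reindex[OF inj] comp_def)
      have "g (eigvec i) = (\<Sum>x\<in>index. q i x * coords (\<Sum>i\<in>A. C_scale (g (eigvec i)) (eigvec i)) x)"
        by (rule eigvec_coefficient[OF A(1) i(1), symmetric])
      also have "\<dots> = 0" unfolding zero by (intro sum.neutral) (simp add: coords_zero)
      finally show False using gw(2) i(2) by simp
    qed
  qed
qed

lemma eigenspace_nontrivial: "eigenspace G N M z \<noteq> {0} \<longleftrightarrow> (\<exists>i<card index. l i = z)"
proof -
  interpret vs: vector_space "C_scale :: complex \<Rightarrow> ('v \<Rightarrow> 'n dist) \<Rightarrow> 'v \<Rightarrow> 'n dist" by (rule vector_space_C_scale)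
  note zero = zero_eigenspace[of z]
  show ?thesis
  proof
    assume "\<exists>i<card index. l i = z"
    then obtain i where i: "i < card index" "l i = z" by blast
    have "eigvec i \<noteq> 0"
    proof
      assume *: "eigvec i = 0"
      have "coords (eigvec i) x = p x i" if "x \<in> index" for x using that by (simp add: eigvec_def coords_state)
      then have "p x i = 0" if "x \<in> index" for x using * coords_zero[OF that] that by simp
      then have "(\<Sum>x\<in>index. q i x * p x i) = 0" by (intro sum.neutral) auto
      then show False using qp[OF i(1) i(1)] by simp
    qed
    then show "eigenspace G N M z \<noteq> {0}" using eigvec_eigenspace[OF i(1)] i(2) by auto
  next
    assume nz: "eigenspace G N M z \<noteq> {0}"
    show "\<exists>i<card index. l i = z"
    proof (rule ccontr)
      assume none: "\<not> (\<exists>i<card index. l i = z)"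
      obtain u where u: "u \<in> eigenspace G N M z" "u \<noteq> 0" using nz zero by blast
      then have uC: "u \<in> C_space G N" by (simp add: eigenspace_iff)
      have b0: "(\<Sum>x\<in>index. q i x * coords u x) = 0" if "i < card index" for i
        by (rule eigenspace_coefficient[OF u(1) that]) (use none that in blast)
      have "u = 0"
      proof (rule C_space_eqI[OF uC zero_C_space])
        fix x assume x: "x \<in> index"
        have "coords u x = 0" unfolding coords_expansion[OF x, of u] by (intro sum.neutral) (simp add: b0)
        then show "coords u x = coords 0 x" by (simp only: coords_zero[OF x])
      qed
      then show False using u(2) by simp
    qed
  qed
qed

lemma eigenvalue_count_eq: "eigenvalue_count G N M I = card {i. i < card index \<and> l i \<in> I}"
proof -
  define X where "X = {x \<in> I. eigenspace G N M x \<noteq> {0}}"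
  have X: "X = l ` {i. i < card index \<and> l i \<in> I}" unfolding X_def eigenspace_nontrivial by auto
  have "eigenvalue_count G N M I = (\<Sum>x\<in>X. card {i. i < card index \<and> l i = x})"
    unfolding eigenvalue_count_def X_def[symmetric] by (simp only: eigenspace_dim)
  also have "\<dots> = (\<Sum>x\<in>X. card {i \<in> {i. i < card index \<and> l i \<in> I}. l i = x})"
    by (intro sum.cong refl arg_cong[where f = card]) (auto simp: X)
  also have "\<dots> = (\<Sum>x\<in>X. \<Sum>i | i \<in> {i. i < card index \<and> l i \<in> I} \<and> l i = x. 1)" by simp
  also have "\<dots> = (\<Sum>i\<in>{i. i < card index \<and> l i \<in> I}. 1)"
    by (rule sum.group) (auto simp: X)
  finally show ?thesis by simp
qed

end

theorem spectrum:
  obtains l :: "nat \<Rightarrow> real"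
  where "\<And>i. i < card (verts G) * N ^ CARD('n) \<Longrightarrow> \<bar>l i\<bar> \<le> real d"
    and "\<And>k. complex_of_real (\<Sum>i<card (verts G) * N ^ CARD('n). nonbacktracking_poly d k (l i))
      = (\<Sum>v\<in>verts G. \<Sum>p\<in>nb_walks G arev k v v. op_trace N (foldr M p))"
    and "\<And>I. eigenvalue_count G N M I = card {i. i < card (verts G) * N ^ CARD('n) \<and> l i \<in> I}"
proof -
  obtain l :: "nat \<Rightarrow> real" and p q where
    *: "\<forall>x\<in>index. \<forall>y\<in>index. (\<Sum>i<card index. p x i * q i y) = (if x = y then 1 else 0)"
    "\<forall>i<card index. \<forall>i'<card index. (\<Sum>x\<in>index. q i x * p x i') = (if i = i' then 1 else 0)"
    "\<forall>x\<in>index. \<forall>y\<in>index. adj x y = (\<Sum>i<card index. p x i * of_real (l i) * q i y)"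
    using hermitian_diagonalization[where a = adj, OF finite_index adj_hermitian] by blast
  note rules = *(1)[rule_format] *(2)[rule_format] *(3)[rule_format]
  have nontrivial: "eigenspace G N M z \<noteq> {0} \<longleftrightarrow> (\<exists>i<card index. l i = z)" for z
    by (rule eigenspace_nontrivial[of p q l]) (rule rules; assumption)+
  have trace: "(\<Sum>x\<in>index. walk_sum k x x) = complex_of_real (\<Sum>i<card index. nonbacktracking_poly d k (l i))" for k
    by (rule trace_spectral[of p q l]) (rule rules; assumption)+
  have count: "eigenvalue_count G N M I = card {i. i < card index \<and> l i \<in> I}" for I
    by (rule eigenvalue_count_eq[of p q l]) (rule rules; assumption)+
  show thesis
  proof (rule that[of l])
    show "\<bar>l i\<bar> \<le> real d" if "i < card (verts G) * N ^ CARD('n)" for i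
    proof -
      have "i < card index" using that by (simp only: card_index)
      then have "\<exists>i'<card index. l i' = l i" by (intro exI[of _ i] conjI refl)
      then have "eigenspace G N M (l i) \<noteq> {0}" by (rule iffD2[OF nontrivial])
      then obtain u where "u \<in> eigenspace G N M (l i)" "u \<noteq> 0" using zero_eigenspace[of "l i"] by blast
      then show ?thesis by (rule eigenvalue_bound)
    qed
    show "complex_of_real (\<Sum>i<card (verts G) * N ^ CARD('n). nonbacktracking_poly d k (l i))
      = (\<Sum>v\<in>verts G. \<Sum>p\<in>nb_walks G arev k v v. op_trace N (foldr M p))" for k
      unfolding card_index[symmetric] by (rule trans[OF trace[symmetric] walk_sum_trace])
    show "eigenvalue_count G N M I = card {i. i < card (verts G) * N ^ CARD('n) \<and> l i \<in> I}" for I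
      unfolding card_index[symmetric] by (rule count)
  qed
qed

end

section \<open>Convergence of moments and of counting functions\<close>

context
  fixes d :: nat
  assumes d: "d \<ge> 2"
begin

lemma kesten_mckay_sets [simp, measurable_cong]: "sets (kesten_mckay d) = sets borel"
  by (simp add: kesten_mckay_def)

lemma kesten_mckay_space [simp]: "space (kesten_mckay d) = UNIV"
  by (simp add: kesten_mckay_def)

lemma integrable_kesten_mckay: "continuous_on UNIV f \<Longrightarrow> integrable (kesten_mckay d) f"
  for f :: "real \<Rightarrow> real"
  by (rule kesten_mckay_integral(1)[OF d refl])

lemma emeasure_kesten_mckay: "emeasure (kesten_mckay d) UNIV = 1"
proof -
  have i: "integrable (kesten_mckay d) (\<lambda>_. 1 :: real)" by (intro integrable_kesten_mckay continuous_intros)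
  have "integral\<^sup>L (kesten_mckay d) (\<lambda>_. 1) = (1::real)"
  proof -
    have "nonbacktracking_poly d 0 = (\<lambda>_. 1)" by (rule ext) simp
    then show ?thesis using kesten_mckay_nonbacktracking[OF d, of 0] by simp
  qed
  then have "ennreal (integral\<^sup>L (kesten_mckay d) (\<lambda>_. 1)) = 1" by simp
  then show ?thesis using nn_integral_eq_integral[OF i] by simp
qed

lemma measure_kesten_mckay_UNIV: "measure (kesten_mckay d) UNIV = 1"
  by (simp add: measure_def emeasure_kesten_mckay)

lemma finite_measure_kesten_mckay: "finite_measure (kesten_mckay d)"
  by (rule finite_measureI) (simp add: emeasure_kesten_mckay)

lemma AE_kesten_mckay: "AE x in kesten_mckay d. \<bar>x\<bar> \<le> real d"
proof -
  have "km_radius d \<le> real d"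
  proof (rule power2_le_imp_le)
    have "0 \<le> (real d - 2)\<^sup>2" by simp
    then show "(km_radius d)\<^sup>2 \<le> (real d)\<^sup>2"
      using d by (simp add: power_mult_distrib power2_eq_square algebra_simps)
  qed simp
  then have "\<bar>x\<bar> \<le> real d" if "km_density d x * indicator {- km_radius d..km_radius d} x > 0" for x
  proof -
    have "x \<in> {- km_radius d..km_radius d}" using that by (rule contrapos_pp) simp
    then show ?thesis using \<open>km_radius d \<le> real d\<close> by auto
  qed
  then show ?thesis
    unfolding kesten_mckay_density by (subst AE_density) auto
qed

lemma kesten_mckay_null:
  assumes "A \<in> null_sets lborel"
  shows "A \<in> null_sets (kesten_mckay d)"
  unfolding kesten_mckay_density
proof (subst null_sets_density_iff)
  show "A \<in> sets lborel \<and> (AE x in lborel. x \<in> A \<longrightarrow> ennreal (km_density d x * indicator {- km_radius d..km_radius d} x) = 0)"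
    using AE_not_in[OF assms] assms by auto
qed simp

end

locale bounded_spectra =
  fixes d :: nat and F :: "nat filter" and D :: "nat \<Rightarrow> nat" and l :: "nat \<Rightarrow> nat \<Rightarrow> real"
  assumes d2: "d \<ge> 2"
    and bound: "\<forall>\<^sub>F N in F. D N > 0 \<and> (\<forall>i<D N. \<bar>l N i\<bar> \<le> real d)"
    and moments: "((\<lambda>N. (\<Sum>i<D N. nonbacktracking_poly d k (l N i)) / real (D N)) \<longlongrightarrow> (if k = 0 then 1 else 0)) F"
begin

interpretation km: finite_measure "kesten_mckay d"
  by (rule finite_measure_kesten_mckay[OF d2])

definition avg :: "nat \<Rightarrow> (real \<Rightarrow> real) \<Rightarrow> real" where
  "avg N f = (\<Sum>i<D N. f (l N i)) / real (D N)"

definition good :: "(real \<Rightarrow> real) \<Rightarrow> bool" where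
  "good f \<longleftrightarrow> continuous_on UNIV f \<and> ((\<lambda>N. avg N f) \<longlongrightarrow> integral\<^sup>L (kesten_mckay d) f) F"

lemma good_cmult: "good f \<Longrightarrow> good (\<lambda>x. c * f x)"
  unfolding good_def avg_def
  by (auto simp: sum_distrib_left[symmetric] times_divide_eq_right[symmetric] intro!: continuous_intros tendsto_mult_left
      simp del: times_divide_eq_right)

lemma good_add: "good f \<Longrightarrow> good g \<Longrightarrow> good (\<lambda>x. f x + g x)"
proof -
  assume fg: "good f" "good g"
  have a: "avg N (\<lambda>x. f x + g x) = avg N f + avg N g" for N by (simp add: avg_def sum.distrib add_divide_distrib)
  have "integral\<^sup>L (kesten_mckay d) (\<lambda>x. f x + g x) = integral\<^sup>L (kesten_mckay d) f + integral\<^sup>L (kesten_mckay d) g"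
    using fg by (intro Bochner_Integration.integral_add integrable_kesten_mckay[OF d2]) (auto simp: good_def)
  then show ?thesis
    using fg unfolding good_def a by (auto intro!: continuous_intros tendsto_add)
qed

lemma good_poly: "good (nonbacktracking_poly d k)"
  unfolding good_def avg_def kesten_mckay_nonbacktracking[OF d2]
  using moments[of k] continuous_nonbacktracking_poly by blast

text \<open>By the recursion, multiplication by \<open>x\<close> preserves the span of the polynomials.\<close>

lemma good_power_poly: "good (\<lambda>x. x ^ m * nonbacktracking_poly d k x)"
proof (induction m arbitrary: k)
  case 0
  then show ?case using good_poly[of k] by simp
next
  case (Suc m)
  show ?case
  proof (cases k)
    case 0
    then show ?thesis using Suc.IH[of 1] by (simp add: mult.commute)
  next
    case (Suc j)
    define c where "c = (if j = 0 then real d else real d - 1)"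
    have "x ^ Suc m * nonbacktracking_poly d k x
      = x ^ m * nonbacktracking_poly d (Suc k) x + c * (x ^ m * nonbacktracking_poly d j x)" for x
      unfolding Suc nonbacktracking_poly.simps c_def[symmetric] by (simp add: algebra_simps)
    then show ?thesis using good_add[OF Suc.IH[of "Suc k"] good_cmult[OF Suc.IH[of j], of c]] by (simp only:)
  qed
qed

lemma good_polynomial: "good (\<lambda>x. \<Sum>i\<le>n. a i * x ^ i)"
proof (induction n)
  case 0
  then show ?case using good_cmult[OF good_power_poly[of 0 0], of "a 0"] by simp
next
  case (Suc n)
  then show ?case using good_add[OF Suc.IH good_cmult[OF good_power_poly[of "Suc n" 0], of "a (Suc n)"]] by simp
qed

lemma avg_diff:
  assumes "D N > 0" "\<And>i. i < D N \<Longrightarrow> \<bar>f (l N i) - g (l N i)\<bar> \<le> \<epsilon>"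
  shows "\<bar>avg N f - avg N g\<bar> \<le> \<epsilon>"
proof -
  have "\<bar>\<Sum>i<D N. f (l N i) - g (l N i)\<bar> \<le> (\<Sum>i<D N. \<epsilon>)"
    by (rule order_trans[OF sum_abs]) (intro sum_mono assms(2), simp)
  then have "\<bar>\<Sum>i<D N. f (l N i) - g (l N i)\<bar> / real (D N) \<le> \<epsilon>"
    using assms(1) by (simp add: divide_le_eq mult.commute)
  moreover have "avg N f - avg N g = (\<Sum>i<D N. f (l N i) - g (l N i)) / real (D N)"
    by (simp add: avg_def sum_subtractf diff_divide_distrib)
  ultimately show ?thesis by (simp add: abs_divide)
qed

text \<open>Approximation by polynomials on \<open>[-d, d]\<close>, which contains the spectra and the support of the limit distribution.\<close>

lemma good_continuous:
  assumes f: "continuous_on UNIV f"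
  shows "good f"
proof -
  have "((\<lambda>N. avg N f) \<longlongrightarrow> integral\<^sup>L (kesten_mckay d) f) F"
    unfolding tendsto_iff
  proof (intro allI impI)
    fix e :: real assume e: "e > 0"
    define S where "S = {- real d..real d}"
    have "compact S" "continuous_on S f" "0 < e / 3"
      using continuous_on_subset[OF f] e by (auto simp: S_def)
    then obtain g where g: "real_polynomial_function g" "\<And>x. x \<in> S \<Longrightarrow> \<bar>f x - g x\<bar> < e / 3"
      using Stone_Weierstrass_real_polynomial_function by metis
    obtain a n where "g = (\<lambda>x. \<Sum>i\<le>n. a i * x ^ i)" using g(1) unfolding real_polynomial_function_iff_sum by blast
    then have gg: "good g" using good_polynomial by (simp only:)
    then have cg: "continuous_on UNIV g" by (simp add: good_def)
    have E: "\<bar>integral\<^sup>L (kesten_mckay d) f - integral\<^sup>L (kesten_mckay d) g\<bar> \<le> e / 3"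
    proof -
      have fg: "integrable (kesten_mckay d) (\<lambda>x. f x - g x)"
        by (intro integrable_kesten_mckay[OF d2] continuous_intros f cg)
      have "integral\<^sup>L (kesten_mckay d) f - integral\<^sup>L (kesten_mckay d) g = integral\<^sup>L (kesten_mckay d) (\<lambda>x. f x - g x)"
        by (intro Bochner_Integration.integral_diff[symmetric] integrable_kesten_mckay[OF d2] f cg)
      also have "\<bar>\<dots>\<bar> \<le> integral\<^sup>L (kesten_mckay d) (\<lambda>x. \<bar>f x - g x\<bar>)"
        by (rule integral_abs_bound)
      also have "\<dots> \<le> integral\<^sup>L (kesten_mckay d) (\<lambda>x. e / 3)"
      proof (rule integral_mono_AE)
        show "integrable (kesten_mckay d) (\<lambda>x. \<bar>f x - g x\<bar>)" using fg by (rule integrable_abs)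
        show "integrable (kesten_mckay d) (\<lambda>x. e / 3)" by simp
        show "AE x in kesten_mckay d. \<bar>f x - g x\<bar> \<le> e / 3"
          using AE_kesten_mckay[OF d2]
        proof eventually_elim
          case (elim x)
          then have "x \<in> S" by (auto simp: S_def)
          then show ?case using g(2)[of x] by simp
        qed
      qed
      also have "\<dots> = e / 3" by (simp add: kesten_mckay_space[OF d2] measure_kesten_mckay_UNIV[OF d2])
      finally show ?thesis .
    qed
    have "\<forall>\<^sub>F N in F. \<bar>avg N g - integral\<^sup>L (kesten_mckay d) g\<bar> < e / 3"
      using gg e unfolding good_def tendsto_iff dist_real_def by (auto dest!: spec[of _ "e / 3"])
    then show "\<forall>\<^sub>F N in F. dist (avg N f) (integral\<^sup>L (kesten_mckay d) f) < e"
      using bound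
    proof eventually_elim
      case (elim N)
      have "\<bar>avg N f - avg N g\<bar> \<le> e / 3"
      proof (rule avg_diff)
        fix i assume "i < D N"
        then have "l N i \<in> S" using elim(2) by (auto simp: S_def abs_le_iff)
        then show "\<bar>f (l N i) - g (l N i)\<bar> \<le> e / 3" using g(2)[of "l N i"] by simp
      qed (use elim in simp)
      then show ?case using elim(1) E unfolding dist_real_def by linarith
    qed
  qed
  then show ?thesis using f by (simp add: good_def)
qed

text \<open>The indicator of the interior is the increasing limit of continuous functions. A lower bound
  is enough for convergence, since an upper bound results from the lower bound for the complement.\<close>

lemma counting_lower:
  assumes A: "A \<in> sets borel" and ne: "- A \<noteq> {}" and fr: "frontier A \<in> null_sets lborel" and e: "e > 0"
  shows "\<forall>\<^sub>F N in F. measure (kesten_mckay d) A - e < real (card {i. i < D N \<and> l N i \<in> A}) / real (D N)"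
proof -
  define g where "g n x = min 1 (real n * infdist x (- A))" for n x
  have g0: "g n x = 0" if "x \<notin> interior A" for n x
  proof -
    have "x \<in> closure (- A)" using that by (simp add: closure_complement)
    then show ?thesis using in_closure_iff_infdist_zero[OF ne] by (simp add: g_def)
  qed
  have g01: "0 \<le> g n x" "g n x \<le> 1" for n x by (simp_all add: g_def infdist_nonneg)
  have cg: "continuous_on UNIV (g n)" for n unfolding g_def by (intro continuous_intros)
  have lim: "(\<lambda>n. g n x) \<longlonglongrightarrow> indicator (interior A) x" for x
  proof (cases "x \<in> interior A")
    case True
    then have "x \<notin> closure (- A)" by (simp add: closure_complement)
    then have pos: "infdist x (- A) > 0"
      using in_closure_iff_infdist_zero[OF ne] infdist_nonneg[of x "- A"] by (auto simp: less_le)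
    obtain n0 :: nat where n0: "1 / infdist x (- A) < real n0" using reals_Archimedean2 by blast
    have "g n x = 1" if "n \<ge> n0" for n
    proof -
      have "1 / infdist x (- A) < real n" using n0 that by linarith
      then have "1 < real n * infdist x (- A)" using pos by (simp add: divide_less_eq)
      then show ?thesis by (simp add: g_def)
    qed
    then have "\<forall>\<^sub>F n in sequentially. g n x = 1" by (auto simp: eventually_sequentially)
    then show ?thesis using True by (simp add: tendsto_eventually)
  qed (simp add: g0)
  have "(\<lambda>n. integral\<^sup>L (kesten_mckay d) (g n)) \<longlonglongrightarrow> integral\<^sup>L (kesten_mckay d) (indicator (interior A))"
  proof (rule integral_dominated_convergence[where w = "\<lambda>_. 1"])
    show "g n \<in> borel_measurable (kesten_mckay d)" for n
      unfolding measurable_cong_sets[OF kesten_mckay_sets[OF d2] refl] by (rule borel_measurable_continuous_onI[OF cg])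
    show "indicator (interior A) \<in> borel_measurable (kesten_mckay d)"
      by (rule borel_measurable_indicator) (simp add: kesten_mckay_sets[OF d2])
    show "AE x in kesten_mckay d. (\<lambda>n. g n x) \<longlonglongrightarrow> indicator (interior A) x" by (rule AE_I2) (rule lim)
    show "AE x in kesten_mckay d. norm (g n x) \<le> 1" for n by (rule AE_I2) (use g01 in \<open>simp add: abs_of_nonneg\<close>)
  qed simp
  moreover have "integral\<^sup>L (kesten_mckay d) (indicator (interior A)) = measure (kesten_mckay d) A"
  proof -
    have "A \<in> sets (kesten_mckay d)" using A by (simp add: kesten_mckay_sets[OF d2])
    moreover have "AE x in kesten_mckay d. x \<notin> frontier A"
      by (rule AE_not_in[OF kesten_mckay_null[OF d2 fr]])
    then have "AE x in kesten_mckay d. x \<in> interior A \<longleftrightarrow> x \<in> A"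
      by eventually_elim (use interior_subset[of A] closure_subset[of A] in \<open>auto simp: frontier_def\<close>)
    ultimately have "measure (kesten_mckay d) (interior A) = measure (kesten_mckay d) A"
      by (intro measure_eq_AE) (simp_all add: kesten_mckay_sets[OF d2])
    then show ?thesis by (simp add: kesten_mckay_space[OF d2])
  qed
  ultimately have "(\<lambda>n. integral\<^sup>L (kesten_mckay d) (g n)) \<longlonglongrightarrow> measure (kesten_mckay d) A" by (simp only:)
  then have "\<forall>\<^sub>F n in sequentially. measure (kesten_mckay d) A - e / 2 < integral\<^sup>L (kesten_mckay d) (g n)"
    by (rule order_tendstoD(1)) (use e in simp)
  then obtain n where n: "measure (kesten_mckay d) A - e / 2 < integral\<^sup>L (kesten_mckay d) (g n)"
    by (auto simp: eventually_sequentially)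
  have "((\<lambda>N. avg N (g n)) \<longlongrightarrow> integral\<^sup>L (kesten_mckay d) (g n)) F" using good_continuous[OF cg] by (simp add: good_def)
  then have "\<forall>\<^sub>F N in F. integral\<^sup>L (kesten_mckay d) (g n) - e / 2 < avg N (g n)"
    by (rule order_tendstoD(1)) (use e in simp)
  then show ?thesis
  proof eventually_elim
    case (elim N)
    have "(\<Sum>i<D N. g n (l N i)) \<le> (\<Sum>i<D N. if l N i \<in> A then 1 else 0)"
    proof (rule sum_mono)
      fix i
      show "g n (l N i) \<le> (if l N i \<in> A then 1 else 0)"
      proof (cases "l N i \<in> A")
        case False
        then have "l N i \<notin> interior A" using interior_subset[of A] by blast
        then show ?thesis using False g0 by simp
      qed (simp add: g01)
    qed
    also have "\<dots> = real (card {i. i < D N \<and> l N i \<in> A})"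
      by (simp add: sum.If_cases Int_def)
    finally have "avg N (g n) \<le> real (card {i. i < D N \<and> l N i \<in> A}) / real (D N)"
      unfolding avg_def by (rule divide_right_mono) simp
    then show ?case using elim n by linarith
  qed
qed

theorem counting_tendsto:
  assumes I: "is_interval I"
  shows "((\<lambda>N. real (card {i. i < D N \<and> l N i \<in> I}) / real (D N)) \<longlongrightarrow> measure (kesten_mckay d) I) F"
proof -
  have Ib: "I \<in> sets borel"
  proof -
    have "\<exists>a b. I = {} \<or> I = UNIV \<or> I = {..<b} \<or> I = {..b} \<or> I = {a<..} \<or> I = {a..} \<or>
        I = {a<..<b} \<or> I = {a<..b} \<or> I = {a..<b} \<or> I = {a..b}"
      by (rule interval_cases) (rule mem_is_interval_1_I[OF I])
    then show ?thesis by (elim exE disjE) simp_all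
  qed
  have fr: "frontier I \<in> null_sets lborel"
  proof -
    have "negligible (frontier I)" using I by (intro negligible_convex_frontier) (simp add: is_interval_convex_1)
    then have "frontier I \<in> null_sets lebesgue" by (simp add: negligible_iff_null_sets)
    then show ?thesis by (subst (asm) null_sets_completion_iff) auto
  qed
  have split: "real (card {i. i < D N \<and> l N i \<in> - I}) / real (D N) = 1 - real (card {i. i < D N \<and> l N i \<in> I}) / real (D N)"
    if "D N > 0" for N
  proof -
    have "card {i. i < D N \<and> l N i \<in> I} + card {i. i < D N \<and> l N i \<in> - I} = card ({i. i < D N \<and> l N i \<in> I} \<union> {i. i < D N \<and> l N i \<in> - I})"
      by (rule card_Un_disjoint[symmetric]) auto
    also have "{i. i < D N \<and> l N i \<in> I} \<union> {i. i < D N \<and> l N i \<in> - I} = {..<D N}" by auto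
    finally have "real (card {i. i < D N \<and> l N i \<in> - I}) = real (D N) - real (card {i. i < D N \<and> l N i \<in> I})" by simp
    then show ?thesis using that by (simp add: diff_divide_distrib)
  qed
  have lower: "\<forall>\<^sub>F N in F. measure (kesten_mckay d) I - e < real (card {i. i < D N \<and> l N i \<in> I}) / real (D N)" if e: "e > 0" for e
  proof (cases "- I = {}")
    case True
    then have "I = UNIV" by auto
    have "measure (kesten_mckay d) I = 1" unfolding \<open>I = UNIV\<close> by (rule measure_kesten_mckay_UNIV[OF d2])
    moreover have "real (card {i. i < D N \<and> l N i \<in> I}) / real (D N) = 1" if "D N > 0" for N
      unfolding \<open>I = UNIV\<close> using that by simp
    ultimately show ?thesis using bound e by (auto elim: eventually_mono)
  next
    case False
    then show ?thesis by (rule counting_lower[OF Ib _ fr e])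
  qed
  have upper: "\<forall>\<^sub>F N in F. real (card {i. i < D N \<and> l N i \<in> I}) / real (D N) < measure (kesten_mckay d) I + e" if e: "e > 0" for e
  proof (cases "I = {}")
    case False
    have below: "\<forall>\<^sub>F N in F. measure (kesten_mckay d) (- I) - e < real (card {i. i < D N \<and> l N i \<in> - I}) / real (D N)"
      using Ib False fr e by (intro counting_lower) (auto simp: frontier_complement)
    have compl: "measure (kesten_mckay d) (- I) = 1 - measure (kesten_mckay d) I"
      using km.finite_measure_compl[of I] Ib
      by (simp add: kesten_mckay_space[OF d2] kesten_mckay_sets[OF d2] Compl_eq_Diff_UNIV measure_kesten_mckay_UNIV[OF d2])
    show ?thesis
      using below bound
    proof eventually_elim
      case (elim N)
      then show ?case using compl split[of N] by linarith
    qed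
  qed (use e in simp)
  show ?thesis
    unfolding tendsto_iff
  proof (intro allI impI)
    fix e :: real assume e: "e > 0"
    show "\<forall>\<^sub>F N in F. dist (real (card {i. i < D N \<and> l N i \<in> I}) / real (D N)) (measure (kesten_mckay d) I) < e"
      using lower[OF e] upper[OF e] 
    proof eventually_elim
      case (elim N)
      then show ?case unfolding dist_real_def by linarith
    qed
  qed
qed

end

section \<open>The eigenvalue distribution\<close>

lemma eventually_even_pos: "\<forall>\<^sub>F N in inf at_top (principal {N. even N}). N > 0 \<and> even (N::nat)"
  unfolding eventually_inf_principal using eventually_gt_at_top[of "0::nat"] by eventually_elim simp

text \<open>The trace along \<open>p\<close> is that along a loop at the base point with nontrivial holonomy.\<close>

lemma nonbacktracking_trace_small:
  fixes G :: "('v,'e) pre_digraph" and M :: "nat \<Rightarrow> 'e \<Rightarrow> 'n::finite dist \<Rightarrow> 'n dist"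
  assumes qg: "\<And>N. N > 0 \<Longrightarrow> even N \<Longrightarrow> quantum_graph G arev d N (M N)"
    and cat: "\<And>N e. N > 0 \<Longrightarrow> even N \<Longrightarrow> e \<in> arcs G \<Longrightarrow> quantum_cat_map N (chi e) (M N e)"
    and graph: "bidirected_digraph G arev" "Digraph_Component.connected G"
    and biv: "v0 \<in> verts G" "BIV G arev v0 chi"
    and p: "p \<in> nb_walks G arev k v v" "k > 0"
  shows "((\<lambda>N. norm (op_trace N (foldr (M N) p)) / real (N ^ CARD('n))) \<longlongrightarrow> 0) (inf at_top (principal {N. even N}))"
proof -
  interpret bidirected_digraph G arev by (rule graph(1))
  have pw: "awalk v p v" "nonbacktracking arev p" "p \<noteq> []" using p by (auto simp: nb_walks_def)
  then have v: "v \<in> verts G" by (auto dest: awalk_hd_in_verts)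
  obtain q where q: "awalk v0 q v" using connected_awalk[OF graph(2) biv(1) v] .
  define r where "r = q @ p @ map arev (rev q)"
  have sets: "set p \<subseteq> arcs G" "set q \<subseteq> arcs G" using pw q by auto
  then have rG: "set r \<subseteq> arcs G" by (auto simp: r_def)
  have "((\<lambda>N. norm (op_trace N (foldr (M N) r)) / real (N ^ CARD('n))) \<longlongrightarrow> 0) (inf at_top (principal {N. even N}))"
  proof (rule trace_small)
    show "holonomy chi r \<noteq> Finite_Cartesian_Product.mat 1"
      unfolding r_def by (rule BIV_holonomy[OF biv(2) pw(2,3,1) q])
    fix N :: nat assume N: "N > 0" "even N"
    show "H_isometry N (foldr (M N) r)"
      using rG by (intro H_isometry_walk quantum_cat_map_isometry[OF cat[OF N]]) auto
    fix \<omega> :: "real^('n + 'n)" and f :: "'n dist" assume "\<omega> \<in> int_lattice" "f \<in> H_space N"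
    then show "phase_shift N \<omega> (foldr (M N) r f) = foldr (M N) r (phase_shift N (dual_action (holonomy chi r) \<omega>) f)"
      using rG by (intro walk_intertwines[OF N(1)] cat[OF N]) auto
  qed
  moreover have "\<forall>\<^sub>F N in inf at_top (principal {N. even N}).
      norm (op_trace N (foldr (M N) r)) / real (N ^ CARD('n)) = norm (op_trace N (foldr (M N) p)) / real (N ^ CARD('n))"
    using eventually_even_pos
  proof eventually_elim
    case (elim N)
    then interpret quantum_graph G arev d N "M N" by (intro qg) auto
    show ?case unfolding r_def op_trace_conjugate[OF sets] ..
  qed
  ultimately show ?thesis by (rule Lim_transform_eventually)
qed

theorem theorem1p1:
  fixes G :: "('v,'e) pre_digraph" and arev :: "'e \<Rightarrow> 'e" and d :: nat and v0 :: 'v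
    and chi :: "'e \<Rightarrow> int^('n::finite + 'n)^('n + 'n)"
    and M :: "nat \<Rightarrow> 'e \<Rightarrow> 'n dist \<Rightarrow> 'n dist"
    and I :: "real set"
  assumes graph: "fin_digraph G" "bidirected_digraph G arev" "Digraph_Component.connected G"
    and regular: "\<forall>v\<in>verts G. out_degree G v = d" "d \<ge> 2"
    and symplectic: "\<forall>e\<in>arcs G. chi e \<in> Sp" "\<forall>e\<in>arcs G. chi (arev e) = matrix_inv (chi e)"
    and cat_maps: "\<forall>N>0. even N \<longrightarrow> (\<forall>e\<in>arcs G. quantum_cat_map N (chi e) (M N e))"
      "\<forall>N>0. even N \<longrightarrow> (\<forall>e\<in>arcs G. \<forall>f\<in>H_space N. M N (arev e) f = inv_into (H_space N) (M N e) f)"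
    and biv: "v0 \<in> verts G" "BIV G arev v0 chi"
    and interval: "is_interval I"
  shows "((\<lambda>N. \<bar>real (eigenvalue_count G N (M N) I) / (real (card (verts G)) * real (N ^ CARD('n)))
              - measure (kesten_mckay d) I\<bar>) \<longlongrightarrow> 0)
           (inf at_top (principal {N. even N}))"
proof -
  define F where "F = inf at_top (principal {N::nat. even N})"
  define D where "D N = card (verts G) * N ^ CARD('n)" for N
  interpret fin_digraph G by (rule graph(1))
  have cat: "quantum_cat_map N (chi e) (M N e)" if "N > 0" "even N" "e \<in> arcs G" for N e
    using cat_maps(1) that by blast
  have qg: "quantum_graph G arev d N (M N)" if N: "N > 0" "even N" for N
  proof (intro quantum_graph.intro finite_bidirected.intro graph quantum_graph_axioms.intro N(1))
    show "out_degree G v = d" if "v \<in> verts G" for v using regular(1) that by blast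
    show "H_isometry N (M N e)" if "e \<in> arcs G" for e
      by (rule quantum_cat_map_isometry[OF cat[OF N that]])
    show "M N e (M N (arev e) f) = f" if e: "e \<in> arcs G" and f: "f \<in> H_space N" for e f
    proof -
      have "M N e ` H_space N = H_space N"
        using cat[OF N e] by (simp add: quantum_cat_map_def H_unitary_def bij_betw_def)
      then have "f \<in> M N e ` H_space N" using f by simp
      then have "M N e (inv_into (H_space N) (M N e) f) = f" by (rule f_inv_into_f)
      moreover have "M N (arev e) f = inv_into (H_space N) (M N e) f" using cat_maps(2) N e f by blast
      ultimately show ?thesis by simp
    qed
  qed
  define Q where "Q N l \<longleftrightarrow> (\<forall>i<D N. \<bar>l i\<bar> \<le> real d) \<and>
      (\<forall>k. complex_of_real (\<Sum>i<D N. nonbacktracking_poly d k (l i))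
        = (\<Sum>v\<in>verts G. \<Sum>p\<in>nb_walks G arev k v v. op_trace N (foldr (M N) p))) \<and>
      eigenvalue_count G N (M N) I = card {i. i < D N \<and> l i \<in> I}" for N and l :: "nat \<Rightarrow> real"
  have "\<exists>l. N > 0 \<and> even N \<longrightarrow> Q N l" for N
  proof (cases "N > 0 \<and> even N")
    case True
    then interpret Q: quantum_graph G arev d N "M N" by (intro qg) auto
    have "\<exists>l. Q N l"
    proof (rule Q.spectrum)
      fix l :: "nat \<Rightarrow> real"
      assume 1: "\<And>i. i < card (verts G) * N ^ CARD('n) \<Longrightarrow> \<bar>l i\<bar> \<le> real d"
        and 2: "\<And>k. complex_of_real (\<Sum>i<card (verts G) * N ^ CARD('n). nonbacktracking_poly d k (l i))
          = (\<Sum>v\<in>verts G. \<Sum>p\<in>nb_walks G arev k v v. op_trace N (foldr (M N) p))"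
        and 3: "\<And>I. eigenvalue_count G N (M N) I = card {i. i < card (verts G) * N ^ CARD('n) \<and> l i \<in> I}"
      show "\<exists>l. Q N l"
        unfolding Q_def D_def by (intro exI[of _ l] conjI allI impI 1 2 3)
    qed
    then show ?thesis by blast
  qed blast
  then have "\<forall>N. \<exists>l. N > 0 \<and> even N \<longrightarrow> Q N l" by (rule allI)
  from choice[OF this] obtain l where L: "\<forall>N. N > 0 \<and> even N \<longrightarrow> Q N (l N)" by (rule exE)
  have QN: "Q N (l N)" if "N > 0" "even N" for N using L that by blast
  have l: "\<And>N. N > 0 \<Longrightarrow> even N \<Longrightarrow> \<forall>i<D N. \<bar>l N i\<bar> \<le> real d"
    "\<And>N k. N > 0 \<Longrightarrow> even N \<Longrightarrow> complex_of_real (\<Sum>i<D N. nonbacktracking_poly d k (l N i))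
        = (\<Sum>v\<in>verts G. \<Sum>p\<in>nb_walks G arev k v v. op_trace N (foldr (M N) p))"
    "\<And>N. N > 0 \<Longrightarrow> even N \<Longrightarrow> eigenvalue_count G N (M N) I = card {i. i < D N \<and> l N i \<in> I}"
    by (use QN[unfolded Q_def] in blast)+
  have vpos: "card (verts G) > 0" using biv(1) card_gt_0_iff[of "verts G"] by auto
  have Dpos: "D N > 0" if "N > 0" for N using that vpos by (simp add: D_def)
  have spectra: "bounded_spectra d F D l"
  proof
    show "d \<ge> 2" by (rule regular(2))
    show "\<forall>\<^sub>F N in F. D N > 0 \<and> (\<forall>i<D N. \<bar>l N i\<bar> \<le> real d)"
      unfolding F_def using eventually_even_pos 
    proof eventually_elim
      case (elim N)
      then show ?case using l(1)[of N] Dpos[of N] by simp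
    qed
    fix k
    show "((\<lambda>N. (\<Sum>i<D N. nonbacktracking_poly d k (l N i)) / real (D N)) \<longlongrightarrow> (if k = 0 then 1 else 0)) F"
    proof (cases "k = 0")
      case True
      have "\<forall>\<^sub>F N in F. (\<Sum>i<D N. nonbacktracking_poly d k (l N i)) / real (D N) = 1"
        unfolding F_def using eventually_even_pos
      proof eventually_elim
        case (elim N)
        then show ?case using Dpos[of N] True by simp
      qed
      then show ?thesis using True by (simp add: tendsto_eventually)
    next
      case False
      define t where "t N = (\<Sum>v\<in>verts G. \<Sum>p\<in>nb_walks G arev k v v. norm (op_trace N (foldr (M N) p)) / real (N ^ CARD('n)))" for N
      have "(t \<longlongrightarrow> (\<Sum>v\<in>verts G. \<Sum>p\<in>nb_walks G arev k v v. 0)) F"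
        unfolding t_def F_def
      proof (intro tendsto_sum)
        fix v p assume p: "p \<in> nb_walks G arev k v v"
        show "((\<lambda>N. norm (op_trace N (foldr (M N) p)) / real (N ^ CARD('n))) \<longlongrightarrow> 0) (inf at_top (principal {N. even N}))"
        proof (rule nonbacktracking_trace_small)
          show "quantum_graph G arev d N (M N)" if "N > 0" "even N" for N by (rule qg[OF that])
          show "quantum_cat_map N (chi e) (M N e)" if "N > 0" "even N" "e \<in> arcs G" for N e by (rule cat[OF that])
          show "bidirected_digraph G arev" by (rule graph(2))
          show "Digraph_Component.connected G" by (rule graph(3))
          show "v0 \<in> verts G" by (rule biv(1))
          show "BIV G arev v0 chi" by (rule biv(2))
          show "p \<in> nb_walks G arev k v v" by (rule p)
          show "k > 0" using False by simp
        qed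
      qed
      then have t0: "(t \<longlongrightarrow> 0) F" by simp
      have "\<forall>\<^sub>F N in F. norm ((\<Sum>i<D N. nonbacktracking_poly d k (l N i)) / real (D N)) \<le> t N"
        unfolding F_def using eventually_even_pos
      proof eventually_elim
        case (elim N)
        define Q where "Q = real (N ^ CARD('n))"
        have Q: "Q > 0" using elim by (simp add: Q_def)
        have QD: "Q \<le> real (D N)"
        proof -
          have "1 * Q \<le> real (card (verts G)) * Q" using vpos Q by (intro mult_right_mono) auto
          then show ?thesis by (simp add: Q_def D_def)
        qed
        define s where "s = (\<Sum>v\<in>verts G. \<Sum>p\<in>nb_walks G arev k v v. norm (op_trace N (foldr (M N) p)))"
        have s0: "s \<ge> 0" unfolding s_def by (intro sum_nonneg) simp
        have "\<bar>\<Sum>i<D N. nonbacktracking_poly d k (l N i)\<bar>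
          = norm (complex_of_real (\<Sum>i<D N. nonbacktracking_poly d k (l N i)))" by (simp only: norm_of_real)
        also have "\<dots> = norm (\<Sum>v\<in>verts G. \<Sum>p\<in>nb_walks G arev k v v. op_trace N (foldr (M N) p))"
          using l(2)[of N k] elim by simp
        also have "\<dots> \<le> s"
          unfolding s_def by (rule order_trans[OF norm_sum]) (intro sum_mono norm_sum)
        finally have "\<bar>\<Sum>i<D N. nonbacktracking_poly d k (l N i)\<bar> / real (D N) \<le> s / Q"
          using Q QD s0 by (intro frac_le) auto
        also have "s / Q = t N" by (simp add: s_def t_def Q_def sum_divide_distrib)
        finally show ?case by (simp add: abs_divide)
      qed
      then have "((\<lambda>N. (\<Sum>i<D N. nonbacktracking_poly d k (l N i)) / real (D N)) \<longlongrightarrow> 0) F"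
        using t0 by (rule Lim_null_comparison)
      then show ?thesis using False by simp
    qed
  qed
  have "((\<lambda>N. real (card {i. i < D N \<and> l N i \<in> I}) / real (D N)) \<longlongrightarrow> measure (kesten_mckay d) I) F"
    by (rule bounded_spectra.counting_tendsto[OF spectra interval])
  then have "((\<lambda>N. \<bar>real (card {i. i < D N \<and> l N i \<in> I}) / real (D N) - measure (kesten_mckay d) I\<bar>) \<longlongrightarrow> 0) F"
    by (rule tendsto_rabs_zero[OF LIM_zero])
  moreover have "\<forall>\<^sub>F N in F. \<bar>real (card {i. i < D N \<and> l N i \<in> I}) / real (D N) - measure (kesten_mckay d) I\<bar>
    = \<bar>real (eigenvalue_count G N (M N) I) / (real (card (verts G)) * real (N ^ CARD('n))) - measure (kesten_mckay d) I\<bar>"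
    unfolding F_def using eventually_even_pos
  proof eventually_elim
    case (elim N)
    then show ?case using l(3)[of N] by (simp add: D_def)
  qed
  ultimately show ?thesis unfolding F_def[symmetric] by (rule Lim_transform_eventually)
qed

end
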